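(* Let the generators $g_1$ and $g_2$ both satisfy (A1) and (A2), and let $L$ be an obstacle. Suppose that for every stopping time $\tau$ with values in $(0,T]$ and every $\xi\in L^2(\mathcal{F}_\tau)$ with $\xi\ge L_\tau$, there exist, for $i=1,2$, solutions $(Y^{\tau,i},Z^{\tau,i},K^{\tau,i})$ of the RBSDE with parameter $(g_i,\tau,\xi,L)$ such that for each $t\in[0,T]$, $P$-a.s., $$Y_{t\wedge\tau}^{\tau,1}\ge Y_{t\wedge\tau}^{\tau,2}\quad\text{and}\quad E\left[K_\tau^{\tau,1}-K_{t\wedge\tau}^{\tau,1}\,\middle|\,\mathcal{F}_t\right]\le E\left[K_\tau^{\tau,2}-K_{t\wedge\tau}^{\tau,2}\,\middle|\,\mathcal{F}_t\right].$$ Then for each $\eta\in\mathcal{S}^2(0,T;\mathbf{R})$ satisfying $\eta\ge L$, each $z\in\mathbf{R}^d$, and almost every $t\in[0,T)$, $$P\text{-a.s.},\qquad g_1(t,\eta_t,z)\ge g_2(t,\eta_t,z).$$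
   Context: $(\Omega,\mathcal{F},P)$ is a complete probability space carrying a $d$-dimensional standard Brownian motion $(B_t)_{t\ge0}$ with $B_0=0$; $(\mathcal{F}_t)_{t\ge 0}$ is its natural filtration augmented by the $P$-null sets; $T>0$ is fixed. $L^p(\mathcal{F}_t)$ is the set of $\mathcal{F}_t$-measurable $\xi$ with $E|\xi|^p<\infty$ (similarly for stopping times). $\mathcal{S}^2(0,T;\mathbf{R})$: continuous predictable real processes $\psi$ with $E[\sup_{t\in[0,T]}|\psi_t|^2]<\infty$. $\mathcal{H}^2(0,T;\mathbf{R}^d)$: predictable $\mathbf{R}^d$-valued processes with $E\int_0^T|\psi_t|^2dt<\infty$. Generator: $g:\Omega\times[0,T]\times\mathbf{R}\times\mathbf{R}^d\to\mathbf{R}$ with $(g(t,y,z))_{t\in[0,T]}$ progressively measurable for each $(y,z)$. (A1) There are a constant $\lambda>0$ and a non-negative process $\gamma\in\mathcal{H}^2(0,T;\mathbf{R})$ such that $P$-a.s., for all $t\in[0,T]$ and $(y,z)$, $|g(t,y,z)|\le\lambda(\gamma_t+|y|+|z|)$. (A2) $P$-a.s., for each $t\in[0,T]$, $(y,z)\mapsto g(t,y,z)$ is continuous. Obstacle: $L=(L_t)_{0\le t\le T}$ is a continuous progressively measurable real-valued process with $L^+=\max(L,0)\in\mathcal{S}^2(0,T;\mathbf{R})$. RBSDE: let $\theta$ be a stopping time with values in $[0,T]$, and $\xi\in L^2(\mathcal{F}_\theta)$ with $L_\theta\le\xi$ a.s. A solution of the RBSDE with parameter $(g,\theta,\xi,L)$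 is a triple $(Y,Z,K)$ of progressively measurable processes on $[0,\theta]$ with values in $\mathbf{R}\times\mathbf{R}^d\times\mathbf{R}_+$ such that: (i) $Y,K$ are continuous with $E[\sup_{s\in[0,\theta]}(|Y_s|^2+|K_s|^2)]<\infty$ and $E\int_0^\theta|Z_s|^2ds<\infty$; (ii) $Y_s=\xi+\int_s^\theta g(r,Y_r,Z_r)dr+K_\theta-K_s-\int_s^\theta Z_r\cdot dB_r$ for all $s\in[0,\theta]$; (iii) a.s. $L_s\le Y_s$ for all $s\in[0,\theta]$ and $\int_0^\theta(Y_s-L_s)dK_s=0$; (iv) $K$ is continuous and increasing with $K_0=0$. *)

theory Defs
  imports "HOL-Probability.Probability"
begin

text \<open>
  A process is a function \<open>X :: real \<Rightarrow> 'a \<Rightarrow> 'b\<close>, written \<open>X t \<omega>\<close>; only its values at times in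
  the relevant interval (\<open>[0,\<infinity>)\<close>, \<open>[0,T]\<close> or \<open>[0,\<theta> \<omega>]\<close>) are ever used. Properties of paths are
  understood up to a null set, as usual on a complete space with an augmented filtration.
\<close>

section \<open>Brownian motion and its augmented filtration\<close>

definition natural_filtration ::
    "'a measure \<Rightarrow> (real \<Rightarrow> 'a \<Rightarrow> 'b::topological_space) \<Rightarrow> real \<Rightarrow> 'a measure" where
  "natural_filtration M X t =
     sigma (space M) (\<Union>s\<in>{0..t}. {X s -` A \<inter> space M | A. A \<in> sets borel})"

text \<open>
  For \<open>t < 0\<close> only the null sets remain among the generators, so this is a filtration indexed by
  all reals and the library notions of stopping time and pre-sigma-algebra apply to it.
\<close>

definition augmented_filtration ::
    "'a measure \<Rightarrow> (real \<Rightarrow> 'a \<Rightarrow> 'b::topological_space) \<Rightarrow> real \<Rightarrow> 'a measure" where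
  "augmented_filtration M X t =
     sigma (space M) (sets (natural_filtration M X t) \<union> null_sets M)"

lemma filtration_augmented_filtration: "filtration (space M) (augmented_filtration M X)"
proof
  let ?G = "\<lambda>t. \<Union>s\<in>{0..t}. {X s -` A \<inter> space M | A. A \<in> sets borel}"
  let ?H = "\<lambda>t. sets (natural_filtration M X t) \<union> null_sets M"
  have G_sub: "?G t \<subseteq> Pow (space M)" for t
    by auto
  have nat_sets: "sets (natural_filtration M X t) = sigma_sets (space M) (?G t)" for t
    unfolding natural_filtration_def by (rule sets_measure_of[OF G_sub])
  have H_sub: "?H t \<subseteq> Pow (space M)" for t
    using sigma_sets_into_sp[OF G_sub] sets.sets_into_space unfolding nat_sets by blast
  have aug_sets: "sets (augmented_filtration M X t) = sigma_sets (space M) (?H t)" for t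
    unfolding augmented_filtration_def by (rule sets_measure_of[OF H_sub])
  show "space (augmented_filtration M X i) = space M" for i
    unfolding augmented_filtration_def by (rule space_measure_of[OF H_sub])
  show "sets (augmented_filtration M X i) \<subseteq> sets (augmented_filtration M X j)"
    if "i \<le> j" for i j
  proof -
    have "?G i \<subseteq> ?G j"
      using that by (intro UN_mono) auto
    then have "sets (natural_filtration M X i) \<subseteq> sets (natural_filtration M X j)"
      unfolding nat_sets by (rule sigma_sets_mono')
    then have "?H i \<subseteq> ?H j"
      by (rule Un_mono) simp
    then show ?thesis
      unfolding aug_sets by (rule sigma_sets_mono')
  qed
qed

text \<open>
  Standard Brownian motion: the increment over \<open>[s,t]\<close> is independent of the past up to \<open>s\<close> and
  has law \<open>N(0, (t - s) I)\<close>, given by its density, a product of one-dimensional normal densities.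
\<close>

definition brownian_motion :: "'a measure \<Rightarrow> (real \<Rightarrow> 'a \<Rightarrow> real ^ 'd::finite) \<Rightarrow> bool" where
  "brownian_motion M B \<longleftrightarrow>
     (\<forall>t\<ge>0. B t \<in> borel_measurable M) \<and>
     (AE \<omega> in M. B 0 \<omega> = 0) \<and>
     (AE \<omega> in M. continuous_on {0..} (\<lambda>t. B t \<omega>)) \<and>
     (\<forall>s t. 0 \<le> s \<and> s < t \<longrightarrow>
        prob_space.indep_set M (sets (natural_filtration M B s))
          (sets (vimage_algebra (space M) (\<lambda>\<omega>. B t \<omega> - B s \<omega>) borel)) \<and>
        distributed M lborel (\<lambda>\<omega>. B t \<omega> - B s \<omega>)
          (\<lambda>x. ennreal (\<Prod>i\<in>UNIV. normal_density 0 (sqrt (t - s)) (x $ i))))"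

section \<open>Classes of processes\<close>

definition progressively_measurable ::
    "(real \<Rightarrow> 'a measure) \<Rightarrow> real \<Rightarrow> (real \<Rightarrow> 'a \<Rightarrow> 'b::topological_space) \<Rightarrow> bool" where
  "progressively_measurable F T X \<longleftrightarrow>
     (\<forall>t\<in>{0..T}. (\<lambda>(s, \<omega>). X s \<omega>) \<in> borel_measurable (restrict_space borel {0..t} \<Otimes>\<^sub>M F t))"

definition predictable_sigma :: "(real \<Rightarrow> 'a measure) \<Rightarrow> real \<Rightarrow> (real \<times> 'a) measure" where
  "predictable_sigma F T =
     sigma ({0..T} \<times> space (F 0))
       ({{0} \<times> A | A. A \<in> sets (F 0)} \<union>
        {{s<..t} \<times> A | s t A. 0 \<le> s \<and> s < t \<and> t \<le> T \<and> A \<in> sets (F s)})"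

definition predictable_process ::
    "(real \<Rightarrow> 'a measure) \<Rightarrow> real \<Rightarrow> (real \<Rightarrow> 'a \<Rightarrow> 'b::topological_space) \<Rightarrow> bool" where
  "predictable_process F T X \<longleftrightarrow> (\<lambda>(t, \<omega>). X t \<omega>) \<in> borel_measurable (predictable_sigma F T)"

definition S2_process ::
    "'a measure \<Rightarrow> (real \<Rightarrow> 'a measure) \<Rightarrow> real \<Rightarrow> (real \<Rightarrow> 'a \<Rightarrow> real) \<Rightarrow> bool" where
  "S2_process M F T X \<longleftrightarrow>
     predictable_process F T X \<and>
     (AE \<omega> in M. continuous_on {0..T} (\<lambda>t. X t \<omega>)) \<and>
     (\<integral>\<^sup>+\<omega>. (SUP t\<in>{0..T}. ennreal (\<bar>X t \<omega>\<bar>\<^sup>2)) \<partial>M) < \<infinity>"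

definition H2_process ::
    "'a measure \<Rightarrow> (real \<Rightarrow> 'a measure) \<Rightarrow> real \<Rightarrow> (real \<Rightarrow> 'a \<Rightarrow> 'b::euclidean_space) \<Rightarrow> bool" where
  "H2_process M F T X \<longleftrightarrow>
     predictable_process F T X \<and>
     (\<integral>\<^sup>+\<omega>. (\<integral>\<^sup>+t\<in>{0..T}. ennreal ((norm (X t \<omega>))\<^sup>2) \<partial>lborel) \<partial>M) < \<infinity>"

definition L2_variable :: "'a measure \<Rightarrow> 'a measure \<Rightarrow> ('a \<Rightarrow> real) \<Rightarrow> bool" where
  "L2_variable M G \<xi> \<longleftrightarrow> \<xi> \<in> borel_measurable G \<and> integrable M (\<lambda>\<omega>. \<bar>\<xi> \<omega>\<bar>\<^sup>2)"

section \<open>The Ito integral\<close>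

text \<open>
  The elementary integrand \<open>\<Sum>i<n. \<phi> i * indicator (p i, p (i+1)]\<close>, where \<open>\<phi> i\<close> is bounded and
  measurable at time \<open>p i\<close>, and its integral process with respect to \<open>B\<close>.
\<close>

definition elementary_integrand ::
    "'a measure \<Rightarrow> (real \<Rightarrow> 'a measure) \<Rightarrow> real \<Rightarrow>
      nat \<Rightarrow> (nat \<Rightarrow> real) \<Rightarrow> (nat \<Rightarrow> 'a \<Rightarrow> 'b::euclidean_space) \<Rightarrow> bool" where
  "elementary_integrand M F T n p \<phi> \<longleftrightarrow>
     0 \<le> p 0 \<and> (\<forall>i<n. p i \<le> p (Suc i)) \<and> p n \<le> T \<and>
     (\<forall>i<n. \<phi> i \<in> borel_measurable (F (p i)) \<and> (\<exists>C. \<forall>\<omega>\<in>space M. norm (\<phi> i \<omega>) \<le> C))"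

definition elementary_process ::
    "nat \<Rightarrow> (nat \<Rightarrow> real) \<Rightarrow> (nat \<Rightarrow> 'a \<Rightarrow> 'b::euclidean_space) \<Rightarrow> real \<Rightarrow> 'a \<Rightarrow> 'b" where
  "elementary_process n p \<phi> t \<omega> = (\<Sum>i<n. indicator {p i<..p (Suc i)} t *\<^sub>R \<phi> i \<omega>)"

definition elementary_integral ::
    "(real \<Rightarrow> 'a \<Rightarrow> 'b::euclidean_space) \<Rightarrow>
      nat \<Rightarrow> (nat \<Rightarrow> real) \<Rightarrow> (nat \<Rightarrow> 'a \<Rightarrow> 'b) \<Rightarrow> real \<Rightarrow> 'a \<Rightarrow> real" where
  "elementary_integral B n p \<phi> t \<omega> =
     (\<Sum>i<n. \<phi> i \<omega> \<bullet> (B (min (p (Suc i)) t) \<omega> - B (min (p i) t) \<omega>))"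

text \<open>
  \<open>I\<close> is a version of \<open>(\<integral>\<^sub>0\<^sup>t Z\<^sub>r \<bullet> dB\<^sub>r)\<close>, \<open>t \<in> [0,T]\<close>: a continuous adapted process which is, at
  every time, the \<open>L\<^sup>2\<close>-limit of the integrals of elementary integrands approximating \<open>Z\<close> in
  \<open>L\<^sup>2(dt \<otimes> dP)\<close>. Being a stochastic integral is a relation because \<open>I\<close> is determined only up to
  indistinguishability.
\<close>

definition ito_integral ::
    "'a measure \<Rightarrow> (real \<Rightarrow> 'a measure) \<Rightarrow> (real \<Rightarrow> 'a \<Rightarrow> 'b::euclidean_space) \<Rightarrow> real \<Rightarrow>
      (real \<Rightarrow> 'a \<Rightarrow> 'b) \<Rightarrow> (real \<Rightarrow> 'a \<Rightarrow> real) \<Rightarrow> bool" where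
  "ito_integral M F B T Z I \<longleftrightarrow>
     (\<forall>t\<in>{0..T}. I t \<in> borel_measurable (F t)) \<and>
     (AE \<omega> in M. continuous_on {0..T} (\<lambda>t. I t \<omega>)) \<and>
     (\<exists>n p \<phi>.
        (\<forall>k. elementary_integrand M F T (n k) (p k) (\<phi> k)) \<and>
        (\<lambda>k. \<integral>\<^sup>+\<omega>. (\<integral>\<^sup>+t\<in>{0..T}.
           ennreal ((norm (elementary_process (n k) (p k) (\<phi> k) t \<omega> - Z t \<omega>))\<^sup>2) \<partial>lborel) \<partial>M)
          \<longlonglongrightarrow> 0 \<and>
        (\<forall>t\<in>{0..T}.
          (\<lambda>k. \<integral>\<^sup>+\<omega>. ennreal (\<bar>elementary_integral B (n k) (p k) (\<phi> k) t \<omega> - I t \<omega>\<bar>\<^sup>2) \<partial>M)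
            \<longlonglongrightarrow> 0))"

section \<open>Generators, obstacles and reflected BSDEs\<close>

definition generator ::
    "(real \<Rightarrow> 'a measure) \<Rightarrow> real \<Rightarrow> (real \<Rightarrow> 'a \<Rightarrow> real \<Rightarrow> real ^ 'd::finite \<Rightarrow> real) \<Rightarrow> bool" where
  "generator F T g \<longleftrightarrow> (\<forall>y z. progressively_measurable F T (\<lambda>t \<omega>. g t \<omega> y z))"

definition linear_growth ::
    "'a measure \<Rightarrow> (real \<Rightarrow> 'a measure) \<Rightarrow> real \<Rightarrow>
      (real \<Rightarrow> 'a \<Rightarrow> real \<Rightarrow> real ^ 'd::finite \<Rightarrow> real) \<Rightarrow> bool" where
  "linear_growth M F T g \<longleftrightarrow>
     (\<exists>c \<gamma>. c > 0 \<and> H2_process M F T \<gamma> \<and>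
        (\<forall>t\<in>{0..T}. \<forall>\<omega>\<in>space M. 0 \<le> \<gamma> t \<omega>) \<and>
        (AE \<omega> in M. \<forall>t\<in>{0..T}. \<forall>y z. \<bar>g t \<omega> y z\<bar> \<le> c * (\<gamma> t \<omega> + \<bar>y\<bar> + norm z)))"

definition continuous_generator ::
    "'a measure \<Rightarrow> real \<Rightarrow> (real \<Rightarrow> 'a \<Rightarrow> real \<Rightarrow> real ^ 'd::finite \<Rightarrow> real) \<Rightarrow> bool" where
  "continuous_generator M T g \<longleftrightarrow>
     (AE \<omega> in M. \<forall>t\<in>{0..T}. continuous_on UNIV (\<lambda>(y, z). g t \<omega> y z))"

definition obstacle ::
    "'a measure \<Rightarrow> (real \<Rightarrow> 'a measure) \<Rightarrow> real \<Rightarrow> (real \<Rightarrow> 'a \<Rightarrow> real) \<Rightarrow> bool" where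
  "obstacle M F T L \<longleftrightarrow>
     progressively_measurable F T L \<and>
     (AE \<omega> in M. continuous_on {0..T} (\<lambda>t. L t \<omega>)) \<and>
     S2_process M F T (\<lambda>t \<omega>. max (L t \<omega>) 0)"

definition zero_after :: "('a \<Rightarrow> real) \<Rightarrow> (real \<Rightarrow> 'a \<Rightarrow> 'b::zero) \<Rightarrow> real \<Rightarrow> 'a \<Rightarrow> 'b" where
  "zero_after \<theta> X s \<omega> = (if s \<le> \<theta> \<omega> then X s \<omega> else 0)"

text \<open>
  Progressive measurability on \<open>[0,\<theta>]\<close> is that of the process extended by 0 after \<open>\<theta>\<close>.
  The integrability clause makes the \<open>dr\<close>-integral in the equation meaningful (it would
  otherwise default to 0); for generators that are continuous and of linear growth it follows from
  the other clauses. The measure \<open>dK\<close> is the Stieltjes measure of the path of \<open>K\<close>, extended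
  constantly to the left of \<open>0\<close> and to the right of \<open>\<theta>\<close>.
\<close>

definition rbsde_solution ::
    "'a measure \<Rightarrow> (real \<Rightarrow> 'a measure) \<Rightarrow> (real \<Rightarrow> 'a \<Rightarrow> real ^ 'd::finite) \<Rightarrow> real \<Rightarrow>
      (real \<Rightarrow> 'a \<Rightarrow> real \<Rightarrow> real ^ 'd \<Rightarrow> real) \<Rightarrow> ('a \<Rightarrow> real) \<Rightarrow> ('a \<Rightarrow> real) \<Rightarrow>
      (real \<Rightarrow> 'a \<Rightarrow> real) \<Rightarrow>
      (real \<Rightarrow> 'a \<Rightarrow> real) \<Rightarrow> (real \<Rightarrow> 'a \<Rightarrow> real ^ 'd) \<Rightarrow> (real \<Rightarrow> 'a \<Rightarrow> real) \<Rightarrow> bool" where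
  "rbsde_solution M F B T g \<theta> \<xi> L Y Z K \<longleftrightarrow>
     progressively_measurable F T (zero_after \<theta> Y) \<and>
     progressively_measurable F T (zero_after \<theta> Z) \<and>
     progressively_measurable F T (zero_after \<theta> K) \<and>
     (AE \<omega> in M. continuous_on {0..\<theta> \<omega>} (\<lambda>s. Y s \<omega>)) \<and>
     (\<integral>\<^sup>+\<omega>. (SUP s\<in>{0..\<theta> \<omega>}. ennreal (\<bar>Y s \<omega>\<bar>\<^sup>2 + \<bar>K s \<omega>\<bar>\<^sup>2)) \<partial>M) < \<infinity> \<and>
     (\<integral>\<^sup>+\<omega>. (\<integral>\<^sup>+s\<in>{0..\<theta> \<omega>}. ennreal ((norm (Z s \<omega>))\<^sup>2) \<partial>lborel) \<partial>M) < \<infinity> \<and>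
     (AE \<omega> in M. set_integrable lborel {0..\<theta> \<omega>} (\<lambda>r. g r \<omega> (Y r \<omega>) (Z r \<omega>))) \<and>
     (\<exists>I. ito_integral M F B T (zero_after \<theta> Z) I \<and>
        (AE \<omega> in M. \<forall>s\<in>{0..\<theta> \<omega>}.
           Y s \<omega> = \<xi> \<omega> + (LINT r:{s..\<theta> \<omega>}|lborel. g r \<omega> (Y r \<omega>) (Z r \<omega>))
             + K (\<theta> \<omega>) \<omega> - K s \<omega> - (I (\<theta> \<omega>) \<omega> - I s \<omega>))) \<and>
     (AE \<omega> in M. (\<forall>s\<in>{0..\<theta> \<omega>}. L s \<omega> \<le> Y s \<omega>) \<and>
        (LINT s:{0..\<theta> \<omega>}|interval_measure (\<lambda>u. K (max 0 (min u (\<theta> \<omega>))) \<omega>). Y s \<omega> - L s \<omega>) = 0) \<and>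
     (AE \<omega> in M. continuous_on {0..\<theta> \<omega>} (\<lambda>s. K s \<omega>) \<and> mono_on {0..\<theta> \<omega>} (\<lambda>s. K s \<omega>) \<and>
        K 0 \<omega> = 0 \<and> (\<forall>s\<in>{0..\<theta> \<omega>}. 0 \<le> K s \<omega>))"

end

theory Submission
  imports Defs
begin

text \<open>
  Fix \<open>z\<close> and replace \<open>\<eta>\<close> by \<open>y0 = \<eta> + \<delta>\<close>, which stays strictly above the obstacle. From time \<open>t\<close> on,
  solve both equations up to a short stopping time \<open>\<tau>\<close>, before which \<open>y0\<^sub>t + z \<bullet> (B - B\<^sub>t)\<close> has not
  met \<open>L\<close>, with this process at \<open>\<tau>\<close> as terminal value. The terminal value makes \<open>Z\<close> close to \<open>z\<close> and
  \<open>Y\<close> close to \<open>y0\<close>: an energy estimate for \<open>Y - (y0\<^sub>t + z \<bullet> (B - B\<^sub>t))\<close>, in which the reflection term has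
  a favourable sign, bounds the error on an interval of length \<open>h\<close> by \<open>o(h)\<close>. Taking conditional
  expectations at \<open>t\<close>, the assumed inequalities for \<open>Y\<close> and \<open>K\<close> say that the expected drift of the first
  solution dominates that of the second. As the generators are only continuous, each drift is
  replaced by its Lipschitz envelope (a sup-convolution with slope \<open>m\<close>), whose error is linear in
  \<open>|Y - y0| + |Z - z|\<close>. Dividing by \<open>h\<close> and letting \<open>h \<rightarrow> 0\<close> at Lebesgue points, then \<open>m \<rightarrow> \<infinity>\<close> and \<open>\<delta> \<rightarrow> 0\<close>,
  gives the claim. No Ito formula is needed: the energy estimate comes from orthogonality of
  increments along a partition.
\<close>

section \<open>Square integrable functions and Lipschitz envelopes\<close>

text \<open>Only L2 information on \<open>Z\<close> is available, and this fixes the scale of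
  everything. Over an interval of length h the energy estimate bounds the squared error by a
  constant times sqrt h times the energy of the data, which is O(h) at the Lebesgue points used. The
  squared error is thus O(h^(3/2)), and Young's inequality with weight h^(1/4) turns it into an L1
  error O(h^(5/4)). An L1 error can be exploited through a linear modulus only, whence the
  envelopes; upper bounds of \<open>g1\<close> and of \<open>- g2\<close> suffice, so a one-sided
  envelope serves both. Conditional expectations are tested on events of \<open>F t\<close>, at the
  end on the event where the sum of the two envelopes is negative. The stopping time equals the end
  of the window only from some index on that depends on the path; L2 bounds uniform in h carry the
  limit through. Suprema of a solution run over uncountably many times and may fail to be
  measurable, so they enter only as majorants of measurable functions. The exceptional times must
  not depend on the path, hence Lebesgue points are taken on the product space.\<close>

lemma sq_norm_diff_bound:
  fixes x y :: "'b::real_normed_vector"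
  assumes "a > 0"
  shows "\<bar>(norm x)\<^sup>2 - (norm y)\<^sup>2\<bar> \<le> (1 + 1 / a) * (norm (x - y))\<^sup>2 + a * (norm y)\<^sup>2"
proof -
  define d where "d = norm (x - y)"
  have d: "d \<ge> 0" "\<bar>norm x - norm y\<bar> \<le> d"
    unfolding d_def by (auto simp: norm_triangle_ineq3)
  have "(norm x)\<^sup>2 - (norm y)\<^sup>2 = (norm x - norm y) * ((norm x - norm y) + 2 * norm y)"
    by (simp add: power2_eq_square algebra_simps)
  then have "\<bar>(norm x)\<^sup>2 - (norm y)\<^sup>2\<bar> = \<bar>norm x - norm y\<bar> * \<bar>(norm x - norm y) + 2 * norm y\<bar>"
    by (simp only: abs_mult)
  also have "\<dots> \<le> d * (d + 2 * norm y)"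
    using d by (intro mult_mono) auto
  also have "\<dots> = d\<^sup>2 + 2 * (d / sqrt a) * (sqrt a * norm y)"
    using assms by (simp add: power2_eq_square algebra_simps)
  also have "\<dots> \<le> d\<^sup>2 + ((d / sqrt a)\<^sup>2 + (sqrt a * norm y)\<^sup>2)"
    using sum_squares_bound[of "d / sqrt a" "sqrt a * norm y"] by simp
  also have "\<dots> = (1 + 1 / a) * d\<^sup>2 + a * (norm y)\<^sup>2"
    using assms by (simp add: power_divide power_mult_distrib algebra_simps)
  finally show ?thesis by (simp add: d_def)
qed

lemma sq_norm_add_le:
  fixes x y :: "'b::real_normed_vector"
  shows "(norm (x + y))\<^sup>2 \<le> 2 * (norm x)\<^sup>2 + 2 * (norm y)\<^sup>2"
proof -
  have "(norm (x + y))\<^sup>2 \<le> (norm x + norm y)\<^sup>2"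
    by (intro power_mono norm_triangle_ineq) auto
  also have "\<dots> \<le> 2 * (norm x)\<^sup>2 + 2 * (norm y)\<^sup>2"
    using sum_squares_bound[of "norm x" "norm y"] by (simp add: power2_sum)
  finally show ?thesis .
qed

lemma integrable_sq_add:
  fixes f g :: "'a \<Rightarrow> 'b::euclidean_space"
  assumes [measurable]: "f \<in> borel_measurable M" "g \<in> borel_measurable M"
  assumes "integrable M (\<lambda>x. (norm (f x))\<^sup>2)" "integrable M (\<lambda>x. (norm (g x))\<^sup>2)"
  shows "integrable M (\<lambda>x. (norm (f x + g x))\<^sup>2)"
  by (rule Bochner_Integration.integrable_bound[where f="\<lambda>x. 2 * (norm (f x))\<^sup>2 + 2 * (norm (g x))\<^sup>2"])
    (use assms in \<open>auto intro!: sq_norm_add_le\<close>)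

lemma integrable_sq_diff:
  fixes f g :: "'a \<Rightarrow> 'b::euclidean_space"
  assumes [measurable]: "f \<in> borel_measurable M" "g \<in> borel_measurable M"
  assumes "integrable M (\<lambda>x. (norm (f x))\<^sup>2)" "integrable M (\<lambda>x. (norm (g x))\<^sup>2)"
  shows "integrable M (\<lambda>x. (norm (f x - g x))\<^sup>2)"
  using integrable_sq_add[of f M "\<lambda>x. - g x"] assms by simp

text \<open>The weight chosen in the two limit lemmas that follow: adding 1 to \<open>S\<close>
  keeps the denominator positive, and the term carrying the weight stays below half of the tolerance
  \<open>r\<close>.\<close>

lemma eps_frac:
  fixes r S :: real
  assumes "r > 0" "S \<ge> 0"
  shows "r / (2 * (S + 1)) > 0" "r / (2 * (S + 1)) * S < r / 2"
  using assms by (auto simp: field_simps add_nonneg_pos)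

lemma abs_mult_le_sq: "\<bar>u * v\<bar> \<le> u\<^sup>2 + v\<^sup>2" for u v :: real
proof -
  have "2 * (\<bar>u\<bar> * \<bar>v\<bar>) \<le> u\<^sup>2 + v\<^sup>2"
    using sum_squares_bound[of "\<bar>u\<bar>" "\<bar>v\<bar>"] by simp
  moreover have "0 \<le> \<bar>u\<bar> * \<bar>v\<bar>" by simp
  ultimately show ?thesis unfolding abs_mult by linarith
qed

lemma integrable_mult_L2:
  fixes f g :: "'a \<Rightarrow> real"
  assumes [measurable]: "f \<in> borel_measurable M" "g \<in> borel_measurable M"
  assumes "integrable M (\<lambda>x. (f x)\<^sup>2)" "integrable M (\<lambda>x. (g x)\<^sup>2)"
  shows "integrable M (\<lambda>x. f x * g x)"
proof (rule Bochner_Integration.integrable_bound[where f="\<lambda>x. (f x)\<^sup>2 + (g x)\<^sup>2"])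
  show "AE x in M. norm (f x * g x) \<le> norm ((f x)\<^sup>2 + (g x)\<^sup>2)"
    using abs_mult_le_sq by (auto simp: power2_eq_square)
qed (use assms in auto)

lemma (in finite_measure) integrable_of_sq:
  fixes f :: "'a \<Rightarrow> real"
  assumes "f \<in> borel_measurable M" "integrable M (\<lambda>x. (f x)\<^sup>2)"
  shows "integrable M f"
  using integrable_mult_L2[of f M "\<lambda>_. 1"] assms by simp

text \<open>Distances are given as nonnegative integrals because the Ito integral is defined this
  way. Once one of them is below 1, \<open>f\<close> is a difference of two square integrable
  functions. Second moments converge by \<open>sq_norm_diff_bound\<close>: its weight is fixed
  first, by the size of the second moment of \<open>f\<close>, and \<open>k\<close>
  afterwards.\<close>

lemma L2_tendsto:
  fixes f :: "'a \<Rightarrow> 'b::euclidean_space" and F :: "nat \<Rightarrow> 'a \<Rightarrow> 'b"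
  assumes [measurable]: "f \<in> borel_measurable M" "\<And>k. F k \<in> borel_measurable M"
    and F: "\<And>k. integrable M (\<lambda>x. (norm (F k x))\<^sup>2)"
    and lim: "(\<lambda>k. \<integral>\<^sup>+x. ennreal ((norm (F k x - f x))\<^sup>2) \<partial>M) \<longlonglongrightarrow> 0"
  shows "integrable M (\<lambda>x. (norm (f x))\<^sup>2)"
    and "(\<lambda>k. \<integral>x. (norm (F k x - f x))\<^sup>2 \<partial>M) \<longlonglongrightarrow> 0"
    and "(\<lambda>k. \<integral>x. (norm (F k x))\<^sup>2 \<partial>M) \<longlonglongrightarrow> (\<integral>x. (norm (f x))\<^sup>2 \<partial>M)"
proof -
  have "\<forall>\<^sub>F k in sequentially. (\<integral>\<^sup>+x. ennreal ((norm (F k x - f x))\<^sup>2) \<partial>M) < 1"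
    using lim by (rule order_tendstoD) simp
  then obtain k where "(\<integral>\<^sup>+x. ennreal ((norm (F k x - f x))\<^sup>2) \<partial>M) < 1"
    by (auto dest: eventually_happens)
  then have "(\<integral>\<^sup>+x. ennreal ((norm (F k x - f x))\<^sup>2) \<partial>M) < \<infinity>"
    by (rule order.strict_trans) simp
  then have k: "integrable M (\<lambda>x. (norm (F k x - f x))\<^sup>2)"
    by (intro integrableI_bounded) auto
  have "integrable M (\<lambda>x. (norm (F k x - (F k x - f x)))\<^sup>2)"
    by (rule integrable_sq_diff) (use k F in auto)
  then show f: "integrable M (\<lambda>x. (norm (f x))\<^sup>2)" by simp
  have d: "integrable M (\<lambda>x. (norm (F k x - f x))\<^sup>2)" for k
    by (rule integrable_sq_diff) (use f F in auto)
  define e where "e = (\<lambda>k. \<integral>x. (norm (F k x - f x))\<^sup>2 \<partial>M)"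
  have "(\<lambda>k. ennreal (e k)) \<longlonglongrightarrow> ennreal 0"
    using lim by (simp add: e_def nn_integral_eq_integral[OF d])
  then show e0: "(\<lambda>k. \<integral>x. (norm (F k x - f x))\<^sup>2 \<partial>M) \<longlonglongrightarrow> 0"
    unfolding e_def[symmetric] by (rule tendsto_ennrealD) (auto simp: e_def)
  let ?S = "\<integral>x. (norm (f x))\<^sup>2 \<partial>M"
  have bound: "\<bar>(\<integral>x. (norm (F k x))\<^sup>2 \<partial>M) - ?S\<bar> \<le> (1 + 1 / a) * e k + a * ?S" if "a > 0" for a k
  proof -
    have "\<bar>(\<integral>x. (norm (F k x))\<^sup>2 \<partial>M) - ?S\<bar> = \<bar>\<integral>x. (norm (F k x))\<^sup>2 - (norm (f x))\<^sup>2 \<partial>M\<bar>"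
      using F f by simp
    also have "\<dots> \<le> (\<integral>x. \<bar>(norm (F k x))\<^sup>2 - (norm (f x))\<^sup>2\<bar> \<partial>M)"
      by (rule integral_abs_bound)
    also have "\<dots> \<le> (\<integral>x. (1 + 1 / a) * (norm (F k x - f x))\<^sup>2 + a * (norm (f x))\<^sup>2 \<partial>M)"
      using F f d that by (intro integral_mono) (auto intro!: sq_norm_diff_bound)
    also have "\<dots> = (1 + 1 / a) * e k + a * ?S"
      using f d by (simp add: e_def)
    finally show ?thesis .
  qed
  have S0: "?S \<ge> 0" by simp
  show "(\<lambda>k. \<integral>x. (norm (F k x))\<^sup>2 \<partial>M) \<longlonglongrightarrow> ?S"
  proof (rule LIMSEQ_I)
    fix r :: real assume "r > 0"
    define a where "a = r / (2 * (?S + 1))"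
    have a: "a > 0" "a * ?S < r / 2"
      using eps_frac[OF \<open>r > 0\<close> S0] by (simp_all add: a_def)
    have "(\<lambda>k. (1 + 1 / a) * e k) \<longlonglongrightarrow> (1 + 1 / a) * 0"
      by (intro tendsto_intros) (use e0 in \<open>simp add: e_def\<close>)
    then have "\<forall>\<^sub>F k in sequentially. (1 + 1 / a) * e k < r / 2"
      by (rule order_tendstoD) (use \<open>r > 0\<close> in simp)
    then obtain k0 where "\<forall>k\<ge>k0. (1 + 1 / a) * e k < r / 2"
      by (auto simp: eventually_sequentially)
    then have "\<forall>k\<ge>k0. \<bar>(\<integral>x. (norm (F k x))\<^sup>2 \<partial>M) - ?S\<bar> < r"
      using bound[OF a(1)] a(2) by (smt (verit) field_sum_of_halves)
    then show "\<exists>k0. \<forall>k\<ge>k0. norm ((\<integral>x. (norm (F k x))\<^sup>2 \<partial>M) - ?S) < r"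
      by auto
  qed
qed

text \<open>The proof rests on the weighted bound
  \<open>\<bar>u\<bar> \<le> u\<^sup>2 / a + a\<close> with \<open>a\<close> small; the constant
  term is integrable because the measure is finite.\<close>

lemma (in finite_measure) L2_tendsto_mean:
  fixes f :: "'a \<Rightarrow> real" and F :: "nat \<Rightarrow> 'a \<Rightarrow> real"
  assumes [measurable]: "f \<in> borel_measurable M" "\<And>k. F k \<in> borel_measurable M"
    and F: "\<And>k. integrable M (\<lambda>x. (F k x)\<^sup>2)"
    and lim: "(\<lambda>k. \<integral>\<^sup>+x. ennreal ((F k x - f x)\<^sup>2) \<partial>M) \<longlonglongrightarrow> 0"
  shows "(\<lambda>k. \<integral>x. F k x \<partial>M) \<longlonglongrightarrow> (\<integral>x. f x \<partial>M)"
proof -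
  have F': "integrable M (\<lambda>x. (norm (F k x))\<^sup>2)" for k using F by simp
  have lim': "(\<lambda>k. \<integral>\<^sup>+x. ennreal ((norm (F k x - f x))\<^sup>2) \<partial>M) \<longlonglongrightarrow> 0" using lim by simp
  note L = L2_tendsto[OF assms(1,2) F' lim']
  have If: "integrable M f" and IF: "integrable M (F k)" for k
    using L(1) F by (auto intro: integrable_of_sq)
  have Id: "integrable M (\<lambda>x. (F k x - f x)\<^sup>2)" for k
    using integrable_sq_diff[of "F k" M f] F L(1) by simp
  define e where "e = (\<lambda>k. \<integral>x. (F k x - f x)\<^sup>2 \<partial>M)"
  let ?m = "measure M (space M)"
  have bound: "\<bar>(\<integral>x. F k x \<partial>M) - (\<integral>x. f x \<partial>M)\<bar> \<le> e k / a + a * ?m" if "a > 0" for a k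
  proof -
    have elem: "\<bar>u\<bar> \<le> u\<^sup>2 / a + a" for u :: real
    proof -
      have "2 * (\<bar>u\<bar> / sqrt a) * sqrt a \<le> (\<bar>u\<bar> / sqrt a)\<^sup>2 + (sqrt a)\<^sup>2"
        by (rule sum_squares_bound)
      then have "2 * \<bar>u\<bar> \<le> u\<^sup>2 / a + a"
        using that by (simp add: power_divide)
      then show ?thesis by simp
    qed
    have "\<bar>(\<integral>x. F k x \<partial>M) - (\<integral>x. f x \<partial>M)\<bar> = \<bar>\<integral>x. F k x - f x \<partial>M\<bar>"
      using If IF by simp
    also have "\<dots> \<le> (\<integral>x. \<bar>F k x - f x\<bar> \<partial>M)"
      by (rule integral_abs_bound)
    also have "\<dots> \<le> (\<integral>x. (F k x - f x)\<^sup>2 / a + a \<partial>M)"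
      using If IF Id elem by (intro integral_mono) auto
    also have "\<dots> = e k / a + a * ?m"
      using Id by (simp add: e_def)
    finally show ?thesis .
  qed
  have e0: "e \<longlonglongrightarrow> 0" using L(2) by (simp add: e_def)
  show ?thesis
  proof (rule LIMSEQ_I)
    fix r :: real assume "r > 0"
    have m0: "?m \<ge> 0" by simp
    define a where "a = r / (2 * (?m + 1))"
    have a: "a > 0" "a * ?m < r / 2"
      using eps_frac[OF \<open>r > 0\<close> m0] by (simp_all add: a_def)
    have "(\<lambda>k. e k / a) \<longlonglongrightarrow> 0 / a"
      by (intro tendsto_intros e0) (use a in auto)
    then have "\<forall>\<^sub>F k in sequentially. e k / a < r / 2"
      by (rule order_tendstoD) (use \<open>r > 0\<close> in simp)
    then obtain k0 where "\<forall>k\<ge>k0. e k / a < r / 2"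
      by (auto simp: eventually_sequentially)
    then have "\<forall>k\<ge>k0. \<bar>(\<integral>x. F k x \<partial>M) - (\<integral>x. f x \<partial>M)\<bar> < r"
      using bound[OF a(1)] a(2) by (smt (verit) field_sum_of_halves)
    then show "\<exists>k0. \<forall>k\<ge>k0. norm ((\<integral>x. F k x \<partial>M) - (\<integral>x. f x \<partial>M)) < r"
      by auto
  qed
qed

lemma integrable_sq_Fatou:
  fixes f :: "'a \<Rightarrow> real" and F :: "nat \<Rightarrow> 'a \<Rightarrow> real"
  assumes [measurable]: "f \<in> borel_measurable M" "\<And>k. F k \<in> borel_measurable M"
    and lim: "AE x in M. (\<lambda>k. F k x) \<longlonglongrightarrow> f x"
    and F: "\<And>k. integrable M (\<lambda>x. (F k x)\<^sup>2)" "\<And>k. (\<integral>x. (F k x)\<^sup>2 \<partial>M) \<le> C"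
  shows "integrable M (\<lambda>x. (f x)\<^sup>2)" "(\<integral>x. (f x)\<^sup>2 \<partial>M) \<le> C"
proof -
  have "0 \<le> (\<integral>x. (F 0 x)\<^sup>2 \<partial>M)" by simp
  then have C: "C \<ge> 0" using F(2)[of 0] by linarith
  have "(\<integral>\<^sup>+x. ennreal ((f x)\<^sup>2) \<partial>M) = (\<integral>\<^sup>+x. liminf (\<lambda>k. ennreal ((F k x)\<^sup>2)) \<partial>M)"
  proof (rule nn_integral_cong_AE)
    show "AE x in M. ennreal ((f x)\<^sup>2) = liminf (\<lambda>k. ennreal ((F k x)\<^sup>2))"
      using lim
    proof eventually_elim
      case (elim x)
      then have "(\<lambda>k. ennreal ((F k x)\<^sup>2)) \<longlonglongrightarrow> ennreal ((f x)\<^sup>2)"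
        by (intro tendsto_intros)
      from lim_imp_Liminf[OF _ this] show ?case by simp
    qed
  qed
  also have "\<dots> \<le> liminf (\<lambda>k. \<integral>\<^sup>+x. ennreal ((F k x)\<^sup>2) \<partial>M)"
    by (rule nn_integral_liminf) simp
  also have "\<dots> \<le> liminf (\<lambda>k. ennreal C)"
  proof (intro Liminf_mono always_eventually allI)
    fix k
    have "(\<integral>\<^sup>+x. ennreal ((F k x)\<^sup>2) \<partial>M) = ennreal (\<integral>x. (F k x)\<^sup>2 \<partial>M)"
      by (rule nn_integral_eq_integral) (use F in auto)
    then show "(\<integral>\<^sup>+x. ennreal ((F k x)\<^sup>2) \<partial>M) \<le> ennreal C"
      using F(2)[of k] by (simp add: ennreal_leI)
  qed
  also have "\<dots> = ennreal C" by (simp add: Liminf_const)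
  finally have le: "(\<integral>\<^sup>+x. ennreal ((f x)\<^sup>2) \<partial>M) \<le> ennreal C" .
  then show f: "integrable M (\<lambda>x. (f x)\<^sup>2)"
    by (intro integrableI_bounded) (auto intro: order.strict_trans1)
  show "(\<integral>x. (f x)\<^sup>2 \<partial>M) \<le> C"
    using le C by (simp add: nn_integral_eq_integral[OF f])
qed

text \<open>Boundedness in L2 gives uniform integrability. The differences are cut at a level
  \<open>R\<close>: the cut part converges by dominated convergence, and above the level
  \<open>\<bar>u\<bar> \<le> u\<^sup>2 / R\<close>.\<close>

lemma (in finite_measure) L2_bounded_L1_tendsto:
  fixes f :: "'a \<Rightarrow> real" and F :: "nat \<Rightarrow> 'a \<Rightarrow> real"
  assumes [measurable]: "f \<in> borel_measurable M" "\<And>k. F k \<in> borel_measurable M"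
    and lim: "AE x in M. (\<lambda>k. F k x) \<longlonglongrightarrow> f x"
    and F: "\<And>k. integrable M (\<lambda>x. (F k x)\<^sup>2)" "\<And>k. (\<integral>x. (F k x)\<^sup>2 \<partial>M) \<le> C"
  shows "integrable M (F k)" "integrable M f" "(\<lambda>k. \<integral>x. \<bar>F k x - f x\<bar> \<partial>M) \<longlonglongrightarrow> 0"
    "(\<lambda>k. \<integral>x. F k x \<partial>M) \<longlonglongrightarrow> (\<integral>x. f x \<partial>M)"
proof -
  note f = integrable_sq_Fatou[OF assms]
  show IF: "integrable M (F k)" for k using F by (auto intro: integrable_of_sq)
  show If: "integrable M f" using f by (auto intro: integrable_of_sq)
  have d: "integrable M (\<lambda>x. (F k x - f x)\<^sup>2)" for k
    using integrable_sq_diff[of "F k" M f] F f(1) by simp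
  have dC: "(\<integral>x. (F k x - f x)\<^sup>2 \<partial>M) \<le> 4 * C" for k
  proof -
    have "(\<integral>x. (F k x - f x)\<^sup>2 \<partial>M) \<le> (\<integral>x. 2 * (F k x)\<^sup>2 + 2 * (f x)\<^sup>2 \<partial>M)"
      using d F f sq_norm_add_le[of "F k _" "- f _"] by (intro integral_mono) auto
    also have "\<dots> = 2 * (\<integral>x. (F k x)\<^sup>2 \<partial>M) + 2 * (\<integral>x. (f x)\<^sup>2 \<partial>M)"
      using F f by simp
    also have "\<dots> \<le> 4 * C" using f(2) F(2)[of k] by linarith
    finally show ?thesis .
  qed
  have "0 \<le> (\<integral>x. (f x)\<^sup>2 \<partial>M)" by simp
  then have C: "C \<ge> 0" using f(2) by linarith
  show L1: "(\<lambda>k. \<integral>x. \<bar>F k x - f x\<bar> \<partial>M) \<longlonglongrightarrow> 0"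
  proof (rule LIMSEQ_I)
    fix r :: real assume "r > 0"
    \<comment> \<open>The second moments of the differences are at most \<open>4 * C\<close>, so
      this level leaves a tail below \<open>r / 2\<close>.\<close>
    define R where "R = 8 * (C + 1) / r"
    have R: "R > 0" "4 * C / R < r / 2"
      using C \<open>r > 0\<close> by (auto simp: R_def field_simps)
    have "(\<lambda>k. \<integral>x. min \<bar>F k x - f x\<bar> R \<partial>M) \<longlonglongrightarrow> (\<integral>x. 0 \<partial>M)"
    proof (rule integral_dominated_convergence[where w="\<lambda>_. R"])
      show "AE x in M. (\<lambda>k. min \<bar>F k x - f x\<bar> R) \<longlonglongrightarrow> 0"
        using lim
      proof eventually_elim
        case (elim x)
        have "(\<lambda>k. min \<bar>F k x - f x\<bar> R) \<longlonglongrightarrow> min \<bar>f x - f x\<bar> R"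
          by (intro tendsto_intros elim)
        then show ?case using R by simp
      qed
    qed (use R in auto)
    then have "\<forall>\<^sub>F k in sequentially. (\<integral>x. min \<bar>F k x - f x\<bar> R \<partial>M) < r / 2"
      by (rule order_tendstoD) (use \<open>r > 0\<close> in simp)
    then obtain k0 where k0: "\<And>k. k \<ge> k0 \<Longrightarrow> (\<integral>x. min \<bar>F k x - f x\<bar> R \<partial>M) < r / 2"
      by (auto simp: eventually_sequentially)
    have "(\<integral>x. \<bar>F k x - f x\<bar> \<partial>M) < r" if "k \<ge> k0" for k
    proof -
      have Im: "integrable M (\<lambda>x. min \<bar>F k x - f x\<bar> R)"
        by (rule integrable_const_bound[where B=R]) (use R in auto)
      have "\<bar>u\<bar> \<le> min \<bar>u\<bar> R + u\<^sup>2 / R" for u :: real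
      proof (cases "\<bar>u\<bar> \<le> R")
        case False
        then have "R * \<bar>u\<bar> \<le> \<bar>u\<bar> * \<bar>u\<bar>" using R by (intro mult_right_mono) auto
        then have "\<bar>u\<bar> \<le> u\<^sup>2 / R" using R by (simp add: field_simps power2_eq_square)
        then show ?thesis using False R by simp
      qed (use R in auto)
      then have "(\<integral>x. \<bar>F k x - f x\<bar> \<partial>M) \<le> (\<integral>x. min \<bar>F k x - f x\<bar> R + (F k x - f x)\<^sup>2 / R \<partial>M)"
        using IF If d Im by (intro integral_mono) auto
      also have "\<dots> = (\<integral>x. min \<bar>F k x - f x\<bar> R \<partial>M) + (\<integral>x. (F k x - f x)\<^sup>2 \<partial>M) / R"
        using Im d by simp
      also have "\<dots> \<le> (\<integral>x. min \<bar>F k x - f x\<bar> R \<partial>M) + 4 * C / R"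
        using dC R by (intro add_left_mono divide_right_mono) auto
      also have "\<dots> < r" using k0[OF that] R(2) by simp
      finally show ?thesis .
    qed
    then show "\<exists>k0. \<forall>k\<ge>k0. norm ((\<integral>x. \<bar>F k x - f x\<bar> \<partial>M) - 0) < r"
      by auto
  qed
  show "(\<lambda>k. \<integral>x. F k x \<partial>M) \<longlonglongrightarrow> (\<integral>x. f x \<partial>M)"
  proof (rule LIM_zero_cancel, rule tendsto_rabs_zero_cancel, rule tendsto_sandwich[OF _ _ tendsto_const L1])
    show "\<forall>\<^sub>F k in sequentially. \<bar>(\<integral>x. F k x \<partial>M) - (\<integral>x. f x \<partial>M)\<bar> \<le> (\<integral>x. \<bar>F k x - f x\<bar> \<partial>M)"
      using IF If integral_abs_bound[of M "\<lambda>x. F _ x - f x"] by (auto intro!: always_eventually)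
  qed auto
qed

section \<open>Pathwise energy bound along fine partitions\<close>

text \<open>Here \<open>J\<close> is a drift with variation \<open>V\<close>, \<open>R\<close> stands for the integral of \<open>\<bar>U\<bar>\<close> against \<open>V\<close>, and \<open>K\<close> is
  the reflection: it grows only where \<open>U \<le> 0\<close>, so it contributes nothing positive.\<close>

lemma discrete_energy_bound:
  fixes U K V J R :: "real \<Rightarrow> real"
  assumes "a \<le> b" and cont: "continuous_on {a..b} U" "continuous_on {a..b} K" "continuous_on {a..b} V"
    and K: "\<And>s t. a \<le> s \<Longrightarrow> s \<le> t \<Longrightarrow> t \<le> b \<Longrightarrow> K s \<le> K t"
    and J: "\<And>s t. a \<le> s \<Longrightarrow> s \<le> t \<Longrightarrow> t \<le> b \<Longrightarrow> \<bar>J t - J s\<bar> \<le> V t - V s"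
    and R: "\<And>s t c. a \<le> s \<Longrightarrow> s \<le> t \<Longrightarrow> t \<le> b \<Longrightarrow> (\<And>r. r \<in> {s..t} \<Longrightarrow> c \<le> \<bar>U r\<bar>) \<Longrightarrow>
               c * (V t - V s) \<le> R t - R s"
    and KU: "\<And>s t. a \<le> s \<Longrightarrow> s \<le> t \<Longrightarrow> t \<le> b \<Longrightarrow> K s < K t \<Longrightarrow> \<exists>r\<in>{s..t}. U r \<le> 0"
    and "e > 0"
  shows "\<exists>d>0. \<forall>n p. p 0 = a \<and> p n = b \<and> (\<forall>i<n. p i \<le> p (Suc i) \<and> p (Suc i) - p i < d) \<longrightarrow>
    (\<Sum>i<n. 2 * U (p i) * (J (p (Suc i)) - J (p i) + (K (p (Suc i)) - K (p i)))
        + (J (p (Suc i)) - J (p i) + (K (p (Suc i)) - K (p i)))\<^sup>2) \<le> 2 * (R b - R a) + e"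
proof -
  define P where "P = (\<lambda>s. V s + K s)"
  have V: "V s \<le> V t" if "a \<le> s" "s \<le> t" "t \<le> b" for s t
    using J[OF that] by linarith
  define tot where "tot = P b - P a"
  have tot: "tot \<ge> 0" unfolding tot_def P_def using V[of a b] K[of a b] \<open>a \<le> b\<close> by auto
  \<comment> \<open>\<open>w\<close> bounds the oscillation of \<open>U\<close> and of
    \<open>P\<close> on a cell. Replacing \<open>U s\<close> by other values in the cell costs
    \<open>2 * w\<close> times the increment of \<open>P\<close>, the squared term once more
    \<open>w\<close> times it; the increments add up to \<open>tot\<close>.\<close>
  define w where "w = e / (3 * (tot + 1))"
  have w: "w > 0" "3 * w * tot \<le> e"
    using tot \<open>e > 0\<close> by (auto simp: w_def field_simps)
  have "uniformly_continuous_on {a..b} U" "uniformly_continuous_on {a..b} P"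
    unfolding P_def by (auto intro!: compact_uniformly_continuous continuous_intros cont)
  then have ex: "\<exists>d>0. \<forall>x\<in>{a..b}. \<forall>y\<in>{a..b}. \<bar>y - x\<bar> < d \<longrightarrow> \<bar>U y - U x\<bar> < w"
      "\<exists>d>0. \<forall>x\<in>{a..b}. \<forall>y\<in>{a..b}. \<bar>y - x\<bar> < d \<longrightarrow> \<bar>P y - P x\<bar> < w"
    unfolding uniformly_continuous_on_def dist_real_def using w(1) by blast+
  from ex(1) obtain d1 where d1: "d1 > 0"
      "\<And>x y. x \<in> {a..b} \<Longrightarrow> y \<in> {a..b} \<Longrightarrow> \<bar>y - x\<bar> < d1 \<Longrightarrow> \<bar>U y - U x\<bar> < w"
    by blast
  from ex(2) obtain d2 where d2: "d2 > 0"
      "\<And>x y. x \<in> {a..b} \<Longrightarrow> y \<in> {a..b} \<Longrightarrow> \<bar>y - x\<bar> < d2 \<Longrightarrow> \<bar>P y - P x\<bar> < w"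
    by blast
  have step: "2 * U s * (J t - J s + (K t - K s)) + (J t - J s + (K t - K s))\<^sup>2
      \<le> 2 * (R t - R s) + 3 * w * (P t - P s)"
    if st: "a \<le> s" "s \<le> t" "t \<le> b" "t - s < min d1 d2" for s t
  proof -
    have Us: "\<bar>U r - U s\<bar> < w" if "r \<in> {s..t}" for r
      using that st by (intro d1(2)) auto
    have Vst: "0 \<le> V t - V s" and Kst: "0 \<le> K t - K s" using V[OF st(1-3)] K[OF st(1-3)] by auto
    have "(\<bar>U s\<bar> - w) * (V t - V s) \<le> R t - R s"
      by (rule R[OF st(1-3)]) (use Us in fastforce)
    then have 1: "\<bar>U s\<bar> * (V t - V s) \<le> R t - R s + w * (V t - V s)"
      by (simp add: algebra_simps)
    have "U s * (J t - J s) \<le> \<bar>U s\<bar> * (V t - V s)"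
      using mult_left_mono[OF J[OF st(1-3)] abs_ge_zero[of "U s"]] abs_ge_self[of "U s * (J t - J s)"]
      unfolding abs_mult by linarith
    with 1 have 2: "U s * (J t - J s) \<le> R t - R s + w * (V t - V s)" by simp
    \<comment> \<open>Growth of \<open>K\<close> on the cell forces a point of the cell with
      \<open>U \<le> 0\<close>, so \<open>U s\<close> is at most the oscillation
      \<open>w\<close>.\<close>
    have 3: "U s * (K t - K s) \<le> w * (K t - K s)"
    proof (cases "K s < K t")
      case True
      from KU[OF st(1-3) this] obtain r where "r \<in> {s..t}" "U r \<le> 0" by auto
      then have "U s \<le> w" using Us[of r] by auto
      then show ?thesis using Kst by (intro mult_right_mono) auto
    next
      case False
      then show ?thesis using Kst by auto
    qed
    have a: "\<bar>J t - J s + (K t - K s)\<bar> \<le> P t - P s"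
      unfolding P_def using J[OF st(1-3)] Kst by auto
    \<comment> \<open>Vanishing quadratic variation of a continuous path of finite variation: the
      square is at most the increment of \<open>P\<close> times a factor below
      \<open>w\<close>.\<close>
    have "\<bar>P t - P s\<bar> < w" using st by (intro d2(2)) auto
    then have "(P t - P s) * (P t - P s) \<le> w * (P t - P s)"
      using a by (intro mult_right_mono) auto
    moreover have "(J t - J s + (K t - K s))\<^sup>2 \<le> (P t - P s)\<^sup>2"
      using a by (metis abs_ge_zero power2_abs power_mono)
    ultimately have 4: "(J t - J s + (K t - K s))\<^sup>2 \<le> w * (P t - P s)"
      by (simp add: power2_eq_square)
    have "2 * U s * (J t - J s + (K t - K s)) = 2 * (U s * (J t - J s)) + 2 * (U s * (K t - K s))"
      by (simp add: algebra_simps)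
    then show ?thesis using 2 3 4 unfolding P_def by (simp add: algebra_simps)
  qed
  show ?thesis
  proof (intro exI[of _ "min d1 d2"] conjI allI impI)
    fix n and p :: "nat \<Rightarrow> real"
    assume p: "p 0 = a \<and> p n = b \<and> (\<forall>i<n. p i \<le> p (Suc i) \<and> p (Suc i) - p i < min d1 d2)"
    have a_le: "a \<le> p i" if "i \<le> n" for i
      using that by (induction i) (use p in \<open>auto intro: order_trans\<close>)
    have le_b: "p i \<le> b" if "i \<le> n" for i
      using that
    proof (induction rule: inc_induct)
      case base
      then show ?case using p by simp
    next
      case (step m)
      then show ?case using p by (meson order_trans)
    qed
    have "(\<Sum>i<n. 2 * U (p i) * (J (p (Suc i)) - J (p i) + (K (p (Suc i)) - K (p i)))
        + (J (p (Suc i)) - J (p i) + (K (p (Suc i)) - K (p i)))\<^sup>2)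
      \<le> (\<Sum>i<n. 2 * (R (p (Suc i)) - R (p i)) + 3 * w * (P (p (Suc i)) - P (p i)))"
      by (intro sum_mono step) (use p a_le le_b in auto)
    also have "\<dots> = 2 * (R b - R a) + 3 * w * tot"
      unfolding sum.distrib sum_distrib_left[symmetric]
      using p by (simp only: sum_lessThan_telescope[of "\<lambda>i. R (p i)"]
          sum_lessThan_telescope[of "\<lambda>i. P (p i)"] tot_def)
    also have "\<dots> \<le> 2 * (R b - R a) + e" using w by simp
    finally show "(\<Sum>i<n. 2 * U (p i) * (J (p (Suc i)) - J (p i) + (K (p (Suc i)) - K (p i)))
        + (J (p (Suc i)) - J (p i) + (K (p (Suc i)) - K (p i)))\<^sup>2) \<le> 2 * (R b - R a) + e" .
  qed (use d1 d2 in auto)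
qed

section \<open>Lipschitz envelopes by sup-convolution\<close>

text \<open>Fixed once by \<open>SOME\<close>, so that the index set of the supremum depends neither
  on the function nor on the point.\<close>

definition dense_subset :: "'p::second_countable_topology set" where
  "dense_subset = (SOME D. countable D \<and> (\<forall>X. open X \<longrightarrow> X \<noteq> {} \<longrightarrow> (\<exists>d\<in>D. d \<in> X)))"

lemma countable_dense_subset: "countable (dense_subset :: 'p::second_countable_topology set)"
  and dense_subset: "open X \<Longrightarrow> X \<noteq> {} \<Longrightarrow> \<exists>d\<in>dense_subset. d \<in> (X :: 'p set)"
proof -
  have "\<exists>D::'p set. countable D \<and> (\<forall>X. open X \<longrightarrow> X \<noteq> {} \<longrightarrow> (\<exists>d\<in>D. d \<in> X))"
    using countable_dense_setE by metis
  from someI_ex[OF this]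
  show "countable (dense_subset :: 'p set)" "open X \<Longrightarrow> X \<noteq> {} \<Longrightarrow> \<exists>d\<in>dense_subset. d \<in> X"
    unfolding dense_subset_def by blast+
qed

text \<open>The supremum is over a countable set so that envelopes of measurable families are measurable.\<close>

definition sup_conv :: "real \<Rightarrow> ('p::euclidean_space \<Rightarrow> real) \<Rightarrow> 'p \<Rightarrow> real" where
  "sup_conv m f p = (SUP q\<in>dense_subset. f q - m * norm (q - p))"

lemma dense_subset_nonempty: "dense_subset \<noteq> {}"
  using dense_subset[of UNIV] by auto

context
  fixes f :: "'p::euclidean_space \<Rightarrow> real" and c \<gamma> m :: real
  assumes growth: "\<And>p. \<bar>f p\<bar> \<le> c * (\<gamma> + norm p)" and c: "0 < c" "c \<le> m"
begin

text \<open>A slope \<open>m \<ge> c\<close> absorbs the growth of \<open>f\<close> between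
  \<open>p\<close> and \<open>q\<close> into the penalty. This makes the supremum finite and hands
  on to it the linear growth of \<open>f\<close>.\<close>

lemma sup_conv_term_le: "f q - m * norm (q - p) \<le> c * (\<gamma> + norm p)"
proof -
  have "f q \<le> c * (\<gamma> + norm q)" using growth[of q] by auto
  also have "\<dots> \<le> c * (\<gamma> + (norm p + norm (q - p)))"
    using c norm_triangle_ineq[of p "q - p"] by (intro mult_left_mono add_left_mono) auto
  also have "\<dots> \<le> c * (\<gamma> + norm p) + m * norm (q - p)"
    using c by (simp add: algebra_simps mult_right_mono)
  finally show ?thesis by simp
qed

lemma sup_conv_bdd: "bdd_above ((\<lambda>q. f q - m * norm (q - p)) ` dense_subset)"
  using sup_conv_term_le by (intro bdd_aboveI2) auto

lemma sup_conv_le: "sup_conv m f p \<le> c * (\<gamma> + norm p)"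
  unfolding sup_conv_def by (rule cSUP_least[OF dense_subset_nonempty sup_conv_term_le])

text \<open>The purpose of the envelope: \<open>f\<close> at any point is at most the envelope at
  \<open>p'\<close> plus \<open>m\<close> times the distance. For points of the dense set this is
  the definition; continuity of \<open>f\<close> gives the others.\<close>

lemma sup_conv_lower:
  assumes "continuous_on UNIV f"
  shows "f p - m * norm (p - p') \<le> sup_conv m f p'"
proof (rule field_le_epsilon)
  fix e :: real assume "e > 0"
  have "isCont (\<lambda>q. f q - m * norm (q - p')) p"
    using assms by (auto intro!: continuous_intros simp: continuous_on_eq_continuous_at)
  then have "\<forall>\<^sub>F q in at p. \<bar>f q - m * norm (q - p') - (f p - m * norm (p - p'))\<bar> < e"
    using \<open>e > 0\<close> unfolding isCont_def by (auto simp: tendsto_iff dist_real_def)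
  then obtain X where X: "open X" "p \<in> X"
    "\<And>q. q \<in> X \<Longrightarrow> q \<noteq> p \<Longrightarrow> \<bar>f q - m * norm (q - p') - (f p - m * norm (p - p'))\<bar> < e"
    by (auto simp: eventually_at_topological)
  then obtain q where q: "q \<in> dense_subset" "q \<in> X"
    using dense_subset[of X] by auto
  have "\<bar>f q - m * norm (q - p') - (f p - m * norm (p - p'))\<bar> < e"
    using X(3)[OF q(2)] \<open>e > 0\<close> by (cases "q = p") auto
  moreover have "f q - m * norm (q - p') \<le> sup_conv m f p'"
    unfolding sup_conv_def by (rule cSUP_upper[OF q(1) sup_conv_bdd])
  ultimately show "f p - m * norm (p - p') \<le> sup_conv m f p' + e" by linarith
qed

lemma abs_sup_conv_le:
  assumes "continuous_on UNIV f"
  shows "\<bar>sup_conv m f p\<bar> \<le> c * (\<gamma> + norm p)"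
  using sup_conv_le[of p] sup_conv_lower[OF assms, of p p] growth[of p] by auto

end

text \<open>Points near \<open>p\<close> are handled by continuity of \<open>f\<close>; far from
  \<open>p\<close> the penalty beats the growth of \<open>f\<close> as soon as the slope is
  large.\<close>

lemma sup_conv_tendsto:
  fixes f :: "'p::euclidean_space \<Rightarrow> real"
  assumes growth: "\<And>p. \<bar>f p\<bar> \<le> c * (\<gamma> + norm p)" and c: "0 < c"
    and cont: "continuous_on UNIV f"
  shows "(\<lambda>k. sup_conv (real k) f p) \<longlonglongrightarrow> f p"
proof (rule LIMSEQ_I)
  fix e :: real assume "e > 0"
  have "isCont f p" using cont by (auto simp: continuous_on_eq_continuous_at)
  then obtain d where d: "d > 0" "\<And>q. norm (q - p) < d \<Longrightarrow> \<bar>f q - f p\<bar> < e / 2"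
    using \<open>e > 0\<close> unfolding continuous_at_eps_delta dist_norm real_norm_def
    by (metis half_gt_zero)
  \<comment> \<open>For slopes beyond \<open>k0\<close> the surplus \<open>(k - c) * d\<close>
    exceeds the growth bound at \<open>p\<close> plus \<open>\<bar>f p\<bar>\<close>, so a point at
    distance at least \<open>d\<close> contributes at most \<open>- \<bar>f p\<bar>\<close>.\<close>
  obtain k0 :: nat where k0: "real k0 > c + (c * (\<gamma> + norm p) + \<bar>f p\<bar>) / d"
    using reals_Archimedean2 by blast
  have cp: "0 \<le> c * (\<gamma> + norm p)" using growth[of p] by linarith
  have "\<bar>sup_conv (real k) f p - f p\<bar> < e" if "k \<ge> k0" for k
  proof -
    have kk: "real k \<ge> real k0" using that by simp
    have "(c * (\<gamma> + norm p) + \<bar>f p\<bar>) / d \<ge> 0" using cp d by auto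
    then have k: "c \<le> real k" using k0 kk by linarith
    have "(c * (\<gamma> + norm p) + \<bar>f p\<bar>) / d \<le> real k - c" using k0 kk by linarith
    then have kd: "c * (\<gamma> + norm p) + \<bar>f p\<bar> \<le> (real k - c) * d"
      using d by (simp add: field_simps)
    have "sup_conv (real k) f p \<le> f p + e / 2"
      unfolding sup_conv_def
    proof (rule cSUP_least[OF dense_subset_nonempty])
      fix q :: 'p
      show "f q - real k * norm (q - p) \<le> f p + e / 2"
      proof (cases "norm (q - p) < d")
        case True
        have "0 \<le> real k * norm (q - p)" by simp
        then show ?thesis using d(2)[OF True] by linarith
      next
        case False
        have "f q - c * norm (q - p) \<le> c * (\<gamma> + norm p)"
          by (rule sup_conv_term_le[OF growth c order_refl])
        moreover have "(real k - c) * d \<le> (real k - c) * norm (q - p)"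
          using False k by (intro mult_left_mono) auto
        ultimately have "f q - real k * norm (q - p) \<le> - \<bar>f p\<bar>"
          using kd by (simp add: algebra_simps)
        also have "\<dots> \<le> f p + e / 2" using \<open>e > 0\<close> by linarith
        finally show ?thesis .
      qed
    qed
    moreover have "f p - real k * norm (p - p) \<le> sup_conv (real k) f p"
      by (rule sup_conv_lower[OF growth c k cont])
    ultimately show ?thesis using \<open>e > 0\<close> by auto
  qed
  then show "\<exists>k0. \<forall>k\<ge>k0. norm (sup_conv (real k) f p - f p) < e" by auto
qed

lemma measurable_sup_conv:
  fixes G :: "'x \<Rightarrow> 'p::euclidean_space \<Rightarrow> real"
  assumes G: "\<And>q. (\<lambda>y. G y q) \<in> borel_measurable N" and P: "P \<in> borel_measurable N"
    and growth: "\<And>y. y \<in> space N \<Longrightarrow> \<exists>c \<gamma>. 0 < c \<and> c \<le> m \<and> (\<forall>p. \<bar>G y p\<bar> \<le> c * (\<gamma> + norm p))"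
  shows "(\<lambda>y. sup_conv m (G y) (P y)) \<in> borel_measurable N"
  unfolding sup_conv_def
proof (rule borel_measurable_cSUP[OF countable_dense_subset])
  show "(\<lambda>y. G y q - m * norm (q - P y)) \<in> borel_measurable N" for q
    using G P by measurable
  fix y assume "y \<in> space N"
  then obtain c \<gamma> where "0 < c" "c \<le> m" "\<And>p. \<bar>G y p\<bar> \<le> c * (\<gamma> + norm p)" using growth by blast
  from sup_conv_bdd[of "G y" c \<gamma> m, OF this(3,1,2)]
  show "bdd_above ((\<lambda>q. G y q - m * norm (q - P y)) ` dense_subset)" .
qed

section \<open>Forward averages\<close>

lemma abs_integral_le:
  fixes f g :: "'x \<Rightarrow> real"
  assumes "integrable N g" "AE x in N. \<bar>f x\<bar> \<le> g x"
  shows "\<bar>\<integral>x. f x \<partial>N\<bar> \<le> (\<integral>x. g x \<partial>N)"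
proof (cases "integrable N f")
  case True
  have "(\<integral>x. f x \<partial>N) \<le> (\<integral>x. g x \<partial>N)" "(\<integral>x. - f x \<partial>N) \<le> (\<integral>x. g x \<partial>N)"
    by (intro integral_mono_AE integrable_minus True assms(1); use assms(2) in \<open>auto elim!: eventually_mono\<close>)+
  then show ?thesis by simp
next
  \<comment> \<open>By convention the integral of a non-integrable function is 0, and the majorant
    is nonnegative almost everywhere.\<close>
  case False
  have "AE x in N. 0 \<le> g x" using assms(2) by eventually_elim linarith
  then show ?thesis using not_integrable_integral_eq[OF False] by (simp add: integral_nonneg_AE)
qed

text \<open>Cauchy-Schwarz against the indicator of \<open>A\<close>, obtained by expanding the
  nonnegative integral of \<open>(?T * f x - ?m * indicator A x)\<^sup>2\<close>.\<close>

lemma integral_sq_le: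
  fixes f :: "'x \<Rightarrow> real"
  assumes f: "integrable N f" "integrable N (\<lambda>x. (f x)\<^sup>2)"
    and A: "A \<in> sets N" "emeasure N A < \<infinity>" "\<And>x. x \<notin> A \<Longrightarrow> f x = 0"
  shows "(\<integral>x. f x \<partial>N)\<^sup>2 \<le> measure N A * (\<integral>x. (f x)\<^sup>2 \<partial>N)"
proof -
  let ?m = "\<integral>x. f x \<partial>N" and ?T = "measure N A"
  show ?thesis
  proof (cases "?T = 0")
    case True
    then have "A \<in> null_sets N" using A by (auto simp: emeasure_eq_ennreal_measure less_top intro!: null_setsI)
    from AE_not_in[OF this] have "AE x in N. f x = 0" by eventually_elim (rule A(3))
    then have "?m = (\<integral>x. 0 \<partial>N)" using f(1) by (intro integral_cong_AE) auto
    then show ?thesis using True by simp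
  next
    case False
    then have T: "?T > 0" using measure_nonneg[of N A] by linarith
    have IA: "integrable N (indicator A :: 'x \<Rightarrow> real)" using A by simp
    have "0 \<le> (\<integral>x. (?T * f x - ?m * indicator A x)\<^sup>2 \<partial>N)" by simp
    also have "\<dots> = (\<integral>x. ?T\<^sup>2 * (f x)\<^sup>2 - 2 * ?T * ?m * f x + ?m\<^sup>2 * indicator A x \<partial>N)"
      using A(3) by (intro Bochner_Integration.integral_cong)
        (auto simp: power2_diff power_mult_distrib split: split_indicator)
    also have "\<dots> = ?T\<^sup>2 * (\<integral>x. (f x)\<^sup>2 \<partial>N) - 2 * ?T * ?m * ?m + ?m\<^sup>2 * ?T"
      using f IA A(1) by simp
    also have "\<dots> = ?T * (?T * (\<integral>x. (f x)\<^sup>2 \<partial>N) - ?m\<^sup>2)"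
      by (simp add: power2_eq_square algebra_simps)
    finally show ?thesis using T by (simp add: zero_le_mult_iff)
  qed
qed

text \<open>The window looks forward only, because the equations are solved from time
  \<open>t\<close> up to \<open>t + 1 / Suc n\<close>.\<close>

definition fwd_avg :: "nat \<Rightarrow> (real \<Rightarrow> real) \<Rightarrow> real \<Rightarrow> real" where
  "fwd_avg n f t = real (Suc n) * (\<integral>u. indicator {t..t + 1 / real (Suc n)} u * f u \<partial>lborel)"

lemma measurable_fwd_avg:
  assumes [measurable]: "(\<lambda>(u, x). f u x) \<in> borel_measurable (lborel \<Otimes>\<^sub>M M)"
  shows "(\<lambda>(t, x). fwd_avg n (\<lambda>u. f u x) t) \<in> borel_measurable (lborel \<Otimes>\<^sub>M M)"
proof -
  have 1: "(\<lambda>p. f (snd p) (snd (fst p))) \<in> borel_measurable ((lborel \<Otimes>\<^sub>M M) \<Otimes>\<^sub>M lborel)"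
    using measurable_compose[OF _ assms, of "\<lambda>p. (snd p, snd (fst p))"] by simp
  have 2: "(\<lambda>p. indicator {fst (fst p)..fst (fst p) + 1 / real (Suc n)} (snd p) :: real)
      \<in> borel_measurable ((lborel \<Otimes>\<^sub>M M) \<Otimes>\<^sub>M lborel)"
    unfolding indicator_def atLeastAtMost_iff by measurable
  have "(\<lambda>p. \<integral>u. indicator {fst p..fst p + 1 / real (Suc n)} u * f u (snd p) \<partial>lborel)
      \<in> borel_measurable (lborel \<Otimes>\<^sub>M M)"
    using borel_measurable_times[OF 2 1]
    by (intro lborel.borel_measurable_lebesgue_integral) (simp add: split_beta)
  then show ?thesis
    unfolding fwd_avg_def split_beta by (intro borel_measurable_times measurable_const) auto
qed

lemma measurable_fwd_avg1:
  assumes "f \<in> borel_measurable borel"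
  shows "fwd_avg n f \<in> borel_measurable borel"
proof -
  have "(\<lambda>(u, x). f u) \<in> borel_measurable (lborel \<Otimes>\<^sub>M (count_space {()}))"
    using assms by measurable
  from measurable_compose[OF _ measurable_fwd_avg[OF this], of "\<lambda>t. (t, ())" borel]
  show ?thesis by simp
qed

lemma integrable_window:
  fixes f :: "real \<Rightarrow> real"
  assumes "integrable lborel f"
  shows "integrable lborel (\<lambda>u. indicator {a..b} u * f u)"
proof -
  have "{a..b} \<in> sets lborel" by simp
  from integrable_mult_indicator[OF this assms] show ?thesis by simp
qed

lemma fwd_avg_diff:
  assumes "integrable lborel f" "integrable lborel g"
  shows "fwd_avg n (\<lambda>u. f u - g u) t = fwd_avg n f t - fwd_avg n g t"
  unfolding fwd_avg_def using integrable_window[OF assms(1)] integrable_window[OF assms(2)]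
  by (simp add: right_diff_distrib)

lemma fwd_avg_add:
  assumes "integrable lborel f" "integrable lborel g"
  shows "fwd_avg n (\<lambda>u. f u + g u) t = fwd_avg n f t + fwd_avg n g t"
  unfolding fwd_avg_def using integrable_window[OF assms(1)] integrable_window[OF assms(2)]
  by (simp add: distrib_left)

text \<open>Tonelli: a point \<open>u\<close> lies in the windows started at times in
  \<open>{u - w..u}\<close>, a set of length \<open>w\<close>.\<close>

lemma nn_integral_window:
  assumes [measurable]: "f \<in> borel_measurable borel" and "w > 0"
  shows "(\<lambda>t. \<integral>\<^sup>+u. ennreal (indicator {t..t + w} u * \<bar>f u :: real\<bar>) \<partial>lborel) \<in> borel_measurable borel"
    and "(\<integral>\<^sup>+t. (\<integral>\<^sup>+u. ennreal (indicator {t..t + w} u * \<bar>f u\<bar>) \<partial>lborel) \<partial>lborel)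
    = ennreal w * (\<integral>\<^sup>+u. ennreal \<bar>f u\<bar> \<partial>lborel)"
proof -
  have [measurable]: "(\<lambda>p. indicator {fst p..fst p + w} (snd p) :: real)
      \<in> borel_measurable (lborel \<Otimes>\<^sub>M lborel)"
    unfolding indicator_def atLeastAtMost_iff by measurable
  have m: "(\<lambda>p. ennreal (indicator {fst p..fst p + w} (snd p) * \<bar>f (snd p)\<bar>))
      \<in> borel_measurable (lborel \<Otimes>\<^sub>M lborel)"
    by measurable
  then show "(\<lambda>t. \<integral>\<^sup>+u. ennreal (indicator {t..t + w} u * \<bar>f u :: real\<bar>) \<partial>lborel) \<in> borel_measurable borel"
    using lborel.borel_measurable_nn_integral[of "\<lambda>t u. ennreal (indicator {t..t + w} u * \<bar>f u\<bar>)" lborel]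
    by (simp add: split_beta)
  have "(\<integral>\<^sup>+t. (\<integral>\<^sup>+u. ennreal (indicator {t..t + w} u * \<bar>f u\<bar>) \<partial>lborel) \<partial>lborel)
    = (\<integral>\<^sup>+u. (\<integral>\<^sup>+t. ennreal (indicator {t..t + w} u * \<bar>f u\<bar>) \<partial>lborel) \<partial>lborel)"
    using m by (intro lborel_pair.Fubini'[symmetric]) (simp add: split_beta)
  also have "\<dots> = (\<integral>\<^sup>+u. (\<integral>\<^sup>+t. ennreal \<bar>f u\<bar> * indicator {u - w..u} t \<partial>lborel) \<partial>lborel)"
    by (intro nn_integral_cong) (auto split: split_indicator)
  also have "\<dots> = (\<integral>\<^sup>+u. ennreal w * ennreal \<bar>f u\<bar> \<partial>lborel)"
    using \<open>w > 0\<close> by (intro nn_integral_cong) (simp add: nn_integral_cmult_indicator mult.commute)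
  also have "\<dots> = ennreal w * (\<integral>\<^sup>+u. ennreal \<bar>f u\<bar> \<partial>lborel)"
    by (simp add: nn_integral_cmult)
  finally show "(\<integral>\<^sup>+t. (\<integral>\<^sup>+u. ennreal (indicator {t..t + w} u * \<bar>f u\<bar>) \<partial>lborel) \<partial>lborel)
    = ennreal w * (\<integral>\<^sup>+u. ennreal \<bar>f u\<bar> \<partial>lborel)" .
qed

text \<open>Averaging contracts L1, since the total weight \<open>w\<close> of a point cancels the
  normalisation \<open>1 / w\<close>. By contraction, L1 convergence of averages is preserved under
  L1 approximation.\<close>

lemma nn_integral_fwd_avg_le:
  assumes [measurable]: "f \<in> borel_measurable borel"
  shows "(\<integral>\<^sup>+t. ennreal \<bar>fwd_avg n f t\<bar> \<partial>lborel) \<le> (\<integral>\<^sup>+u. ennreal \<bar>f u\<bar> \<partial>lborel)"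
proof -
  define w where "w = 1 / real (Suc n)"
  have w: "w > 0" "real (Suc n) = 1 / w" unfolding w_def by auto
  have "ennreal \<bar>fwd_avg n f t\<bar> \<le> ennreal (1 / w) *
      (\<integral>\<^sup>+u. ennreal (indicator {t..t + w} u * \<bar>f u\<bar>) \<partial>lborel)" for t
  proof (cases "integrable lborel (\<lambda>u. indicator {t..t + w} u * f u)")
    case True
    have "ennreal \<bar>fwd_avg n f t\<bar> = ennreal (1 / w) * ennreal \<bar>\<integral>u. indicator {t..t + w} u * f u \<partial>lborel\<bar>"
      unfolding fwd_avg_def w(2) abs_mult using w(1) by (subst ennreal_mult'[symmetric]) auto
    also have "\<dots> \<le> ennreal (1 / w) * (\<integral>\<^sup>+u. ennreal (indicator {t..t + w} u * \<bar>f u\<bar>) \<partial>lborel)"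
      using integral_norm_bound_ennreal[OF True] by (intro mult_left_mono) (auto simp: abs_mult)
    finally show ?thesis .
  next
    case False
    then show ?thesis unfolding fwd_avg_def w(2) by (simp add: not_integrable_integral_eq)
  qed
  then have "(\<integral>\<^sup>+t. ennreal \<bar>fwd_avg n f t\<bar> \<partial>lborel) \<le> (\<integral>\<^sup>+t. ennreal (1 / w) *
      (\<integral>\<^sup>+u. ennreal (indicator {t..t + w} u * \<bar>f u\<bar>) \<partial>lborel) \<partial>lborel)"
    by (intro nn_integral_mono) auto
  also have "\<dots> = ennreal (1 / w) * (ennreal w * (\<integral>\<^sup>+u. ennreal \<bar>f u\<bar> \<partial>lborel))"
    using nn_integral_window[OF assms w(1)] by (subst nn_integral_cmult) simp_all
  also have "\<dots> = (\<integral>\<^sup>+u. ennreal \<bar>f u\<bar> \<partial>lborel)"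
    using w(1) by (simp add: mult.assoc[symmetric] ennreal_mult'[symmetric])
  finally show ?thesis .
qed

lemma integrable_fwd_avg:
  assumes f: "integrable lborel f"
  shows "integrable lborel (fwd_avg n f)" "(\<integral>t. \<bar>fwd_avg n f t\<bar> \<partial>lborel) \<le> (\<integral>t. \<bar>f t\<bar> \<partial>lborel)"
proof -
  have fm[measurable]: "f \<in> borel_measurable borel" using borel_measurable_integrable[OF f] by simp
  have fin: "(\<integral>\<^sup>+u. ennreal \<bar>f u\<bar> \<partial>lborel) = ennreal (\<integral>t. \<bar>f t\<bar> \<partial>lborel)"
    by (rule nn_integral_eq_integral) (use f in auto)
  note le = nn_integral_fwd_avg_le[OF fm, of n]
  show I: "integrable lborel (fwd_avg n f)"
    using order.strict_trans1[OF le[unfolded fin] ennreal_less_top] measurable_fwd_avg1[OF fm, of n]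
    by (intro integrableI_bounded) (simp_all del: One_nat_def)
  have "(\<integral>\<^sup>+t. ennreal \<bar>fwd_avg n f t\<bar> \<partial>lborel) = ennreal (\<integral>t. \<bar>fwd_avg n f t\<bar> \<partial>lborel)"
    by (rule nn_integral_eq_integral) (use I in auto)
  then show "(\<integral>t. \<bar>fwd_avg n f t\<bar> \<partial>lborel) \<le> (\<integral>t. \<bar>f t\<bar> \<partial>lborel)"
    using le unfolding fin by simp
qed

text \<open>At a point of the open set the average is exactly 1 from some \<open>n\<close> on, so
  the deficit inside \<open>U\<close> vanishes by dominated convergence. The mass that leaks out of
  \<open>U\<close> is at most this deficit, as averaging does not increase the total mass.\<close>

lemma fwd_avg_indicator_open:
  assumes "open U" "emeasure lborel U < \<infinity>"
  shows "(\<lambda>n. \<integral>t. \<bar>fwd_avg n (indicator U) t - indicator U t\<bar> \<partial>lborel) \<longlonglongrightarrow> 0"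
proof -
  have [measurable]: "U \<in> sets borel" using \<open>open U\<close> by simp
  let ?f = "indicator U :: real \<Rightarrow> real"
  have If: "integrable lborel ?f" using assms by simp
  define g where "g = (\<lambda>n. fwd_avg n ?f)"
  have Ig: "integrable lborel (g n)" for n unfolding g_def by (rule integrable_fwd_avg(1)[OF If])
  have [measurable]: "g n \<in> borel_measurable borel" for n using borel_measurable_integrable[OF Ig] by simp
  have g0: "0 \<le> g n t" for n t
    unfolding g_def fwd_avg_def by (intro mult_nonneg_nonneg Bochner_Integration.integral_nonneg) auto
  have g1: "g n t \<le> 1" for n t
  proof -
    have "(\<integral>u. indicator {t..t + 1 / real (Suc n)} u * ?f u \<partial>lborel)
        \<le> (\<integral>u. indicator {t..t + 1 / real (Suc n)} u \<partial>lborel)"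
      using integrable_window[OF If] by (intro integral_mono) (auto split: split_indicator)
    also have "\<dots> = 1 / real (Suc n)" by simp
    finally show ?thesis unfolding g_def fwd_avg_def by (simp add: field_simps)
  qed
  have mass: "(\<integral>t. g n t \<partial>lborel) \<le> (\<integral>t. ?f t \<partial>lborel)" for n
    using integrable_fwd_avg(2)[OF If, of n] g0[of n] by (simp add: g_def)
  have "(\<lambda>n. \<integral>t. ?f t * (1 - g n t) \<partial>lborel) \<longlonglongrightarrow> (\<integral>t. 0 \<partial>(lborel :: real measure))"
  proof (rule integral_dominated_convergence[where w="indicator U :: real \<Rightarrow> real"])
    show "AE t in lborel. (\<lambda>n. ?f t * (1 - g n t)) \<longlonglongrightarrow> 0"
    proof (rule AE_I2)
      fix t
      show "(\<lambda>n. ?f t * (1 - g n t)) \<longlonglongrightarrow> 0"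
      proof (cases "t \<in> U")
        case True
        then obtain e where e: "e > 0" "cball t e \<subseteq> U"
          using \<open>open U\<close> open_contains_cball by blast
        obtain n0 where n0: "inverse (real (Suc n0)) < e" using reals_Archimedean[OF e(1)] by auto
        have "g n t = 1" if "n \<ge> n0" for n
        proof -
          have "1 / real (Suc n) \<le> inverse (real (Suc n0))"
            using that by (simp add: field_simps)
          then have "{t..t + 1 / real (Suc n)} \<subseteq> cball t e"
            using n0 by (auto simp: dist_real_def)
          then have "{t..t + 1 / real (Suc n)} \<subseteq> U" using e by auto
          then have "(\<integral>u. indicator {t..t + 1 / real (Suc n)} u * ?f u \<partial>lborel)
            = (\<integral>u. indicator {t..t + 1 / real (Suc n)} u \<partial>lborel)"
            by (intro Bochner_Integration.integral_cong) (auto split: split_indicator)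
          also have "\<dots> = 1 / real (Suc n)" by simp
          finally show ?thesis unfolding g_def fwd_avg_def by simp
        qed
        then have "\<forall>\<^sub>F n in sequentially. ?f t * (1 - g n t) = 0"
          by (auto simp: eventually_sequentially)
        then show ?thesis by (rule tendsto_eventually)
      qed simp
    qed
    show "AE t in lborel. norm (?f t * (1 - g n t)) \<le> ?f t" for n
      using g0[of n] g1[of n] by (auto split: split_indicator)
  qed (use If in auto)
  then have lim: "(\<lambda>n. 2 * (\<integral>t. ?f t * (1 - g n t) \<partial>lborel)) \<longlonglongrightarrow> 2 * 0"
    by (intro tendsto_intros) simp
  have Ifg: "integrable lborel (\<lambda>t. ?f t * (1 - g n t))" for n
    by (rule Bochner_Integration.integrable_bound[OF If]) (use g0[of n] g1[of n] in \<open>auto split: split_indicator\<close>)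
  \<comment> \<open>Since the averages lie between 0 and 1,
    \<open>\<bar>g - 1\<bar> = (g - 1) + 2 * (1 - g)\<close> on \<open>U\<close>, and off
    \<open>U\<close> the absolute value is \<open>g\<close> itself; the signed part has nonpositive
    integral by \<open>mass\<close>.\<close>
  have eq: "(\<integral>t. \<bar>g n t - ?f t\<bar> \<partial>lborel) \<le> 2 * (\<integral>t. ?f t * (1 - g n t) \<partial>lborel)" for n
  proof -
    have "(\<integral>t. \<bar>g n t - ?f t\<bar> \<partial>lborel) = (\<integral>t. (g n t - ?f t) + 2 * (?f t * (1 - g n t)) \<partial>lborel)"
      using g0[of n] g1[of n] by (intro Bochner_Integration.integral_cong) (auto split: split_indicator)
    also have "\<dots> = ((\<integral>t. g n t \<partial>lborel) - (\<integral>t. ?f t \<partial>lborel)) + 2 * (\<integral>t. ?f t * (1 - g n t) \<partial>lborel)"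
      by (subst Bochner_Integration.integral_add) (use Ig If Ifg in auto)
    finally show ?thesis using mass[of n] by linarith
  qed
  have "(\<lambda>n. \<integral>t. \<bar>g n t - ?f t\<bar> \<partial>lborel) \<longlonglongrightarrow> 0"
  proof (rule tendsto_sandwich[OF _ _ tendsto_const])
    show "(\<lambda>n. 2 * (\<integral>t. ?f t * (1 - g n t) \<partial>lborel)) \<longlonglongrightarrow> 0" using lim by simp
    show "\<forall>\<^sub>F n in sequentially. (\<integral>t. \<bar>g n t - ?f t\<bar> \<partial>lborel)
        \<le> 2 * (\<integral>t. ?f t * (1 - g n t) \<partial>lborel)"
      using eq by (intro always_eventually allI)
  qed (auto intro!: always_eventually)
  then show ?thesis by (simp add: g_def)
qed

text \<open>Three terms of size \<open>e / 3\<close>: the approximation error, its average, which is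
  no larger by contraction, and the convergence for the approximant.\<close>

lemma fwd_avg_L1_approx:
  assumes f: "integrable lborel f"
    and approx: "\<And>e::real. e > 0 \<Longrightarrow> \<exists>g. integrable lborel g \<and>
       (\<lambda>n. \<integral>t. \<bar>fwd_avg n g t - g t\<bar> \<partial>lborel) \<longlonglongrightarrow> 0 \<and> (\<integral>t. \<bar>f t - g t\<bar> \<partial>lborel) < e"
  shows "(\<lambda>n. \<integral>t. \<bar>fwd_avg n f t - f t\<bar> \<partial>lborel) \<longlonglongrightarrow> 0"
proof (rule LIMSEQ_I)
  fix e :: real assume "e > 0"
  then obtain g where g: "integrable lborel g"
    and lim: "(\<lambda>n. \<integral>t. \<bar>fwd_avg n g t - g t\<bar> \<partial>lborel) \<longlonglongrightarrow> 0"
    and d: "(\<integral>t. \<bar>f t - g t\<bar> \<partial>lborel) < e / 3"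
    using approx[of "e / 3"] by auto
  have "\<forall>\<^sub>F n in sequentially. (\<integral>t. \<bar>fwd_avg n g t - g t\<bar> \<partial>lborel) < e / 3"
    using lim by (rule order_tendstoD) (use \<open>e > 0\<close> in simp)
  then obtain n0 where n0: "\<And>n. n \<ge> n0 \<Longrightarrow> (\<integral>t. \<bar>fwd_avg n g t - g t\<bar> \<partial>lborel) < e / 3"
    by (auto simp: eventually_sequentially)
  have fg: "integrable lborel (\<lambda>t. f t - g t)" using f g by simp
  note I = integrable_fwd_avg[OF f] integrable_fwd_avg[OF g] integrable_fwd_avg[OF fg]
  have "(\<integral>t. \<bar>fwd_avg n f t - f t\<bar> \<partial>lborel) < e" if "n \<ge> n0" for n
  proof -
    have "(\<integral>t. \<bar>fwd_avg n f t - f t\<bar> \<partial>lborel) \<le>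
      (\<integral>t. \<bar>fwd_avg n (\<lambda>t. f t - g t) t\<bar> + (\<bar>fwd_avg n g t - g t\<bar> + \<bar>f t - g t\<bar>) \<partial>lborel)"
      using I f g by (intro integral_mono) (auto simp: fwd_avg_diff)
    also have "\<dots> = (\<integral>t. \<bar>fwd_avg n (\<lambda>t. f t - g t) t\<bar> \<partial>lborel) +
        ((\<integral>t. \<bar>fwd_avg n g t - g t\<bar> \<partial>lborel) + (\<integral>t. \<bar>f t - g t\<bar> \<partial>lborel))"
      using I f g by simp
    also have "\<dots> < e"
      using I(6)[of n] n0[OF that] d by linarith
    finally show ?thesis .
  qed
  then show "\<exists>n0. \<forall>n\<ge>n0. norm ((\<integral>t. \<bar>fwd_avg n f t - f t\<bar> \<partial>lborel) - 0) < e" by auto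
qed

lemma fwd_avg_cmult: "fwd_avg n (\<lambda>u. c * f u) t = c * fwd_avg n f t"
  unfolding fwd_avg_def by (simp add: mult.left_commute)

text \<open>Lebesgue differentiation in L1 form. Indicators of Borel sets are reached from open sets
  by outer regularity, then linearity and L1 limits give all integrable functions.\<close>

lemma fwd_avg_L1_tendsto:
  assumes "integrable lborel f"
  shows "(\<lambda>n. \<integral>t. \<bar>fwd_avg n f t - f t\<bar> \<partial>lborel) \<longlonglongrightarrow> 0"
  using assms
proof (induction rule: integrable_induct)
  case (base A c)
  then have A: "A \<in> sets borel" "emeasure lborel A < \<infinity>" by auto
  let ?I = "indicator A :: real \<Rightarrow> real"
  have "(\<lambda>n. \<integral>t. \<bar>fwd_avg n ?I t - ?I t\<bar> \<partial>lborel) \<longlonglongrightarrow> 0"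
  proof (rule fwd_avg_L1_approx)
    show "integrable lborel ?I" using A by simp
    fix e :: real assume "e > 0"
    then obtain U where U: "open U" "A \<subseteq> U" "emeasure lborel (U - A) < ennreal e"
      using outer_regular_lborel[OF A(1)] by blast
    have [measurable]: "U \<in> sets borel" using U by simp
    have "emeasure lborel U \<le> emeasure lborel A + emeasure lborel (U - A)"
      using U A by (metis Un_Diff_cancel Un_absorb1 emeasure_subadditive sets_lborel sets.Diff \<open>U \<in> sets borel\<close>)
    also have "\<dots> < \<infinity>"
      using A less_trans[OF U(3) ennreal_less_top] by simp
    finally have fin: "emeasure lborel U < \<infinity>" .
    have "(\<integral>t. \<bar>?I t - indicator U t\<bar> \<partial>lborel) = (\<integral>t. indicator (U - A) t \<partial>lborel)"
      using U(2) by (intro Bochner_Integration.integral_cong) (auto split: split_indicator)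
    also have "\<dots> < e"
      using U(3) \<open>e > 0\<close> by (simp add: measure_def enn2real_less_iff less_trans[OF _ ennreal_less_top])
    finally have "(\<integral>t. \<bar>?I t - indicator U t\<bar> \<partial>lborel) < e" .
    then show "\<exists>g. integrable lborel g \<and>
       (\<lambda>n. \<integral>t. \<bar>fwd_avg n g t - g t\<bar> \<partial>lborel) \<longlonglongrightarrow> 0 \<and> (\<integral>t. \<bar>?I t - g t\<bar> \<partial>lborel) < e"
      using fwd_avg_indicator_open[OF U(1) fin] fin by (intro exI[of _ "indicator U"]) auto
  qed
  then have "(\<lambda>n. \<bar>c\<bar> * (\<integral>t. \<bar>fwd_avg n ?I t - ?I t\<bar> \<partial>lborel)) \<longlonglongrightarrow> \<bar>c\<bar> * 0"
    by (intro tendsto_intros)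
  moreover have "\<bar>fwd_avg n (\<lambda>t. indicator A t *\<^sub>R c) t - indicator A t *\<^sub>R c\<bar>
      = \<bar>c\<bar> * \<bar>fwd_avg n ?I t - ?I t\<bar>" for n t
    using fwd_avg_cmult[of n c ?I t] by (simp add: mult.commute right_diff_distrib flip: abs_mult)
  ultimately show ?case by simp
next
  case (add f g)
  note I = integrable_fwd_avg(1)[OF add(1)] integrable_fwd_avg(1)[OF add(2)]
  have lim: "(\<lambda>n. (\<integral>t. \<bar>fwd_avg n f t - f t\<bar> \<partial>lborel) + (\<integral>t. \<bar>fwd_avg n g t - g t\<bar> \<partial>lborel)) \<longlonglongrightarrow> 0"
    using tendsto_add[OF add(3,4)] by simp
  have le: "(\<integral>t. \<bar>fwd_avg n (\<lambda>t. f t + g t) t - (f t + g t)\<bar> \<partial>lborel)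
      \<le> (\<integral>t. \<bar>fwd_avg n f t - f t\<bar> \<partial>lborel) + (\<integral>t. \<bar>fwd_avg n g t - g t\<bar> \<partial>lborel)" for n
  proof -
    have "(\<integral>t. \<bar>fwd_avg n (\<lambda>t. f t + g t) t - (f t + g t)\<bar> \<partial>lborel)
      \<le> (\<integral>t. \<bar>fwd_avg n f t - f t\<bar> + \<bar>fwd_avg n g t - g t\<bar> \<partial>lborel)"
      using I add(1,2) integrable_fwd_avg(1)[of "\<lambda>t. f t + g t"]
      by (intro integral_mono) (auto simp: fwd_avg_add)
    also have "\<dots> = (\<integral>t. \<bar>fwd_avg n f t - f t\<bar> \<partial>lborel) + (\<integral>t. \<bar>fwd_avg n g t - g t\<bar> \<partial>lborel)"
      using I add(1,2) by (intro Bochner_Integration.integral_add) auto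
    finally show ?thesis .
  qed
  show ?case
    by (rule tendsto_sandwich[OF _ _ tendsto_const lim]) (auto intro!: always_eventually le)
next
  case (lim f s)
  show ?case
  proof (rule fwd_avg_L1_approx)
    show "integrable lborel f" by fact
    fix e :: real assume "e > 0"
    have "(\<lambda>i. \<integral>t. \<bar>f t - s i t\<bar> \<partial>lborel) \<longlonglongrightarrow> (\<integral>t. 0 \<partial>(lborel :: real measure))"
    proof (rule integral_dominated_convergence[where w="\<lambda>t. 3 * \<bar>f t\<bar>"])
      show "AE t in lborel. (\<lambda>i. \<bar>f t - s i t\<bar>) \<longlonglongrightarrow> 0"
      proof (rule AE_I2)
        fix t
        have "(\<lambda>i. \<bar>f t - s i t\<bar>) \<longlonglongrightarrow> \<bar>f t - f t\<bar>"
          by (intro tendsto_intros lim(2)) simp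
        then show "(\<lambda>i. \<bar>f t - s i t\<bar>) \<longlonglongrightarrow> 0" by simp
      qed
      show "AE t in lborel. norm \<bar>f t - s i t\<bar> \<le> 3 * \<bar>f t\<bar>" for i
      proof (rule AE_I2)
        fix t
        show "norm \<bar>f t - s i t\<bar> \<le> 3 * \<bar>f t\<bar>"
          using lim(3)[of t i] by (auto simp: real_norm_def)
      qed
    qed (use lim in \<open>auto dest: borel_measurable_integrable\<close>)
    then have "\<forall>\<^sub>F i in sequentially. (\<integral>t. \<bar>f t - s i t\<bar> \<partial>lborel) < e"
      by (rule order_tendstoD) (use \<open>e > 0\<close> in simp)
    then obtain i where "(\<integral>t. \<bar>f t - s i t\<bar> \<partial>lborel) < e"
      by (auto dest: eventually_happens)
    then show "\<exists>g. integrable lborel g \<and>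
       (\<lambda>n. \<integral>t. \<bar>fwd_avg n g t - g t\<bar> \<partial>lborel) \<longlonglongrightarrow> 0 \<and> (\<integral>t. \<bar>f t - g t\<bar> \<partial>lborel) < e"
      using lim by (intro exI[of _ "s i"]) auto
  qed
qed

section \<open>Lebesgue points on the product of time and probability space\<close>

text \<open>The one-dimensional statement on almost every path, integrated over paths by dominated
  convergence; contraction bounds the error on a path by twice its L1 norm
  \<open>H x\<close>.\<close>

lemma fwd_avg_pair_L1_tendsto:
  assumes "sigma_finite_measure M"
  assumes h: "integrable (lborel \<Otimes>\<^sub>M M) (\<lambda>(u, x). h u x :: real)"
  shows "integrable (lborel \<Otimes>\<^sub>M M) (\<lambda>(t, x). \<bar>fwd_avg n (\<lambda>u. h u x) t - h t x\<bar>)"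
    and "(\<lambda>n. \<integral>p. \<bar>fwd_avg n (\<lambda>u. h u (snd p)) (fst p) - h (fst p) (snd p)\<bar> \<partial>(lborel \<Otimes>\<^sub>M M)) \<longlonglongrightarrow> 0"
proof -
  interpret M: sigma_finite_measure M by fact
  interpret pair_sigma_finite lborel M ..
  have hm[measurable]: "(\<lambda>(u, x). h u x) \<in> borel_measurable (lborel \<Otimes>\<^sub>M M)"
    using h by (rule borel_measurable_integrable)
  define D where "D = (\<lambda>n p. \<bar>fwd_avg n (\<lambda>u. h u (snd p)) (fst p) - h (fst p) (snd p)\<bar>)"
  have [measurable]: "D n \<in> borel_measurable (lborel \<Otimes>\<^sub>M M)" for n
    using measurable_fwd_avg[OF hm, of n] hm unfolding D_def split_beta by measurable
  have hx: "AE x in M. integrable lborel (\<lambda>u. h u x)"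
    using AE_integrable_snd[OF h] by simp
  define H where "H = (\<lambda>x. \<integral>u. \<bar>h u x\<bar> \<partial>lborel)"
  have "integrable (lborel \<Otimes>\<^sub>M M) (\<lambda>(u, x). \<bar>h u x\<bar>)"
    using integrable_abs[OF h] by (simp add: case_prod_beta')
  from integrable_snd[OF this] have H: "integrable M H" unfolding H_def by simp
  have Dx: "integrable lborel (\<lambda>t. D n (t, x))" "(\<integral>t. D n (t, x) \<partial>lborel) \<le> 2 * H x"
    if "integrable lborel (\<lambda>u. h u x)" for n x
  proof -
    note I = integrable_fwd_avg[OF that, of n]
    show "integrable lborel (\<lambda>t. D n (t, x))" unfolding D_def using I that by simp
    have "(\<integral>t. D n (t, x) \<partial>lborel) \<le> (\<integral>t. \<bar>fwd_avg n (\<lambda>u. h u x) t\<bar> + \<bar>h t x\<bar> \<partial>lborel)"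
      unfolding D_def using I that by (intro integral_mono) auto
    also have "\<dots> \<le> 2 * H x" using I that by (simp add: H_def)
    finally show "(\<integral>t. D n (t, x) \<partial>lborel) \<le> 2 * H x" .
  qed
  have D0: "0 \<le> D n p" for n p by (simp add: D_def)
  have E: "integrable M (\<lambda>x. \<integral>t. D n (t, x) \<partial>lborel)" for n
  proof (rule Bochner_Integration.integrable_bound[where f="\<lambda>x. 2 * H x"])
    show "AE x in M. norm (\<integral>t. D n (t, x) \<partial>lborel) \<le> norm (2 * H x)"
      using hx
    proof eventually_elim
      case (elim x)
      have "0 \<le> (\<integral>t. D n (t, x) \<partial>lborel)" using D0 by simp
      then show ?case using Dx(2)[OF elim, of n] by simp
    qed
    have "(\<lambda>(x, t). D n (t, x)) \<in> borel_measurable (M \<Otimes>\<^sub>M lborel)" by measurable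
    then show "(\<lambda>x. \<integral>t. D n (t, x) \<partial>lborel) \<in> borel_measurable M"
      by (rule lborel.borel_measurable_lebesgue_integral)
  qed (use H in simp)
  have ID: "integrable (lborel \<Otimes>\<^sub>M M) (D n)" for n
  proof -
    have "(\<integral>\<^sup>+p. ennreal (D n p) \<partial>(lborel \<Otimes>\<^sub>M M)) = (\<integral>\<^sup>+x. (\<integral>\<^sup>+t. ennreal (D n (t, x)) \<partial>lborel) \<partial>M)"
      by (rule nn_integral_snd[symmetric]) measurable
    also have "\<dots> = (\<integral>\<^sup>+x. ennreal (\<integral>t. D n (t, x) \<partial>lborel) \<partial>M)"
      by (rule nn_integral_cong_AE) (use hx in \<open>eventually_elim, simp add: nn_integral_eq_integral Dx D0\<close>)
    also have "\<dots> < \<infinity>"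
      by (subst nn_integral_eq_integral[OF E]) (auto intro!: Bochner_Integration.integral_nonneg D0)
    finally show ?thesis by (intro integrableI_bounded) (auto simp: D0)
  qed
  then show "integrable (lborel \<Otimes>\<^sub>M M) (\<lambda>(t, x). \<bar>fwd_avg n (\<lambda>u. h u x) t - h t x\<bar>)"
    unfolding D_def split_beta .
  have "(\<lambda>n. \<integral>x. (\<integral>t. D n (t, x) \<partial>lborel) \<partial>M) \<longlonglongrightarrow> (\<integral>x. 0 \<partial>M)"
  proof (rule integral_dominated_convergence[where w="\<lambda>x. 2 * H x"])
    show "AE x in M. (\<lambda>n. \<integral>t. D n (t, x) \<partial>lborel) \<longlonglongrightarrow> 0"
      using hx
    proof eventually_elim
      case (elim x)
      from fwd_avg_L1_tendsto[OF this] show ?case by (simp add: D_def)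
    qed
    show "AE x in M. norm (\<integral>t. D n (t, x) \<partial>lborel) \<le> 2 * H x" for n
      using hx
    proof eventually_elim
      case (elim x)
      have "0 \<le> (\<integral>t. D n (t, x) \<partial>lborel)" using D0 by simp
      then show ?case using Dx(2)[OF elim, of n] by simp
    qed
  qed (use H E in \<open>auto dest: borel_measurable_integrable\<close>)
  moreover have "(\<integral>x. (\<integral>t. D n (t, x) \<partial>lborel) \<partial>M) = (\<integral>p. D n p \<partial>(lborel \<Otimes>\<^sub>M M))" for n
    using integral_snd[of "\<lambda>t x. D n (t, x)"] ID[of n] by simp
  ultimately show "(\<lambda>n. \<integral>p. \<bar>fwd_avg n (\<lambda>u. h u (snd p)) (fst p) - h (fst p) (snd p)\<bar> \<partial>(lborel \<Otimes>\<^sub>M M)) \<longlonglongrightarrow> 0"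
    by (simp add: D_def)
qed

text \<open>Both functions are treated at once so that they share a subsequence. The statement on
  the product is then sliced by time, which puts the null set of times first, independent of the
  path.\<close>

lemma fwd_avg_AE_subseq:
  assumes M: "sigma_finite_measure M"
  assumes h: "integrable (lborel \<Otimes>\<^sub>M M) (\<lambda>(u, x). h1 u x :: real)"
    "integrable (lborel \<Otimes>\<^sub>M M) (\<lambda>(u, x). h2 u x :: real)"
  shows "\<exists>r::nat \<Rightarrow> nat. strict_mono r \<and> (AE t in lborel. AE x in M.
    (\<lambda>k. fwd_avg (r k) (\<lambda>u. h1 u x) t) \<longlonglongrightarrow> h1 t x \<and> (\<lambda>k. fwd_avg (r k) (\<lambda>u. h2 u x) t) \<longlonglongrightarrow> h2 t x)"
proof -
  interpret M: sigma_finite_measure M by fact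
  interpret pair_sigma_finite lborel M ..
  define D :: "(real \<Rightarrow> 'a \<Rightarrow> real) \<Rightarrow> nat \<Rightarrow> real \<times> 'a \<Rightarrow> real" where
    "D = (\<lambda>h n p. \<bar>fwd_avg n (\<lambda>u. h u (snd p)) (fst p) - h (fst p) (snd p)\<bar>)"
  have I: "integrable (lborel \<Otimes>\<^sub>M M) (D h1 n)" "integrable (lborel \<Otimes>\<^sub>M M) (D h2 n)" for n
    using fwd_avg_pair_L1_tendsto(1)[OF M h(1), of n] fwd_avg_pair_L1_tendsto(1)[OF M h(2), of n]
    by (simp_all add: D_def case_prod_beta')
  have "(\<lambda>n. (\<integral>p. D h1 n p \<partial>(lborel \<Otimes>\<^sub>M M)) + (\<integral>p. D h2 n p \<partial>(lborel \<Otimes>\<^sub>M M))) \<longlonglongrightarrow> 0"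
    using tendsto_add[OF fwd_avg_pair_L1_tendsto(2)[OF M h(1)] fwd_avg_pair_L1_tendsto(2)[OF M h(2)]]
    by (simp add: D_def)
  moreover have "(\<integral>p. norm (D h1 n p + D h2 n p) \<partial>(lborel \<Otimes>\<^sub>M M))
      = (\<integral>p. D h1 n p \<partial>(lborel \<Otimes>\<^sub>M M)) + (\<integral>p. D h2 n p \<partial>(lborel \<Otimes>\<^sub>M M))" for n
  proof -
    have "(\<integral>p. norm (D h1 n p + D h2 n p) \<partial>(lborel \<Otimes>\<^sub>M M)) = (\<integral>p. D h1 n p + D h2 n p \<partial>(lborel \<Otimes>\<^sub>M M))"
      by (rule Bochner_Integration.integral_cong) (auto simp: D_def)
    then show ?thesis using I[of n] by simp
  qed
  ultimately have "(\<lambda>n. \<integral>p. norm (D h1 n p + D h2 n p) \<partial>(lborel \<Otimes>\<^sub>M M)) \<longlonglongrightarrow> 0" by simp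
  from tendsto_L1_AE_subseq[OF _ this] I obtain r :: "nat \<Rightarrow> nat" where r: "strict_mono r"
    and ae: "AE p in lborel \<Otimes>\<^sub>M M. (\<lambda>k. D h1 (r k) p + D h2 (r k) p) \<longlonglongrightarrow> 0"
    by (auto intro: Bochner_Integration.integrable_add)
  have "AE p in lborel \<Otimes>\<^sub>M M. (\<lambda>k. fwd_avg (r k) (\<lambda>u. h1 u (snd p)) (fst p)) \<longlonglongrightarrow> h1 (fst p) (snd p) \<and>
      (\<lambda>k. fwd_avg (r k) (\<lambda>u. h2 u (snd p)) (fst p)) \<longlonglongrightarrow> h2 (fst p) (snd p)"
    using ae
  proof eventually_elim
    case (elim p)
    have "(\<lambda>k. D h1 (r k) p) \<longlonglongrightarrow> 0" "(\<lambda>k. D h2 (r k) p) \<longlonglongrightarrow> 0"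
      by (rule tendsto_sandwich[OF _ _ tendsto_const elim]; force simp: D_def intro!: always_eventually)+
    then show ?case unfolding D_def
      by (auto intro: LIM_zero_cancel tendsto_rabs_zero_cancel)
  qed
  from AE_pair[OF this] show ?thesis using r by auto
qed

lemma fwd_avg_abs_le:
  assumes "\<And>u. u \<in> {t..t + 1 / real (Suc n)} \<Longrightarrow> \<bar>f u\<bar> \<le> e"
  shows "\<bar>fwd_avg n f t\<bar> \<le> e"
proof -
  let ?w = "1 / real (Suc n)"
  have I: "integrable lborel (\<lambda>u. indicator {t..t + ?w} u * e)" by (intro integrable_mult_left) (simp add: integrable_indicator_iff)
  have "\<bar>\<integral>u. indicator {t..t + ?w} u * f u \<partial>lborel\<bar> \<le> (\<integral>u. indicator {t..t + ?w} u * e \<partial>lborel)"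
    by (rule abs_integral_le[OF I]) (use assms in \<open>auto split: split_indicator\<close>)
  also have "\<dots> = ?w * e" by simp
  finally show ?thesis unfolding fwd_avg_def abs_mult by (simp add: field_simps)
qed

text \<open>Jensen's inequality for the uniform law on the window, from
  \<open>integral_sq_le\<close>.\<close>

lemma fwd_avg_sq_le:
  assumes f: "integrable lborel f" "integrable lborel (\<lambda>u. (f u)\<^sup>2)"
  shows "(fwd_avg n f t)\<^sup>2 \<le> fwd_avg n (\<lambda>u. (f u)\<^sup>2) t"
proof -
  let ?A = "{t..t + 1 / real (Suc n)}" let ?f = "\<lambda>u. indicator ?A u * f u"
  have sq: "(?f u)\<^sup>2 = indicator ?A u * (f u)\<^sup>2" for u by (simp split: split_indicator)
  have "(\<integral>u. ?f u \<partial>lborel)\<^sup>2 \<le> measure lborel ?A * (\<integral>u. (?f u)\<^sup>2 \<partial>lborel)"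
  proof (rule integral_sq_le[OF integrable_window[OF f(1)]])
    show "integrable lborel (\<lambda>u. (?f u)\<^sup>2)" unfolding sq by (rule integrable_window[OF f(2)])
  qed auto
  then have "(real (Suc n))\<^sup>2 * (\<integral>u. ?f u \<partial>lborel)\<^sup>2 \<le> (real (Suc n))\<^sup>2 * (1 / real (Suc n) * (\<integral>u. (?f u)\<^sup>2 \<partial>lborel))"
    by (intro mult_left_mono) auto
  also have "\<dots> = real (Suc n) * (\<integral>u. (?f u)\<^sup>2 \<partial>lborel)" by (simp add: power2_eq_square)
  finally show ?thesis unfolding fwd_avg_def sq by (simp only: power_mult_distrib)
qed

section \<open>Stopping times and martingales on the Brownian filtration\<close>

lemma integral_lborel_prod:
  fixes f :: "'b::euclidean_space \<Rightarrow> real \<Rightarrow> real"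
  assumes "\<And>b. b \<in> Basis \<Longrightarrow> integrable lborel (f b)"
  shows "integrable lborel (\<lambda>x. \<Prod>b\<in>Basis. f b (x \<bullet> b))"
    and "(\<integral>x. (\<Prod>b\<in>Basis. f b (x \<bullet> b)) \<partial>lborel) = (\<Prod>b\<in>Basis. (\<integral>x. f b x \<partial>lborel))"
proof -
  interpret product_sigma_finite "\<lambda>_::'b. lborel :: real measure" ..
  have m: "(\<lambda>g. \<Sum>b\<in>Basis. g b *\<^sub>R b) \<in> measurable (\<Pi>\<^sub>M b\<in>(Basis :: 'b set). lborel) borel"
    by measurable
  have fm: "f b \<in> borel_measurable borel" if "b \<in> Basis" for b
    using borel_measurable_integrable[OF assms[OF that]] by simp
  have pm: "(\<lambda>x. \<Prod>b\<in>Basis. f b (x \<bullet> b)) \<in> borel_measurable borel"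
    using fm by (intro borel_measurable_prod measurable_compose[OF _ fm]) auto
  have eq: "(\<Prod>b\<in>Basis. f b ((\<Sum>b\<in>Basis. g b *\<^sub>R b) \<bullet> b)) = (\<Prod>b\<in>Basis. f b (g b))" for g :: "'b \<Rightarrow> real"
    by (intro prod.cong) auto
  show "integrable lborel (\<lambda>x. \<Prod>b\<in>Basis. f b (x \<bullet> b))"
    using product_integrable_prod[OF finite_Basis assms]
    by (subst lborel_eq) (simp add: integrable_distr_eq[OF m pm] eq)
  show "(\<integral>x. (\<Prod>b\<in>Basis. f b (x \<bullet> b)) \<partial>lborel) = (\<Prod>b\<in>Basis. (\<integral>x. f b x \<partial>lborel))"
    using product_integral_prod[OF finite_Basis assms]
    by (subst lborel_eq) (simp add: integral_distr[OF m pm] eq)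
qed

lemma prod_Basis_vec: "(\<Prod>b\<in>(Basis :: (real ^ 'd::finite) set). f b) = (\<Prod>i\<in>UNIV. f (axis i 1))"
proof -
  have B: "(Basis :: (real ^ 'd) set) = (\<lambda>i. axis i 1) ` UNIV"
    by (auto simp: Basis_vec_def)
  have i: "inj (\<lambda>i::'d. axis i (1::real))"
    by (auto simp: inj_on_def axis_eq_axis)
  show ?thesis unfolding B prod.reindex[OF i] comp_def ..
qed

lemma integral_lborel_prod_vec:
  fixes f :: "'d::finite \<Rightarrow> real \<Rightarrow> real"
  assumes "\<And>i. integrable lborel (f i)"
  shows "integrable lborel (\<lambda>x::real ^ 'd. \<Prod>i\<in>UNIV. f i (x $ i))"
    and "(\<integral>x. (\<Prod>i\<in>UNIV. f i (x $ i)) \<partial>(lborel :: (real ^ 'd) measure)) = (\<Prod>i\<in>UNIV. (\<integral>x. f i x \<partial>lborel))"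
proof -
  \<comment> \<open>The basis of \<open>real ^ 'd\<close> consists of the axis vectors, and
    \<open>THE\<close> reads the index back from such a vector.\<close>
  define g where "g = (\<lambda>b::real ^ 'd. f (THE i. b = axis i 1))"
  have g: "g (axis i 1) = f i" for i
    by (simp add: g_def axis_eq_axis)
  have gi: "\<And>b. b \<in> Basis \<Longrightarrow> integrable lborel (g b)"
    using assms unfolding Basis_vec_def by (auto simp: g)
  note I = integral_lborel_prod[of g, OF gi, simplified]
  show "integrable lborel (\<lambda>x::real ^ 'd. \<Prod>i\<in>UNIV. f i (x $ i))"
    "(\<integral>x. (\<Prod>i\<in>UNIV. f i (x $ i)) \<partial>(lborel :: (real ^ 'd) measure)) = (\<Prod>i\<in>UNIV. (\<integral>x. f i x \<partial>lborel))"
    using I by (simp_all add: prod_Basis_vec g inner_axis)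
qed

lemma normal_product_moment:
  fixes k :: "'d::finite \<Rightarrow> nat"
  assumes D: "distributed M lborel X (\<lambda>x::real ^ 'd. ennreal (\<Prod>i\<in>UNIV. normal_density 0 s (x $ i)))"
    and "s > 0"
  shows "integrable M (\<lambda>w. \<Prod>i\<in>UNIV. (X w $ i) ^ k i)"
    and "(\<integral>w. (\<Prod>i\<in>UNIV. (X w $ i) ^ k i) \<partial>M) = (\<Prod>i\<in>UNIV. \<integral>x. normal_density 0 s x * x ^ k i \<partial>lborel)"
proof -
  have I: "integrable lborel (\<lambda>x. normal_density 0 s x * x ^ k i)" for i
    using integrable_normal_moment[OF \<open>s > 0\<close>, of 0] by simp
  have m: "(\<lambda>x::real ^ 'd. \<Prod>i\<in>UNIV. (x $ i) ^ k i) \<in> borel_measurable lborel" by measurable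
  have nn: "0 \<le> (\<Prod>i\<in>UNIV. normal_density 0 s (x $ i))" for x :: "real ^ 'd"
    by (intro prod_nonneg) auto
  note L = integral_lborel_prod_vec[of "\<lambda>i x. normal_density 0 s x * x ^ k i", OF I, unfolded prod.distrib]
  show "integrable M (\<lambda>w. \<Prod>i\<in>UNIV. (X w $ i) ^ k i)"
    using distributed_integrable[OF D m nn] L(1) by simp
  show "(\<integral>w. (\<Prod>i\<in>UNIV. (X w $ i) ^ k i) \<partial>M) = (\<Prod>i\<in>UNIV. \<integral>x. normal_density 0 s x * x ^ k i \<partial>lborel)"
    using distributed_integral[OF D m nn] L(2) by simp
qed

lemma normal_vec_moments:
  assumes D: "distributed M lborel X (\<lambda>x::real ^ 'd::finite. ennreal (\<Prod>i\<in>UNIV. normal_density 0 s (x $ i)))"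
    and "s > 0"
  shows "integrable M (\<lambda>w. X w $ i)" "(\<integral>w. X w $ i \<partial>M) = 0"
    "integrable M (\<lambda>w. X w $ i * X w $ j)"
    "(\<integral>w. X w $ i * X w $ j \<partial>M) = (if i = j then s\<^sup>2 else 0)"
proof -
  have m0: "(\<integral>x. normal_density 0 s x \<partial>lborel) = 1"
    and m1: "(\<integral>x. normal_density 0 s x * x \<partial>lborel) = 0"
    and m2: "(\<integral>x. normal_density 0 s x * x\<^sup>2 \<partial>lborel) = s\<^sup>2"
    using integral_normal_density[OF \<open>s > 0\<close>, of 0] integral_normal_moment_nz_1[OF \<open>s > 0\<close>, of 0]
      integral_normal_moment_even[OF \<open>s > 0\<close>, of 0 1] by (simp_all add: eval_nat_numeral)
  have p1: "(\<Prod>l\<in>UNIV. x $ l ^ (if l = i then 1 else 0)) = x $ i" for x :: "real ^ 'd" and i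
  proof -
    have "(\<Prod>l\<in>UNIV. x $ l ^ (if l = i then 1 else 0)) = (\<Prod>l\<in>UNIV. if l = i then x $ i else 1)"
      by (intro prod.cong) auto
    then show ?thesis by simp
  qed
  note N = normal_product_moment[OF D \<open>s > 0\<close>]
  show "integrable M (\<lambda>w. X w $ i)"
    using N(1)[of "\<lambda>l. if l = i then 1 else 0"] by (simp only: p1)
  have "(\<integral>w. X w $ i \<partial>M) = (\<Prod>l\<in>UNIV. \<integral>x. normal_density 0 s x * x ^ (if l = i then 1 else 0) \<partial>lborel)"
    using N(2)[of "\<lambda>l. if l = i then 1 else 0"] by (simp only: p1)
  also have "\<dots> = 0" by (rule prod_zero) (auto intro!: bexI[of _ i] simp: m1)
  finally show "(\<integral>w. X w $ i \<partial>M) = 0" .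
  \<comment> \<open>Exponents that make the monomial equal to \<open>x $ i * x $ j\<close>; for
    \<open>i \<noteq> j\<close> they leave a first moment as a factor, which is zero.\<close>
  define k :: "'d \<Rightarrow> nat" where "k = (\<lambda>l. (if l = i then 1 else 0) + (if l = j then 1 else 0))"
  have p2: "(\<Prod>l\<in>UNIV. x $ l ^ k l) = x $ i * x $ j" for x :: "real ^ 'd"
    unfolding k_def power_add prod.distrib p1 ..
  show "integrable M (\<lambda>w. X w $ i * X w $ j)"
    using N(1)[of k] by (simp only: p2)
  have *: "(\<integral>w. X w $ i * X w $ j \<partial>M) = (\<Prod>l\<in>UNIV. \<integral>x. normal_density 0 s x * x ^ k l \<partial>lborel)"
    using N(2)[of k] by (simp only: p2)
  show "(\<integral>w. X w $ i * X w $ j \<partial>M) = (if i = j then s\<^sup>2 else 0)"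
  proof (cases "i = j")
    case True
    have "(\<Prod>l\<in>UNIV. \<integral>x. normal_density 0 s x * x ^ k l \<partial>lborel) = (\<Prod>l\<in>UNIV. if l = i then s\<^sup>2 else 1)"
      using True by (intro prod.cong) (auto simp: k_def m0 m2 numeral_2_eq_2[symmetric])
    then show ?thesis using True * by simp
  next
    case False
    have "(\<Prod>l\<in>UNIV. \<integral>x. normal_density 0 s x * x ^ k l \<partial>lborel) = 0"
      using False by (intro prod_zero) (auto intro!: bexI[of _ i] simp: m1 k_def)
    then show ?thesis using False * by simp
  qed
qed

locale brownian_setting =
  fixes M :: "'a measure" and B :: "real \<Rightarrow> 'a \<Rightarrow> real ^ 'd::finite" and F :: "real \<Rightarrow> 'a measure"
  assumes prob_M: "prob_space M" and complete_M: "complete_measure M"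
    and BM: "brownian_motion M B" and F_eq: "F = augmented_filtration M B"

sublocale brownian_setting \<subseteq> prob_space M by (rule prob_M)
sublocale brownian_setting \<subseteq> complete_measure M by (rule complete_M)
sublocale brownian_setting \<subseteq> filtration "space M" F
  unfolding F_eq by (rule filtration_augmented_filtration)

section \<open>Step functions and grids\<close>

lemma step_sum_eq:
  fixes q :: "nat \<Rightarrow> real" and f :: "nat \<Rightarrow> 'v::real_vector"
  assumes mono: "\<And>i. i < n \<Longrightarrow> q i \<le> q (Suc i)" and j: "j < n" "u \<in> {q j<..q (Suc j)}"
  shows "(\<Sum>i<n. indicator {q i<..q (Suc i)} u *\<^sub>R f i) = f j"
proof -
  have le: "q i \<le> q k" if "i \<le> k" "k \<le> n" for i k
    using that by (induction rule: dec_induct) (use mono in \<open>auto intro: order_trans\<close>)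
  have "indicator {q i<..q (Suc i)} u *\<^sub>R f i = (if i = j then f j else 0)" if "i < n" for i
  proof (cases i j rule: linorder_cases)
    case less
    then have "q (Suc i) \<le> q j" using le[of "Suc i" j] j(1) by auto
    then show ?thesis using less j by auto
  next
    case greater
    then have "q (Suc j) \<le> q i" using le[of "Suc j" i] that by auto
    then show ?thesis using greater j by auto
  qed (use j in auto)
  then have "(\<Sum>i<n. indicator {q i<..q (Suc i)} u *\<^sub>R f i) = (\<Sum>i<n. if i = j then f j else 0)"
    by (intro sum.cong) auto
  then show ?thesis using j by simp
qed

lemma step_sum_zero:
  fixes q :: "nat \<Rightarrow> real" and f :: "nat \<Rightarrow> 'v::real_vector"
  assumes "\<And>j. j < n \<Longrightarrow> u \<notin> {q j<..q (Suc j)}"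
  shows "(\<Sum>i<n. indicator {q i<..q (Suc i)} u *\<^sub>R f i) = 0"
  using assms by (intro sum.neutral) auto

lemma step_exists:
  fixes q :: "nat \<Rightarrow> real"
  assumes "q 0 < u" "u \<le> q n"
  shows "\<exists>j<n. u \<in> {q j<..q (Suc j)}"
  using assms(2)
proof (induction n)
  case (Suc n)
  then show ?case by (cases "u \<le> q n") (auto intro: less_SucI)
qed (use assms in auto)

lemma norm_elementary_process_sq:
  assumes "\<And>i. i < n \<Longrightarrow> p i \<le> p (Suc i)"
  shows "(norm (elementary_process n p \<phi> u w))\<^sup>2
    = (\<Sum>i<n. indicator {p i<..p (Suc i)} u * (norm (\<phi> i w))\<^sup>2)"
proof (cases "\<exists>j<n. u \<in> {p j<..p (Suc j)}")
  case True
  then obtain j where j: "j < n" "u \<in> {p j<..p (Suc j)}" by auto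
  show ?thesis
    using step_sum_eq[OF assms j, of "\<lambda>i. \<phi> i w"] step_sum_eq[OF assms j, of "\<lambda>i. (norm (\<phi> i w))\<^sup>2"]
    by (simp add: elementary_process_def)
next
  case False
  then show ?thesis
    using step_sum_zero[of n u p "\<lambda>i. \<phi> i w"] step_sum_zero[of n u p "\<lambda>i. (norm (\<phi> i w))\<^sup>2"]
    by (simp add: elementary_process_def)
qed

text \<open>Clamping the partition points to \<open>{q..q'}\<close> turns the increment of the
  integral into a sum over the clamped partition with the same coefficients.\<close>

lemma elementary_integral_increment:
  assumes "q \<le> q'"
  shows "elementary_integral B n p \<phi> q' w - elementary_integral B n p \<phi> q w =
    (\<Sum>i<n. \<phi> i w \<bullet> (B (max q (min q' (p (Suc i)))) w - B (max q (min q' (p i))) w))"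
proof -
  have a: "B (min x q') w - B (min x q) w = B (max q (min q' x)) w - B q w" for x
    using assms by (auto simp: min_def max_def)
  have *: "(B (min x q') w - B (min y q') w) - (B (min x q) w - B (min y q) w)
      = B (max q (min q' x)) w - B (max q (min q' y)) w" for x y
  proof -
    have "(B (min x q') w - B (min y q') w) - (B (min x q) w - B (min y q) w)
      = (B (min x q') w - B (min x q) w) - (B (min y q') w - B (min y q) w)"
      by simp
    then show ?thesis by (simp only: a) simp
  qed
  show ?thesis
    unfolding elementary_integral_def sum_subtractf[symmetric] inner_diff_right[symmetric] * ..
qed

lemma integrable_tensor:
  fixes f :: "'x \<Rightarrow> real" and g :: "'y \<Rightarrow> real"
  assumes "sigma_finite_measure N" "sigma_finite_measure M" "integrable N f" "integrable M g"
  shows "integrable (N \<Otimes>\<^sub>M M) (\<lambda>p. f (fst p) * g (snd p))"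
    "(\<integral>p. f (fst p) * g (snd p) \<partial>(N \<Otimes>\<^sub>M M)) = (\<integral>x. f x \<partial>N) * (\<integral>y. g y \<partial>M)"
proof -
  interpret N: sigma_finite_measure N by fact
  interpret M: sigma_finite_measure M by fact
  interpret pair_sigma_finite N M ..
  have [measurable]: "f \<in> borel_measurable N" "g \<in> borel_measurable M" using assms by auto
  show I: "integrable (N \<Otimes>\<^sub>M M) (\<lambda>p. f (fst p) * g (snd p))"
  proof (rule Fubini_integrable)
    show "integrable N (\<lambda>x. \<integral>y. norm (f (fst (x, y)) * g (snd (x, y))) \<partial>M)"
      using assms by (simp add: abs_mult)
    show "AE x in N. integrable M (\<lambda>y. f (fst (x, y)) * g (snd (x, y)))"
      using assms by simp
  qed measurable
  show "(\<integral>p. f (fst p) * g (snd p) \<partial>(N \<Otimes>\<^sub>M M)) = (\<integral>x. f x \<partial>N) * (\<integral>y. g y \<partial>M)"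
    using integral_fst'[OF I] by simp
qed

definition grid :: "real \<Rightarrow> real \<Rightarrow> nat \<Rightarrow> nat \<Rightarrow> real" where
  "grid r s n j = r + real j * ((s - r) / real n)"

lemma grid_0 [simp]: "grid r s n 0 = r"
  by (simp add: grid_def)

lemma grid_n [simp]: "n > 0 \<Longrightarrow> grid r s n n = s"
  by (simp add: grid_def)

lemma grid_Suc: "grid r s n (Suc j) = grid r s n j + (s - r) / real n"
  by (simp add: grid_def distrib_right del: of_nat_Suc) (simp add: add_divide_distrib distrib_right)

lemma grid_mono: "r \<le> s \<Longrightarrow> i \<le> j \<Longrightarrow> grid r s n i \<le> grid r s n j"
  unfolding grid_def by (intro add_left_mono mult_right_mono) auto

lemma grid_bounds: "r \<le> s \<Longrightarrow> n > 0 \<Longrightarrow> j \<le> n \<Longrightarrow> r \<le> grid r s n j \<and> grid r s n j \<le> s"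
  using grid_mono[of r s 0 j n] grid_mono[of r s j n n] by auto

lemma grid_refine: "l > 0 \<Longrightarrow> grid r s (n * l) (j * l) = grid r s n j"
  unfolding grid_def by simp

text \<open>The terms whose left endpoint lies before \<open>x\<close> telescope up to the first
  grid point at or after \<open>x\<close>, which exceeds \<open>x\<close> by at most one
  mesh.\<close>

lemma grid_stop:
  fixes f :: "real \<Rightarrow> real"
  assumes "r \<le> x" "x \<le> s" "n > 0"
  shows "\<exists>y\<in>{r..s}. x \<le> y \<and> y \<le> x + (s - r) / real n \<and>
    (\<Sum>j<n. (if grid r s n j < x then f (grid r s n (Suc j)) - f (grid r s n j) else 0)) = f y - f r"
proof -
  define J where "J = (LEAST j. x \<le> grid r s n j)"
  have ex: "x \<le> grid r s n n" using assms by simp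
  have J: "x \<le> grid r s n J" unfolding J_def by (rule LeastI[of _ n]) (rule ex)
  have Jn: "J \<le> n" unfolding J_def by (rule Least_le) (rule ex)
  have iff: "grid r s n j < x \<longleftrightarrow> j < J" for j
  proof
    assume "j < J"
    then show "grid r s n j < x" unfolding J_def using not_less_Least not_le by blast
  next
    assume "grid r s n j < x"
    then show "j < J" using J grid_mono[of r s J j n] assms by (meson not_le order_trans leD)
  qed
  have "(\<Sum>j<n. (if grid r s n j < x then f (grid r s n (Suc j)) - f (grid r s n j) else 0))
     = (\<Sum>j<J. f (grid r s n (Suc j)) - f (grid r s n j))"
    unfolding iff using Jn by (intro sum.mono_neutral_cong_right) auto
  also have "\<dots> = f (grid r s n J) - f r"
    using sum_lessThan_telescope[of "\<lambda>j. f (grid r s n j)" J] by simp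
  finally have 1: "(\<Sum>j<n. (if grid r s n j < x then f (grid r s n (Suc j)) - f (grid r s n j) else 0))
     = f (grid r s n J) - f r" .
  have "grid r s n J \<le> x + (s - r) / real n"
  proof (cases J)
    case 0
    have "0 \<le> (s - r) / real n" using assms by simp
    then show ?thesis unfolding 0 grid_0 using assms by linarith
  next
    case (Suc i)
    then have "grid r s n i < x" using iff by simp
    then show ?thesis unfolding Suc grid_Suc by simp
  qed
  then show ?thesis
    using 1 J grid_bounds[of r s n J] Jn assms by (intro bexI[of _ "grid r s n J"]) auto
qed

lemma sum_lessThan_ends: "(\<Sum>j<Suc (Suc n). f j) = f 0 + (\<Sum>i<n. f (Suc i)) + (f (Suc n) :: 'v::comm_monoid_add)"
  by (simp only: sum.lessThan_Suc[of f "Suc n"] sum.lessThan_Suc_shift[of f n])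

section \<open>First hitting times of continuous paths\<close>

text \<open>Rewrites hitting zero by time \<open>x\<close> as a countable condition on values at
  times in \<open>{a..x}\<close>, for the measurability of the hitting time. A continuous function
  attains its minimum on the interval, so values below every \<open>1 / Suc n\<close> force a value
  \<open>\<le> 0\<close>.\<close>

lemma dense_clip_less:
  fixes D :: "real \<Rightarrow> real"
  assumes "a \<le> x" and cont: "continuous_on {a..x} D"
  shows "(\<exists>s\<in>{a..x}. D s \<le> 0) \<longleftrightarrow> (\<forall>n. \<exists>q::rat. D (max a (min x (of_rat q))) < 1 / real (Suc n))"
proof
  assume "\<exists>s\<in>{a..x}. D s \<le> 0"
  then obtain s where s: "s \<in> {a..x}" "D s \<le> 0" by auto
  show "\<forall>n. \<exists>q::rat. D (max a (min x (of_rat q))) < 1 / real (Suc n)"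
  proof
    fix n
    have c: "continuous_on UNIV (\<lambda>u. D (max a (min x u)))"
      by (rule continuous_on_compose2[OF cont]) (use \<open>a \<le> x\<close> in \<open>auto intro!: continuous_intros\<close>)
    have o: "open {u. D (max a (min x u)) < 1 / real (Suc n)}"
      by (intro open_Collect_less c continuous_intros)
    have "s \<in> {u. D (max a (min x u)) < 1 / real (Suc n)}"
      using s le_less_trans[OF s(2), of "1 / real (Suc n)"] by (simp add: max_absorb2 min_absorb2)
    then obtain e where e: "e > 0" "\<And>y. dist y s < e \<Longrightarrow> y \<in> {u. D (max a (min x u)) < 1 / real (Suc n)}"
      using o unfolding open_dist by blast
    obtain q where q: "s < of_rat q" "of_rat q < s + e" using of_rat_dense[of s "s + e"] e(1) by auto
    have "dist (of_rat q) s < e" using q by (auto simp: dist_real_def)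
    from e(2)[OF this] show "\<exists>q::rat. D (max a (min x (of_rat q))) < 1 / real (Suc n)" by auto
  qed
next
  assume *: "\<forall>n. \<exists>q::rat. D (max a (min x (of_rat q))) < 1 / real (Suc n)"
  obtain m where m: "m \<in> {a..x}" "\<And>s. s \<in> {a..x} \<Longrightarrow> D m \<le> D s"
    using continuous_attains_inf[OF compact_Icc _ cont] \<open>a \<le> x\<close> by auto
  have "D m \<le> 0"
  proof (rule ccontr)
    assume "\<not> D m \<le> 0"
    then obtain n where n: "inverse (real (Suc n)) < D m" using reals_Archimedean[of "D m"] by auto
    from * obtain q :: rat where "D (max a (min x (of_rat q))) < 1 / real (Suc n)" by blast
    moreover have "D m \<le> D (max a (min x (of_rat q)))" using \<open>a \<le> x\<close> by (intro m) auto
    ultimately show False using n by (simp add: divide_inverse)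
  qed
  then show "\<exists>s\<in>{a..x}. D s \<le> 0" using m by auto
qed

text \<open>Paths that are not continuous form a null set and get the junk value \<open>b\<close>.\<close>

definition hit :: "real \<Rightarrow> real \<Rightarrow> (real \<Rightarrow> real) \<Rightarrow> real" where
  "hit a b D = (if continuous_on {a..b} D then Inf (insert b {s\<in>{a..b}. D s \<le> 0}) else b)"

lemma hit_bounds:
  assumes "a \<le> b"
  shows "a \<le> hit a b D" "hit a b D \<le> b"
proof -
  have bb: "bdd_below (insert b {s\<in>{a..b}. D s \<le> 0})" by (intro bdd_belowI[of _ a]) (use assms in auto)
  show "a \<le> hit a b D" unfolding hit_def using assms by (auto intro!: cInf_greatest)
  show "hit a b D \<le> b" unfolding hit_def using bb by (auto intro!: cInf_lower)
qed

lemma hit_pos: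
  assumes "a \<le> b" "continuous_on {a..b} D" "a \<le> s" "s < hit a b D"
  shows "0 < D s"
proof (rule ccontr)
  assume "\<not> 0 < D s"
  moreover have "s \<le> b" using hit_bounds(2)[OF assms(1), of D] assms(4) by simp
  ultimately have "s \<in> insert b {s\<in>{a..b}. D s \<le> 0}" using assms by auto
  then have "hit a b D \<le> s"
    unfolding hit_def using assms(1,2) by (auto intro!: cInf_lower bdd_belowI[of _ a])
  then show False using assms(4) by simp
qed

text \<open>The bound \<open>x < b\<close> matters because \<open>hit\<close> never exceeds
  \<open>b\<close>. If \<open>D\<close> is positive on \<open>{a..x}\<close>, it stays positive a
  little beyond \<open>x\<close> by continuity, and the infimum lies strictly past
  \<open>x\<close>.\<close>

lemma hit_le_iff:
  assumes "a \<le> b" "continuous_on {a..b} D" "a \<le> x" "x < b"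
  shows "hit a b D \<le> x \<longleftrightarrow> (\<exists>s\<in>{a..x}. D s \<le> 0)"
proof
  assume "\<exists>s\<in>{a..x}. D s \<le> 0"
  then obtain s where "s \<in> {a..x}" "D s \<le> 0" by auto
  then show "hit a b D \<le> x" using hit_pos[OF assms(1,2), of s] by force
next
  assume h: "hit a b D \<le> x"
  show "\<exists>s\<in>{a..x}. D s \<le> 0"
  proof (rule ccontr)
    assume "\<not> (\<exists>s\<in>{a..x}. D s \<le> 0)"
    then have pos: "\<And>s. s \<in> {a..x} \<Longrightarrow> 0 < D s" by force
    have "isCont (\<lambda>u. D (max a (min b u))) x"
    proof -
      have "continuous_on UNIV (\<lambda>u. D (max a (min b u)))"
        by (rule continuous_on_compose2[OF assms(2)]) (use assms in \<open>auto intro!: continuous_intros\<close>)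
      then show ?thesis by (simp add: continuous_on_eq_continuous_at)
    qed
    moreover have "0 < D (max a (min b x))" using pos[of x] assms by (simp add: max_absorb2 min_absorb2)
    ultimately have "\<forall>\<^sub>F u in at x. 0 < D (max a (min b u))"
      unfolding isCont_def by (rule order_tendstoD)
    then obtain e where e: "e > 0" "\<And>u. u \<noteq> x \<Longrightarrow> dist u x < e \<Longrightarrow> 0 < D (max a (min b u))"
      unfolding eventually_at by auto
    define y where "y = min b (x + e)"
    have y: "x < y" using e assms by (simp add: y_def)
    have "y \<le> hit a b D"
      unfolding hit_def if_P[OF assms(2)]
    proof (rule cInf_greatest)
      fix s assume "s \<in> insert b {s \<in> {a..b}. D s \<le> 0}"
      then consider "s = b" | "a \<le> s" "s \<le> b" "D s \<le> 0" by auto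
      then show "y \<le> s"
      proof cases
        case 2
        have "x < s" using pos[of s] 2 by force
        show ?thesis
        proof (rule ccontr)
          assume "\<not> y \<le> s"
          then have "dist s x < e" using \<open>x < s\<close> by (auto simp: y_def dist_real_def)
          then have "0 < D (max a (min b s))" using e(2)[of s] \<open>x < s\<close> by auto
          then show False using 2 by (simp add: max_absorb2 min_absorb2)
        qed
      qed (simp add: y_def)
    qed simp
    then show False using y h by simp
  qed
qed

text \<open>At the hitting time the value is a left limit of positive values; \<open>0 < D a\<close>
  settles the case where the hitting time is \<open>a\<close>.\<close>

lemma hit_nonneg:
  assumes "a \<le> b" "continuous_on {a..b} D" "0 < D a" "s \<in> {a..hit a b D}"
  shows "0 \<le> D s"
proof (cases "s < hit a b D")
  case True
  then show ?thesis using hit_pos[OF assms(1,2), of s] assms(4) by auto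
next
  case False
  then have s: "s = hit a b D" using assms(4) by auto
  have ab: "a \<le> s" "s \<le> b" using hit_bounds[OF assms(1), of D] s by auto
  show ?thesis
  proof (cases "a < s")
    case True
    have sub: "{a..s} \<subseteq> {a..b}" using ab by auto
    have "(D \<longlongrightarrow> D s) (at s within {a..s})"
      using continuous_on_subset[OF assms(2) sub] ab by (auto simp: continuous_on_def)
    moreover have "at s within {a..s} = at_left s"
      by (rule at_within_Icc_at_left[OF True])
    ultimately have "(D \<longlongrightarrow> D s) (at_left s)" by simp
    moreover have "\<forall>\<^sub>F u in at_left s. 0 \<le> D u"
    proof (rule eventually_at_leftI[OF _ True])
      fix u assume "u \<in> {a<..<s}"
      then show "0 \<le> D u" using hit_pos[OF assms(1,2), of u] s by auto
    qed
    ultimately show ?thesis by (rule tendsto_lowerbound) simp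
  next
    case False
    then show ?thesis using ab assms(3) by (metis antisym_conv not_less order.strict_implies_order)
  qed
qed

lemma hit_eq_end:
  assumes "t \<le> b" "continuous_on {t..b} D" "\<And>s. s \<in> {t..b} \<Longrightarrow> 0 < D s"
  shows "hit t b D = b"
proof (rule ccontr)
  assume "hit t b D \<noteq> b"
  with hit_bounds[OF assms(1), of D] have h: "t \<le> hit t b D" "hit t b D < b" by auto
  from hit_le_iff[OF assms(1,2) h] obtain s where s: "s \<in> {t..hit t b D}" "D s \<le> 0" by auto
  with assms(3)[of s] h show False by auto
qed

section \<open>The Skorokhod condition and non-measurable majorants\<close>

text \<open>A nonnegative function with zero integral vanishes almost everywhere, so the Stieltjes
  measure is carried by the contact set of \<open>y\<close> and \<open>l\<close>. A half-open
  interval without contact has measure zero, and this measure is the increment of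
  \<open>k\<close>.\<close>

lemma stieltjes_flat:
  fixes k y l :: "real \<Rightarrow> real"
  assumes "0 \<le> \<theta>" and cont: "continuous_on {0..\<theta>} y" "continuous_on {0..\<theta>} l" "continuous_on {0..\<theta>} k"
    and mono: "mono_on {0..\<theta>} k" and le: "\<And>s. s \<in> {0..\<theta>} \<Longrightarrow> l s \<le> y s"
    and zero: "(LINT s:{0..\<theta>}|interval_measure (\<lambda>u. k (max 0 (min u \<theta>))). y s - l s) = 0"
    and s: "0 \<le> s" "s \<le> s'" "s' \<le> \<theta>" and less: "\<And>r. r \<in> {s..s'} \<Longrightarrow> l r < y r"
  shows "k s' \<le> k s"
proof -
  define kk where "kk = (\<lambda>u. k (max 0 (min u \<theta>)))"
  have kk_cont: "continuous_on UNIV kk" unfolding kk_def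
    by (rule continuous_on_compose2[OF cont(3)]) (use \<open>0 \<le> \<theta>\<close> in \<open>auto intro!: continuous_intros\<close>)
  have kk_mono: "kk u \<le> kk v" if "u \<le> v" for u v
    unfolding kk_def by (rule mono_onD[OF mono]) (use that \<open>0 \<le> \<theta>\<close> in auto)
  have kk_right: "continuous (at_right u) kk" for u
    using kk_cont by (auto simp: continuous_on_eq_continuous_at intro: continuous_at_imp_continuous_within)
  let ?\<mu> = "interval_measure kk"
  have em: "emeasure ?\<mu> {u<..v} = ennreal (kk v - kk u)" if "u \<le> v" for u v
    by (rule emeasure_interval_measure_Ioc[OF that]) (use kk_mono kk_right in auto)
  define f where "f = (\<lambda>s. indicator {0..\<theta>} s *\<^sub>R (y s - l s))"
  have fm: "f \<in> borel_measurable borel" unfolding f_def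
    by (rule borel_measurable_continuous_on_indicator) (auto intro!: continuous_intros cont)
  have "bounded ((\<lambda>s. y s - l s) ` {0..\<theta>})"
    by (intro compact_imp_bounded compact_continuous_image continuous_intros cont) auto
  then obtain C where "\<forall>v\<in>(\<lambda>s. y s - l s) ` {0..\<theta>}. norm v \<le> C"
    unfolding bounded_iff by blast
  then have C: "\<And>s. s \<in> {0..\<theta>} \<Longrightarrow> \<bar>y s - l s\<bar> \<le> C" by auto
  \<comment> \<open>The interval measure is known on half-open intervals only; starting at -1 covers
    a possible atom at 0, and \<open>kk\<close> is constant to the left of 0.\<close>
  have "emeasure ?\<mu> {0..\<theta>} \<le> emeasure ?\<mu> {-1<..\<theta>}" by (intro emeasure_mono) auto
  also have "\<dots> < \<infinity>" using em[of "-1" \<theta>] \<open>0 \<le> \<theta>\<close> by simp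
  finally have fin: "emeasure ?\<mu> {0..\<theta>} < \<infinity>" .
  have I: "integrable ?\<mu> f"
  proof (rule integrableI_bounded_set[where A="{0..\<theta>}" and B=C])
    show "AE x\<in>{0..\<theta>} in ?\<mu>. norm (f x) \<le> C" using C by (auto simp: f_def)
  qed (use fm fin in \<open>auto simp: f_def\<close>)
  have "(\<integral>s. f s \<partial>?\<mu>) = 0" using zero unfolding set_lebesgue_integral_def f_def kk_def .
  then have ae: "AE s in ?\<mu>. f s = 0"
    using integral_nonneg_eq_0_iff_AE[OF I] le by (auto simp: f_def split: split_indicator)
  have "AE u in ?\<mu>. u \<notin> {s<..s'}"
    using ae
  proof eventually_elim
    case (elim u)
    show ?case
    proof
      assume "u \<in> {s<..s'}"
      then show False using less[of u] elim s by (auto simp: f_def)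
    qed
  qed
  then have "emeasure ?\<mu> {s<..s'} = 0"
    by (subst (asm) AE_iff_null[where P="\<lambda>u. u \<notin> {s<..s'}"])
      (auto simp: null_sets_def greaterThanAtMost_def greaterThan_def atMost_def Int_def)
  then have "kk s' \<le> kk s" using em[OF s(2)] by (simp add: ennreal_eq_0_iff)
  then show ?thesis using s unfolding kk_def by (simp add: max_absorb2 min_absorb1)
qed

text \<open>The majorant \<open>h\<close> may be non-measurable, so its integral is a lower integral; this is the form in
  which the pathwise suprema of a solution are controlled.\<close>

lemma nn_integral_finite_of_majorant:
  fixes S h :: "'x \<Rightarrow> ennreal"
  assumes S: "S \<in> borel_measurable N" and q: "integrable N q" "\<And>y. 0 \<le> q y" and "0 < a"
    and le: "AE y in N. S y \<le> ennreal a * h y + ennreal (q y)"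
    and h: "(\<integral>\<^sup>+y. h y \<partial>N) < \<infinity>"
  shows "(\<integral>\<^sup>+y. S y \<partial>N) < \<infinity>"
proof -
  \<comment> \<open>All algebra is moved to the side of the measurable \<open>S\<close>: towards
    \<open>h\<close> only monotonicity of the lower integral is available.\<close>
  have "(\<integral>\<^sup>+y. S y - ennreal (q y) \<partial>N) / ennreal a = (\<integral>\<^sup>+y. (S y - ennreal (q y)) / ennreal a \<partial>N)"
    using S q by (subst nn_integral_divide) auto
  also have "\<dots> \<le> (\<integral>\<^sup>+y. h y \<partial>N)"
  proof (rule nn_integral_mono_AE)
    show "AE y in N. (S y - ennreal (q y)) / ennreal a \<le> h y"
      using le
    proof eventually_elim
      case (elim y)
      then have "S y - ennreal (q y) \<le> ennreal a * h y"
        by (simp add: ennreal_minus_le_iff add.commute)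
      then have "(S y - ennreal (q y)) / ennreal a \<le> (ennreal a * h y) / ennreal a" by (rule divide_right_mono_ennreal)
      also have "\<dots> = h y" by (subst mult.commute) (rule ennreal_mult_divide_eq, use \<open>0 < a\<close> in auto)
      finally show ?case .
    qed
  qed
  also note h
  finally have f1: "(\<integral>\<^sup>+y. S y - ennreal (q y) \<partial>N) < \<infinity>"
    by (cases "\<integral>\<^sup>+y. S y - ennreal (q y) \<partial>N" rule: ennreal_cases) (auto simp: ennreal_top_divide)
  have "(\<integral>\<^sup>+y. S y \<partial>N) \<le> (\<integral>\<^sup>+y. (S y - ennreal (q y)) + ennreal (q y) \<partial>N)"
  proof (rule nn_integral_mono)
    fix y
    show "S y \<le> (S y - ennreal (q y)) + ennreal (q y)"
    proof (cases "ennreal (q y) \<le> S y")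
      case True
      then show ?thesis by (simp add: diff_add_cancel_ennreal)
    next
      case False
      then show ?thesis by (simp add: add_increasing)
    qed
  qed
  also have "\<dots> = (\<integral>\<^sup>+y. S y - ennreal (q y) \<partial>N) + (\<integral>\<^sup>+y. ennreal (q y) \<partial>N)"
    using S q by (intro nn_integral_add) auto
  also have "\<dots> < \<infinity>" using f1 nn_integral_eq_integral[OF q(1)] q(2) by auto
  finally show ?thesis .
qed

section \<open>The augmented Brownian filtration\<close>

context brownian_setting
begin

lemma B_meas: "0 \<le> t \<Longrightarrow> B t \<in> borel_measurable M"
  and B_zero: "AE w in M. B 0 w = 0"
  and B_cont: "AE w in M. continuous_on {0..} (\<lambda>t. B t w)"
  and B_indep: "0 \<le> s \<Longrightarrow> s < t \<Longrightarrow> indep_set (sets (natural_filtration M B s))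
          (sets (vimage_algebra (space M) (\<lambda>w. B t w - B s w) borel))"
  and B_dist: "0 \<le> s \<Longrightarrow> s < t \<Longrightarrow> distributed M lborel (\<lambda>w. B t w - B s w)
          (\<lambda>x. ennreal (\<Prod>i\<in>UNIV. normal_density 0 (sqrt (t - s)) (x $ i)))"
  using BM unfolding brownian_motion_def by auto

lemma sets_natural: "sets (natural_filtration M B t) =
    sigma_sets (space M) (\<Union>s\<in>{0..t}. {B s -` A \<inter> space M | A. A \<in> sets borel})"
  unfolding natural_filtration_def by (rule sets_measure_of) auto

lemma sets_natural_sub: "sets (natural_filtration M B t) \<subseteq> sets M"
  unfolding sets_natural by (rule sets.sigma_sets_subset) (auto intro: measurable_sets[OF B_meas])

lemma sets_F: "sets (F t) = sigma_sets (space M) (sets (natural_filtration M B t) \<union> null_sets M)"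
  unfolding F_eq augmented_filtration_def using sets_natural_sub[of t] sets.sets_into_space
  by (intro sets_measure_of) blast

lemma sets_F_sub: "sets (F t) \<subseteq> sets M"
  unfolding sets_F using sets_natural_sub[of t] by (intro sets.sigma_sets_subset) auto

lemma natural_sub_F: "sets (natural_filtration M B t) \<subseteq> sets (F t)"
  unfolding sets_F by auto

lemma null_in_F: "N \<in> null_sets M \<Longrightarrow> N \<in> sets (F t)"
  unfolding sets_F by auto

lemma subalgebra_F: "subalgebra M (F t)"
  by (simp add: subalgebra_def space_F sets_F_sub)

lemma sigma_finite_subalgebra_F: "sigma_finite_subalgebra M (F t)"
  by (intro finite_measure_subalgebra_is_sigma_finite)
    (simp add: finite_measure_subalgebra_def finite_measure_subalgebra_axioms_def subalgebra_F finite_measure_axioms)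

lemma measurable_F_M: "f \<in> measurable (F t) N \<Longrightarrow> f \<in> measurable M N"
  by (rule measurable_from_subalg[OF subalgebra_F])

lemma measurable_F_mono: "f \<in> measurable (F s) N \<Longrightarrow> s \<le> t \<Longrightarrow> f \<in> measurable (F t) N"
  using sets_F_mono[of s t] by (auto simp: measurable_def space_F)

lemma B_adapted: "0 \<le> s \<Longrightarrow> s \<le> t \<Longrightarrow> B s \<in> borel_measurable (F t)"
proof (rule measurableI)
  fix A :: "(real ^ 'd) set" assume "0 \<le> s" "s \<le> t" "A \<in> sets borel"
  then have "B s -` A \<inter> space M \<in> sets (natural_filtration M B t)"
    unfolding sets_natural by (intro sigma_sets.Basic UN_I[of s]) auto
  then show "B s -` A \<inter> space (F t) \<in> sets (F t)" using natural_sub_F by (auto simp: space_F)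
qed (auto)

text \<open>Completeness at work: both differences are subsets of a null set, hence null sets
  themselves, and these belong to \<open>G\<close>. Properties that hold for almost all paths may
  therefore be used when proving adaptedness.\<close>

lemma sets_AE_eq:
  assumes "A \<in> sets G" "null_sets M \<subseteq> sets G" "A' \<subseteq> space M" "AE w in M. w \<in> A \<longleftrightarrow> w \<in> A'"
    and "space G = space M"
  shows "A' \<in> sets G"
proof -
  have sp: "A \<subseteq> space M" using sets.sets_into_space[OF assms(1)] assms(5) by simp
  obtain N where N: "N \<in> null_sets M" "{w\<in>space M. \<not> (w \<in> A \<longleftrightarrow> w \<in> A')} \<subseteq> N"
    using assms(4) by (auto elim!: AE_E3 simp: null_sets_def)
  have "A - A' \<in> null_sets M" "A' - A \<in> null_sets M"
    using N sp assms(3) by (auto intro!: complete2[OF _ N(1)])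
  then have "A - A' \<in> sets G" "A' - A \<in> sets G" using assms(2) by auto
  moreover have "A' = (A - (A - A')) \<union> (A' - A)" by auto
  ultimately show ?thesis using assms(1) by (metis sets.Diff sets.Un)
qed

lemma measurable_AE_eq_gen:
  assumes f: "f \<in> measurable G N" and G: "null_sets M \<subseteq> sets G" "space G = space M"
    and "AE w in M. f w = g w" "\<And>w. w \<in> space M \<Longrightarrow> g w \<in> space N"
  shows "g \<in> measurable G N"
proof (rule measurableI)
  fix A assume A: "A \<in> sets N"
  show "g -` A \<inter> space G \<in> sets G"
    using assms(4) by (intro sets_AE_eq[OF measurable_sets[OF f A] G(1) _ _ G(2)]) (auto simp: G(2))
qed (use assms in auto)

lemma measurable_AE_eq_F:
  "f \<in> borel_measurable (F t) \<Longrightarrow> AE w in M. f w = g w \<Longrightarrow> g \<in> borel_measurable (F t)"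
  by (rule measurable_AE_eq_gen) (auto simp: null_in_F space_F)

lemma measurable_AE_eq:
  "f \<in> borel_measurable M \<Longrightarrow> AE w in M. f w = g w \<Longrightarrow> g \<in> borel_measurable M"
  by (rule measurable_AE_eq_gen) auto

text \<open>Brownian increments are given as independent of the natural filtration. Independence is
  carried over to the augmented one through events that agree almost surely, found by induction over
  the generated sigma-algebra.\<close>

lemma F_natural_AE:
  assumes "A \<in> sets (F t)"
  shows "\<exists>A0\<in>sets (natural_filtration M B t). AE w in M. w \<in> A \<longleftrightarrow> w \<in> A0"
  using assms unfolding sets_F
proof (induction rule: sigma_sets.induct)
  case (Basic a)
  then show ?case
  proof
    assume "a \<in> null_sets M"
    from AE_not_in[OF this] show ?case by (intro bexI[of _ "{}"]) auto
  qed auto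
next
  case Empty
  then show ?case by auto
next
  case (Compl a)
  then obtain A0 where A0: "A0 \<in> sets (natural_filtration M B t)" "AE w in M. w \<in> a \<longleftrightarrow> w \<in> A0" by auto
  have sp: "space (natural_filtration M B t) = space M"
    unfolding natural_filtration_def by (rule space_measure_of) auto
  show ?case
  proof (rule bexI[of _ "space (natural_filtration M B t) - A0"])
    show "AE w in M. w \<in> space M - a \<longleftrightarrow> w \<in> space (natural_filtration M B t) - A0"
      using A0(2) by eventually_elim (auto simp: sp)
  qed (use A0 in auto)
next
  case (Union a)
  then obtain A0 where A0: "\<And>i. A0 i \<in> sets (natural_filtration M B t)" "\<And>i. AE w in M. w \<in> a i \<longleftrightarrow> w \<in> A0 i"
    by metis
  have "AE w in M. \<forall>i::nat. w \<in> a i \<longleftrightarrow> w \<in> A0 i" using A0(2) by (simp add: AE_all_countable)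
  then show ?case
    using A0(1) by (intro bexI[of _ "\<Union>i. A0 i"]) (auto elim!: eventually_mono)
qed

text \<open>An event of \<open>F s\<close> is replaced by its natural counterpart, which changes no
  probability. The function \<open>h\<close> makes one statement cover single components of the
  increment and their products.\<close>

lemma indep_F_increment:
  assumes "0 \<le> s" "s < t" and W: "W \<in> borel_measurable (F s)" and h: "h \<in> borel_measurable borel"
  shows "indep_var borel (W :: 'a \<Rightarrow> real) borel (\<lambda>w. h (B t w - B s w) :: real)"
  unfolding indep_var_eq
proof (intro conjI)
  let ?D = "\<lambda>w. B t w - B s w"
  have D: "?D \<in> borel_measurable M" using assms(1,2) by (intro borel_measurable_diff B_meas) auto
  show rv: "random_variable borel W" "random_variable borel (\<lambda>w. h (?D w))"
    using measurable_F_M[OF W] measurable_compose[OF D h] by auto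
  have sub: "indep_set {W -` A \<inter> space M | A. A \<in> sets borel} {(\<lambda>w. h (?D w)) -` A \<inter> space M | A. A \<in> sets borel}"
    unfolding indep_sets2_eq
  proof (intro conjI ballI)
    show "{W -` A \<inter> space M | A. A \<in> sets borel} \<subseteq> events"
      "{(\<lambda>w. h (?D w)) -` A \<inter> space M | A. A \<in> sets borel} \<subseteq> events"
      using rv by (auto intro: measurable_sets)
    fix a b assume "a \<in> {W -` A \<inter> space M | A. A \<in> sets borel}" "b \<in> {(\<lambda>w. h (?D w)) -` A \<inter> space M | A. A \<in> sets borel}"
    then obtain C C' where C: "C \<in> sets borel" "a = W -` C \<inter> space M" "C' \<in> sets borel" "b = (\<lambda>w. h (?D w)) -` C' \<inter> space M" by auto
    have a: "a \<in> sets (F s)" using measurable_sets[OF W C(1)] C(2) by (simp add: space_F)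
    have aM: "a \<in> events" using a sets_F_sub by auto
    obtain A0 where A0: "A0 \<in> sets (natural_filtration M B s)" "AE w in M. w \<in> a \<longleftrightarrow> w \<in> A0"
      using F_natural_AE[OF a] by auto
    have A0M: "A0 \<in> events" using A0(1) sets_natural_sub by auto
    have "b = ?D -` (h -` C') \<inter> space M" unfolding C(4) by auto
    moreover have "h -` C' \<in> sets borel" using measurable_sets[OF h C(3)] by simp
    ultimately have b: "b \<in> sets (vimage_algebra (space M) ?D borel)"
      by (auto simp: in_vimage_algebra)
    have bM: "b \<in> events" using measurable_sets[OF rv(2) C(3)] C(4) by simp
    have "prob (a \<inter> b) = prob (A0 \<inter> b)"
      using A0(2) aM A0M bM by (intro finite_measure_eq_AE) auto
    also have "\<dots> = prob A0 * prob b"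
      using B_indep[OF assms(1,2)] A0(1) b unfolding indep_sets2_eq by auto
    also have "prob A0 = prob a"
      using A0(2) aM A0M by (intro finite_measure_eq_AE) auto
    finally show "prob (a \<inter> b) = prob a * prob b" .
  qed
  show "indep_set (sigma_sets (space M) {W -` A \<inter> space M | A. A \<in> sets borel})
     (sigma_sets (space M) {(\<lambda>w. h (?D w)) -` A \<inter> space M | A. A \<in> sets borel})"
  proof (rule indep_set_sigma_sets[OF sub])
    have "\<And>(f :: 'a \<Rightarrow> real) S. Int_stable {f -` A \<inter> space M | A. A \<in> sets borel}"
      unfolding Int_stable_def by (safe, rule_tac x="A \<inter> Aa" in exI) auto
    then show "Int_stable {W -` A \<inter> space M | A. A \<in> sets borel}"
      "Int_stable {(\<lambda>w. h (?D w)) -` A \<inter> space M | A. A \<in> sets borel}" by blast+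
  qed
qed

section \<open>Ito isometry for elementary integrands\<close>

lemma increment_product:
  assumes "0 \<le> s" "s < t" and W: "W \<in> borel_measurable (F s)" "integrable M W"
    and h: "h \<in> borel_measurable borel" "integrable M (\<lambda>w. h (B t w - B s w))"
  shows "integrable M (\<lambda>w. W w * h (B t w - B s w) :: real)"
    "(\<integral>w. W w * h (B t w - B s w) \<partial>M) = (\<integral>w. W w \<partial>M) * (\<integral>w. h (B t w - B s w) \<partial>M)"
  using indep_var_integrable[OF indep_F_increment[OF assms(1,2) W(1) h(1)] W(2) h(2)]
    indep_var_lebesgue_integral[OF indep_F_increment[OF assms(1,2) W(1) h(1)] W(2) h(2)] by auto

lemma increment_mean:
  assumes "0 \<le> s" "s \<le> t" and W: "\<And>i. (\<lambda>w. W w $ i) \<in> borel_measurable (F s)" "\<And>i. integrable M (\<lambda>w. W w $ i)"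
  shows "integrable M (\<lambda>w. W w \<bullet> (B t w - B s w))" "(\<integral>w. W w \<bullet> (B t w - B s w) \<partial>M) = 0"
proof -
  have *: "integrable M (\<lambda>w. W w $ i * (B t w - B s w) $ i) \<and> (\<integral>w. W w $ i * (B t w - B s w) $ i \<partial>M) = 0" for i
  proof (cases "s = t")
    case False
    then have st: "s < t" using assms by simp
    then have "sqrt (t - s) > 0" by simp
    note N = normal_vec_moments[OF B_dist[OF assms(1) st] this]
    from increment_product[OF assms(1) st W(1) W(2) _ N(1)] show ?thesis
      using N(2) by simp
  qed simp
  show "integrable M (\<lambda>w. W w \<bullet> (B t w - B s w))" "(\<integral>w. W w \<bullet> (B t w - B s w) \<partial>M) = 0"
    unfolding inner_vec_def inner_real_def using * by (auto simp: Bochner_Integration.integral_sum)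
qed

text \<open>Expanded in components, each term factors by independence, and the covariance
  \<open>(t - s) I\<close> of the increment leaves the diagonal. The case \<open>s = t\<close> is
  separate, as the law is given for \<open>s < t\<close>.\<close>

lemma increment_square:
  assumes "0 \<le> s" "s \<le> t" and W: "\<And>i. (\<lambda>w. W w $ i) \<in> borel_measurable (F s)"
    "\<And>i. integrable M (\<lambda>w. (W w $ i)\<^sup>2)"
  shows "integrable M (\<lambda>w. (W w \<bullet> (B t w - B s w))\<^sup>2)"
    "(\<integral>w. (W w \<bullet> (B t w - B s w))\<^sup>2 \<partial>M) = (t - s) * (\<integral>w. (norm (W w))\<^sup>2 \<partial>M)"
proof -
  note WM = measurable_F_M[OF W(1)]
  have WW: "integrable M (\<lambda>w. W w $ i * W w $ j)" for i j
    by (rule integrable_mult_L2[OF WM WM W(2) W(2)])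
  have *: "integrable M (\<lambda>w. (W w $ i * W w $ j) * ((B t w - B s w) $ i * (B t w - B s w) $ j)) \<and>
      (\<integral>w. (W w $ i * W w $ j) * ((B t w - B s w) $ i * (B t w - B s w) $ j) \<partial>M)
      = (if i = j then (t - s) * (\<integral>w. (W w $ i)\<^sup>2 \<partial>M) else 0)" for i j
  proof (cases "s = t")
    case False
    then have st: "s < t" using assms by simp
    then have "sqrt (t - s) > 0" by simp
    note N = normal_vec_moments[OF B_dist[OF assms(1) st] this]
    from increment_product[OF assms(1) st borel_measurable_times[OF W(1) W(1)] WW _ N(3)] show ?thesis
      using N(4)[of i j] st by (simp add: power2_eq_square mult.commute)
  qed simp
  have eq: "(W w \<bullet> (B t w - B s w))\<^sup>2 = (\<Sum>i\<in>UNIV. \<Sum>j\<in>UNIV.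
      (W w $ i * W w $ j) * ((B t w - B s w) $ i * (B t w - B s w) $ j))" for w
    unfolding inner_vec_def inner_real_def power2_eq_square sum_product by (simp add: mult_ac)
  show "integrable M (\<lambda>w. (W w \<bullet> (B t w - B s w))\<^sup>2)"
    unfolding eq using * by auto
  have "(\<integral>w. (W w \<bullet> (B t w - B s w))\<^sup>2 \<partial>M) = (\<Sum>i\<in>UNIV. \<Sum>j\<in>UNIV. (if i = j then (t - s) * (\<integral>w. (W w $ i)\<^sup>2 \<partial>M) else 0))"
    unfolding eq using * by (simp add: Bochner_Integration.integral_sum)
  also have "\<dots> = (t - s) * (\<Sum>i\<in>UNIV. \<integral>w. (W w $ i)\<^sup>2 \<partial>M)"
    by (simp add: sum_distrib_left)
  also have "(\<Sum>i\<in>UNIV. \<integral>w. (W w $ i)\<^sup>2 \<partial>M) = (\<integral>w. (norm (W w))\<^sup>2 \<partial>M)"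
    using W(2) by (simp add: norm_vec_def L2_set_def sum_nonneg Bochner_Integration.integral_sum)
  finally show "(\<integral>w. (W w \<bullet> (B t w - B s w))\<^sup>2 \<partial>M) = (t - s) * (\<integral>w. (norm (W w))\<^sup>2 \<partial>M)" .
qed

text \<open>The partial sum is measurable at \<open>a n\<close>, so the next increment is orthogonal
  to it. Measurability is demanded on nondegenerate cells: clamping a partition to
  \<open>{q..q'}\<close> produces degenerate cells at \<open>q'\<close> whose coefficients may be
  revealed later.\<close>

lemma chain_isometry:
  fixes a :: "nat \<Rightarrow> real" and \<psi> :: "nat \<Rightarrow> 'a \<Rightarrow> real ^ 'd"
  assumes "0 \<le> a 0" and mono: "\<And>i. i < n \<Longrightarrow> a i \<le> a (Suc i)"
    and meas: "\<And>i. i < n \<Longrightarrow> a i < a (Suc i) \<Longrightarrow> \<psi> i \<in> borel_measurable (F (a i))"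
    and bdd: "\<And>i. i < n \<Longrightarrow> \<exists>C. \<forall>w\<in>space M. norm (\<psi> i w) \<le> C"
  shows "(\<lambda>w. \<Sum>i<n. \<psi> i w \<bullet> (B (a (Suc i)) w - B (a i) w)) \<in> borel_measurable (F (a n))"
    "integrable M (\<lambda>w. (\<Sum>i<n. \<psi> i w \<bullet> (B (a (Suc i)) w - B (a i) w))\<^sup>2)"
    "(\<integral>w. (\<Sum>i<n. \<psi> i w \<bullet> (B (a (Suc i)) w - B (a i) w)) \<partial>M) = 0"
    "(\<integral>w. (\<Sum>i<n. \<psi> i w \<bullet> (B (a (Suc i)) w - B (a i) w))\<^sup>2 \<partial>M) =
       (\<Sum>i<n. (a (Suc i) - a i) * (\<integral>w. (norm (\<psi> i w))\<^sup>2 \<partial>M))"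
proof -
  have "0 \<le> a n \<and> (\<lambda>w. \<Sum>i<n. \<psi> i w \<bullet> (B (a (Suc i)) w - B (a i) w)) \<in> borel_measurable (F (a n)) \<and>
    integrable M (\<lambda>w. (\<Sum>i<n. \<psi> i w \<bullet> (B (a (Suc i)) w - B (a i) w))\<^sup>2) \<and>
    (\<integral>w. (\<Sum>i<n. \<psi> i w \<bullet> (B (a (Suc i)) w - B (a i) w)) \<partial>M) = 0 \<and>
    (\<integral>w. (\<Sum>i<n. \<psi> i w \<bullet> (B (a (Suc i)) w - B (a i) w))\<^sup>2 \<partial>M) =
       (\<Sum>i<n. (a (Suc i) - a i) * (\<integral>w. (norm (\<psi> i w))\<^sup>2 \<partial>M))"
    using mono meas bdd
  proof (induction n)
    case 0
    then show ?case using \<open>0 \<le> a 0\<close> by simp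
  next
    case (Suc n)
    define S where "S = (\<lambda>w. \<Sum>i<n. \<psi> i w \<bullet> (B (a (Suc i)) w - B (a i) w))"
    have IH: "0 \<le> a n" "S \<in> borel_measurable (F (a n))" "integrable M (\<lambda>w. (S w)\<^sup>2)" "(\<integral>w. S w \<partial>M) = 0"
      "(\<integral>w. (S w)\<^sup>2 \<partial>M) = (\<Sum>i<n. (a (Suc i) - a i) * (\<integral>w. (norm (\<psi> i w))\<^sup>2 \<partial>M))"
      using Suc unfolding S_def by auto
    have le: "a n \<le> a (Suc n)" using Suc.prems(1)[of n] by simp
    show ?case
    proof (cases "a n = a (Suc n)")
      case True
      then show ?thesis using IH unfolding S_def by simp
    next
      case False
      then have lt: "a n < a (Suc n)" using le by simp
      have \<psi>: "\<psi> n \<in> borel_measurable (F (a n))" using Suc.prems(2)[of n] lt by simp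
      note \<psi>M = measurable_F_M[OF \<psi>] and SM = measurable_F_M[OF IH(2)]
      obtain C where C: "\<forall>w\<in>space M. norm (\<psi> n w) \<le> C" using Suc.prems(3)[of n] by auto
      have Ci: "\<bar>\<psi> n w $ i\<bar> \<le> C" if "w \<in> space M" for w i
        using C that component_le_norm_cart[of "\<psi> n w" i] by force
      have \<psi>i: "(\<lambda>w. \<psi> n w $ i) \<in> borel_measurable (F (a n))" for i
        by (rule measurable_compose[OF \<psi>]) measurable
      have \<psi>iM: "(\<lambda>w. \<psi> n w $ i) \<in> borel_measurable M" for i
        using measurable_F_M[OF \<psi>i] .
      have I\<psi>: "integrable M (\<lambda>w. \<psi> n w $ i)" "integrable M (\<lambda>w. (\<psi> n w $ i)\<^sup>2)" for i
      proof -
        show "integrable M (\<lambda>w. \<psi> n w $ i)"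
          by (rule integrable_const_bound[where B=C]) (use Ci \<psi>iM in auto)
        have "(\<psi> n w $ i)\<^sup>2 \<le> C\<^sup>2" if "w \<in> space M" for w
          using Ci[OF that, of i] by (metis abs_ge_zero power2_abs power_mono)
        then show "integrable M (\<lambda>w. (\<psi> n w $ i)\<^sup>2)"
          using \<psi>iM by (intro integrable_const_bound[where B="C\<^sup>2"]) auto
      qed
      define E where "E = (\<lambda>w. \<psi> n w \<bullet> (B (a (Suc n)) w - B (a n) w))"
      have Em: "E \<in> borel_measurable (F (a (Suc n)))"
        unfolding E_def using IH(1) lt measurable_F_mono[OF \<psi> le]
        by (intro borel_measurable_inner borel_measurable_diff B_adapted) auto
      have EM: "E \<in> borel_measurable M" using measurable_F_M[OF Em] .
      have mE: "integrable M E" "(\<integral>w. E w \<partial>M) = 0"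
        using increment_mean[OF IH(1) le \<psi>i I\<psi>(1)] by (auto simp: E_def)
      have sE: "integrable M (\<lambda>w. (E w)\<^sup>2)"
        "(\<integral>w. (E w)\<^sup>2 \<partial>M) = (a (Suc n) - a n) * (\<integral>w. (norm (\<psi> n w))\<^sup>2 \<partial>M)"
        using increment_square[OF IH(1) le \<psi>i I\<psi>(2)] by (auto simp: E_def)
      have IS: "integrable M S" using IH(3) SM by (rule integrable_of_sq[rotated])
      have "integrable M (\<lambda>w. (S w *\<^sub>R \<psi> n w) $ i)" for i
        using integrable_mult_L2[OF SM \<psi>iM IH(3) I\<psi>(2)] by simp
      moreover have "(\<lambda>w. (S w *\<^sub>R \<psi> n w) $ i) \<in> borel_measurable (F (a n))" for i
        using IH(2) \<psi>i[of i] by simp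
      ultimately have cross: "integrable M (\<lambda>w. S w * E w)" "(\<integral>w. S w * E w \<partial>M) = 0"
        using increment_mean[OF IH(1) le, of "\<lambda>w. S w *\<^sub>R \<psi> n w"] by (auto simp: E_def)
      have sq: "(S w + E w)\<^sup>2 = (S w)\<^sup>2 + (2 * (S w * E w) + (E w)\<^sup>2)" for w
        by (simp add: power2_sum)
      have i1: "integrable M (\<lambda>w. 2 * (S w * E w) + (E w)\<^sup>2)"
        by (intro Bochner_Integration.integrable_add integrable_mult_right cross sE)
      have "integrable M (\<lambda>w. (S w + E w)\<^sup>2)"
        unfolding sq by (intro Bochner_Integration.integrable_add IH i1)
      moreover have "(\<integral>w. (S w + E w)\<^sup>2 \<partial>M) = (\<integral>w. (S w)\<^sup>2 \<partial>M) + (\<integral>w. (E w)\<^sup>2 \<partial>M)"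
        unfolding sq Bochner_Integration.integral_add[OF IH(3) i1]
        using cross sE by simp
      moreover have "(\<lambda>w. S w + E w) \<in> borel_measurable (F (a (Suc n)))"
        using measurable_F_mono[OF IH(2) le] Em by (rule borel_measurable_add)
      moreover have "(\<integral>w. S w + E w \<partial>M) = 0"
        using IS mE IH(4) by simp
      moreover have "0 \<le> a (Suc n)" using IH(1) le by simp
      ultimately show ?thesis
        using IH(5) sE(2) unfolding S_def E_def by simp
    qed
  qed
  then show "(\<lambda>w. \<Sum>i<n. \<psi> i w \<bullet> (B (a (Suc i)) w - B (a i) w)) \<in> borel_measurable (F (a n))"
    "integrable M (\<lambda>w. (\<Sum>i<n. \<psi> i w \<bullet> (B (a (Suc i)) w - B (a i) w))\<^sup>2)"
    "(\<integral>w. (\<Sum>i<n. \<psi> i w \<bullet> (B (a (Suc i)) w - B (a i) w)) \<partial>M) = 0"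
    "(\<integral>w. (\<Sum>i<n. \<psi> i w \<bullet> (B (a (Suc i)) w - B (a i) w))\<^sup>2 \<partial>M) =
       (\<Sum>i<n. (a (Suc i) - a i) * (\<integral>w. (norm (\<psi> i w))\<^sup>2 \<partial>M))" by auto
qed

sublocale lp: pair_sigma_finite "lborel :: real measure" M ..

abbreviation lM :: "(real \<times> 'a) measure" where
  "lM \<equiv> lborel \<Otimes>\<^sub>M M"

lemma AE_snd_lift:
  assumes "AE w in M. Q w"
  shows "AE p in lM. Q (snd p)"
proof -
  obtain A where A: "A \<in> null_sets M" "{w\<in>space M. \<not> Q w} \<subseteq> A"
    using assms by (auto elim!: AE_E3 simp: null_sets_def)
  have "UNIV \<times> A \<in> null_sets lM"
    by (rule times_in_null_sets2) (use A in auto)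
  then show ?thesis
    by (rule AE_I') (use A in \<open>auto simp: space_pair_measure\<close>)
qed

text \<open>Values outside \<open>{0..T}\<close> are arbitrary, hence the indicator inside the
  measurability condition.\<close>

definition joint :: "real \<Rightarrow> (real \<Rightarrow> 'a \<Rightarrow> 'b::euclidean_space) \<Rightarrow> bool" where
  "joint T H \<longleftrightarrow> (\<lambda>p. indicator {0..T} (fst p) *\<^sub>R H (fst p) (snd p)) \<in> borel_measurable lM"

lemma indicator_fst_measurable [measurable]:
  "(\<lambda>p. indicator {a<..b::real} (fst p) :: real) \<in> borel_measurable lM"
  "(\<lambda>p. indicator {a..b::real} (fst p) :: real) \<in> borel_measurable lM"
  by measurable

lemma joint_window:
  assumes "joint T H" "0 \<le> q" "q' \<le> T"
  shows "(\<lambda>p. indicator {q<..q'} (fst p) *\<^sub>R H (fst p) (snd p)) \<in> borel_measurable lM"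
proof -
  have "(\<lambda>p. (indicator {q<..q'} (fst p) :: real) *\<^sub>R (indicator {0..T} (fst p) *\<^sub>R H (fst p) (snd p)))
      \<in> borel_measurable lM"
    by (rule borel_measurable_scaleR[OF indicator_fst_measurable(1) assms(1)[unfolded joint_def]])
  moreover have "indicator {q<..q'} u *\<^sub>R (indicator {0..T} u *\<^sub>R h) = indicator {q<..q'} u *\<^sub>R h"
    for u and h :: 'b
    using assms(2,3) by (auto split: split_indicator)
  ultimately show ?thesis by (simp only:)
qed

text \<open>Both sides are put in a form that passes to L2 limits: an increment restricted to an
  event \<open>A\<close> known at its start, and the integrand as a function on the product.
  Clamping the partition absorbs the window, and \<open>A\<close> goes into the
  coefficients.\<close>

lemma elementary_isometry:
  assumes el: "elementary_integrand M F T n p \<phi>" and q: "0 \<le> q" "q \<le> q'" "q' \<le> T" and A: "A \<in> sets (F q)"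
  defines "D \<equiv> \<lambda>w. indicator A w * (elementary_integral B n p \<phi> q' w - elementary_integral B n p \<phi> q w)"
    and "E \<equiv> \<lambda>x. indicator A (snd x) *\<^sub>R indicator {q<..q'} (fst x) *\<^sub>R elementary_process n p \<phi> (fst x) (snd x)"
  shows "D \<in> borel_measurable M" "integrable M (\<lambda>w. (D w)\<^sup>2)" "(\<integral>w. D w \<partial>M) = 0"
    "E \<in> borel_measurable lM"
    "integrable lM (\<lambda>x. (norm (E x))\<^sup>2)"
    "(\<integral>w. (D w)\<^sup>2 \<partial>M) = (\<integral>x. (norm (E x))\<^sup>2 \<partial>lM)"
proof -
  have p: "0 \<le> p 0" "\<And>i. i < n \<Longrightarrow> p i \<le> p (Suc i)" "p n \<le> T"
    and \<phi>: "\<And>i. i < n \<Longrightarrow> \<phi> i \<in> borel_measurable (F (p i))"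
    "\<And>i. i < n \<Longrightarrow> \<exists>C. \<forall>w\<in>space M. norm (\<phi> i w) \<le> C"
    using el unfolding elementary_integrand_def by auto
  define a where "a = (\<lambda>i. max q (min q' (p i)))"
  define \<psi> where "\<psi> = (\<lambda>i w. indicator A w *\<^sub>R \<phi> i w)"
  have AM: "A \<in> sets M" using A sets_F_sub by auto
  note [measurable] = AM
  have a0: "0 \<le> a 0" using q by (simp add: a_def)
  have am: "a i \<le> a (Suc i)" if "i < n" for i
    using p(2)[OF that] by (auto simp: a_def max_def min_def)
  have \<phi>M: "\<phi> i \<in> borel_measurable M" if "i < n" for i using measurable_F_M[OF \<phi>(1)[OF that]] .
  have \<psi>m: "\<psi> i \<in> borel_measurable (F (a i))" if "i < n" "a i < a (Suc i)" for i
  proof -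
    have "p i \<le> a i" "q \<le> a i" using that(2) by (auto simp: a_def max_def min_def split: if_splits)
    then have "\<phi> i \<in> borel_measurable (F (a i))" "A \<in> sets (F (a i))"
      using measurable_F_mono[OF \<phi>(1)[OF that(1)]] A sets_F_mono[of q "a i"] by auto
    then show ?thesis unfolding \<psi>_def by measurable
  qed
  have \<psi>b: "\<exists>C. \<forall>w\<in>space M. norm (\<psi> i w) \<le> C" if i: "i < n" for i
  proof -
    obtain C where "\<forall>w\<in>space M. norm (\<phi> i w) \<le> C" using \<phi>(2)[OF i] by auto
    then have "\<forall>w\<in>space M. norm (\<psi> i w) \<le> max C 0"
      by (auto simp: \<psi>_def split: split_indicator)
    then show ?thesis by blast
  qed
  note C = chain_isometry[of a n \<psi>, OF a0 am \<psi>m \<psi>b]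
  have Deq: "D = (\<lambda>w. \<Sum>i<n. \<psi> i w \<bullet> (B (a (Suc i)) w - B (a i) w))"
    unfolding D_def elementary_integral_increment[OF q(2)] sum_distrib_left
    by (simp add: a_def \<psi>_def)
  show "D \<in> borel_measurable M" "integrable M (\<lambda>w. (D w)\<^sup>2)" "(\<integral>w. D w \<partial>M) = 0"
    unfolding Deq using C measurable_F_M by auto
  have I\<psi>: "integrable M (\<lambda>w. (norm (\<psi> i w))\<^sup>2)" if i: "i < n" for i
  proof -
    obtain C where C: "\<forall>w\<in>space M. norm (\<psi> i w) \<le> C" using \<psi>b[OF i] by auto
    have "\<psi> i \<in> borel_measurable M" unfolding \<psi>_def using \<phi>M[OF i] by measurable
    then show ?thesis
      using C by (intro integrable_const_bound[where B="C\<^sup>2"]) (auto intro!: power_mono)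
  qed
  show Em: "E \<in> borel_measurable lM"
    unfolding E_def elementary_process_def
    by (intro borel_measurable_scaleR indicator_fst_measurable borel_measurable_sum
        measurable_compose[OF measurable_snd \<phi>M]) (auto intro: measurable_compose[OF measurable_snd])
  have Eeq: "(norm (E x))\<^sup>2 = (\<Sum>i<n. indicator {a i<..a (Suc i)} (fst x) * (norm (\<psi> i (snd x)))\<^sup>2)" for x
  proof -
    have "(norm (E x))\<^sup>2 = indicator A (snd x) * (indicator {q<..q'} (fst x) * (norm (elementary_process n p \<phi> (fst x) (snd x)))\<^sup>2)"
      unfolding E_def by (auto split: split_indicator)
    also have "\<dots> = (\<Sum>i<n. indicator A (snd x) * (indicator {q<..q'} (fst x) *
        (indicator {p i<..p (Suc i)} (fst x) * (norm (\<phi> i (snd x)))\<^sup>2)))"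
      by (subst norm_elementary_process_sq) (use p in \<open>auto simp only: sum_distrib_left\<close>)
    also have "\<dots> = (\<Sum>i<n. indicator {a i<..a (Suc i)} (fst x) * (norm (\<psi> i (snd x)))\<^sup>2)"
    proof (rule sum.cong[OF refl])
      fix i assume "i \<in> {..<n}"
      then have "p i \<le> p (Suc i)" using p by auto
      then have "indicator {q<..q'} u * indicator {p i<..p (Suc i)} u = (indicator {a i<..a (Suc i)} u :: real)" for u
        using q by (auto simp: a_def split: split_indicator)
      from this[of "fst x", symmetric]
      show "indicator A (snd x) * (indicator {q<..q'} (fst x) *
        (indicator {p i<..p (Suc i)} (fst x) * (norm (\<phi> i (snd x)))\<^sup>2)) =
        indicator {a i<..a (Suc i)} (fst x) * (norm (\<psi> i (snd x)))\<^sup>2"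
        by (simp add: \<psi>_def power_mult_distrib split: split_indicator)
    qed
    finally show ?thesis .
  qed
  have T: "integrable lM (\<lambda>x. indicator {a i<..a (Suc i)} (fst x) * (norm (\<psi> i (snd x)))\<^sup>2)"
    "(\<integral>x. indicator {a i<..a (Suc i)} (fst x) * (norm (\<psi> i (snd x)))\<^sup>2 \<partial>lM)
      = (a (Suc i) - a i) * (\<integral>w. (norm (\<psi> i w))\<^sup>2 \<partial>M)" if "i < n" for i
    using integrable_tensor[OF lborel.sigma_finite_measure_axioms sigma_finite_measure_axioms _ I\<psi>[OF that],
        of "indicator {a i<..a (Suc i)}"] am[OF that] by simp_all
  show "integrable lM (\<lambda>x. (norm (E x))\<^sup>2)"
    unfolding Eeq by (intro Bochner_Integration.integrable_sum T) auto
  show "(\<integral>w. (D w)\<^sup>2 \<partial>M) = (\<integral>x. (norm (E x))\<^sup>2 \<partial>lM)"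
    unfolding Eeq Deq by (subst Bochner_Integration.integral_sum) (use C(4) in \<open>simp_all add: T\<close>)
qed

section \<open>Ito integrals as isometric martingales\<close>

text \<open>All that is used of the integral of \<open>H\<close> against \<open>B\<close>; these properties pass to \<open>L\<^sup>2\<close>-limits.\<close>

definition isometric_martingale :: "real \<Rightarrow> (real \<Rightarrow> 'a \<Rightarrow> real ^ 'd) \<Rightarrow> (real \<Rightarrow> 'a \<Rightarrow> real) \<Rightarrow> bool" where
  "isometric_martingale T H N \<longleftrightarrow> joint T H \<and>
    (\<forall>t\<in>{0..T}. N t \<in> borel_measurable (F t)) \<and> (AE w in M. continuous_on {0..T} (\<lambda>t. N t w)) \<and>
    integrable lM (\<lambda>x. indicator {0..T} (fst x) * (norm (H (fst x) (snd x)))\<^sup>2) \<and>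
    (\<forall>q q' A. 0 \<le> q \<and> q \<le> q' \<and> q' \<le> T \<and> A \<in> sets (F q) \<longrightarrow>
       integrable M (\<lambda>w. (indicator A w * (N q' w - N q w))\<^sup>2) \<and>
       (\<integral>w. indicator A w * (N q' w - N q w) \<partial>M) = 0 \<and>
       (\<integral>w. (indicator A w * (N q' w - N q w))\<^sup>2 \<partial>M) =
       (\<integral>x. indicator A (snd x) * indicator {q<..q'} (fst x) * (norm (H (fst x) (snd x)))\<^sup>2 \<partial>lM))"

text \<open>For fixed \<open>q\<close>, \<open>q'\<close>, \<open>A\<close> the increments of the
  elementary integrals converge in L2 over \<open>M\<close> and the restricted integrands in L2 over
  the product; norms and means converge along, so the elementary identities survive.\<close>

lemma ito_integral_isometric_martingale:
  assumes ito: "ito_integral M F B T H N" and H: "joint T H" and "T \<ge> 0"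
  shows "isometric_martingale T H N"
proof -
  obtain n p \<phi> where P: "(\<forall>k. elementary_integrand M F T (n k) (p k) (\<phi> k)) \<and>
        (\<lambda>k. \<integral>\<^sup>+w. (\<integral>\<^sup>+t\<in>{0..T}.
           ennreal ((norm (elementary_process (n k) (p k) (\<phi> k) t w - H t w))\<^sup>2) \<partial>lborel) \<partial>M) \<longlonglongrightarrow> 0 \<and>
        (\<forall>t\<in>{0..T}.
          (\<lambda>k. \<integral>\<^sup>+w. ennreal (\<bar>elementary_integral B (n k) (p k) (\<phi> k) t w - N t w\<bar>\<^sup>2) \<partial>M) \<longlonglongrightarrow> 0)"
    using ito[unfolded ito_integral_def, THEN conjunct2, THEN conjunct2] by (elim exE) (rule that)
  note el = P[THEN conjunct1, rule_format]
    and l1 = P[THEN conjunct2, THEN conjunct1]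
    and l2 = P[THEN conjunct2, THEN conjunct2, rule_format]
    and Nm = ito[unfolded ito_integral_def, THEN conjunct1, rule_format]
    and Nc = ito[unfolded ito_integral_def, THEN conjunct2, THEN conjunct1]
  have NM: "N t \<in> borel_measurable M" if "t \<in> {0..T}" for t using measurable_F_M[OF Nm[OF that]] .
  have main: "integrable M (\<lambda>w. (indicator A w * (N q' w - N q w))\<^sup>2) \<and>
       (\<integral>w. indicator A w * (N q' w - N q w) \<partial>M) = 0 \<and>
       (\<integral>w. (indicator A w * (N q' w - N q w))\<^sup>2 \<partial>M) =
       (\<integral>x. indicator A (snd x) * indicator {q<..q'} (fst x) * (norm (H (fst x) (snd x)))\<^sup>2 \<partial>lM) \<and>
       integrable lM (\<lambda>x. indicator A (snd x) * indicator {q<..q'} (fst x) * (norm (H (fst x) (snd x)))\<^sup>2)"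
    if q: "0 \<le> q" "q \<le> q'" "q' \<le> T" and A: "A \<in> sets (F q)" for q q' A
  proof -
    define D where "D k = (\<lambda>w. indicator A w * (elementary_integral B (n k) (p k) (\<phi> k) q' w
        - elementary_integral B (n k) (p k) (\<phi> k) q w))" for k
    define E where "E k = (\<lambda>x. indicator A (snd x) *\<^sub>R indicator {q<..q'} (fst x) *\<^sub>R
        elementary_process (n k) (p k) (\<phi> k) (fst x) (snd x))" for k
    define f where "f = (\<lambda>w. indicator A w * (N q' w - N q w))"
    define e where "e = (\<lambda>x. indicator A (snd x) *\<^sub>R indicator {q<..q'} (fst x) *\<^sub>R H (fst x) (snd x))"
    note I = elementary_isometry[OF el q A, folded D_def E_def]
    have AM: "A \<in> sets M" using A sets_F_sub by auto
    note [measurable] = AM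
    have [measurable]: "N q \<in> borel_measurable M" "N q' \<in> borel_measurable M" using NM q by auto
    have fm: "f \<in> borel_measurable M" unfolding f_def by measurable
    have em: "e \<in> borel_measurable lM" unfolding e_def
      by (intro borel_measurable_scaleR joint_window[OF H q(1) q(3)]) measurable
    have el_meas: "elementary_integral B (n k) (p k) (\<phi> k) t \<in> borel_measurable M" if "t \<in> {0..T}" for k t
    proof -
      have "\<phi> k i \<in> borel_measurable M" if "i < n k" for i
        using el[of k] measurable_F_M that unfolding elementary_integrand_def by blast
      moreover have "0 \<le> p k i" if "i \<le> n k" for i
        using that
      proof (induction i)
        case (Suc i)
        then have "p k i \<le> p k (Suc i)" using el[of k] unfolding elementary_integrand_def by auto
        then show ?case using Suc by auto
      qed (use el[of k] in \<open>auto simp: elementary_integrand_def\<close>)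
      ultimately show ?thesis
        unfolding elementary_integral_def using that
        by (intro borel_measurable_sum borel_measurable_inner borel_measurable_diff B_meas) auto
    qed
    have L1: "(\<lambda>k. \<integral>\<^sup>+w. ennreal ((norm (D k w - f w))\<^sup>2) \<partial>M) \<longlonglongrightarrow> 0"
    proof (rule tendsto_sandwich[OF _ _ tendsto_const])
      have "(\<lambda>k. 2 * (\<integral>\<^sup>+w. ennreal (\<bar>elementary_integral B (n k) (p k) (\<phi> k) q' w - N q' w\<bar>\<^sup>2) \<partial>M)
        + 2 * (\<integral>\<^sup>+w. ennreal (\<bar>elementary_integral B (n k) (p k) (\<phi> k) q w - N q w\<bar>\<^sup>2) \<partial>M)) \<longlonglongrightarrow> 2 * 0 + 2 * 0"
        using q by (intro tendsto_add ennreal_tendsto_cmult l2) auto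
      then show "(\<lambda>k. 2 * (\<integral>\<^sup>+w. ennreal (\<bar>elementary_integral B (n k) (p k) (\<phi> k) q' w - N q' w\<bar>\<^sup>2) \<partial>M)
        + 2 * (\<integral>\<^sup>+w. ennreal (\<bar>elementary_integral B (n k) (p k) (\<phi> k) q w - N q w\<bar>\<^sup>2) \<partial>M)) \<longlonglongrightarrow> 0"
        by simp
      show "\<forall>\<^sub>F k in sequentially. (\<integral>\<^sup>+w. ennreal ((norm (D k w - f w))\<^sup>2) \<partial>M) \<le>
        2 * (\<integral>\<^sup>+w. ennreal (\<bar>elementary_integral B (n k) (p k) (\<phi> k) q' w - N q' w\<bar>\<^sup>2) \<partial>M)
        + 2 * (\<integral>\<^sup>+w. ennreal (\<bar>elementary_integral B (n k) (p k) (\<phi> k) q w - N q w\<bar>\<^sup>2) \<partial>M)"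
      proof (intro always_eventually allI)
        fix k
        have [measurable]: "elementary_integral B (n k) (p k) (\<phi> k) q' \<in> borel_measurable M"
          "elementary_integral B (n k) (p k) (\<phi> k) q \<in> borel_measurable M" using el_meas q by auto
        have "ennreal ((norm (D k w - f w))\<^sup>2) \<le> 2 * ennreal (\<bar>elementary_integral B (n k) (p k) (\<phi> k) q' w - N q' w\<bar>\<^sup>2)
          + 2 * ennreal (\<bar>elementary_integral B (n k) (p k) (\<phi> k) q w - N q w\<bar>\<^sup>2)" for w
        proof -
          let ?a = "elementary_integral B (n k) (p k) (\<phi> k) q' w - N q' w"
          let ?b = "elementary_integral B (n k) (p k) (\<phi> k) q w - N q w"
          have "(norm (D k w - f w))\<^sup>2 \<le> (norm (?a + (- ?b)))\<^sup>2"
            unfolding D_def f_def by (auto split: split_indicator simp: algebra_simps)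
          also have "\<dots> \<le> 2 * (norm ?a)\<^sup>2 + 2 * (norm (- ?b))\<^sup>2" by (rule sq_norm_add_le)
          finally have "ennreal ((norm (D k w - f w))\<^sup>2) \<le> ennreal (2 * \<bar>?a\<bar>\<^sup>2 + 2 * \<bar>?b\<bar>\<^sup>2)"
            by (intro ennreal_leI) (simp add: abs_minus_commute)
          then show ?thesis by (simp add: ennreal_plus ennreal_mult)
        qed
        then have "(\<integral>\<^sup>+w. ennreal ((norm (D k w - f w))\<^sup>2) \<partial>M) \<le>
          (\<integral>\<^sup>+w. 2 * ennreal (\<bar>elementary_integral B (n k) (p k) (\<phi> k) q' w - N q' w\<bar>\<^sup>2)
          + 2 * ennreal (\<bar>elementary_integral B (n k) (p k) (\<phi> k) q w - N q w\<bar>\<^sup>2) \<partial>M)"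
          by (intro nn_integral_mono) auto
        then show "(\<integral>\<^sup>+w. ennreal ((norm (D k w - f w))\<^sup>2) \<partial>M) \<le>
        2 * (\<integral>\<^sup>+w. ennreal (\<bar>elementary_integral B (n k) (p k) (\<phi> k) q' w - N q' w\<bar>\<^sup>2) \<partial>M)
        + 2 * (\<integral>\<^sup>+w. ennreal (\<bar>elementary_integral B (n k) (p k) (\<phi> k) q w - N q w\<bar>\<^sup>2) \<partial>M)"
          by (simp add: nn_integral_add nn_integral_cmult)
      qed
    qed auto
    have L2: "(\<lambda>k. \<integral>\<^sup>+x. ennreal ((norm (E k x - e x))\<^sup>2) \<partial>lM) \<longlonglongrightarrow> 0"
    proof (rule tendsto_sandwich[OF _ _ tendsto_const l1])
      show "\<forall>\<^sub>F k in sequentially. (\<integral>\<^sup>+x. ennreal ((norm (E k x - e x))\<^sup>2) \<partial>lM) \<le>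
        (\<integral>\<^sup>+w. (\<integral>\<^sup>+t\<in>{0..T}.
           ennreal ((norm (elementary_process (n k) (p k) (\<phi> k) t w - H t w))\<^sup>2) \<partial>lborel) \<partial>M)"
      proof (intro always_eventually allI)
        fix k
        have [measurable]: "E k \<in> borel_measurable lM" by (rule I(4))
        note [measurable] = em
        have "(\<integral>\<^sup>+x. ennreal ((norm (E k x - e x))\<^sup>2) \<partial>lM) =
            (\<integral>\<^sup>+w. (\<integral>\<^sup>+t. ennreal ((norm (E k (t, w) - e (t, w)))\<^sup>2) \<partial>lborel) \<partial>M)"
          by (rule lp.nn_integral_snd[symmetric]) measurable
        also have "\<dots> \<le> (\<integral>\<^sup>+w. (\<integral>\<^sup>+t\<in>{0..T}.
           ennreal ((norm (elementary_process (n k) (p k) (\<phi> k) t w - H t w))\<^sup>2) \<partial>lborel) \<partial>M)"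
          using q by (intro nn_integral_mono) (auto simp: E_def e_def split: split_indicator)
        finally show "(\<integral>\<^sup>+x. ennreal ((norm (E k x - e x))\<^sup>2) \<partial>lM) \<le>
        (\<integral>\<^sup>+w. (\<integral>\<^sup>+t\<in>{0..T}.
           ennreal ((norm (elementary_process (n k) (p k) (\<phi> k) t w - H t w))\<^sup>2) \<partial>lborel) \<partial>M)" .
      qed
    qed auto
    have I2: "integrable M (\<lambda>x. (norm (D k x))\<^sup>2)" for k using I(2)[of k] by (simp add: D_def)
    have E2: "integrable lM (\<lambda>x. (norm (E k x))\<^sup>2)"
      and DE: "(\<integral>w. (D k w)\<^sup>2 \<partial>M) = (\<integral>x. (norm (E k x))\<^sup>2 \<partial>lM)" for k
      using I(5,6)[of k] by (simp_all add: D_def E_def)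
    have D2: "integrable M (\<lambda>x. (D k x)\<^sup>2)" for k using I2[of k] by simp
    have D0: "(\<integral>w. D k w \<partial>M) = 0" for k using I(3)[of k] by (simp add: D_def)
    note R1 = L2_tendsto[OF fm I(1) I2 L1]
    note R2 = L2_tendsto[OF em I(4) E2 L2]
    have eq: "(norm (e x))\<^sup>2 = indicator A (snd x) * indicator {q<..q'} (fst x) * (norm (H (fst x) (snd x)))\<^sup>2" for x
      unfolding e_def by (auto split: split_indicator)
    have "(\<lambda>k. \<integral>x. (norm (E k x))\<^sup>2 \<partial>lM) \<longlonglongrightarrow> (\<integral>w. (f w)\<^sup>2 \<partial>M)"
      using R1(3) DE by simp
    from LIMSEQ_unique[OF this R2(3)] have sq: "(\<integral>w. (f w)\<^sup>2 \<partial>M) = (\<integral>x. (norm (e x))\<^sup>2 \<partial>lM)" .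
    have "(\<lambda>k. \<integral>w. D k w \<partial>M) \<longlonglongrightarrow> (\<integral>w. f w \<partial>M)"
      by (rule L2_tendsto_mean[OF fm I(1) D2]) (use L1 in simp)
    then have "(\<integral>w. f w \<partial>M) = 0" using D0 by (simp add: LIMSEQ_const_iff)
    then show ?thesis using R1(1) R2(1) sq unfolding eq by (simp add: f_def)
  qed
  \<comment> \<open>The isometry over \<open>{0<..T}\<close> misses time 0, whose slice is a null
    set of the product.\<close>
  have "integrable lM (\<lambda>x. indicator {0..T} (fst x) * (norm (H (fst x) (snd x)))\<^sup>2)"
  proof (rule integrable_cong_AE_imp)
    show "integrable lM (\<lambda>x. indicator (space M) (snd x) * indicator {0<..T} (fst x) * (norm (H (fst x) (snd x)))\<^sup>2)"
      using main[of 0 T "space M"] \<open>T \<ge> 0\<close> sets.top[of "F 0"] by (simp add: space_F)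
    have "(\<lambda>x. (norm (indicator {0..T} (fst x) *\<^sub>R H (fst x) (snd x)))\<^sup>2) \<in> borel_measurable lM"
      using H unfolding joint_def by measurable
    moreover have "(norm (indicator {0..T} (fst x) *\<^sub>R H (fst x) (snd x)))\<^sup>2
        = indicator {0..T} (fst x) * (norm (H (fst x) (snd x)))\<^sup>2" for x
      by (auto split: split_indicator)
    ultimately show "(\<lambda>x. indicator {0..T} (fst x) * (norm (H (fst x) (snd x)))\<^sup>2) \<in> borel_measurable lM"
      by simp
    have m: "{x \<in> space lM. fst x \<noteq> (0::real)} \<in> sets lM" by measurable
    have "AE t in lborel. AE w in M. fst (t, w) \<noteq> (0::real)"
      using AE_lborel_singleton[of "0::real"] by eventually_elim simp
    from lp.AE_pair_measure[OF m this]
    have "AE x in lM. fst x \<noteq> (0::real)" .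
    with AE_space show "AE x in lM. indicator (space M) (snd x) * indicator {0<..T} (fst x) * (norm (H (fst x) (snd x)))\<^sup>2
        = indicator {0..T} (fst x) * (norm (H (fst x) (snd x)))\<^sup>2"
      by eventually_elim (auto simp: space_pair_measure split: split_indicator)
  qed
  with main show ?thesis unfolding isometric_martingale_def using H Nm Nc by auto
qed

text \<open>The assumption on events says that the conditional expectation of \<open>D\<close> given
  \<open>F q\<close> vanishes, and a factor measurable in \<open>F q\<close> may be integrated
  against it.\<close>

lemma orthogonal_of_sets:
  assumes D: "integrable M D" and zero: "\<And>A. A \<in> sets (F q) \<Longrightarrow> (\<integral>w. indicator A w * D w \<partial>M) = 0"
    and W: "W \<in> borel_measurable (F q)" and I: "integrable M (\<lambda>w. W w * D w)"
  shows "(\<integral>w. W w * D w \<partial>M) = (0::real)"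
proof -
  interpret sigma_finite_subalgebra M "F q" by (rule sigma_finite_subalgebra_F)
  have "AE w in M. real_cond_exp M (F q) D w = 0"
    by (rule real_cond_exp_charact) (use zero D in \<open>auto simp: set_lebesgue_integral_def\<close>)
  then have "(\<integral>w. W w * real_cond_exp M (F q) D w \<partial>M) = (\<integral>w. 0 \<partial>M)"
    by (intro integral_cong_AE) (use measurable_F_M[OF W] in auto)
  then show ?thesis
    using real_cond_exp_intg(2)[OF I W borel_measurable_integrable[OF D]] by simp
qed

context
  fixes T :: real and H :: "real \<Rightarrow> 'a \<Rightarrow> real ^ 'd" and N :: "real \<Rightarrow> 'a \<Rightarrow> real"
  assumes iso: "isometric_martingale T H N"
begin

lemma iso_joint: "joint T H"
  and iso_adapted: "0 \<le> t \<Longrightarrow> t \<le> T \<Longrightarrow> N t \<in> borel_measurable (F t)"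
  and iso_cont: "AE w in M. continuous_on {0..T} (\<lambda>t. N t w)"
  and iso_integrable: "integrable lM (\<lambda>x. indicator {0..T} (fst x) * (norm (H (fst x) (snd x)))\<^sup>2)"
  using iso unfolding isometric_martingale_def by auto

lemma iso_increment:
  assumes "0 \<le> q" "q \<le> q'" "q' \<le> T" "A \<in> sets (F q)"
  shows "integrable M (\<lambda>w. (indicator A w * (N q' w - N q w))\<^sup>2)"
    "(\<integral>w. indicator A w * (N q' w - N q w) \<partial>M) = 0"
    "(\<integral>w. (indicator A w * (N q' w - N q w))\<^sup>2 \<partial>M) =
       (\<integral>x. indicator A (snd x) * indicator {q<..q'} (fst x) * (norm (H (fst x) (snd x)))\<^sup>2 \<partial>lM)"
  using iso assms unfolding isometric_martingale_def by auto

definition energy :: "real \<times> 'a \<Rightarrow> real" where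
  "energy x = indicator {0..T} (fst x) * (norm (H (fst x) (snd x)))\<^sup>2"

lemma energy_integrable: "integrable lM energy"
  using iso_integrable by (simp add: energy_def[abs_def])

lemma energy_nonneg: "0 \<le> energy x"
  by (simp add: energy_def)

lemma energy_window:
  assumes "0 \<le> q" "q' \<le> T"
  shows "indicator {q<..q'} (fst x) * (norm (H (fst x) (snd x)))\<^sup>2 = indicator {q<..q'} (fst x) * energy x"
  using assms by (auto simp: energy_def split: split_indicator)

lemma energy_mult_integrable:
  assumes "f \<in> borel_measurable lM" "\<And>x. \<bar>f x\<bar> \<le> (1::real)"
  shows "integrable lM (\<lambda>x. f x * energy x)"
proof (rule Bochner_Integration.integrable_bound[OF energy_integrable])
  have "\<bar>f x\<bar> * energy x \<le> 1 * energy x" for x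
    using assms(2) energy_nonneg by (intro mult_right_mono) auto
  then show "AE x in lM. norm (f x * energy x) \<le> norm (energy x)"
    using energy_nonneg by (auto simp: abs_mult)
qed (use assms borel_measurable_integrable[OF energy_integrable] in measurable)

text \<open>Indicators of events as coefficients are what stopping requires. By induction the
  partial sum is measurable at \<open>q n\<close> and hence orthogonal to the next increment
  restricted to \<open>A n\<close>.\<close>

lemma step_isometry:
  assumes q: "0 \<le> q 0" "\<And>i. i < n \<Longrightarrow> q i \<le> q (Suc i)" "q n \<le> T"
    and A: "\<And>i. i < n \<Longrightarrow> A i \<in> sets (F (q i))"
  defines "S \<equiv> \<lambda>w. \<Sum>i<n. indicator (A i) w * (N (q (Suc i)) w - N (q i) w)"
  shows "S \<in> borel_measurable (F (q n))" "integrable M (\<lambda>w. (S w)\<^sup>2)" "(\<integral>w. S w \<partial>M) = 0"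
    "(\<integral>w. (S w)\<^sup>2 \<partial>M) = (\<integral>x. (\<Sum>i<n. indicator {q i<..q (Suc i)} (fst x) *\<^sub>R indicator (A i) (snd x)) * energy x \<partial>lM)"
proof -
  have "0 \<le> q n \<and> S \<in> borel_measurable (F (q n)) \<and> integrable M (\<lambda>w. (S w)\<^sup>2) \<and> (\<integral>w. S w \<partial>M) = 0 \<and>
    (\<integral>w. (S w)\<^sup>2 \<partial>M) = (\<integral>x. (\<Sum>i<n. indicator {q i<..q (Suc i)} (fst x) *\<^sub>R indicator (A i) (snd x)) * energy x \<partial>lM)"
    using q A unfolding S_def
  proof (induction n)
    case 0
    then show ?case by simp
  next
    case (Suc n)
    define S where "S = (\<lambda>w. \<Sum>i<n. indicator (A i) w * (N (q (Suc i)) w - N (q i) w))"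
    let ?E = "\<lambda>i x. indicator {q i<..q (Suc i)} (fst x) *\<^sub>R indicator (A i) (snd x) :: real"
    have le: "q n \<le> q (Suc n)" "q (Suc n) \<le> T" using Suc.prems by auto
    have IH: "0 \<le> q n" "S \<in> borel_measurable (F (q n))" "integrable M (\<lambda>w. (S w)\<^sup>2)" "(\<integral>w. S w \<partial>M) = 0"
      "(\<integral>w. (S w)\<^sup>2 \<partial>M) = (\<integral>x. (\<Sum>i<n. ?E i x) * energy x \<partial>lM)"
      using Suc le unfolding S_def by auto
    define D where "D = (\<lambda>w. indicator (A n) w * (N (q (Suc n)) w - N (q n) w))"
    have An: "A n \<in> sets (F (q n))" using Suc.prems(4) by simp
    note An' = this sets_F_mono[OF le(1), THEN subsetD, OF this]
    have Dm: "D \<in> borel_measurable (F (q (Suc n)))"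
      unfolding D_def using An'(2) iso_adapted[of "q (Suc n)"] measurable_F_mono[OF iso_adapted[of "q n"] le(1)] IH(1) le
      by (intro borel_measurable_times borel_measurable_diff borel_measurable_indicator) auto
    note inc = iso_increment[OF IH(1) le(1) le(2)]
    have D2: "integrable M (\<lambda>w. (D w)\<^sup>2)" "(\<integral>w. D w \<partial>M) = 0" using inc(1,2)[OF An] by (auto simp: D_def)
    have DM: "D \<in> borel_measurable M" and SM: "S \<in> borel_measurable M"
      using measurable_F_M[OF Dm] measurable_F_M[OF IH(2)] by auto
    have D1: "integrable M D" "integrable M S" using D2(1) IH(3) DM SM by (auto intro: integrable_of_sq)
    have SD: "integrable M (\<lambda>w. S w * D w)" by (rule integrable_mult_L2[OF SM DM IH(3) D2(1)])
    have SD0: "(\<integral>w. S w * D w \<partial>M) = 0"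
    proof (rule orthogonal_of_sets[OF D1(1) _ IH(2) SD])
      fix C assume "C \<in> sets (F (q n))"
      then have "C \<inter> A n \<in> sets (F (q n))" using An by auto
      from inc(2)[OF this] show "(\<integral>w. indicator C w * D w \<partial>M) = 0"
        by (simp add: D_def indicator_inter_arith mult.assoc)
    qed
    have AM: "A i \<in> sets M" if "i < Suc n" for i using Suc.prems(4)[OF that] sets_F_sub by auto
    have Em: "?E i \<in> borel_measurable lM" if "i < Suc n" for i
    proof -
      have [measurable]: "A i \<in> sets M" using AM[OF that] .
      show ?thesis by measurable
    qed
    have EI: "integrable lM (\<lambda>x. ?E i x * energy x)" if "i < Suc n" for i
      by (rule energy_mult_integrable[OF Em[OF that]]) (auto split: split_indicator)
    have sq: "(S w + D w)\<^sup>2 = (S w)\<^sup>2 + (2 * (S w * D w) + (D w)\<^sup>2)" for w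
      by (simp add: power2_sum)
    have i1: "integrable M (\<lambda>w. 2 * (S w * D w) + (D w)\<^sup>2)"
      by (intro Bochner_Integration.integrable_add integrable_mult_right SD D2)
    have "integrable M (\<lambda>w. (S w + D w)\<^sup>2)"
      unfolding sq by (intro Bochner_Integration.integrable_add IH i1)
    moreover have "(\<integral>w. (S w + D w)\<^sup>2 \<partial>M) = (\<integral>w. (S w)\<^sup>2 \<partial>M) + (\<integral>w. (D w)\<^sup>2 \<partial>M)"
      unfolding sq Bochner_Integration.integral_add[OF IH(3) i1]
      using SD SD0 D2 by simp
    moreover have "(\<integral>w. (D w)\<^sup>2 \<partial>M) = (\<integral>x. ?E n x * energy x \<partial>lM)"
      using inc(3)[OF An] energy_window[OF IH(1) le(2)] by (simp add: D_def mult.assoc mult.left_commute mult.commute)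
    moreover have "(\<integral>x. (\<Sum>i<n. ?E i x) * energy x \<partial>lM) + (\<integral>x. ?E n x * energy x \<partial>lM)
       = (\<integral>x. (\<Sum>i<Suc n. ?E i x) * energy x \<partial>lM)"
    proof -
      have "integrable lM (\<lambda>x. (\<Sum>i<n. ?E i x) * energy x)"
        unfolding sum_distrib_right by (intro Bochner_Integration.integrable_sum EI) auto
      then show ?thesis using EI[of n] by (simp only: sum.lessThan_Suc distrib_right Bochner_Integration.integral_add lessI)
    qed
    moreover have "(\<lambda>w. S w + D w) \<in> borel_measurable (F (q (Suc n)))"
      using measurable_F_mono[OF IH(2) le(1)] Dm by (rule borel_measurable_add)
    moreover have "(\<integral>w. S w + D w \<partial>M) = 0"
      using D1 D2 IH(4) by simp
    moreover have "0 \<le> q (Suc n)" using IH(1) le by simp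
    moreover have Sp: "(\<Sum>i<Suc n. indicator (A i) w * (N (q (Suc i)) w - N (q i) w)) = S w + D w" for w
      by (simp only: S_def D_def sum.lessThan_Suc)
    ultimately show ?case using IH(5) unfolding Sp by (intro conjI) (assumption | simp only:)+
  qed
  then show "S \<in> borel_measurable (F (q n))" "integrable M (\<lambda>w. (S w)\<^sup>2)" "(\<integral>w. S w \<partial>M) = 0"
    "(\<integral>w. (S w)\<^sup>2 \<partial>M) = (\<integral>x. (\<Sum>i<n. indicator {q i<..q (Suc i)} (fst x) *\<^sub>R indicator (A i) (snd x)) * energy x \<partial>lM)"
    by auto
qed

section \<open>Stopping an isometric martingale\<close>

context
  fixes r s :: real and \<sigma> :: "'a \<Rightarrow> real"
  assumes rs: "0 \<le> r" "r \<le> s" "s \<le> T"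
    and \<sigma>: "\<And>w. w \<in> space M \<Longrightarrow> r \<le> \<sigma> w \<and> \<sigma> w \<le> s"
    and stop: "\<And>x. r \<le> x \<Longrightarrow> x \<le> s \<Longrightarrow> {w\<in>space M. x < \<sigma> w} \<in> sets (F x)"
begin

text \<open>By \<open>grid_stop\<close> this is the increment of \<open>N\<close> from
  \<open>r\<close> to the first grid time not before \<open>\<sigma>\<close>, an approximation of
  the stopped increment from the right.\<close>

definition stop_sum :: "nat \<Rightarrow> 'a \<Rightarrow> real" where
  "stop_sum n w = (\<Sum>j<n. indicator {w\<in>space M. grid r s n j < \<sigma> w} w * (N (grid r s n (Suc j)) w - N (grid r s n j) w))"

lemma \<sigma>_meas: "\<sigma> \<in> borel_measurable M"
proof (rule borel_measurableI_greater)
  fix x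
  consider "x < r" | "r \<le> x" "x \<le> s" | "s < x" by linarith
  then show "{w \<in> space M. x < \<sigma> w} \<in> events"
  proof cases
    case 1
    then have "{w \<in> space M. x < \<sigma> w} = space M" using \<sigma> by force
    then show ?thesis by simp
  next
    case 2
    then show ?thesis using stop sets_F_sub by blast
  next
    case 3
    then have "{w \<in> space M. x < \<sigma> w} = {}" using \<sigma> by force
    then show ?thesis by (simp only: sets.empty_sets)
  qed
qed

lemma grid_sets: "j < n \<Longrightarrow> {w\<in>space M. grid r s n j < \<sigma> w} \<in> sets (F (grid r s n j))"
  using grid_bounds[OF rs(2), of n j] by (intro stop) auto

lemma stop_sum_L2:
  assumes "n > 0"
  shows "stop_sum n \<in> borel_measurable M" "integrable M (\<lambda>w. (stop_sum n w)\<^sup>2)"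
    "A \<in> sets (F r) \<Longrightarrow> (\<integral>w. indicator A w * stop_sum n w \<partial>M) = 0"
    "(\<integral>w. (stop_sum n w)\<^sup>2 \<partial>M) = (\<integral>x. (\<Sum>i<n. indicator {grid r s n i<..grid r s n (Suc i)} (fst x) *\<^sub>R
        indicator {w\<in>space M. grid r s n i < \<sigma> w} (snd x)) * energy x \<partial>lM)"
proof -
  have g: "0 \<le> grid r s n 0" "\<And>i. i < n \<Longrightarrow> grid r s n i \<le> grid r s n (Suc i)" "grid r s n n \<le> T"
    using rs assms grid_mono[OF rs(2)] by auto
  note S = step_isometry[of "grid r s n" n "\<lambda>j. {w\<in>space M. grid r s n j < \<sigma> w}", OF g grid_sets]
  show "stop_sum n \<in> borel_measurable M" "integrable M (\<lambda>w. (stop_sum n w)\<^sup>2)"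
    using S(1,2) measurable_F_M unfolding stop_sum_def[abs_def] by auto
  show "(\<integral>w. (stop_sum n w)\<^sup>2 \<partial>M) = (\<integral>x. (\<Sum>i<n. indicator {grid r s n i<..grid r s n (Suc i)} (fst x) *\<^sub>R
        indicator {w\<in>space M. grid r s n i < \<sigma> w} (snd x)) * energy x \<partial>lM)"
    unfolding stop_sum_def by (rule S(4)) auto
  assume A: "A \<in> sets (F r)"
  have "A \<inter> {w\<in>space M. grid r s n j < \<sigma> w} \<in> sets (F (grid r s n j))" if "j < n" for j
    using A grid_sets[OF that] sets_F_mono[of r "grid r s n j"] grid_bounds[OF rs(2), of n j] that by auto
  note S' = step_isometry(3)[of "grid r s n" n "\<lambda>j. A \<inter> {w\<in>space M. grid r s n j < \<sigma> w}", OF g this]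
  show "(\<integral>w. indicator A w * stop_sum n w \<partial>M) = 0"
    using S' unfolding stop_sum_def sum_distrib_left indicator_inter_arith mult.assoc by simp
qed

lemma stop_sum_path:
  assumes "w \<in> space M" "n > 0"
  shows "\<exists>y\<in>{r..s}. \<sigma> w \<le> y \<and> y \<le> \<sigma> w + (s - r) / real n \<and> stop_sum n w = N y w - N r w"
proof -
  have "stop_sum n w = (\<Sum>j<n. (if grid r s n j < \<sigma> w then N (grid r s n (Suc j)) w - N (grid r s n j) w else 0))"
    unfolding stop_sum_def using assms by (intro sum.cong) auto
  then show ?thesis using grid_stop[of r "\<sigma> w" s n "\<lambda>t. N t w"] \<sigma>[OF assms(1)] assms(2) by auto
qed

lemma stop_sum_tendsto:
  "AE w in M. (\<lambda>n. stop_sum (Suc n) w) \<longlonglongrightarrow> N (\<sigma> w) w - N r w"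
  using iso_cont AE_space
proof eventually_elim
  case (elim w)
  from stop_sum_path[OF elim(2)] have "\<forall>n. \<exists>y\<in>{r..s}. \<sigma> w \<le> y \<and> y \<le> \<sigma> w + (s - r) / real (Suc n) \<and> stop_sum (Suc n) w = N y w - N r w"
    by blast
  then obtain y where y: "\<And>n. y n \<in> {r..s}" "\<And>n. \<sigma> w \<le> y n" "\<And>n. y n \<le> \<sigma> w + (s - r) / real (Suc n)"
    "\<And>n. stop_sum (Suc n) w = N (y n) w - N r w" by metis
  have "(\<lambda>n. \<sigma> w + (s - r) * inverse (real (Suc n))) \<longlonglongrightarrow> \<sigma> w + (s - r) * 0"
    by (intro tendsto_intros LIMSEQ_inverse_real_of_nat)
  then have l: "(\<lambda>n. \<sigma> w + (s - r) / real (Suc n)) \<longlonglongrightarrow> \<sigma> w"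
    by (simp only: divide_inverse mult_zero_right add_0_right)
  have "y \<longlonglongrightarrow> \<sigma> w"
    by (rule tendsto_sandwich[OF _ _ tendsto_const l]) (intro always_eventually allI y(2,3))+
  moreover have "y n \<in> {0..T}" for n using y(1)[of n] rs by auto
  moreover have "\<sigma> w \<in> {0..T}" using \<sigma>[OF elim(2)] rs by auto
  ultimately have "(\<lambda>n. N (y n) w) \<longlonglongrightarrow> N (\<sigma> w) w"
    by (intro continuous_on_tendsto_compose[OF elim(1)] always_eventually) auto
  then show ?case unfolding y(4) by (rule tendsto_diff[OF _ tendsto_const])
qed

lemma stopped_meas: "(\<lambda>w. N (\<sigma> w) w - N r w) \<in> borel_measurable M"
proof -
  have "(\<lambda>w. lim (\<lambda>n. stop_sum (Suc n) w)) \<in> borel_measurable M"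
    by (intro borel_measurable_lim_metric stop_sum_L2) simp
  then show ?thesis
    by (rule measurable_AE_eq) (use stop_sum_tendsto in \<open>auto elim!: eventually_mono simp: limI\<close>)
qed

text \<open>Indicator of the times within one mesh after \<open>\<sigma>\<close>, the region where
  the integrand stopped on a grid may differ from the truly stopped one.\<close>

definition overshoot :: "nat \<Rightarrow> real \<times> 'a \<Rightarrow> real" where
  "overshoot n x = indicator {0<..<(s - r) / real n} (fst x - \<sigma> (snd x))"

lemma overshoot_meas: "overshoot n \<in> borel_measurable lM"
proof -
  note [measurable] = \<sigma>_meas
  show ?thesis unfolding overshoot_def[abs_def] by measurable
qed

lemma refine_meas: "(\<lambda>x. \<sigma> (snd x)) \<in> borel_measurable lM"
  by (rule measurable_compose[OF measurable_snd \<sigma>_meas])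

text \<open>The difference of coarse and fine stopping is again a step sum, over cells after
  \<open>\<sigma>\<close> but before the next coarse grid point; the isometry bounds it by the
  energy in the overshoot region. The bound is uniform in the refinement \<open>l\<close>.\<close>

lemma stop_sum_refine:
  assumes "n > 0" "l > 0"
  shows "(\<integral>w. (stop_sum n w - stop_sum (n * l) w)\<^sup>2 \<partial>M) \<le> (\<integral>x. overshoot n x * energy x \<partial>lM)"
proof -
  let ?q = "grid r s (n * l)"
  have nl: "n * l > 0" using assms by simp
  \<comment> \<open>On these events the fine grid has stopped while the coarse one still runs;
    \<open>i div l * l\<close> is the fine index of the last coarse point not after
    \<open>i\<close>.\<close>
  define A where "A = (\<lambda>i. {w\<in>space M. ?q (i div l * l) < \<sigma> w \<and> \<not> ?q i < \<sigma> w})"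
  have coarse: "stop_sum n w = (\<Sum>i<n * l. indicator {w\<in>space M. ?q (i div l * l) < \<sigma> w} w * (N (?q (Suc i)) w - N (?q i) w))" for w
  proof -
    have "stop_sum n w = (\<Sum>j<n. \<Sum>i\<in>{j * l..<j * l + l}. indicator {w\<in>space M. ?q (i div l * l) < \<sigma> w} w * (N (?q (Suc i)) w - N (?q i) w))"
      unfolding stop_sum_def
    proof (rule sum.cong[OF refl])
      fix j
      have "(\<Sum>i\<in>{j * l..<j * l + l}. indicator {w\<in>space M. ?q (i div l * l) < \<sigma> w} w * (N (?q (Suc i)) w - N (?q i) w))
        = (\<Sum>i\<in>{j * l..<j * l + l}. indicator {w\<in>space M. grid r s n j < \<sigma> w} w * (N (?q (Suc i)) w - N (?q i) w))"
      proof (rule sum.cong[OF refl])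
        fix i assume "i \<in> {j * l..<j * l + l}"
        then have "i div l = j" using \<open>l > 0\<close>
          by (metis atLeastLessThan_iff div_nat_eqI mult.commute add.commute mult_Suc_right)
        then show "indicator {w\<in>space M. ?q (i div l * l) < \<sigma> w} w * (N (?q (Suc i)) w - N (?q i) w)
          = indicator {w\<in>space M. grid r s n j < \<sigma> w} w * (N (?q (Suc i)) w - N (?q i) w)"
          using grid_refine[OF \<open>l > 0\<close>, of r s n j] by simp
      qed
      also have "\<dots> = indicator {w\<in>space M. grid r s n j < \<sigma> w} w * (N (?q (j * l + l)) w - N (?q (j * l)) w)"
        unfolding sum_distrib_left[symmetric] using sum_Suc_diff'[of "j * l" "j * l + l" "\<lambda>i. N (?q i) w"] by simp
      also have "?q (j * l + l) = grid r s n (Suc j)"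
        using grid_refine[OF \<open>l > 0\<close>, of r s n "Suc j"] by (simp add: add.commute)
      finally show "indicator {w\<in>space M. grid r s n j < \<sigma> w} w * (N (grid r s n (Suc j)) w - N (grid r s n j) w)
         = (\<Sum>i\<in>{j * l..<j * l + l}. indicator {w\<in>space M. ?q (i div l * l) < \<sigma> w} w * (N (?q (Suc i)) w - N (?q i) w))"
        unfolding grid_refine[OF \<open>l > 0\<close>] by simp
    qed
    also have "\<dots> = (\<Sum>i<n * l. indicator {w\<in>space M. ?q (i div l * l) < \<sigma> w} w * (N (?q (Suc i)) w - N (?q i) w))"
      by (rule sum.nat_group)
    finally show ?thesis .
  qed
  have dl: "i div l * l \<le> i" for i by simp
  have diff: "stop_sum n w - stop_sum (n * l) w = (\<Sum>i<n * l. indicator (A i) w * (N (?q (Suc i)) w - N (?q i) w))"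
    if "w \<in> space M" for w
    unfolding coarse stop_sum_def[of "n * l"] sum_subtractf[symmetric] left_diff_distrib[symmetric]
  proof (intro sum.cong refl arg_cong2[where f="(*)"])
    fix i
    have "?q (i div l * l) \<le> ?q i" by (rule grid_mono[OF rs(2) dl])
    then show "indicator {w \<in> space M. ?q (i div l * l) < \<sigma> w} w - indicator {w \<in> space M. ?q i < \<sigma> w} w = (indicator (A i) w :: real)"
      using that by (auto simp: A_def split: split_indicator)
  qed
  have g: "0 \<le> ?q 0" "\<And>i. i < n * l \<Longrightarrow> ?q i \<le> ?q (Suc i)" "?q (n * l) \<le> T"
    using rs nl grid_mono[OF rs(2)] by auto
  have AF: "A i \<in> sets (F (?q i))" if "i < n * l" for i
  proof -
    have b: "r \<le> ?q i" "?q i \<le> s" "r \<le> ?q (i div l * l)" "?q (i div l * l) \<le> ?q i"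
      using grid_bounds[OF rs(2) nl, of i] grid_mono[OF rs(2), of 0 "i div l * l" "n * l"] that grid_mono[OF rs(2) dl] by auto
    have "{w\<in>space M. ?q (i div l * l) < \<sigma> w} \<in> sets (F (?q i))" "{w\<in>space M. ?q i < \<sigma> w} \<in> sets (F (?q i))"
      using stop[of "?q (i div l * l)"] stop[of "?q i"] b sets_F_mono[OF b(4)] by auto
    moreover have "A i = {w\<in>space M. ?q (i div l * l) < \<sigma> w} - {w\<in>space M. ?q i < \<sigma> w}" by (auto simp: A_def)
    ultimately show ?thesis by auto
  qed
  note S = step_isometry[of ?q "n * l" A, OF g AF]
  have "(\<integral>w. (stop_sum n w - stop_sum (n * l) w)\<^sup>2 \<partial>M) = (\<integral>w. (\<Sum>i<n * l. indicator (A i) w * (N (?q (Suc i)) w - N (?q i) w))\<^sup>2 \<partial>M)"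
    by (intro Bochner_Integration.integral_cong) (auto simp: diff)
  also have "\<dots> = (\<integral>x. (\<Sum>i<n * l. indicator {?q i<..?q (Suc i)} (fst x) *\<^sub>R indicator (A i) (snd x)) * energy x \<partial>lM)"
    by (rule S(4)) auto
  also have "\<dots> \<le> (\<integral>x. overshoot n x * energy x \<partial>lM)"
  proof (rule integral_mono)
    have le: "(\<Sum>i<n * l. indicator {?q i<..?q (Suc i)} (fst x) *\<^sub>R indicator (A i) (snd x)) \<le> overshoot n x"
      and abs1: "\<bar>\<Sum>i<n * l. indicator {?q i<..?q (Suc i)} (fst x) *\<^sub>R indicator (A i) (snd x)\<bar> \<le> (1::real)" for x :: "real \<times> 'a"
    proof -
      have "(\<Sum>i<n * l. indicator {?q i<..?q (Suc i)} (fst x) *\<^sub>R indicator (A i) (snd x)) \<le> overshoot n x \<and>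
        \<bar>\<Sum>i<n * l. indicator {?q i<..?q (Suc i)} (fst x) *\<^sub>R indicator (A i) (snd x)\<bar> \<le> (1::real)"
      proof (cases "\<exists>i<n * l. fst x \<in> {?q i<..?q (Suc i)}")
        case True
        then obtain i where i: "i < n * l" "fst x \<in> {?q i<..?q (Suc i)}" by auto
        have "indicator (A i) (snd x) \<le> overshoot n x"
        proof (cases "snd x \<in> A i")
          case True
          then have a: "?q (i div l * l) < \<sigma> (snd x)" "\<sigma> (snd x) \<le> ?q i" by (auto simp: A_def)
          have "Suc i \<le> Suc (i div l) * l" using \<open>l > 0\<close>
            by (simp add: Suc_leI dividend_less_div_times)
          then have "?q (Suc i) \<le> ?q (Suc (i div l) * l)" by (rule grid_mono[OF rs(2)])
          also have "\<dots> = grid r s n (i div l) + (s - r) / real n"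
            unfolding grid_refine[OF \<open>l > 0\<close>] grid_Suc ..
          finally have "fst x < \<sigma> (snd x) + (s - r) / real n"
            using i a grid_refine[OF \<open>l > 0\<close>, of r s n "i div l"] by auto
          then show ?thesis using i a by (auto simp: overshoot_def)
        qed (simp add: overshoot_def)
        then show ?thesis
          using step_sum_eq[of "n * l" ?q i "fst x" "\<lambda>i. indicator (A i) (snd x) :: real", OF g(2) i]
          by (simp only:) (auto split: split_indicator)
      next
        case False
        have z: "(\<Sum>i<n * l. indicator {?q i<..?q (Suc i)} (fst x) *\<^sub>R indicator (A i) (snd x)) = (0::real)"
          by (rule step_sum_zero) (use False in auto)
        show ?thesis unfolding z by (simp add: overshoot_def)
      qed
      then show "(\<Sum>i<n * l. indicator {?q i<..?q (Suc i)} (fst x) *\<^sub>R indicator (A i) (snd x)) \<le> overshoot n x"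
        "\<bar>\<Sum>i<n * l. indicator {?q i<..?q (Suc i)} (fst x) *\<^sub>R indicator (A i) (snd x)\<bar> \<le> (1::real)" by auto
    qed
    show "(\<Sum>i<n * l. indicator {?q i<..?q (Suc i)} (fst x) *\<^sub>R indicator (A i) (snd x)) * energy x \<le> overshoot n x * energy x" for x
      using le energy_nonneg by (intro mult_right_mono)
    show "integrable lM (\<lambda>x. (\<Sum>i<n * l. indicator {?q i<..?q (Suc i)} (fst x) *\<^sub>R indicator (A i) (snd x)) * energy x)"
    proof (rule energy_mult_integrable[OF _ abs1])
      have [measurable]: "A i \<in> sets M" if "i \<in> {..<n * l}" for i using AF[of i] that sets_F_sub by auto
      show "(\<lambda>x. \<Sum>i<n * l. indicator {?q i<..?q (Suc i)} (fst x) *\<^sub>R indicator (A i) (snd x) :: real) \<in> borel_measurable lM"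
        by (rule borel_measurable_sum) measurable
    qed
    show "integrable lM (\<lambda>x. overshoot n x * energy x)"
      by (rule energy_mult_integrable[OF overshoot_meas]) (auto simp: overshoot_def split: split_indicator)
  qed
  finally show ?thesis .
qed

lemma overshoot_small: "(\<lambda>n. \<integral>x. overshoot (Suc n) x * energy x \<partial>lM) \<longlonglongrightarrow> 0"
proof -
  note [measurable] = overshoot_meas borel_measurable_integrable[OF energy_integrable]
  have "(\<lambda>n. \<integral>x. overshoot (Suc n) x * energy x \<partial>lM) \<longlonglongrightarrow> (\<integral>x. 0 \<partial>lM)"
  proof (rule integral_dominated_convergence[where w=energy])
    show "AE x in lM. (\<lambda>n. overshoot (Suc n) x * energy x) \<longlonglongrightarrow> 0"
    proof (rule AE_I2)
      fix x :: "real \<times> 'a"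
      have l: "(\<lambda>n. (s - r) * inverse (real (Suc n))) \<longlonglongrightarrow> (s - r) * 0"
        by (intro tendsto_intros LIMSEQ_inverse_real_of_nat)
      have "\<forall>\<^sub>F n in sequentially. overshoot (Suc n) x * energy x = 0"
      proof (cases "fst x - \<sigma> (snd x) > 0")
        case True
        have "\<forall>\<^sub>F n in sequentially. (s - r) * inverse (real (Suc n)) < fst x - \<sigma> (snd x)"
          using l by (rule order_tendstoD) (use True in simp)
        then show ?thesis by eventually_elim (auto simp: overshoot_def divide_inverse)
      qed (simp add: overshoot_def)
      then show "(\<lambda>n. overshoot (Suc n) x * energy x) \<longlonglongrightarrow> 0" by (rule tendsto_eventually)
    qed
    show "AE x in lM. norm (overshoot (Suc n) x * energy x) \<le> energy x" for n
      using energy_nonneg by (auto simp: overshoot_def split: split_indicator)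
  qed (use energy_integrable in auto)
  then show ?thesis by simp
qed

text \<open>Letting \<open>l\<close> grow in \<open>stop_sum_refine\<close>, Fatou's lemma bounds
  the L2 distance of a stopped sum from the stopped value by the overshoot energy, which tends to 0.
  Means and norms then pass to the limit; the step integrand is squeezed between the stopped one and
  the stopped one plus the overshoot.\<close>

theorem stopped_isometry:
  shows "integrable M (\<lambda>w. (N (\<sigma> w) w - N r w)\<^sup>2)"
    "A \<in> sets (F r) \<Longrightarrow> (\<integral>w. indicator A w * (N (\<sigma> w) w - N r w) \<partial>M) = 0"
    "(\<integral>w. (N (\<sigma> w) w - N r w)\<^sup>2 \<partial>M) =
       (\<integral>x. indicator {r<..\<sigma> (snd x)} (fst x) * (norm (H (fst x) (snd x)))\<^sup>2 \<partial>lM)"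
proof -
  let ?X = "\<lambda>w. N (\<sigma> w) w - N r w"
  define e where "e = (\<lambda>n. \<integral>x. overshoot (Suc n) x * energy x \<partial>lM)"
  have Sm: "stop_sum (Suc n) \<in> borel_measurable M" "integrable M (\<lambda>w. (stop_sum (Suc n) w)\<^sup>2)" for n
    using stop_sum_L2[of "Suc n"] by auto
  have d: "integrable M (\<lambda>w. (stop_sum (Suc n) w - ?X w)\<^sup>2)" "(\<integral>w. (stop_sum (Suc n) w - ?X w)\<^sup>2 \<partial>M) \<le> e n" for n
  proof -
    have lm: "AE w in M. (\<lambda>l. stop_sum (Suc n) w - stop_sum (Suc n * Suc l) w) \<longlonglongrightarrow> stop_sum (Suc n) w - ?X w"
      using stop_sum_tendsto
    proof eventually_elim
      case (elim w)
      \<comment> \<open>\<open>Suc n * Suc l = Suc (n + l * Suc n)\<close>, so the refinements of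
        one grid form a subsequence of all grids.\<close>
      have sub: "strict_mono (\<lambda>l. n + l * Suc n)" by (intro strict_monoI) (simp only: add_less_cancel_left mult_less_cancel2, simp)
      have "(\<lambda>l. stop_sum (Suc (n + l * Suc n)) w) \<longlonglongrightarrow> ?X w"
        using LIMSEQ_subseq_LIMSEQ[OF elim sub] by (simp add: comp_def)
      moreover have "Suc n * Suc l = Suc (n + l * Suc n)" for l by (simp add: algebra_simps)
      ultimately show ?case by (simp only: tendsto_diff[OF tendsto_const])
    qed
    have m: "(\<lambda>w. stop_sum (Suc n) w - stop_sum (Suc n * Suc l) w) \<in> borel_measurable M" for l
      by (intro borel_measurable_diff stop_sum_L2) auto
    have i: "integrable M (\<lambda>w. (stop_sum (Suc n) w - stop_sum (Suc n * Suc l) w)\<^sup>2)" for l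
      using integrable_sq_diff[of "stop_sum (Suc n)" M "stop_sum (Suc n * Suc l)"]
        stop_sum_L2[of "Suc n"] stop_sum_L2[of "Suc n * Suc l"] by (simp only: real_norm_def power2_abs) auto
    have b: "(\<integral>w. (stop_sum (Suc n) w - stop_sum (Suc n * Suc l) w)\<^sup>2 \<partial>M) \<le> e n" for l
      unfolding e_def by (rule stop_sum_refine) auto
    from integrable_sq_Fatou[OF borel_measurable_diff[OF Sm(1) stopped_meas] m lm i b]
    show "integrable M (\<lambda>w. (stop_sum (Suc n) w - ?X w)\<^sup>2)" "(\<integral>w. (stop_sum (Suc n) w - ?X w)\<^sup>2 \<partial>M) \<le> e n" by auto
  qed
  have e0: "e \<longlonglongrightarrow> 0" using overshoot_small by (simp add: e_def)
  have L: "(\<lambda>n. \<integral>\<^sup>+w. ennreal ((stop_sum (Suc n) w - ?X w)\<^sup>2) \<partial>M) \<longlonglongrightarrow> 0"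
  proof (rule tendsto_sandwich[OF _ _ tendsto_const])
    show "(\<lambda>n. ennreal (e n)) \<longlonglongrightarrow> 0" using tendsto_ennrealI[OF e0] by simp
    show "\<forall>\<^sub>F n in sequentially. (\<integral>\<^sup>+w. ennreal ((stop_sum (Suc n) w - ?X w)\<^sup>2) \<partial>M) \<le> ennreal (e n)"
      by (intro always_eventually allI) (subst nn_integral_eq_integral[OF d(1)], auto intro!: ennreal_leI d(2))
  qed auto
  have L': "(\<lambda>n. \<integral>\<^sup>+w. ennreal ((norm (stop_sum (Suc n) w - ?X w))\<^sup>2) \<partial>M) \<longlonglongrightarrow> 0" using L by simp
  have Sm': "integrable M (\<lambda>w. (norm (stop_sum (Suc n) w))\<^sup>2)" for n using Sm(2) by simp
  note R = L2_tendsto[OF stopped_meas Sm(1) Sm' L']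
  show X2: "integrable M (\<lambda>w. (?X w)\<^sup>2)" using R(1) by simp
  have S2: "(\<lambda>n. \<integral>w. (stop_sum (Suc n) w)\<^sup>2 \<partial>M) \<longlonglongrightarrow> (\<integral>w. (?X w)\<^sup>2 \<partial>M)" using R(3) by simp
  {
    assume A: "A \<in> sets (F r)"
    then have AM[measurable]: "A \<in> sets M" using sets_F_sub by auto
    note [measurable] = Sm(1) stopped_meas
    have "(\<lambda>n. \<integral>w. indicator A w * stop_sum (Suc n) w \<partial>M) \<longlonglongrightarrow> (\<integral>w. indicator A w * ?X w \<partial>M)"
    proof (rule L2_tendsto_mean)
      show "integrable M (\<lambda>w. (indicator A w * stop_sum (Suc n) w)\<^sup>2)" for n
        by (rule Bochner_Integration.integrable_bound[OF Sm(2)[of n]]) (auto split: split_indicator)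
      show "(\<lambda>n. \<integral>\<^sup>+w. ennreal ((indicator A w * stop_sum (Suc n) w - indicator A w * ?X w)\<^sup>2) \<partial>M) \<longlonglongrightarrow> 0"
        by (rule tendsto_sandwich[OF _ _ tendsto_const L])
          (auto intro!: always_eventually nn_integral_mono split: split_indicator)
    qed measurable
    then show "(\<integral>w. indicator A w * ?X w \<partial>M) = 0"
      using stop_sum_L2(3)[OF _ A] by (simp add: LIMSEQ_const_iff)
  }
  define a where "a n x = (\<Sum>i<n. indicator {grid r s n i<..grid r s n (Suc i)} (fst x) *\<^sub>R
        indicator {w\<in>space M. grid r s n i < \<sigma> w} (snd x) :: real)" for n and x :: "real \<times> 'a"
  define b where "b x = (indicator {r<..\<sigma> (snd x)} (fst x) :: real)" for x :: "real \<times> 'a"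
  have ab: "b x \<le> a (Suc n) x" "a (Suc n) x \<le> b x + overshoot (Suc n) x" if x: "snd x \<in> space M" for x :: "real \<times> 'a" and n
  proof -
    let ?g = "grid r s (Suc n)"
    have g2: "\<And>i. i < Suc n \<Longrightarrow> ?g i \<le> ?g (Suc i)" using grid_mono[OF rs(2)] by auto
    have "b x \<le> a (Suc n) x \<and> a (Suc n) x \<le> b x + overshoot (Suc n) x"
    proof (cases "\<exists>i<Suc n. fst x \<in> {?g i<..?g (Suc i)}")
      case True
      then obtain i where i: "i < Suc n" "fst x \<in> {?g i<..?g (Suc i)}" by auto
      have a: "a (Suc n) x = indicator {w\<in>space M. ?g i < \<sigma> w} (snd x)"
        unfolding a_def by (rule step_sum_eq[OF g2 i]) auto
      have "r < fst x" using i grid_bounds[OF rs(2), of "Suc n" i] by auto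
      moreover have "?g i < \<sigma> (snd x) \<Longrightarrow> \<sigma> (snd x) < fst x \<Longrightarrow> fst x - \<sigma> (snd x) < (s - r) / real (Suc n)"
        using i grid_Suc[of r s "Suc n" i] by auto
      ultimately show ?thesis
        using i x unfolding a b_def overshoot_def by (auto split: split_indicator)
    next
      case False
      then have "a (Suc n) x = 0" unfolding a_def by (intro step_sum_zero) auto
      moreover have "b x = 0"
      proof (rule ccontr)
        assume "b x \<noteq> 0"
        then have "?g 0 < fst x" "fst x \<le> ?g (Suc n)" using \<sigma>[OF x] by (auto simp: b_def split: split_indicator_asm)
        from step_exists[of ?g, OF this] False show False by auto
      qed
      ultimately show ?thesis by (simp add: overshoot_def)
    qed
    then show "b x \<le> a (Suc n) x" "a (Suc n) x \<le> b x + overshoot (Suc n) x" by auto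
  qed
  note [measurable] = refine_meas
  have bm: "b \<in> borel_measurable lM"
    unfolding b_def[abs_def] indicator_def greaterThanAtMost_iff by measurable
  have Ib: "integrable lM (\<lambda>x. b x * energy x)"
    by (rule energy_mult_integrable[OF bm]) (auto simp: b_def split: split_indicator)
  have Io: "integrable lM (\<lambda>x. overshoot n x * energy x)" for n
    by (rule energy_mult_integrable[OF overshoot_meas]) (auto simp: overshoot_def split: split_indicator)
  have sp: "AE x in lM. snd x \<in> space M" using AE_space by (auto simp: space_pair_measure)
  have am: "a (Suc n) \<in> borel_measurable lM" for n
    unfolding a_def[abs_def]
  proof (rule borel_measurable_sum)
    fix i assume "i \<in> {..<Suc n}"
    then have [measurable]: "{w\<in>space M. grid r s (Suc n) i < \<sigma> w} \<in> sets M" using grid_sets[of i "Suc n"] sets_F_sub by auto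
    show "(\<lambda>x. indicator {grid r s (Suc n) i<..grid r s (Suc n) (Suc i)} (fst x) *\<^sub>R
        indicator {w\<in>space M. grid r s (Suc n) i < \<sigma> w} (snd x) :: real) \<in> borel_measurable lM"
      by measurable
  qed
  have Ia: "integrable lM (\<lambda>x. a (Suc n) x * energy x)" for n
  proof (rule Bochner_Integration.integrable_bound[OF Bochner_Integration.integrable_add[OF Ib Io[of "Suc n"]]])
    show "AE x in lM. norm (a (Suc n) x * energy x) \<le> norm (b x * energy x + overshoot (Suc n) x * energy x)"
      using sp
    proof eventually_elim
      case (elim x)
      have "0 \<le> b x" by (simp add: b_def)
      then have "0 \<le> a (Suc n) x" using ab(1)[OF elim, of n] by linarith
      then have "norm (a (Suc n) x * energy x) = a (Suc n) x * energy x" using energy_nonneg by simp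
      also have "\<dots> \<le> (b x + overshoot (Suc n) x) * energy x"
        using ab(2)[OF elim] energy_nonneg by (intro mult_right_mono) auto
      finally show ?case by (simp add: distrib_right)
    qed
  qed (use am borel_measurable_integrable[OF energy_integrable] in measurable)
  have "(\<lambda>n. \<integral>x. a (Suc n) x * energy x \<partial>lM) \<longlonglongrightarrow> (\<integral>x. b x * energy x \<partial>lM)"
  proof (rule tendsto_sandwich[OF _ _ tendsto_const])
    show "(\<lambda>n. (\<integral>x. b x * energy x \<partial>lM) + e n) \<longlonglongrightarrow> (\<integral>x. b x * energy x \<partial>lM)"
      using tendsto_add[OF tendsto_const e0] by simp
    show "\<forall>\<^sub>F n in sequentially. (\<integral>x. b x * energy x \<partial>lM) \<le> (\<integral>x. a (Suc n) x * energy x \<partial>lM)"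
    proof (rule always_eventually, rule allI, rule integral_mono_AE[OF Ib Ia])
      fix n
      show "AE x in lM. b x * energy x \<le> a (Suc n) x * energy x"
        using sp by eventually_elim (rule mult_right_mono[OF ab(1) energy_nonneg])
    qed
    show "\<forall>\<^sub>F n in sequentially. (\<integral>x. a (Suc n) x * energy x \<partial>lM) \<le> (\<integral>x. b x * energy x \<partial>lM) + e n"
      unfolding e_def Bochner_Integration.integral_add[OF Ib Io, symmetric]
    proof (rule always_eventually, rule allI, rule integral_mono_AE[OF Ia Bochner_Integration.integrable_add[OF Ib Io]])
      fix n
      show "AE x in lM. a (Suc n) x * energy x \<le> b x * energy x + overshoot (Suc n) x * energy x"
        unfolding distrib_right[symmetric]
        using sp by eventually_elim (rule mult_right_mono[OF ab(2) energy_nonneg])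
    qed
  qed
  moreover have "(\<integral>w. (stop_sum (Suc n) w)\<^sup>2 \<partial>M) = (\<integral>x. a (Suc n) x * energy x \<partial>lM)" for n
    unfolding a_def by (rule stop_sum_L2(4)) simp
  ultimately have "(\<lambda>n. \<integral>w. (stop_sum (Suc n) w)\<^sup>2 \<partial>M) \<longlonglongrightarrow> (\<integral>x. b x * energy x \<partial>lM)" by simp
  from LIMSEQ_unique[OF S2 this]
  have "(\<integral>w. (?X w)\<^sup>2 \<partial>M) = (\<integral>x. b x * energy x \<partial>lM)" .
  also have "\<dots> = (\<integral>x. indicator {r<..\<sigma> (snd x)} (fst x) * (norm (H (fst x) (snd x)))\<^sup>2 \<partial>lM)"
  proof (rule Bochner_Integration.integral_cong[OF refl])
    fix x :: "real \<times> 'a" assume "x \<in> space lM"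
    then have "snd x \<in> space M" by (auto simp: space_pair_measure)
    then show "b x * energy x = indicator {r<..\<sigma> (snd x)} (fst x) * (norm (H (fst x) (snd x)))\<^sup>2"
      using \<sigma>[of "snd x"] rs by (auto simp: b_def energy_def split: split_indicator)
  qed
  finally show "(\<integral>w. (?X w)\<^sup>2 \<partial>M) =
       (\<integral>x. indicator {r<..\<sigma> (snd x)} (fst x) * (norm (H (fst x) (snd x)))\<^sup>2 \<partial>lM)" .
qed

end
end

section \<open>Shifting the integrand by a constant\<close>

text \<open>The constant \<open>z\<close> can be subtracted from an elementary integrand once its
  partition covers all of \<open>{0..T}\<close>. Time 0, outside the half-open cells, is a null set,
  and \<open>B 0\<close> vanishes almost surely.\<close>

lemma ito_integral_diff_const:
  assumes ito: "ito_integral M F B T Z I" and "T \<ge> 0"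
  shows "ito_integral M F B T (\<lambda>u w. Z u w - z) (\<lambda>t w. I t w - z \<bullet> B t w)"
proof -
  obtain n p \<phi> where P: "(\<forall>k. elementary_integrand M F T (n k) (p k) (\<phi> k)) \<and>
        (\<lambda>k. \<integral>\<^sup>+w. (\<integral>\<^sup>+t\<in>{0..T}.
           ennreal ((norm (elementary_process (n k) (p k) (\<phi> k) t w - Z t w))\<^sup>2) \<partial>lborel) \<partial>M) \<longlonglongrightarrow> 0 \<and>
        (\<forall>t\<in>{0..T}.
          (\<lambda>k. \<integral>\<^sup>+w. ennreal (\<bar>elementary_integral B (n k) (p k) (\<phi> k) t w - I t w\<bar>\<^sup>2) \<partial>M) \<longlonglongrightarrow> 0)"
    using ito[unfolded ito_integral_def, THEN conjunct2, THEN conjunct2] by (elim exE) (rule that)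
  note el = P[THEN conjunct1, rule_format]
    and l1 = P[THEN conjunct2, THEN conjunct1]
    and l2 = P[THEN conjunct2, THEN conjunct2, rule_format]
    and Im = ito[unfolded ito_integral_def, THEN conjunct1, rule_format]
    and Ic = ito[unfolded ito_integral_def, THEN conjunct2, THEN conjunct1]
  \<comment> \<open>The partition is enlarged by the points 0 and \<open>T\<close>;
    \<open>\<phi>0\<close> is zero on the two added cells.\<close>
  define p' where "p' k j = (case j of 0 \<Rightarrow> 0 | Suc i \<Rightarrow> if i \<le> n k then p k i else T)" for k j
  define \<phi>0 where "\<phi>0 k j = (case j of 0 \<Rightarrow> (\<lambda>_. 0) | Suc i \<Rightarrow> if i < n k then \<phi> k i else (\<lambda>_. 0))" for k j
  define \<phi>' where "\<phi>' k j w = \<phi>0 k j w - z" for k j w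
  have p'm: "p' k j \<le> p' k (Suc j)" for k j
  proof -
    note e = el[of k, unfolded elementary_integrand_def]
    show ?thesis
    proof (cases j)
      case 0
      then show ?thesis using e by (simp add: p'_def)
    next
      case (Suc i)
      consider "i < n k" | "i = n k" | "i > n k" by linarith
      then show ?thesis using e Suc by cases (auto simp: p'_def)
    qed
  qed
  have p'0: "p' k 0 = 0" and p'n: "p' k (Suc (Suc (n k))) = T" for k by (auto simp: p'_def)
  have el': "elementary_integrand M F T (Suc (Suc (n k))) (p' k) (\<phi>' k)" for k
    unfolding elementary_integrand_def
  proof (intro conjI allI impI)
    fix j assume "j < Suc (Suc (n k))"
    note e = el[of k, unfolded elementary_integrand_def]
    have "\<phi>0 k j \<in> borel_measurable (F (p' k j)) \<and> (\<exists>C. \<forall>w\<in>space M. norm (\<phi>0 k j w) \<le> C)"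
    proof (cases "\<exists>i<n k. j = Suc i")
      case True
      then show ?thesis using e by (auto simp: \<phi>0_def p'_def)
    next
      case False
      then have "\<phi>0 k j = (\<lambda>_. 0)" by (auto simp: \<phi>0_def split: nat.split)
      then show ?thesis by auto
    qed
    then obtain C where m: "\<phi>0 k j \<in> borel_measurable (F (p' k j))" and C: "\<forall>w\<in>space M. norm (\<phi>0 k j w) \<le> C" by auto
    show "\<phi>' k j \<in> borel_measurable (F (p' k j))" unfolding \<phi>'_def[abs_def] using m by measurable
    have "norm (\<phi>' k j w) \<le> C + norm z" if "w \<in> space M" for w
      unfolding \<phi>'_def using C that norm_triangle_ineq4[of "\<phi>0 k j w" z] by force
    then show "\<exists>C. \<forall>w\<in>space M. norm (\<phi>' k j w) \<le> C" by auto
  qed (use p'm p'0 p'n in auto)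
  have proc: "elementary_process (Suc (Suc (n k))) (p' k) (\<phi>' k) t w = elementary_process (n k) (p k) (\<phi> k) t w - indicator {0<..T} t *\<^sub>R z" for k t w
  proof -
    have 1: "(\<Sum>j<Suc (Suc (n k)). indicator {p' k j<..p' k (Suc j)} t *\<^sub>R \<phi>0 k j w) = elementary_process (n k) (p k) (\<phi> k) t w"
      unfolding sum_lessThan_ends elementary_process_def
      by (simp add: \<phi>0_def) (intro sum.cong, auto simp: p'_def)
    have 2: "(\<Sum>j<Suc (Suc (n k)). indicator {p' k j<..p' k (Suc j)} t *\<^sub>R z) = indicator {0<..T} t *\<^sub>R z"
    proof (cases "t \<in> {0<..T}")
      case True
      then obtain j where "j < Suc (Suc (n k))" "t \<in> {p' k j<..p' k (Suc j)}"
        using step_exists[of "p' k" t "Suc (Suc (n k))"] p'0[of k] p'n[of k] by auto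
      from step_sum_eq[of "Suc (Suc (n k))" "p' k", OF p'm this, of "\<lambda>_. z"] True show ?thesis by simp
    next
      case False
      have "0 \<le> p' k j" for j by (induction j) (use p'm order_trans p'0 in \<open>auto, blast\<close>)
      moreover have "p' k (Suc j) \<le> T" if "j < Suc (Suc (n k))" for j
      proof -
        from that have "Suc j \<le> Suc (Suc (n k))" by simp
        then have "p' k (Suc j) \<le> p' k (Suc (Suc (n k)))"
          by (rule lift_Suc_mono_le[of "p' k", OF p'm])
        then show ?thesis using p'n by simp
      qed
      ultimately have "t \<notin> {p' k j<..p' k (Suc j)}" if "j < Suc (Suc (n k))" for j
        using False that by (auto simp: not_less dest: order_trans le_less_trans)
      then show ?thesis using False step_sum_zero[of "Suc (Suc (n k))" t "p' k" "\<lambda>_. z"] by simp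
    qed
    have "elementary_process (Suc (Suc (n k))) (p' k) (\<phi>' k) t w =
      (\<Sum>j<Suc (Suc (n k)). indicator {p' k j<..p' k (Suc j)} t *\<^sub>R \<phi>0 k j w) - (\<Sum>j<Suc (Suc (n k)). indicator {p' k j<..p' k (Suc j)} t *\<^sub>R z)"
      unfolding elementary_process_def \<phi>'_def scaleR_diff_right sum_subtractf ..
    then show ?thesis unfolding 1 2 .
  qed
  have int: "elementary_integral B (Suc (Suc (n k))) (p' k) (\<phi>' k) t w = elementary_integral B (n k) (p k) (\<phi> k) t w - z \<bullet> (B t w - B 0 w)"
    if "t \<in> {0..T}" for k t w
  proof -
    have 1: "(\<Sum>j<Suc (Suc (n k)). \<phi>0 k j w \<bullet> (B (min (p' k (Suc j)) t) w - B (min (p' k j) t) w)) = elementary_integral B (n k) (p k) (\<phi> k) t w"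
      unfolding sum_lessThan_ends elementary_integral_def
      by (simp add: \<phi>0_def) (intro sum.cong, auto simp: p'_def)
    have 2: "(\<Sum>j<Suc (Suc (n k)). z \<bullet> (B (min (p' k (Suc j)) t) w - B (min (p' k j) t) w)) = z \<bullet> (B t w - B 0 w)"
      unfolding inner_sum_right[symmetric] sum_lessThan_telescope[of "\<lambda>j. B (min (p' k j) t) w"]
      using that by (simp add: p'0 p'n)
    have "elementary_integral B (Suc (Suc (n k))) (p' k) (\<phi>' k) t w =
       (\<Sum>j<Suc (Suc (n k)). \<phi>0 k j w \<bullet> (B (min (p' k (Suc j)) t) w - B (min (p' k j) t) w)) -
       (\<Sum>j<Suc (Suc (n k)). z \<bullet> (B (min (p' k (Suc j)) t) w - B (min (p' k j) t) w))"
      unfolding elementary_integral_def \<phi>'_def inner_diff_left sum_subtractf ..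
    then show ?thesis unfolding 1 2 .
  qed
  show ?thesis
    unfolding ito_integral_def
  proof (intro conjI ballI exI allI)
    show "(\<lambda>w. I t w - z \<bullet> B t w) \<in> borel_measurable (F t)" if "t \<in> {0..T}" for t
      using Im[OF that] B_adapted[of t t] that by (intro borel_measurable_diff borel_measurable_inner) auto
    show "AE w in M. continuous_on {0..T} (\<lambda>t. I t w - z \<bullet> B t w)"
      using Ic B_cont
    proof eventually_elim
      case (elim w)
      have "continuous_on {0..T} (\<lambda>t. B t w)" by (rule continuous_on_subset[OF elim(2)]) auto
      then show ?case using elim(1) by (intro continuous_intros)
    qed
    show "elementary_integrand M F T (Suc (Suc (n k))) (p' k) (\<phi>' k)" for k by (rule el')
    have "(\<integral>\<^sup>+t\<in>{0..T}. ennreal ((norm (elementary_process (Suc (Suc (n k))) (p' k) (\<phi>' k) t w - (Z t w - z)))\<^sup>2) \<partial>lborel)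
        = (\<integral>\<^sup>+t\<in>{0..T}. ennreal ((norm (elementary_process (n k) (p k) (\<phi> k) t w - Z t w))\<^sup>2) \<partial>lborel)" for k w
    proof (rule nn_integral_cong_AE)
      show "AE t in lborel. ennreal ((norm (elementary_process (Suc (Suc (n k))) (p' k) (\<phi>' k) t w - (Z t w - z)))\<^sup>2) * indicator {0..T} t
        = ennreal ((norm (elementary_process (n k) (p k) (\<phi> k) t w - Z t w))\<^sup>2) * indicator {0..T} t"
        using AE_lborel_singleton[of "0::real"]
        by eventually_elim (auto simp: proc split: split_indicator)
    qed
    then show "(\<lambda>k. \<integral>\<^sup>+w. (\<integral>\<^sup>+t\<in>{0..T}. ennreal ((norm (elementary_process (Suc (Suc (n k))) (p' k) (\<phi>' k) t w - (Z t w - z)))\<^sup>2) \<partial>lborel) \<partial>M) \<longlonglongrightarrow> 0"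
      using l1 by simp
    fix t assume t: "t \<in> {0..T}"
    have "(\<integral>\<^sup>+w. ennreal (\<bar>elementary_integral B (Suc (Suc (n k))) (p' k) (\<phi>' k) t w - (I t w - z \<bullet> B t w)\<bar>\<^sup>2) \<partial>M)
       = (\<integral>\<^sup>+w. ennreal (\<bar>elementary_integral B (n k) (p k) (\<phi> k) t w - I t w\<bar>\<^sup>2) \<partial>M)" for k
    proof (rule nn_integral_cong_AE)
      show "AE w in M. ennreal (\<bar>elementary_integral B (Suc (Suc (n k))) (p' k) (\<phi>' k) t w - (I t w - z \<bullet> B t w)\<bar>\<^sup>2)
       = ennreal (\<bar>elementary_integral B (n k) (p k) (\<phi> k) t w - I t w\<bar>\<^sup>2)"
        using B_zero
      proof eventually_elim
        case (elim w)
        have "elementary_integral B (Suc (Suc (n k))) (p' k) (\<phi>' k) t w - (I t w - z \<bullet> B t w) = elementary_integral B (n k) (p k) (\<phi> k) t w - I t w"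
          unfolding int[OF t] using elim by simp
        then show ?case by (simp only:)
      qed
    qed
    then show "(\<lambda>k. \<integral>\<^sup>+w. ennreal (\<bar>elementary_integral B (Suc (Suc (n k))) (p' k) (\<phi>' k) t w - (I t w - z \<bullet> B t w)\<bar>\<^sup>2) \<partial>M) \<longlonglongrightarrow> 0"
      using l2[OF t] by simp
  qed
qed

lemma ito_integral_zero: "T \<ge> 0 \<Longrightarrow> ito_integral M F B T (\<lambda>_ _. 0) (\<lambda>_ _. 0)"
  unfolding ito_integral_def
  by (intro conjI exI[of _ "\<lambda>_. 0"] exI[of _ "\<lambda>_ _. 0"] exI[of _ "\<lambda>_ _ _. 0"])
    (auto simp: elementary_integrand_def elementary_process_def elementary_integral_def)

text \<open>The shift of the zero integral; it serves to bound the stopped terminal value in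
  L2.\<close>

lemma isometric_martingale_BM:
  assumes "T \<ge> 0"
  shows "isometric_martingale T (\<lambda>_ _. - z) (\<lambda>t w. - (z \<bullet> B t w))"
proof -
  have "joint T (\<lambda>_ _. - z)" unfolding joint_def by (intro borel_measurable_scaleR indicator_fst_measurable) simp
  with ito_integral_isometric_martingale[OF ito_integral_diff_const[OF ito_integral_zero]] assms
  show ?thesis by simp
qed

section \<open>Measurability of progressive and predictable processes\<close>

lemma prog_section:
  assumes "progressively_measurable F T X" "t \<in> {0..T}"
  shows "X t \<in> borel_measurable (F t)"
proof -
  have m: "(\<lambda>(s, w). X s w) \<in> borel_measurable (restrict_space borel {0..t} \<Otimes>\<^sub>M F t)"
    using assms unfolding progressively_measurable_def by auto
  have "(\<lambda>w. (t, w)) \<in> measurable (F t) (restrict_space borel {0..t} \<Otimes>\<^sub>M F t)"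
    using assms(2) by (intro measurable_Pair1') (simp add: space_restrict_space)
  from measurable_compose[OF this m] show ?thesis by simp
qed

text \<open>One composition rule for two uses: joint measurability, with the time coordinate clamped
  to \<open>{0..T}\<close>, and the value of a process at a random time.\<close>

lemma prog_clip:
  assumes "progressively_measurable F T X" "T \<ge> 0" and h: "h \<in> borel_measurable N" and k: "k \<in> measurable N M"
    and "\<And>x. x \<in> space N \<Longrightarrow> h x \<in> {0..T}"
  shows "(\<lambda>x. X (h x) (k x)) \<in> borel_measurable N"
proof -
  have m: "(\<lambda>(s, w). X s w) \<in> borel_measurable (restrict_space borel {0..T} \<Otimes>\<^sub>M F T)"
    using assms unfolding progressively_measurable_def by auto
  have "k \<in> measurable N (F T)"
    using k sets_F_sub[of T] by (auto simp: measurable_def space_F)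
  then have "(\<lambda>x. (h x, k x)) \<in> measurable N (restrict_space borel {0..T} \<Otimes>\<^sub>M F T)"
    using assms by (intro measurable_Pair measurable_restrict_space2) auto
  from measurable_compose[OF this m] show ?thesis by simp
qed

lemma prog_joint:
  assumes "progressively_measurable F T X" "T \<ge> 0"
  shows "joint T X"
proof -
  have "(\<lambda>p. X (max 0 (min T (fst p))) (snd p)) \<in> borel_measurable lM"
    using assms(2) by (intro prog_clip[OF assms]) auto
  then have "(\<lambda>p. indicator {0..T} (fst p) *\<^sub>R X (max 0 (min T (fst p))) (snd p)) \<in> borel_measurable lM"
    by (intro borel_measurable_scaleR indicator_fst_measurable)
  moreover have "indicator {0..T} u *\<^sub>R X (max 0 (min T u)) w = indicator {0..T} u *\<^sub>R X u w" for u w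
    by (auto split: split_indicator simp: max_absorb2 min_absorb2)
  ultimately show ?thesis unfolding joint_def by simp
qed

lemma sets_F_space: "A \<in> sets (F s) \<Longrightarrow> A \<subseteq> space M"
  using sets.sets_into_space[of A "F s"] by (simp add: space_F)

lemma predictable_section:
  assumes "predictable_process F T X" "t \<in> {0..T}"
  shows "X t \<in> borel_measurable (F t)"
proof -
  have "(\<lambda>w. (t, w)) \<in> measurable (F t) (predictable_sigma F T)"
    unfolding predictable_sigma_def
  proof (rule measurable_measure_of)
    show "{{0} \<times> A |A. A \<in> sets (F 0)} \<union> {{s<..t} \<times> A |s t A. 0 \<le> s \<and> s < t \<and> t \<le> T \<and> A \<in> sets (F s)}
        \<subseteq> Pow ({0..T} \<times> space (F 0))"
      using assms(2) by (auto simp: space_F dest: sets_F_space[THEN subsetD])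
    show "(\<lambda>w. (t, w)) \<in> space (F t) \<rightarrow> {0..T} \<times> space (F 0)" using assms(2) by (auto simp: space_F)
    fix C assume "C \<in> {{0} \<times> A |A. A \<in> sets (F 0)} \<union> {{s<..t} \<times> A |s t A. 0 \<le> s \<and> s < t \<and> t \<le> T \<and> A \<in> sets (F s)}"
    then consider A where "C = {0} \<times> A" "A \<in> sets (F 0)"
      | s u A where "C = {s<..u} \<times> A" "A \<in> sets (F s)" by blast
    then obtain I A s where C: "C = I \<times> A" "A \<in> sets (F s)" "t \<in> I \<Longrightarrow> s \<le> t"
    proof cases
      case (1 A)
      show ?thesis by (rule that[of "{0}" A 0]) (use 1 in auto)
    next
      case (2 s u A)
      show ?thesis by (rule that[of "{s<..u}" A s]) (use 2 in auto)
    qed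
    show "(\<lambda>w. (t, w)) -` C \<inter> space (F t) \<in> sets (F t)"
    proof (cases "t \<in> I")
      case True
      then have "A \<in> sets (F t)" using C sets_F_mono[of s t] by auto
      moreover have "(\<lambda>w. (t, w)) -` C \<inter> space (F t) = A"
        using True C(1) sets.sets_into_space[OF \<open>A \<in> sets (F t)\<close>] by auto
      ultimately show ?thesis by simp
    next
      case False
      then have "(\<lambda>w. (t, w)) -` C \<inter> space (F t) = {}" using C(1) by auto
      then show ?thesis by (simp only: sets.empty_sets)
    qed
  qed
  from measurable_compose[OF this assms(1)[unfolded predictable_process_def]] show ?thesis by simp
qed

lemma predictable_joint:
  assumes "predictable_process F T X" "T \<ge> 0"
  shows "joint T X"
proof -
  have 1: "(\<lambda>p. (max 0 (min T (fst p)), snd p)) \<in> measurable lM (predictable_sigma F T)"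
    unfolding predictable_sigma_def
  proof (rule measurable_measure_of)
    show "{{0} \<times> A |A. A \<in> sets (F 0)} \<union> {{s<..t} \<times> A |s t A. 0 \<le> s \<and> s < t \<and> t \<le> T \<and> A \<in> sets (F s)}
        \<subseteq> Pow ({0..T} \<times> space (F 0))"
      using assms(2) by (auto simp: space_F dest: sets_F_space[THEN subsetD])
    show "(\<lambda>p. (max 0 (min T (fst p)), snd p)) \<in> space lM \<rightarrow> {0..T} \<times> space (F 0)"
      using assms(2) by (auto simp: space_F space_pair_measure)
    fix C assume "C \<in> {{0} \<times> A |A. A \<in> sets (F 0)} \<union> {{s<..t} \<times> A |s t A. 0 \<le> s \<and> s < t \<and> t \<le> T \<and> A \<in> sets (F s)}"
    then consider A where "C = {0} \<times> A" "A \<in> sets (F 0)"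
      | s u A where "C = {s<..u} \<times> A" "A \<in> sets (F s)" by blast
    then obtain I A where C: "C = I \<times> A" "A \<in> sets M" "I \<in> sets (borel :: real measure)"
    proof cases
      case (1 A)
      show ?thesis by (rule that[of "{0}" A]) (use 1 sets_F_sub in auto)
    next
      case (2 s u A)
      show ?thesis by (rule that[of "{s<..u}" A]) (use 2 sets_F_sub in auto)
    qed
    note [measurable] = C(2,3)
    have "(\<lambda>p. (max 0 (min T (fst p)), snd p)) \<in> measurable lM (borel \<Otimes>\<^sub>M M)" by measurable
    from measurable_sets[OF this, of C] show "(\<lambda>p. (max 0 (min T (fst p)), snd p)) -` C \<inter> space lM \<in> sets lM"
      unfolding C(1) by auto
  qed
  from measurable_compose[OF this assms(1)[unfolded predictable_process_def]]
  have "(\<lambda>p. X (max 0 (min T (fst p))) (snd p)) \<in> borel_measurable lM" by simp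
  then have "(\<lambda>p. indicator {0..T} (fst p) *\<^sub>R X (max 0 (min T (fst p))) (snd p)) \<in> borel_measurable lM"
    by (intro borel_measurable_scaleR indicator_fst_measurable)
  moreover have "indicator {0..T} u *\<^sub>R X (max 0 (min T u)) w = indicator {0..T} u *\<^sub>R X u w" for u w
    by (auto split: split_indicator simp: max_absorb2 min_absorb2)
  ultimately show ?thesis unfolding joint_def by simp
qed

section \<open>Stopping times and stopped values\<close>

text \<open>For \<open>x\<close> in \<open>{a..<b}\<close> the event is, off the null set of
  discontinuous paths, a countable condition on values at times up to \<open>x\<close>; the null set
  belongs to \<open>F x\<close>.\<close>

lemma stopping_time_hit:
  assumes "a \<le> b" and D: "\<And>s. s \<in> {a..b} \<Longrightarrow> D s \<in> borel_measurable (F s)"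
    and cont: "AE w in M. continuous_on {a..b} (\<lambda>s. D s w)"
  shows "stopping_time F (\<lambda>w. hit a b (\<lambda>s. D s w))"
proof
  fix x
  consider "x < a" | "b \<le> x" | "a \<le> x" "x < b" by linarith
  then have "{w\<in>space M. hit a b (\<lambda>s. D s w) \<le> x} \<in> sets (F x)"
  proof cases
    case 1
    then have "{w\<in>space M. hit a b (\<lambda>s. D s w) \<le> x} = {}"
      using hit_bounds(1)[OF assms(1)] by (fastforce dest: le_less_trans)
    then show ?thesis by (simp only: sets.empty_sets)
  next
    case 2
    then have "{w\<in>space M. hit a b (\<lambda>s. D s w) \<le> x} = space (F x)"
      using order_trans[OF hit_bounds(2)[OF assms(1)]] by (auto simp: space_F)
    then show ?thesis by (simp only: sets.top)
  next
    case 3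
    have [measurable]: "D (max a (min x (of_rat q))) \<in> borel_measurable (F x)" for q
      using 3 by (intro measurable_F_mono[OF D]) auto
    have "{w\<in>space (F x). \<forall>n. \<exists>q::rat. D (max a (min x (of_rat q))) w < 1 / real (Suc n)} \<in> sets (F x)"
      by measurable
    then show ?thesis
    proof (rule sets_AE_eq)
      show "AE w in M. (w \<in> {w \<in> space (F x). \<forall>n. \<exists>q. D (max a (min x (real_of_rat q))) w < 1 / real (Suc n)}) =
         (w \<in> {w \<in> space M. hit a b (\<lambda>s. D s w) \<le> x})"
        using cont
      proof eventually_elim
        case (elim w)
        have "continuous_on {a..x} (\<lambda>s. D s w)" by (rule continuous_on_subset[OF elim]) (use 3 in auto)
        from dense_clip_less[OF 3(1) this] hit_le_iff[OF assms(1) elim 3] show ?case by (simp add: space_F)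
      qed
    qed (auto simp: null_in_F space_F)
  qed
  then show "Measurable.pred (F x) (\<lambda>w. hit a b (\<lambda>s. D s w) \<le> x)" by (simp add: pred_def space_F)
qed

text \<open>The stopped value is a limit of telescoping sums over grids of \<open>{0..s}\<close>,
  whose events and increments are all known at time \<open>s\<close>.\<close>

lemma stopped_process_measurable:
  fixes X :: "real \<Rightarrow> 'a \<Rightarrow> real"
  assumes X: "\<And>u. 0 \<le> u \<Longrightarrow> X u \<in> borel_measurable (F u)"
    and cont: "AE w in M. continuous_on {0..} (\<lambda>u. X u w)"
    and \<tau>: "stopping_time F \<tau>" "\<And>w. w \<in> space M \<Longrightarrow> 0 \<le> \<tau> w" and "0 \<le> s"
  shows "(\<lambda>w. X (min (\<tau> w) s) w) \<in> borel_measurable (F s)"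
proof -
  define S where "S n w = (\<Sum>j<Suc n. if grid 0 s (Suc n) j < min (\<tau> w) s
     then X (grid 0 s (Suc n) (Suc j)) w - X (grid 0 s (Suc n) j) w else 0)" for n w
  have Sm: "S n \<in> borel_measurable (F s)" for n
    unfolding S_def[abs_def]
  proof (rule borel_measurable_sum, rule measurable_If)
    fix j assume "j \<in> {..<Suc n}"
    then have b: "0 \<le> grid 0 s (Suc n) j" "grid 0 s (Suc n) j \<le> s" "0 \<le> grid 0 s (Suc n) (Suc j)" "grid 0 s (Suc n) (Suc j) \<le> s"
      using grid_bounds[OF \<open>0 \<le> s\<close>, of "Suc n" j] grid_bounds[OF \<open>0 \<le> s\<close>, of "Suc n" "Suc j"] by auto
    show "(\<lambda>w. X (grid 0 s (Suc n) (Suc j)) w - X (grid 0 s (Suc n) j) w) \<in> borel_measurable (F s)"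
      using b by (intro borel_measurable_diff measurable_F_mono[OF X]) auto
    have "Measurable.pred (F (grid 0 s (Suc n) j)) (\<lambda>w. grid 0 s (Suc n) j < \<tau> w)"
      by (rule stopping_timeD2[OF \<tau>(1)])
    then have "{w\<in>space (F s). grid 0 s (Suc n) j < \<tau> w} \<in> sets (F s)"
      using sets_F_mono[OF b(2)] by (auto simp: pred_def space_F)
    moreover have "{w\<in>space (F s). grid 0 s (Suc n) j < min (\<tau> w) s} =
      (if grid 0 s (Suc n) j < s then {w\<in>space (F s). grid 0 s (Suc n) j < \<tau> w} else {})" by auto
    ultimately show "{w \<in> space (F s). grid 0 s (Suc n) j < min (\<tau> w) s} \<in> sets (F s)" by (simp only: sets.empty_sets if_split) auto
  qed auto
  have lim: "AE w in M. (\<lambda>n. S n w) \<longlonglongrightarrow> X (min (\<tau> w) s) w - X 0 w"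
    using cont AE_space
  proof eventually_elim
    case (elim w)
    let ?x = "min (\<tau> w) s"
    have x: "0 \<le> ?x" "?x \<le> s" using \<tau>(2)[OF elim(2)] \<open>0 \<le> s\<close> by auto
    from grid_stop[OF x, of "Suc _" "\<lambda>u. X u w"]
    have "\<forall>n. \<exists>y\<in>{0..s}. ?x \<le> y \<and> y \<le> ?x + (s - 0) / real (Suc n) \<and> S n w = X y w - X 0 w"
      unfolding S_def by blast
    then obtain y where y: "\<And>n. y n \<in> {0..s}" "\<And>n. ?x \<le> y n" "\<And>n. y n \<le> ?x + (s - 0) / real (Suc n)"
      "\<And>n. S n w = X (y n) w - X 0 w" by metis
    have "(\<lambda>n. ?x + (s - 0) * inverse (real (Suc n))) \<longlonglongrightarrow> ?x + (s - 0) * 0"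
      by (intro tendsto_add tendsto_const tendsto_mult LIMSEQ_inverse_real_of_nat)
    then have l: "(\<lambda>n. ?x + (s - 0) / real (Suc n)) \<longlonglongrightarrow> ?x"
      by (simp only: divide_inverse mult_zero_right add_0_right)
    have "y \<longlonglongrightarrow> ?x"
      by (rule tendsto_sandwich[OF _ _ tendsto_const l]) (intro always_eventually allI y(2,3))+
    then have "(\<lambda>n. X (y n) w) \<longlonglongrightarrow> X ?x w"
      using y(1) x by (intro continuous_on_tendsto_compose[OF elim(1)] always_eventually) auto
    then show ?case unfolding y(4) by (rule tendsto_diff[OF _ tendsto_const])
  qed
  have "(\<lambda>w. lim (\<lambda>n. S n w) + X 0 w) \<in> borel_measurable (F s)"
    using \<open>0 \<le> s\<close> by (intro borel_measurable_add borel_measurable_lim_metric Sm measurable_F_mono[OF X]) auto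
  then show ?thesis
    by (rule measurable_AE_eq_F) (use lim in \<open>auto elim!: eventually_mono simp: limI\<close>)
qed

text \<open>Admits the terminal value to the assumption on solvability. Membership in the
  sigma-algebra at \<open>\<tau>\<close> is tested on \<open>\<tau> \<le> s\<close>, where
  \<open>B\<close> at \<open>\<tau>\<close> is \<open>B\<close> at \<open>min \<tau> s\<close>; the
  second moment comes from the stopped isometry of \<open>z \<bullet> B\<close>.\<close>

lemma terminal_value_L2:
  assumes t: "0 \<le> t" "t \<le> T" and x: "x \<in> borel_measurable (F t)" "integrable M (\<lambda>w. (x w)\<^sup>2)"
    and \<tau>: "stopping_time F \<tau>" "\<And>w. w \<in> space M \<Longrightarrow> t \<le> \<tau> w \<and> \<tau> w \<le> T"
  shows "L2_variable M (pre_sigma \<tau>) (\<lambda>w. x w + z \<bullet> (B (\<tau> w) w - B t w))"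
proof -
  let ?\<xi> = "\<lambda>w. x w + z \<bullet> (B (\<tau> w) w - B t w)"
  have zB: "(\<lambda>w. z \<bullet> B (min (\<tau> w) s) w) \<in> borel_measurable (F s)" if "0 \<le> s" for s
  proof (rule stopped_process_measurable[where X="\<lambda>u w. z \<bullet> B u w"])
    show "(\<lambda>w. z \<bullet> B u w) \<in> borel_measurable (F u)" if "0 \<le> u" for u
      using B_adapted[OF that order_refl] by (intro borel_measurable_inner) auto
    show "AE w in M. continuous_on {0..} (\<lambda>u. z \<bullet> B u w)"
      using B_cont by eventually_elim (intro continuous_intros)
  qed (use \<tau> t that in \<open>auto intro: order_trans\<close>)
  have meas: "?\<xi> \<in> borel_measurable (pre_sigma \<tau>)"
  proof (rule measurableI)
    fix C :: "real set" assume C: "C \<in> sets borel"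
    show "?\<xi> -` C \<inter> space (pre_sigma \<tau>) \<in> sets (pre_sigma \<tau>)"
    proof (rule sets_pre_sigmaI[OF \<tau>(1)])
      fix s
      show "{w \<in> ?\<xi> -` C \<inter> space (pre_sigma \<tau>). \<tau> w \<le> s} \<in> sets (F s)"
      proof (cases "t \<le> s")
        case True
        have "(\<lambda>w. x w + (z \<bullet> B (min (\<tau> w) s) w - z \<bullet> B t w)) \<in> borel_measurable (F s)"
          using True t
          by (intro borel_measurable_add[OF measurable_F_mono[OF x(1) True]] borel_measurable_diff[OF zB]
              borel_measurable_inner[OF _ B_adapted[OF t(1) True]]) auto
        note 1 = measurable_sets[OF this C]
        have 2: "{w\<in>space (F s). \<tau> w \<le> s} \<in> sets (F s)"
          using stopping_timeD[OF \<tau>(1), of s] by (simp add: pred_def)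
        note sets.Int[OF 1 2]
        moreover have "(\<lambda>w. x w + (z \<bullet> B (min (\<tau> w) s) w - z \<bullet> B t w)) -` C \<inter> space (F s) \<inter> {w\<in>space (F s). \<tau> w \<le> s}
          = {w \<in> ?\<xi> -` C \<inter> space (pre_sigma \<tau>). \<tau> w \<le> s}"
          by (auto simp: space_F space_pre_sigma inner_diff_right min_absorb1)
        ultimately show ?thesis by simp
      next
        \<comment> \<open>Before \<open>t\<close> the event is empty because
          \<open>t \<le> \<tau>\<close>.\<close>
        case False
        then have "{w \<in> ?\<xi> -` C \<inter> space (pre_sigma \<tau>). \<tau> w \<le> s} = {}"
          using \<tau>(2) by (auto simp: space_pre_sigma) (meson le_less_trans not_le order_trans)
        then show ?thesis by (simp only: sets.empty_sets)
      qed
    qed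
  qed (auto)
  have T0: "T \<ge> 0" using t by simp
  have st: "{w\<in>space M. y < \<tau> w} \<in> sets (F y)" for y
    using stopping_timeD2[OF \<tau>(1), of y] by (simp add: pred_def space_F)
  note S = stopped_isometry[OF isometric_martingale_BM[OF T0, of z] t(1) t(2) order_refl, of \<tau>, OF \<tau>(2) st]
  have "integrable M (\<lambda>w. (z \<bullet> (B (\<tau> w) w - B t w))\<^sup>2)"
    using S(1) by (simp add: inner_diff_right power2_commute)
  moreover have "(\<lambda>w. z \<bullet> (B (\<tau> w) w - B t w)) \<in> borel_measurable M"
  proof -
    have "(\<lambda>w. z \<bullet> B (min (\<tau> w) T) w - z \<bullet> B t w) \<in> borel_measurable M"
      by (intro borel_measurable_diff[OF measurable_F_M[OF zB[OF T0]]] borel_measurable_inner[OF _ B_meas[OF t(1)]]) auto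
    then show ?thesis
      by (rule measurable_AE_eq) (use \<tau>(2) AE_space in \<open>auto simp: min_absorb1 inner_diff_right elim!: eventually_mono\<close>)
  qed
  ultimately have "integrable M (\<lambda>w. (norm (?\<xi> w))\<^sup>2)"
    using x measurable_F_M[OF x(1)] by (intro integrable_sq_add) auto
  then show ?thesis using meas unfolding L2_variable_def by simp
qed

lemma H2_process_joint_L2:
  fixes X :: "real \<Rightarrow> 'a \<Rightarrow> real"
  assumes X: "H2_process M F T X" and "0 \<le> T"
  shows "joint T X" "integrable lM (\<lambda>p. indicator {0..T} (fst p) * (X (fst p) (snd p))\<^sup>2)"
proof -
  show J: "joint T X" by (rule predictable_joint) (use assms in \<open>auto simp: H2_process_def\<close>)
  have "(\<lambda>p. (indicator {0..T} (fst p) *\<^sub>R X (fst p) (snd p))\<^sup>2) \<in> borel_measurable lM"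
    using J unfolding joint_def by measurable
  moreover have "(indicator {0..T} u *\<^sub>R x)\<^sup>2 = indicator {0..T} u * x\<^sup>2" for u x :: real by (simp split: split_indicator)
  ultimately have m: "(\<lambda>p. indicator {0..T} (fst p) * (X (fst p) (snd p))\<^sup>2) \<in> borel_measurable lM" by (simp only:)
  show "integrable lM (\<lambda>p. indicator {0..T} (fst p) * (X (fst p) (snd p))\<^sup>2)"
  proof (rule integrableI_bounded[OF m])
    have "(\<integral>\<^sup>+p. ennreal (norm (indicator {0..T} (fst p) * (X (fst p) (snd p))\<^sup>2)) \<partial>lM)
      = (\<integral>\<^sup>+w. (\<integral>\<^sup>+u. ennreal (norm (indicator {0..T} u * (X u w)\<^sup>2)) \<partial>lborel) \<partial>M)"
      using lp.nn_integral_snd[of "\<lambda>p. ennreal (norm (indicator {0..T} (fst p) * (X (fst p) (snd p))\<^sup>2))"] m by simp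
    also have "\<dots> = (\<integral>\<^sup>+w. (\<integral>\<^sup>+u\<in>{0..T}. ennreal ((norm (X u w))\<^sup>2) \<partial>lborel) \<partial>M)"
      by (intro nn_integral_cong) (simp split: split_indicator)
    also have "\<dots> < \<infinity>" using X by (simp add: H2_process_def)
    finally show "(\<integral>\<^sup>+p. ennreal (norm (indicator {0..T} (fst p) * (X (fst p) (snd p))\<^sup>2)) \<partial>lM) < \<infinity>" .
  qed
qed

text \<open>The supremum over \<open>{0..T}\<close> may be non-measurable. Rational times of the
  open interval give a measurable supremum, and continuity of the path extends the bound to the
  closure.\<close>

lemma S2_process_majorant:
  assumes X: "S2_process M F T X" and T: "0 < T"
  obtains S where "S \<in> borel_measurable M" "integrable M (\<lambda>w. (S w)\<^sup>2)" "AE w in M. \<forall>u\<in>{0..T}. \<bar>X u w\<bar> \<le> S w"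
proof -
  let ?D = "{0<..<T} \<inter> \<rat>"
  define Q where "Q w = (SUP u\<in>?D. ennreal (\<bar>X u w\<bar>\<^sup>2))" for w
  define S where "S w = sqrt (enn2real (Q w))" for w
  have pr: "predictable_process F T X" and cont: "AE w in M. continuous_on {0..T} (\<lambda>t. X t w)"
    and fin: "(\<integral>\<^sup>+w. (SUP t\<in>{0..T}. ennreal (\<bar>X t w\<bar>\<^sup>2)) \<partial>M) < \<infinity>"
    using X by (auto simp: S2_process_def)
  have Xm: "X u \<in> borel_measurable M" if "u \<in> {0..T}" for u by (rule measurable_F_M[OF predictable_section[OF pr that]])
  have Qm: "Q \<in> borel_measurable M"
    unfolding Q_def[abs_def]
  proof (rule borel_measurable_SUP)
    show "countable ?D" using countable_rat by (rule countable_subset[rotated]) auto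
    show "(\<lambda>w. ennreal (\<bar>X u w\<bar>\<^sup>2)) \<in> borel_measurable M" if "u \<in> ?D" for u
      using Xm[of u] that by (intro measurable_compose[OF _ measurable_ennreal]) auto
  qed
  have "(\<integral>\<^sup>+w. Q w \<partial>M) \<le> (\<integral>\<^sup>+w. (SUP t\<in>{0..T}. ennreal (\<bar>X t w\<bar>\<^sup>2)) \<partial>M)"
    unfolding Q_def by (intro nn_integral_mono SUP_subset_mono) auto
  then have Qfin: "(\<integral>\<^sup>+w. Q w \<partial>M) < \<infinity>" using fin by simp
  have QAE: "AE w in M. Q w \<noteq> \<infinity>" by (rule nn_integral_PInf_AE[OF Qm]) (use Qfin in auto)
  have Sm: "S \<in> borel_measurable M" unfolding S_def[abs_def] using Qm by measurable
  have "(\<integral>\<^sup>+w. ennreal ((S w)\<^sup>2) \<partial>M) = (\<integral>\<^sup>+w. Q w \<partial>M)"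
    by (rule nn_integral_cong_AE) (use QAE in \<open>auto elim!: eventually_mono simp: S_def less_top\<close>)
  then have S2: "integrable M (\<lambda>w. (S w)\<^sup>2)" using Qfin Sm by (intro integrableI_bounded) auto
  have cl: "closure ?D = {0..T}"
    using closure_open_Int_superset[of "{0<..<T}" \<rat>] T by (simp add: Rats_closure_real)
  have "AE w in M. \<forall>u\<in>{0..T}. \<bar>X u w\<bar> \<le> S w"
    using cont QAE
  proof (eventually_elim, intro ballI)
    fix w u assume c: "continuous_on {0..T} (\<lambda>t. X t w)" and q: "Q w \<noteq> \<infinity>" and u: "u \<in> {0..T}"
    show "\<bar>X u w\<bar> \<le> S w"
    proof (rule continuous_le_on_closure[of ?D "\<lambda>u. \<bar>X u w\<bar>"])
      show "continuous_on (closure ?D) (\<lambda>u. \<bar>X u w\<bar>)" unfolding cl by (intro continuous_intros c)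
      show "u \<in> closure ?D" unfolding cl by (rule u)
      fix v assume "v \<in> ?D"
      then have "ennreal (\<bar>X v w\<bar>\<^sup>2) \<le> Q w" unfolding Q_def by (rule SUP_upper)
      then have "enn2real (ennreal (\<bar>X v w\<bar>\<^sup>2)) \<le> enn2real (Q w)" using q by (intro enn2real_mono) (auto simp: less_top)
      then have "\<bar>X v w\<bar>\<^sup>2 \<le> enn2real (Q w)" by simp
      then show "\<bar>X v w\<bar> \<le> S w" unfolding S_def by (rule real_le_rsqrt)
    qed
  qed
  then show ?thesis using Sm S2 that by blast
qed

section \<open>A version of Brownian motion with all paths continuous\<close>

text \<open>\<open>B\<close> is continuous only almost surely. This version is continuous on every
  path and for every real time, so that it is a limit of its values at discretised times and jointly
  measurable.\<close>

definition W :: "real \<Rightarrow> 'a \<Rightarrow> real ^ 'd" where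
  "W u w = (if continuous_on {0..} (\<lambda>t. B t w) then B (max 0 u) w else 0)"

lemma W_eq_B: "AE w in M. \<forall>u\<ge>0. W u w = B u w"
  using B_cont by eventually_elim (simp add: W_def max_absorb2)

lemma W_cont: "continuous_on UNIV (\<lambda>u. W u w)"
proof (cases "continuous_on {0..} (\<lambda>t. B t w)")
  case True
  then show ?thesis unfolding W_def by simp (rule continuous_on_compose2[OF True], auto intro!: continuous_intros)
next
  case False
  then show ?thesis by (simp add: W_def)
qed

lemma W_meas: "0 \<le> u \<Longrightarrow> W u \<in> borel_measurable (F u)"
  by (rule measurable_AE_eq_F[OF B_adapted[OF _ order_refl]]) (use W_eq_B in \<open>auto elim!: eventually_mono\<close>)

lemma W_meas_M: "W u \<in> borel_measurable M"
proof -
  have "W u = W (max 0 u)" by (auto simp: W_def fun_eq_iff)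
  then show ?thesis using measurable_F_M[OF W_meas[of "max 0 u"]] by simp
qed

lemma W_joint: "(\<lambda>p. W (fst p) (snd p)) \<in> borel_measurable lM"
proof (rule borel_measurable_LIMSEQ_metric)
  fix n
  have "(\<lambda>p. W (real_of_int i / real (Suc n)) (snd p)) \<in> borel_measurable lM" for i
    by (rule measurable_compose[OF measurable_snd W_meas_M])
  then show "(\<lambda>p. W (real_of_int \<lfloor>real (Suc n) * fst p\<rfloor> / real (Suc n)) (snd p)) \<in> borel_measurable lM"
    by (rule measurable_compose_countable[where g="\<lambda>p. \<lfloor>real (Suc n) * fst p\<rfloor>"]) measurable
next
  fix p :: "real \<times> 'a"
  have "(\<lambda>n. real_of_int \<lfloor>real (Suc n) * fst p\<rfloor> / real (Suc n)) \<longlonglongrightarrow> fst p"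
  proof (rule tendsto_sandwich)
    have "(\<lambda>n. fst p - inverse (real (Suc n))) \<longlonglongrightarrow> fst p - 0"
      by (intro tendsto_diff tendsto_const LIMSEQ_inverse_real_of_nat)
    then show "(\<lambda>n. fst p - inverse (real (Suc n))) \<longlonglongrightarrow> fst p" by simp
    have lo: "fst p - inverse (real (Suc n)) \<le> real_of_int \<lfloor>real (Suc n) * fst p\<rfloor> / real (Suc n)" for n
    proof -
      have "real (Suc n) * fst p - 1 \<le> real_of_int \<lfloor>real (Suc n) * fst p\<rfloor>" by linarith
      then have "(real (Suc n) * fst p - 1) / real (Suc n) \<le> real_of_int \<lfloor>real (Suc n) * fst p\<rfloor> / real (Suc n)"
        by (rule divide_right_mono) simp
      moreover have "(real (Suc n) * fst p - 1) / real (Suc n) = fst p - inverse (real (Suc n))"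
        by (simp only: diff_divide_distrib inverse_eq_divide) simp
      ultimately show ?thesis by (simp only:)
    qed
    have up: "real_of_int \<lfloor>real (Suc n) * fst p\<rfloor> / real (Suc n) \<le> fst p" for n
    proof -
      have "real_of_int \<lfloor>real (Suc n) * fst p\<rfloor> / real (Suc n) \<le> (real (Suc n) * fst p) / real (Suc n)"
        by (rule divide_right_mono) auto
      moreover have "(real (Suc n) * fst p) / real (Suc n) = fst p" by (rule nonzero_mult_div_cancel_left) auto
      ultimately show ?thesis by (simp only:)
    qed
    show "\<forall>\<^sub>F n in sequentially. fst p - inverse (real (Suc n)) \<le> real_of_int \<lfloor>real (Suc n) * fst p\<rfloor> / real (Suc n)"
      using lo by (intro always_eventually allI)
    show "\<forall>\<^sub>F n in sequentially. real_of_int \<lfloor>real (Suc n) * fst p\<rfloor> / real (Suc n) \<le> fst p"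
      using up by (intro always_eventually allI)
  qed (rule tendsto_const)
  then show "(\<lambda>n. W (real_of_int \<lfloor>real (Suc n) * fst p\<rfloor> / real (Suc n)) (snd p)) \<longlonglongrightarrow> W (fst p) (snd p)"
    by (intro continuous_on_tendsto_compose[OF W_cont]) auto
qed

end

section \<open>A solution up to a short stopping time\<close>

text \<open>Interpreted for each of the two generators with the same \<open>t\<close>,
  \<open>b\<close>, \<open>x\<close>, \<open>z\<close>, \<open>\<tau>\<close>, so that all constants
  are shared. The bound 1 in \<open>barrier\<close> controls the reference process
  \<open>x + z \<bullet> (B - B t)\<close> by the data at time \<open>t\<close>.\<close>

locale short_time_solution = brownian_setting M B F
  for M :: "'a measure" and B :: "real \<Rightarrow> 'a \<Rightarrow> real ^ 'd::finite" and F +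
  fixes T t b c :: real and \<gamma> :: "real \<Rightarrow> 'a \<Rightarrow> real" and g :: "real \<Rightarrow> 'a \<Rightarrow> real \<Rightarrow> real ^ 'd \<Rightarrow> real"
    and x :: "'a \<Rightarrow> real" and z :: "real ^ 'd" and \<tau> :: "'a \<Rightarrow> real" and L Y K :: "real \<Rightarrow> 'a \<Rightarrow> real"
    and Z :: "real \<Rightarrow> 'a \<Rightarrow> real ^ 'd"
  assumes tb: "0 < t" "t < b" "b \<le> T" and c_pos: "0 < c"
    and \<gamma>_joint: "joint T \<gamma>" and \<gamma>_nonneg: "\<And>u w. u \<in> {0..T} \<Longrightarrow> w \<in> space M \<Longrightarrow> 0 \<le> \<gamma> u w"
    and \<gamma>_L2: "integrable lM (\<lambda>p. indicator {0..T} (fst p) * (\<gamma> (fst p) (snd p))\<^sup>2)"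
    and growth: "AE w in M. \<forall>u\<in>{0..T}. \<forall>y z. \<bar>g u w y z\<bar> \<le> c * (\<gamma> u w + \<bar>y\<bar> + norm z)"
    and x_meas: "x \<in> borel_measurable (F t)" and x_L2: "integrable M (\<lambda>w. (x w)\<^sup>2)"
    and \<tau>_stop: "stopping_time F \<tau>" and \<tau>_range: "\<And>w. w \<in> space M \<Longrightarrow> t \<le> \<tau> w \<and> \<tau> w \<le> b"
    and L_cont: "AE w in M. continuous_on {0..T} (\<lambda>s. L s w)"
    and barrier: "AE w in M. \<forall>s\<in>{t..\<tau> w}. L s w \<le> x w + z \<bullet> (B s w - B t w) \<and> \<bar>z \<bullet> (B s w - B t w)\<bar> \<le> 1"
    and sol: "rbsde_solution M F B T g \<tau> (\<lambda>w. x w + z \<bullet> (B (\<tau> w) w - B t w)) L Y Z K"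
begin

lemma T_pos: "0 < T" using tb by simp

lemma Y_prog: "progressively_measurable F T (zero_after \<tau> Y)"
  and Z_prog: "progressively_measurable F T (zero_after \<tau> Z)"
  and K_prog: "progressively_measurable F T (zero_after \<tau> K)"
  and Y_cont: "AE w in M. continuous_on {0..\<tau> w} (\<lambda>s. Y s w)"
  and YK_sup: "(\<integral>\<^sup>+w. (SUP s\<in>{0..\<tau> w}. ennreal (\<bar>Y s w\<bar>\<^sup>2 + \<bar>K s w\<bar>\<^sup>2)) \<partial>M) < \<infinity>"
  and g_int: "AE w in M. set_integrable lborel {0..\<tau> w} (\<lambda>r. g r w (Y r w) (Z r w))"
  and skorohod: "AE w in M. (\<forall>s\<in>{0..\<tau> w}. L s w \<le> Y s w) \<and>
        (LINT s:{0..\<tau> w}|interval_measure (\<lambda>u. K (max 0 (min u (\<tau> w))) w). Y s w - L s w) = 0"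
  and K_path: "AE w in M. continuous_on {0..\<tau> w} (\<lambda>s. K s w) \<and> mono_on {0..\<tau> w} (\<lambda>s. K s w) \<and>
        K 0 w = 0 \<and> (\<forall>s\<in>{0..\<tau> w}. 0 \<le> K s w)"
  using sol unfolding rbsde_solution_def by blast+

text \<open>Being an Ito integral is a relation; \<open>SOME\<close> fixes a version for which the
  equation holds.\<close>

definition I :: "real \<Rightarrow> 'a \<Rightarrow> real" where
  "I = (SOME I. ito_integral M F B T (zero_after \<tau> Z) I \<and>
        (AE w in M. \<forall>s\<in>{0..\<tau> w}.
           Y s w = x w + z \<bullet> (B (\<tau> w) w - B t w) + (LINT r:{s..\<tau> w}|lborel. g r w (Y r w) (Z r w))
             + K (\<tau> w) w - K s w - (I (\<tau> w) w - I s w)))"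

lemma I_ito: "ito_integral M F B T (zero_after \<tau> Z) I"
  and I_eq: "AE w in M. \<forall>s\<in>{0..\<tau> w}.
           Y s w = x w + z \<bullet> (B (\<tau> w) w - B t w) + (LINT r:{s..\<tau> w}|lborel. g r w (Y r w) (Z r w))
             + K (\<tau> w) w - K s w - (I (\<tau> w) w - I s w)"
proof -
  have "\<exists>I. ito_integral M F B T (zero_after \<tau> Z) I \<and>
        (AE w in M. \<forall>s\<in>{0..\<tau> w}.
           Y s w = x w + z \<bullet> (B (\<tau> w) w - B t w) + (LINT r:{s..\<tau> w}|lborel. g r w (Y r w) (Z r w))
             + K (\<tau> w) w - K s w - (I (\<tau> w) w - I s w))"
    using sol unfolding rbsde_solution_def by blast
  from someI_ex[OF this, folded I_def]
  show "ito_integral M F B T (zero_after \<tau> Z) I" "AE w in M. \<forall>s\<in>{0..\<tau> w}.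
           Y s w = x w + z \<bullet> (B (\<tau> w) w - B t w) + (LINT r:{s..\<tau> w}|lborel. g r w (Y r w) (Z r w))
             + K (\<tau> w) w - K s w - (I (\<tau> w) w - I s w)" by blast+
qed

section \<open>The martingale part relative to the reference process\<close>

text \<open>Integrand of the martingale part of \<open>Y\<close> minus the reference process. After
  \<open>\<tau>\<close> it equals \<open>- z\<close> because \<open>Z\<close> is extended by 0
  there; later uses stop at \<open>\<tau>\<close>.\<close>

definition H :: "real \<Rightarrow> 'a \<Rightarrow> real ^ 'd" where
  "H u w = zero_after \<tau> Z u w - z"

definition N :: "real \<Rightarrow> 'a \<Rightarrow> real" where
  "N u w = I u w - z \<bullet> B u w"

lemma N_iso: "isometric_martingale T H N"
proof -
  have "joint T (zero_after \<tau> Z)" using prog_joint[OF Z_prog] T_pos by simp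
  then have "(\<lambda>p. indicator {0..T} (fst p) *\<^sub>R zero_after \<tau> Z (fst p) (snd p) - indicator {0..T} (fst p) *\<^sub>R z) \<in> borel_measurable lM"
    unfolding joint_def by (rule borel_measurable_diff) (intro borel_measurable_scaleR indicator_fst_measurable, simp)
  then have "joint T (\<lambda>u w. zero_after \<tau> Z u w - z)" unfolding joint_def scaleR_diff_right .
  from ito_integral_isometric_martingale[OF ito_integral_diff_const[OF I_ito] this] T_pos
  show ?thesis unfolding H_def[abs_def] N_def[abs_def] by simp
qed

text \<open>Clamping \<open>\<tau>\<close> to \<open>{r..s}\<close> makes
  \<open>stopped_isometry\<close> applicable on every cell of a partition; a path stopped before
  \<open>r\<close> contributes a zero increment.\<close>

definition stop_in :: "real \<Rightarrow> real \<Rightarrow> 'a \<Rightarrow> real" where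
  "stop_in r s w = max r (min s (\<tau> w))"

lemma \<tau>_sets: "{w\<in>space M. y < \<tau> w} \<in> sets (F y)"
  using stopping_timeD2[OF \<tau>_stop, of y] by (simp add: pred_def space_F)

lemma \<tau>_meas: "\<tau> \<in> borel_measurable M"
  by (rule measurable_stopping_time[OF \<tau>_stop sets_F_sub]) (simp add: space_F)

definition incr :: "real \<Rightarrow> real \<Rightarrow> 'a \<Rightarrow> real" where
  "incr r s w = N (stop_in r s w) w - N r w"

lemma incr_props:
  assumes "0 \<le> r" "r \<le> s" "s \<le> T"
  shows "incr r s \<in> borel_measurable M" "integrable M (\<lambda>w. (incr r s w)\<^sup>2)"
    "A \<in> sets (F r) \<Longrightarrow> (\<integral>w. indicator A w * incr r s w \<partial>M) = 0"
    "(\<integral>w. (incr r s w)\<^sup>2 \<partial>M) =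
       (\<integral>p. indicator {r<..stop_in r s (snd p)} (fst p) * (norm (H (fst p) (snd p)))\<^sup>2 \<partial>lM)"
proof -
  have st: "{w\<in>space M. y < stop_in r s w} \<in> sets (F y)" if "r \<le> y" "y \<le> s" for y
  proof -
    show ?thesis
    proof (cases "y < s")
      case True
      then have "{w\<in>space M. y < stop_in r s w} = {w\<in>space M. y < \<tau> w}"
        using that by (auto simp: stop_in_def)
      then show ?thesis using \<tau>_sets[of y] by simp
    next
      case False
      then have "{w\<in>space M. y < stop_in r s w} = {}"
        using that by (auto simp: stop_in_def)
      then show ?thesis by (simp only: sets.empty_sets)
    qed
  qed
  have rg: "r \<le> stop_in r s w \<and> stop_in r s w \<le> s" for w using assms by (auto simp: stop_in_def)
  note S = stopped_isometry[OF N_iso assms rg st]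
  show "integrable M (\<lambda>w. (incr r s w)\<^sup>2)"
    "A \<in> sets (F r) \<Longrightarrow> (\<integral>w. indicator A w * incr r s w \<partial>M) = 0"
    "(\<integral>w. (incr r s w)\<^sup>2 \<partial>M) =
       (\<integral>p. indicator {r<..stop_in r s (snd p)} (fst p) * (norm (H (fst p) (snd p)))\<^sup>2 \<partial>lM)"
    unfolding incr_def using S by auto
  show "incr r s \<in> borel_measurable M" unfolding incr_def[abs_def]
    by (rule stopped_meas[OF N_iso assms rg st])
qed

lemma incr_orth:
  assumes "0 \<le> r" "r \<le> s" "s \<le> T" "\<Phi> \<in> borel_measurable (F r)" "integrable M (\<lambda>w. (\<Phi> w)\<^sup>2)"
  shows "integrable M (\<lambda>w. \<Phi> w * incr r s w)" "(\<integral>w. \<Phi> w * incr r s w \<partial>M) = 0"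
proof -
  note P = incr_props[OF assms(1-3)]
  show i: "integrable M (\<lambda>w. \<Phi> w * incr r s w)"
    by (rule integrable_mult_L2[OF measurable_F_M[OF assms(4)] P(1) assms(5) P(2)])
  show "(\<integral>w. \<Phi> w * incr r s w \<partial>M) = 0"
    by (rule orthogonal_of_sets[OF integrable_of_sq[OF P(1,2)] P(3) assms(4) i])
qed

lemma Z_L2: "integrable lM (\<lambda>p. indicator {0..T} (fst p) * (norm (zero_after \<tau> Z (fst p) (snd p)))\<^sup>2)"
  by (rule iso_integrable[OF ito_integral_isometric_martingale[OF I_ito prog_joint[OF Z_prog]]]) (use T_pos in auto)

lemma H_L2: "integrable lM (\<lambda>p. indicator {0..T} (fst p) * (norm (H (fst p) (snd p)))\<^sup>2)"
  by (rule iso_integrable[OF N_iso])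

section \<open>The deviation from the reference process and its moments\<close>

text \<open>\<open>Y\<close> minus the reference process, extended by 0 from \<open>\<tau>\<close>
  on. The two processes agree at \<open>\<tau>\<close> almost surely by the terminal condition, so
  the extension creates no jump there.\<close>

definition V :: "real \<Rightarrow> 'a \<Rightarrow> real" where
  "V u w = (if u < \<tau> w then zero_after \<tau> Y u w - (x w + z \<bullet> (W u w - W t w)) else 0)"

lemma V_meas:
  assumes "t \<le> u" "u \<le> T"
  shows "V u \<in> borel_measurable (F u)"
  unfolding V_def[abs_def]
proof (rule measurable_If)
  have u: "0 \<le> u" using assms tb by simp
  show "(\<lambda>w. zero_after \<tau> Y u w - (x w + z \<bullet> (W u w - W t w))) \<in> borel_measurable (F u)"
    using prog_section[OF Y_prog, of u] assms u tb measurable_F_mono[OF x_meas assms(1)]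
      measurable_F_mono[OF W_meas[of t] assms(1)] W_meas[OF u]
    by (intro borel_measurable_diff borel_measurable_add borel_measurable_inner) auto
qed (use \<tau>_sets in \<open>auto simp: space_F\<close>)

lemma V_joint: "(\<lambda>p. indicator {t..b} (fst p) * V (fst p) (snd p)) \<in> borel_measurable lM"
proof -
  have jy: "(\<lambda>p. indicator {0..T} (fst p) *\<^sub>R zero_after \<tau> Y (fst p) (snd p)) \<in> borel_measurable lM"
    using prog_joint[OF Y_prog] T_pos by (simp add: joint_def)
  note [measurable] = jy W_joint \<tau>_meas measurable_F_M[OF x_meas] W_meas_M
  have "(\<lambda>p. indicator {t..b} (fst p) * (if fst p < \<tau> (snd p) then indicator {0..T} (fst p) *\<^sub>R zero_after \<tau> Y (fst p) (snd p)
     - (x (snd p) + z \<bullet> (W (fst p) (snd p) - W t (snd p))) else 0)) \<in> borel_measurable lM"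
    by measurable
  moreover have "indicator {t..b} u * (if u < \<tau> w then indicator {0..T} u *\<^sub>R zero_after \<tau> Y u w
     - (x w + z \<bullet> (W u w - W t w)) else 0) = indicator {t..b} u * V u w" for u w
    using tb by (auto simp: V_def split: split_indicator)
  ultimately show ?thesis by simp
qed

text \<open>The assumed moment concerns a supremum over an interval, possibly non-measurable. Over
  countably many times the supremum of \<open>V\<close> is measurable and
  \<open>nn_integral_finite_of_majorant\<close> applies.\<close>

lemma countable_sup_bound:
  fixes times :: "nat \<Rightarrow> real"
  assumes times: "\<And>k. t \<le> times k \<and> times k \<le> b"
  shows "\<exists>m. m \<in> borel_measurable M \<and> integrable M (\<lambda>w. (m w)\<^sup>2) \<and> (AE w in M. \<forall>k. \<bar>V (times k) w\<bar> \<le> m w)"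
proof -
  define S where "S w = (SUP k. ennreal ((V (times k) w)\<^sup>2))" for w
  have Vm: "V (times k) \<in> borel_measurable M" for k
    using measurable_F_M[OF V_meas[of "times k"]] times[of k] tb by auto
  have Sm: "S \<in> borel_measurable M" unfolding S_def[abs_def] using Vm by measurable
  \<comment> \<open>From \<open>V\<^sup>2 \<le> 2 * Y\<^sup>2 + 2 * X\<^sup>2\<close> with
    \<open>X\<close> the reference process, and \<open>X\<^sup>2 \<le> 2 * x\<^sup>2 + 2\<close> by
    the bound 1 on its displacement.\<close>
  define q where "q w = 4 * (x w)\<^sup>2 + 4" for w
  have qi: "integrable M q" unfolding q_def using x_L2 by simp
  let ?Sup = "\<lambda>w. SUP s\<in>{0..\<tau> w}. ennreal (\<bar>Y s w\<bar>\<^sup>2 + \<bar>K s w\<bar>\<^sup>2)"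
  have le: "AE w in M. S w \<le> 2 * ?Sup w + ennreal (q w)"
    using barrier W_eq_B AE_space
  proof eventually_elim
    case (elim w)
    show ?case unfolding S_def
    proof (rule SUP_least)
      fix k
      show "ennreal ((V (times k) w)\<^sup>2) \<le> 2 * ?Sup w + ennreal (q w)"
      proof (cases "times k < \<tau> w")
        case False
        then show ?thesis by (simp add: V_def)
      next
        case True
        let ?u = "times k" let ?X = "x w + z \<bullet> (B ?u w - B t w)"
        have u: "?u \<in> {t..\<tau> w}" "?u \<in> {0..\<tau> w}" using True times[of k] tb by auto
        have V: "V ?u w = Y ?u w + - ?X" using True u elim(2) tb by (simp add: V_def zero_after_def)
        have f1: "(V ?u w)\<^sup>2 \<le> 2 * \<bar>Y ?u w\<bar>\<^sup>2 + 2 * ?X\<^sup>2"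
          unfolding V using sq_norm_add_le[of "Y ?u w" "- ?X"] by (simp only: real_norm_def power2_abs power2_minus)
        have "(z \<bullet> (B ?u w - B t w))\<^sup>2 \<le> 1\<^sup>2"
          using elim(1) u(1) by (intro power2_le_iff_abs_le[THEN iffD2]) auto
        then have f2: "?X\<^sup>2 \<le> 2 * (x w)\<^sup>2 + 2"
          using sq_norm_add_le[of "x w" "z \<bullet> (B ?u w - B t w)"] by simp
        have arith: "0 \<le> k \<Longrightarrow> v \<le> 2 * y + 2 * X \<Longrightarrow> X \<le> 2 * q + 2 \<Longrightarrow> v \<le> 2 * (y + k) + (4 * q + 4)"
          for k v y X q :: real by argo
        have "0 \<le> \<bar>K ?u w\<bar>\<^sup>2" by simp
        then have "(V ?u w)\<^sup>2 \<le> 2 * (\<bar>Y ?u w\<bar>\<^sup>2 + \<bar>K ?u w\<bar>\<^sup>2) + q w"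
          unfolding q_def using f1 f2 by (rule arith)
        then have "ennreal ((V ?u w)\<^sup>2) \<le> ennreal (2 * (\<bar>Y ?u w\<bar>\<^sup>2 + \<bar>K ?u w\<bar>\<^sup>2) + q w)" by (rule ennreal_leI)
        also have "\<dots> = 2 * ennreal (\<bar>Y ?u w\<bar>\<^sup>2 + \<bar>K ?u w\<bar>\<^sup>2) + ennreal (q w)"
          by (subst ennreal_plus) (auto simp: q_def ennreal_mult)
        also have "\<dots> \<le> 2 * ?Sup w + ennreal (q w)"
          by (intro add_right_mono mult_left_mono SUP_upper u) auto
        finally show ?thesis .
      qed
    qed
  qed
  have fin: "(\<integral>\<^sup>+w. S w \<partial>M) < \<infinity>"
    by (rule nn_integral_finite_of_majorant[OF Sm qi _ _ _ YK_sup, of 2])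
      (use le in \<open>auto simp: q_def\<close>)
  define m where "m w = sqrt (enn2real (S w))" for w
  have mm: "m \<in> borel_measurable M" unfolding m_def[abs_def] using Sm by measurable
  have Sfin: "AE w in M. S w \<noteq> \<infinity>" by (rule nn_integral_PInf_AE[OF Sm]) (use fin in auto)
  have "(\<integral>\<^sup>+w. ennreal ((m w)\<^sup>2) \<partial>M) = (\<integral>\<^sup>+w. S w \<partial>M)"
    by (rule nn_integral_cong_AE) (use Sfin in \<open>auto elim!: eventually_mono simp: m_def less_top\<close>)
  then have "integrable M (\<lambda>w. (m w)\<^sup>2)" using fin mm by (intro integrableI_bounded) auto
  moreover have "AE w in M. \<forall>k. \<bar>V (times k) w\<bar> \<le> m w"
    using Sfin
  proof eventually_elim
    case (elim w)
    show ?case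
    proof
      fix k
      have "ennreal ((V (times k) w)\<^sup>2) \<le> S w" unfolding S_def by (rule SUP_upper) auto
      then have "enn2real (ennreal ((V (times k) w)\<^sup>2)) \<le> enn2real (S w)"
        using elim by (intro enn2real_mono) (auto simp: less_top)
      then have "(V (times k) w)\<^sup>2 \<le> enn2real (S w)" by simp
      then show "\<bar>V (times k) w\<bar> \<le> m w" unfolding m_def using real_le_rsqrt[of "\<bar>V (times k) w\<bar>"] by simp
    qed
  qed
  ultimately show ?thesis using mm by blast
qed

text \<open>The growth bound along the solution, a jointly measurable majorant that stands for the
  drift in all integrals over the product.\<close>

definition lam :: "real \<times> 'a \<Rightarrow> real" where
  "lam p = (if t \<le> fst p \<and> fst p \<le> \<tau> (snd p)
     then c * (\<gamma> (fst p) (snd p) + \<bar>Y (fst p) (snd p)\<bar> + norm (Z (fst p) (snd p))) else 0)"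

lemma joint_on_stop:
  assumes "joint T X"
  shows "(\<lambda>p. if t \<le> fst p \<and> fst p \<le> \<tau> (snd p) then X (fst p) (snd p) else 0) \<in> borel_measurable lM"
proof -
  note [measurable] = assms[unfolded joint_def] \<tau>_meas
  have "(\<lambda>p. if t \<le> fst p \<and> fst p \<le> \<tau> (snd p) then indicator {0..T} (fst p) *\<^sub>R X (fst p) (snd p) else 0) \<in> borel_measurable lM"
    by measurable
  then show ?thesis
  proof (rule measurable_cong[THEN iffD1, rotated])
    fix p :: "real \<times> 'a" assume "p \<in> space lM"
    then have "snd p \<in> space M" by (auto simp: space_pair_measure)
    then show "(if t \<le> fst p \<and> fst p \<le> \<tau> (snd p) then indicator {0..T} (fst p) *\<^sub>R X (fst p) (snd p) else 0)
      = (if t \<le> fst p \<and> fst p \<le> \<tau> (snd p) then X (fst p) (snd p) else 0)"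
      using \<tau>_range[of "snd p"] tb by (auto split: split_indicator)
  qed
qed

lemma lam_meas: "lam \<in> borel_measurable lM"
proof -
  have "lam = (\<lambda>p. c * ((if t \<le> fst p \<and> fst p \<le> \<tau> (snd p) then \<gamma> (fst p) (snd p) else 0)
    + \<bar>if t \<le> fst p \<and> fst p \<le> \<tau> (snd p) then zero_after \<tau> Y (fst p) (snd p) else 0\<bar>
    + norm (if t \<le> fst p \<and> fst p \<le> \<tau> (snd p) then zero_after \<tau> Z (fst p) (snd p) else 0)))"
    by (auto simp: lam_def zero_after_def fun_eq_iff)
  then show ?thesis
    using joint_on_stop[OF \<gamma>_joint] joint_on_stop[OF prog_joint[OF Y_prog]] joint_on_stop[OF prog_joint[OF Z_prog]] T_pos
    by (simp only:) (intro borel_measurable_times borel_measurable_add borel_measurable_abs borel_measurable_norm borel_measurable_const, auto)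
qed

lemma lam_nonneg: "snd p \<in> space M \<Longrightarrow> 0 \<le> lam p"
  using \<gamma>_nonneg[of "fst p" "snd p"] \<tau>_range[of "snd p"] tb c_pos by (auto simp: lam_def)

lemma Y_L2: "integrable lM (\<lambda>p. (if t \<le> fst p \<and> fst p \<le> \<tau> (snd p) then Y (fst p) (snd p) else 0)\<^sup>2)"
proof -
  let ?y = "\<lambda>p. if t \<le> fst p \<and> fst p \<le> \<tau> (snd p) then Y (fst p) (snd p) else 0"
  have "(\<lambda>p. if t \<le> fst p \<and> fst p \<le> \<tau> (snd p) then zero_after \<tau> Y (fst p) (snd p) else 0) \<in> borel_measurable lM"
    using joint_on_stop[OF prog_joint[OF Y_prog]] T_pos by simp
  moreover have "(\<lambda>p. if t \<le> fst p \<and> fst p \<le> \<tau> (snd p) then zero_after \<tau> Y (fst p) (snd p) else 0) = ?y"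
    by (auto simp: zero_after_def fun_eq_iff)
  ultimately have ym: "?y \<in> borel_measurable lM" by simp
  let ?Sup = "\<lambda>w. SUP s\<in>{0..\<tau> w}. ennreal (\<bar>Y s w\<bar>\<^sup>2 + \<bar>K s w\<bar>\<^sup>2)"
  have m: "(\<lambda>p. ennreal ((?y p)\<^sup>2)) \<in> borel_measurable lM" using ym by measurable
  have "(\<integral>\<^sup>+w. (\<integral>\<^sup>+u. ennreal ((?y (u, w))\<^sup>2) \<partial>lborel) \<partial>M) < \<infinity>"
  proof (rule nn_integral_finite_of_majorant[OF _ _ _ _ _ YK_sup, where q="\<lambda>_. 0" and a=T])
    show "(\<lambda>w. \<integral>\<^sup>+u. ennreal ((?y (u, w))\<^sup>2) \<partial>lborel) \<in> borel_measurable M"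
    proof (rule lborel.borel_measurable_nn_integral)
      have "(\<lambda>q. ennreal ((?y (snd q, fst q))\<^sup>2)) \<in> borel_measurable (M \<Otimes>\<^sub>M lborel)"
        by (rule measurable_compose[OF _ m, of "\<lambda>q. (snd q, fst q)"]) measurable
      then show "(\<lambda>(w, u). ennreal ((?y (u, w))\<^sup>2)) \<in> borel_measurable (M \<Otimes>\<^sub>M lborel)"
        by (simp add: case_prod_beta')
    qed
    show "AE w in M. (\<integral>\<^sup>+u. ennreal ((?y (u, w))\<^sup>2) \<partial>lborel) \<le> ennreal T * ?Sup w + ennreal 0"
    proof (rule AE_I2)
      fix w assume w: "w \<in> space M"
      have "(\<integral>\<^sup>+u. ennreal ((?y (u, w))\<^sup>2) \<partial>lborel) \<le> (\<integral>\<^sup>+u. ?Sup w * indicator {0..T} u \<partial>lborel)"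
      proof (rule nn_integral_mono)
        fix u :: real
        show "ennreal ((?y (u, w))\<^sup>2) \<le> ?Sup w * indicator {0..T} u"
        proof (cases "t \<le> u \<and> u \<le> \<tau> w")
          case True
          then have u: "u \<in> {0..\<tau> w}" "u \<in> {0..T}" using \<tau>_range[OF w] tb by auto
          have "ennreal ((Y u w)\<^sup>2) \<le> ennreal (\<bar>Y u w\<bar>\<^sup>2 + \<bar>K u w\<bar>\<^sup>2)" by (intro ennreal_leI) simp
          also have "\<dots> \<le> ?Sup w" by (rule SUP_upper[OF u(1)])
          finally show ?thesis using True u by simp
        next
          case False
          then have "?y (u, w) = 0" by auto
          then show ?thesis by simp
        qed
      qed
      also have "\<dots> = ennreal T * ?Sup w"
        using T_pos by (subst nn_integral_cmult_indicator) (auto simp: mult.commute)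
      finally show "(\<integral>\<^sup>+u. ennreal ((?y (u, w))\<^sup>2) \<partial>lborel) \<le> ennreal T * ?Sup w + ennreal 0" by simp
    qed
  qed (use T_pos in auto)
  moreover have "(\<integral>\<^sup>+w. (\<integral>\<^sup>+u. ennreal ((?y (u, w))\<^sup>2) \<partial>lborel) \<partial>M) = (\<integral>\<^sup>+p. ennreal ((?y p)\<^sup>2) \<partial>lM)"
    by (rule lp.nn_integral_snd) (rule m)
  ultimately show ?thesis using ym by (intro integrableI_bounded) auto
qed

lemma sq_sum3: "(u + v + w)\<^sup>2 \<le> 3 * (u\<^sup>2 + v\<^sup>2 + w\<^sup>2)" for u v w :: real
proof -
  have "0 \<le> (u - v)\<^sup>2 + (v - w)\<^sup>2 + (u - w)\<^sup>2" by simp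
  then show ?thesis by (simp add: power2_eq_square algebra_simps)
qed

lemma lam_L2: "integrable lM (\<lambda>p. (lam p)\<^sup>2)"
proof (rule Bochner_Integration.integrable_bound)
  show "integrable lM (\<lambda>p. c\<^sup>2 * (3 * (indicator {0..T} (fst p) * (\<gamma> (fst p) (snd p))\<^sup>2
     + (if t \<le> fst p \<and> fst p \<le> \<tau> (snd p) then Y (fst p) (snd p) else 0)\<^sup>2
     + indicator {0..T} (fst p) * (norm (zero_after \<tau> Z (fst p) (snd p)))\<^sup>2)))"
    by (intro integrable_mult_right Bochner_Integration.integrable_add \<gamma>_L2 Y_L2 Z_L2)
  show "AE p in lM. norm ((lam p)\<^sup>2) \<le> norm (c\<^sup>2 * (3 * (indicator {0..T} (fst p) * (\<gamma> (fst p) (snd p))\<^sup>2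
     + (if t \<le> fst p \<and> fst p \<le> \<tau> (snd p) then Y (fst p) (snd p) else 0)\<^sup>2
     + indicator {0..T} (fst p) * (norm (zero_after \<tau> Z (fst p) (snd p)))\<^sup>2)))"
  proof (rule AE_I2)
    fix p :: "real \<times> 'a" assume "p \<in> space lM"
    then have p: "snd p \<in> space M" by (auto simp: space_pair_measure)
    show "norm ((lam p)\<^sup>2) \<le> norm (c\<^sup>2 * (3 * (indicator {0..T} (fst p) * (\<gamma> (fst p) (snd p))\<^sup>2
     + (if t \<le> fst p \<and> fst p \<le> \<tau> (snd p) then Y (fst p) (snd p) else 0)\<^sup>2
     + indicator {0..T} (fst p) * (norm (zero_after \<tau> Z (fst p) (snd p)))\<^sup>2)))"
    proof (cases "t \<le> fst p \<and> fst p \<le> \<tau> (snd p)")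
      case True
      then have u: "fst p \<in> {0..T}" using \<tau>_range[OF p] tb by auto
      have "(\<gamma> (fst p) (snd p) + \<bar>Y (fst p) (snd p)\<bar> + norm (Z (fst p) (snd p)))\<^sup>2
         \<le> 3 * ((\<gamma> (fst p) (snd p))\<^sup>2 + \<bar>Y (fst p) (snd p)\<bar>\<^sup>2 + (norm (Z (fst p) (snd p)))\<^sup>2)" by (rule sq_sum3)
      then have "(lam p)\<^sup>2 \<le> c\<^sup>2 * (3 * ((\<gamma> (fst p) (snd p))\<^sup>2 + (Y (fst p) (snd p))\<^sup>2 + (norm (Z (fst p) (snd p)))\<^sup>2))"
        using True by (simp add: lam_def power_mult_distrib mult_left_mono)
      then show ?thesis using True u by (simp add: zero_after_def)
    next
      case False
      then have "lam p = 0" by (auto simp: lam_def)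
      then show ?thesis by simp
    qed
  qed
qed (use lam_meas in measurable)

definition Vt :: "real \<times> 'a \<Rightarrow> real" where
  "Vt p = indicator {t..b} (fst p) * V (fst p) (snd p)"

lemma Vt_meas: "Vt \<in> borel_measurable lM"
  using V_joint by (simp add: Vt_def[abs_def])

lemma V_sq_le:
  assumes "\<forall>s\<in>{t..\<tau> w}. L s w \<le> x w + z \<bullet> (B s w - B t w) \<and> \<bar>z \<bullet> (B s w - B t w)\<bar> \<le> 1"
    and "\<forall>u\<ge>0. W u w = B u w" "t \<le> u"
  shows "(V u w)\<^sup>2 \<le> 2 * (if t \<le> u \<and> u \<le> \<tau> w then Y u w else 0)\<^sup>2 + (4 * (x w)\<^sup>2 + 4)"
proof (cases "u < \<tau> w")
  case True
  let ?X = "x w + z \<bullet> (B u w - B t w)"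
  have V: "V u w = Y u w + - ?X" using True assms(2,3) tb by (simp add: V_def zero_after_def)
  have f1: "(V u w)\<^sup>2 \<le> 2 * \<bar>Y u w\<bar>\<^sup>2 + 2 * ?X\<^sup>2"
    unfolding V using sq_norm_add_le[of "Y u w" "- ?X"] by (simp only: real_norm_def power2_abs power2_minus)
  have "(z \<bullet> (B u w - B t w))\<^sup>2 \<le> 1\<^sup>2"
    using assms(1,3) True by (intro power2_le_iff_abs_le[THEN iffD2]) auto
  then have f2: "?X\<^sup>2 \<le> 2 * (x w)\<^sup>2 + 2"
    using sq_norm_add_le[of "x w" "z \<bullet> (B u w - B t w)"] by simp
  have arith: "v \<le> 2 * y + 2 * X \<Longrightarrow> X \<le> 2 * q + 2 \<Longrightarrow> v \<le> 2 * y + (4 * q + 4)"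
    for v y X q :: real by argo
  from arith[OF f1 f2] show ?thesis using True assms(3) by simp
qed (simp add: V_def)

lemma integrable_tb: "integrable lborel (indicator {t..b} :: real \<Rightarrow> real)"
  by (rule integrable_real_indicator) (use tb in auto)

lemma Vt_L2: "integrable lM (\<lambda>p. (Vt p)\<^sup>2)"
proof (rule Bochner_Integration.integrable_bound)
  have "integrable M (\<lambda>w. 4 * (x w)\<^sup>2 + 4)" using x_L2 by simp
  then have 2: "integrable lM (\<lambda>p. indicator {t..b} (fst p) * (4 * (x (snd p))\<^sup>2 + 4))"
    by (intro integrable_tensor lborel.sigma_finite_measure_axioms sigma_finite_measure_axioms integrable_tb)
  show "integrable lM (\<lambda>p. 2 * (if t \<le> fst p \<and> fst p \<le> \<tau> (snd p) then Y (fst p) (snd p) else 0)\<^sup>2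
     + indicator {t..b} (fst p) * (4 * (x (snd p))\<^sup>2 + 4))"
    by (intro Bochner_Integration.integrable_add integrable_mult_right Y_L2 2)
  show "AE p in lM. norm ((Vt p)\<^sup>2) \<le> norm (2 * (if t \<le> fst p \<and> fst p \<le> \<tau> (snd p) then Y (fst p) (snd p) else 0)\<^sup>2
     + indicator {t..b} (fst p) * (4 * (x (snd p))\<^sup>2 + 4))"
    using AE_snd_lift[OF barrier] AE_snd_lift[OF W_eq_B]
  proof eventually_elim
    case (elim p)
    show ?case
    proof (cases "fst p \<in> {t..b}")
      case True
      then show ?thesis using V_sq_le[OF elim, of "fst p"] by (simp add: Vt_def)
    qed (simp add: Vt_def)
  qed
qed (use Vt_meas in measurable)

lemma lam_integrable: "integrable lM lam"
proof (rule Bochner_Integration.integrable_bound)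
  have "integrable lM (\<lambda>p. indicator {t..b} (fst p) * (\<lambda>_. 1::real) (snd p))"
    by (rule integrable_tensor[OF lborel.sigma_finite_measure_axioms sigma_finite_measure_axioms integrable_tb]) auto
  then show "integrable lM (\<lambda>p. indicator {t..b} (fst p) + (lam p)\<^sup>2)"
    by (intro Bochner_Integration.integrable_add lam_L2) simp
  show "AE p in lM. norm (lam p) \<le> norm (indicator {t..b} (fst p) + (lam p)\<^sup>2)"
  proof (rule AE_I2)
    fix p :: "real \<times> 'a" assume "p \<in> space lM"
    then have p: "snd p \<in> space M" by (auto simp: space_pair_measure)
    have "\<bar>v\<bar> \<le> 1 + v\<^sup>2" for v :: real
      using abs_mult_le_sq[of v 1] by simp
    then show "norm (lam p) \<le> norm (indicator {t..b} (fst p) + (lam p)\<^sup>2)"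
      using \<tau>_range[OF p] by (cases "fst p \<in> {t..b}") (auto simp: lam_def)
  qed
qed (rule lam_meas)

lemma Vlam_integrable: "integrable lM (\<lambda>p. \<bar>Vt p\<bar> * lam p)"
  by (rule integrable_mult_L2) (use Vt_meas lam_meas Vt_L2 lam_L2 in auto)

text \<open>Bounds the variation of the drift on a path; together with \<open>K\<tau>\<close> it
  dominates the partition sums of the energy inequality.\<close>

definition P :: "'a \<Rightarrow> real" where
  "P w = (\<integral>u. lam (u, w) \<partial>lborel)"

lemma P_L2: "P \<in> borel_measurable M" "integrable M (\<lambda>w. (P w)\<^sup>2)"
proof -
  show m: "P \<in> borel_measurable M" unfolding P_def[abs_def]
    by (rule lborel.borel_measurable_lebesgue_integral)
      (use measurable_compose[OF measurable_pair_swap' lam_meas] in \<open>simp add: split_beta\<close>)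
  have lam: "integrable lM (\<lambda>(u, w). lam (u, w))" "integrable lM (\<lambda>(u, w). (lam (u, w))\<^sup>2)"
    using lam_integrable lam_L2 by (simp_all add: case_prod_beta')
  have i: "integrable M (\<lambda>w. (b - t) * (\<integral>u. (lam (u, w))\<^sup>2 \<partial>lborel))"
    by (intro integrable_mult_right lp.integrable_snd[OF lam(2)])
  show "integrable M (\<lambda>w. (P w)\<^sup>2)"
  proof (rule Bochner_Integration.integrable_bound[OF i])
    show "AE w in M. norm ((P w)\<^sup>2) \<le> norm ((b - t) * (\<integral>u. (lam (u, w))\<^sup>2 \<partial>lborel))"
      using lp.AE_integrable_snd[OF lam(1)] lp.AE_integrable_snd[OF lam(2)] AE_space
    proof eventually_elim
      case (elim w)
      have "(P w)\<^sup>2 \<le> measure lborel {t..b} * (\<integral>u. (lam (u, w))\<^sup>2 \<partial>lborel)"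
        unfolding P_def by (rule integral_sq_le) (use elim \<tau>_range[OF elim(3)] in \<open>auto simp: lam_def\<close>)
      then show ?case using tb by simp
    qed
  qed (use m in measurable)
qed

definition K\<tau> :: "'a \<Rightarrow> real" where
  "K\<tau> w = K (\<tau> w) w"

lemma K\<tau>_L2: "K\<tau> \<in> borel_measurable M" "integrable M (\<lambda>w. (K\<tau> w)\<^sup>2)"
proof -
  have "(\<lambda>w. zero_after \<tau> K (\<tau> w) w) \<in> borel_measurable M"
    by (rule prog_clip[OF K_prog]) (use \<tau>_meas \<tau>_range tb in \<open>auto intro: order_trans\<close>, (meson less_eq_real_def order_trans)+)
  then show m: "K\<tau> \<in> borel_measurable M" by (simp add: K\<tau>_def[abs_def] zero_after_def)
  have "(\<integral>\<^sup>+w. ennreal ((K\<tau> w)\<^sup>2) \<partial>M) \<le> (\<integral>\<^sup>+w. (SUP s\<in>{0..\<tau> w}. ennreal (\<bar>Y s w\<bar>\<^sup>2 + \<bar>K s w\<bar>\<^sup>2)) \<partial>M)"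
  proof (rule nn_integral_mono)
    fix w assume w: "w \<in> space M"
    have "ennreal ((K\<tau> w)\<^sup>2) \<le> ennreal (\<bar>Y (\<tau> w) w\<bar>\<^sup>2 + \<bar>K (\<tau> w) w\<bar>\<^sup>2)"
      unfolding K\<tau>_def by (intro ennreal_leI) simp
    also have "\<dots> \<le> (SUP s\<in>{0..\<tau> w}. ennreal (\<bar>Y s w\<bar>\<^sup>2 + \<bar>K s w\<bar>\<^sup>2))"
      using \<tau>_range[OF w] tb by (intro SUP_upper) auto
    finally show "ennreal ((K\<tau> w)\<^sup>2) \<le> (SUP s\<in>{0..\<tau> w}. ennreal (\<bar>Y s w\<bar>\<^sup>2 + \<bar>K s w\<bar>\<^sup>2))" .
  qed
  also note YK_sup
  finally show "integrable M (\<lambda>w. (K\<tau> w)\<^sup>2)" using m by (intro integrableI_bounded) auto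
qed

section \<open>Analysis along a fixed path\<close>

text \<open>Collects the almost sure properties in one predicate, so that the path arguments run in
  a context with a fixed path instead of under almost-everywhere quantifiers.\<close>

definition regular_path :: "'a \<Rightarrow> bool" where
  "regular_path w \<longleftrightarrow> w \<in> space M \<and>
    continuous_on {0..\<tau> w} (\<lambda>s. Y s w) \<and> continuous_on {0..\<tau> w} (\<lambda>s. K s w) \<and> mono_on {0..\<tau> w} (\<lambda>s. K s w) \<and>
    (\<forall>s\<in>{0..\<tau> w}. 0 \<le> K s w) \<and>
    continuous_on {0..} (\<lambda>s. B s w) \<and> (\<forall>u\<ge>0. W u w = B u w) \<and> continuous_on {0..T} (\<lambda>s. L s w) \<and>
    (\<forall>s\<in>{t..\<tau> w}. L s w \<le> x w + z \<bullet> (B s w - B t w) \<and> \<bar>z \<bullet> (B s w - B t w)\<bar> \<le> 1) \<and>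
    (\<forall>u\<in>{0..T}. \<forall>y z. \<bar>g u w y z\<bar> \<le> c * (\<gamma> u w + \<bar>y\<bar> + norm z)) \<and>
    set_integrable lborel {0..\<tau> w} (\<lambda>r. g r w (Y r w) (Z r w)) \<and>
    (\<forall>s\<in>{0..\<tau> w}. Y s w = x w + z \<bullet> (B (\<tau> w) w - B t w) + (LINT r:{s..\<tau> w}|lborel. g r w (Y r w) (Z r w))
             + K (\<tau> w) w - K s w - (I (\<tau> w) w - I s w)) \<and>
    (\<forall>s\<in>{0..\<tau> w}. L s w \<le> Y s w) \<and>
    (LINT s:{0..\<tau> w}|interval_measure (\<lambda>u. K (max 0 (min u (\<tau> w))) w). Y s w - L s w) = 0 \<and>
    integrable lborel (\<lambda>u. lam (u, w)) \<and> integrable lborel (\<lambda>u. \<bar>Vt (u, w)\<bar> * lam (u, w))"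

lemma AE_regular_path: "AE w in M. regular_path w"
proof -
  have "integrable lM (\<lambda>(u, w). lam (u, w))" "integrable lM (\<lambda>(u, w). \<bar>Vt (u, w)\<bar> * lam (u, w))"
    using lam_integrable Vlam_integrable by (simp_all add: case_prod_beta')
  from this[THEN lp.AE_integrable_snd]
  show ?thesis
    unfolding regular_path_def
    using Y_cont K_path B_cont W_eq_B L_cont barrier growth g_int I_eq skorohod AE_space
    by eventually_elim blast
qed

text \<open>A gauge integral, additive over adjacent intervals; on a regular path it equals the
  Lebesgue integral of the equation. It runs backwards from \<open>\<tau>\<close>, so its forward
  increments carry a minus sign below.\<close>

definition drift :: "real \<Rightarrow> 'a \<Rightarrow> real" where
  "drift s w = integral {s..\<tau> w} (\<lambda>r. g r w (Y r w) (Z r w))"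

context
  fixes w assumes reg: "regular_path w"
begin

lemma w_space: "w \<in> space M" and rY: "continuous_on {0..\<tau> w} (\<lambda>s. Y s w)"
  and rK: "continuous_on {0..\<tau> w} (\<lambda>s. K s w)" "mono_on {0..\<tau> w} (\<lambda>s. K s w)" "\<forall>s\<in>{0..\<tau> w}. 0 \<le> K s w"
  and rB: "continuous_on {0..} (\<lambda>s. B s w)" and rW: "\<forall>u\<ge>0. W u w = B u w" and rL: "continuous_on {0..T} (\<lambda>s. L s w)"
  and rbar: "\<forall>s\<in>{t..\<tau> w}. L s w \<le> x w + z \<bullet> (B s w - B t w) \<and> \<bar>z \<bullet> (B s w - B t w)\<bar> \<le> 1"
  and rgrowth: "\<forall>u\<in>{0..T}. \<forall>y z. \<bar>g u w y z\<bar> \<le> c * (\<gamma> u w + \<bar>y\<bar> + norm z)"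
  and rg: "set_integrable lborel {0..\<tau> w} (\<lambda>r. g r w (Y r w) (Z r w))"
  and req: "\<forall>s\<in>{0..\<tau> w}. Y s w = x w + z \<bullet> (B (\<tau> w) w - B t w) + (LINT r:{s..\<tau> w}|lborel. g r w (Y r w) (Z r w))
             + K (\<tau> w) w - K s w - (I (\<tau> w) w - I s w)"
  and rLY: "\<forall>s\<in>{0..\<tau> w}. L s w \<le> Y s w"
  and rsk: "(LINT s:{0..\<tau> w}|interval_measure (\<lambda>u. K (max 0 (min u (\<tau> w))) w). Y s w - L s w) = 0"
  and rlam: "integrable lborel (\<lambda>u. lam (u, w))" and rVlam: "integrable lborel (\<lambda>u. \<bar>Vt (u, w)\<bar> * lam (u, w))"
  using reg unfolding regular_path_def by blast+

lemma \<tau>w: "t \<le> \<tau> w" "\<tau> w \<le> b" "0 \<le> \<tau> w" "\<tau> w \<le> T"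
  using \<tau>_range[OF w_space] tb by auto

lemma drift_LINT: "0 \<le> s \<Longrightarrow> (LINT r:{s..\<tau> w}|lborel. g r w (Y r w) (Z r w)) = drift s w"
  unfolding drift_def by (intro set_borel_integral_eq_integral set_integrable_subset[OF rg]) auto

lemma drift_int: "0 \<le> s \<Longrightarrow> s' \<le> \<tau> w \<Longrightarrow> (\<lambda>r. g r w (Y r w) (Z r w)) integrable_on {s..s'}"
  by (intro set_borel_integral_eq_integral set_integrable_subset[OF rg]) auto

lemma drift_diff:
  assumes "0 \<le> s" "s \<le> s'" "s' \<le> \<tau> w"
  shows "drift s w - drift s' w = integral {s..s'} (\<lambda>r. g r w (Y r w) (Z r w))"
  using Henstock_Kurzweil_Integration.integral_combine[OF assms(2,3) drift_int[OF assms(1) order_refl]]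
  unfolding drift_def by simp

definition U :: "real \<Rightarrow> real" where
  "U s = Y s w - (x w + z \<bullet> (B s w - B t w))"

lemma U_eq:
  assumes "s \<in> {0..\<tau> w}"
  shows "U s = drift s w + (K (\<tau> w) w - K s w) - (N (\<tau> w) w - N s w)"
proof -
  have "Y s w = x w + z \<bullet> (B (\<tau> w) w - B t w) + drift s w + K (\<tau> w) w - K s w - (I (\<tau> w) w - I s w)"
    using req assms drift_LINT[of s] by auto
  then show ?thesis unfolding U_def N_def by (simp add: inner_diff_right)
qed

lemma U_end: "U (\<tau> w) = 0"
  using U_eq[of "\<tau> w"] \<tau>w by (simp add: drift_def)

lemma V_U: "t \<le> u \<Longrightarrow> u \<le> \<tau> w \<Longrightarrow> V u w = U u"
  using U_end rW tb by (cases "u = \<tau> w") (auto simp: V_def U_def zero_after_def)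

lemma V_min: "t \<le> u \<Longrightarrow> V u w = U (min u (\<tau> w))"
  using V_U[of u] U_end by (cases "u \<le> \<tau> w") (auto simp: V_def min_def)

lemma U_cont: "continuous_on {t..\<tau> w} U"
proof -
  have "continuous_on {t..\<tau> w} (\<lambda>s. Y s w)" "continuous_on {t..\<tau> w} (\<lambda>s. B s w)"
    using tb by (auto intro: continuous_on_subset[OF rY] continuous_on_subset[OF rB])
  then show ?thesis unfolding U_def[abs_def] by (intro continuous_intros)
qed

text \<open>Where \<open>U\<close> is positive, \<open>Y\<close> exceeds the reference process and
  hence the obstacle, and the Skorokhod condition forbids growth of \<open>K\<close>.\<close>

lemma K_flat:
  assumes "t \<le> s" "s \<le> s'" "s' \<le> \<tau> w" "K s w < K s' w"
  shows "\<exists>r\<in>{s..s'}. U r \<le> 0"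
proof (rule ccontr)
  assume *: "\<not> (\<exists>r\<in>{s..s'}. U r \<le> 0)"
  have "K s' w \<le> K s w"
  proof (rule stieltjes_flat[OF \<tau>w(3) rY _ rK(1,2) _ rsk])
    show "continuous_on {0..\<tau> w} (\<lambda>s. L s w)" by (rule continuous_on_subset[OF rL]) (use \<tau>w in auto)
    fix r assume r: "r \<in> {s..s'}"
    then have "0 < U r" using * by force
    moreover have "r \<in> {t..\<tau> w}" using r assms by auto
    ultimately show "L r w < Y r w" using rbar unfolding U_def by fastforce
  qed (use rLY assms tb in auto)
  then show False using assms by simp
qed

lemma lam_bound:
  assumes "t \<le> u" "u \<le> \<tau> w"
  shows "\<bar>g u w (Y u w) (Z u w)\<bar> \<le> lam (u, w)"
  using rgrowth assms tb \<tau>w by (simp add: lam_def)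

lemma lam_HK: "(\<lambda>u. lam (u, w)) integrable_on {s..s'}" "(\<lambda>u. \<bar>Vt (u, w)\<bar> * lam (u, w)) integrable_on {s..s'}"
  and lam_LINT: "integral {s..s'} (\<lambda>u. lam (u, w)) = (\<integral>u. indicator {s..s'} u * lam (u, w) \<partial>lborel)"
  and Vlam_LINT: "integral {s..s'} (\<lambda>u. \<bar>Vt (u, w)\<bar> * lam (u, w)) = (\<integral>u. indicator {s..s'} u * (\<bar>Vt (u, w)\<bar> * lam (u, w)) \<partial>lborel)"
proof -
  have 1: "set_integrable lborel {s..s'} (\<lambda>u. lam (u, w))" "set_integrable lborel {s..s'} (\<lambda>u. \<bar>Vt (u, w)\<bar> * lam (u, w))"
    using integrable_window[OF rlam] integrable_window[OF rVlam] by (simp_all add: set_integrable_def)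
  show "(\<lambda>u. lam (u, w)) integrable_on {s..s'}" "(\<lambda>u. \<bar>Vt (u, w)\<bar> * lam (u, w)) integrable_on {s..s'}"
    using 1[THEN set_borel_integral_eq_integral(1)] by auto
  show "integral {s..s'} (\<lambda>u. lam (u, w)) = (\<integral>u. indicator {s..s'} u * lam (u, w) \<partial>lborel)"
    "integral {s..s'} (\<lambda>u. \<bar>Vt (u, w)\<bar> * lam (u, w)) = (\<integral>u. indicator {s..s'} u * (\<bar>Vt (u, w)\<bar> * lam (u, w)) \<partial>lborel)"
    using 1[THEN set_borel_integral_eq_integral(2)] by (simp_all add: set_lebesgue_integral_def)
qed

lemma incr_path:
  assumes "t \<le> r" "r \<le> s"
  shows "incr r s w = N (min s (\<tau> w)) w - N (min r (\<tau> w)) w"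
  using assms by (cases "r \<le> \<tau> w") (auto simp: incr_def stop_in_def max_def min_def)

lemma step_eq:
  assumes "t \<le> r" "r \<le> s"
  shows "V r w - V s w + incr r s w =
    (- drift (min s (\<tau> w)) w - - drift (min r (\<tau> w)) w) + (K (min s (\<tau> w)) w - K (min r (\<tau> w)) w)"
  using V_min[of r] V_min[of s] U_eq[of "min r (\<tau> w)"] U_eq[of "min s (\<tau> w)"] incr_path[OF assms] assms tb \<tau>w
  by simp

text \<open>\<open>JV\<close> and \<open>JR\<close> play the parts of \<open>V\<close> and
  \<open>R\<close> in \<open>discrete_energy_bound\<close>.\<close>

definition JV :: "real \<Rightarrow> real" where "JV s = integral {t..s} (\<lambda>u. lam (u, w))"
definition JR :: "real \<Rightarrow> real" where "JR s = integral {t..s} (\<lambda>u. \<bar>Vt (u, w)\<bar> * lam (u, w))"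

lemma JV_diff: "t \<le> s \<Longrightarrow> s \<le> s' \<Longrightarrow> JV s' - JV s = integral {s..s'} (\<lambda>u. lam (u, w))"
  using Henstock_Kurzweil_Integration.integral_combine[of t s s' "\<lambda>u. lam (u, w)"] lam_HK(1) unfolding JV_def by force

lemma JR_diff: "t \<le> s \<Longrightarrow> s \<le> s' \<Longrightarrow> JR s' - JR s = integral {s..s'} (\<lambda>u. \<bar>Vt (u, w)\<bar> * lam (u, w))"
  using Henstock_Kurzweil_Integration.integral_combine[of t s s' "\<lambda>u. \<bar>Vt (u, w)\<bar> * lam (u, w)"] lam_HK(2) unfolding JR_def by force

lemma drift_JV:
  assumes "t \<le> s" "s \<le> s'" "s' \<le> \<tau> w"
  shows "\<bar>- drift s' w - - drift s w\<bar> \<le> JV s' - JV s"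
proof -
  have "- drift s' w - - drift s w = integral {s..s'} (\<lambda>r. g r w (Y r w) (Z r w))"
    using drift_diff[of s s'] assms tb by simp
  then show ?thesis unfolding JV_diff[OF assms(1,2)]
    using integral_norm_bound_integral[OF drift_int[of s s'] lam_HK(1)[of s s']] lam_bound assms tb by auto
qed

lemma energy_path:
  assumes r: "t \<le> r" "r < b" and "e > 0"
  shows "\<exists>d>0. \<forall>n p. p 0 = min r (\<tau> w) \<and> p n = \<tau> w \<and> (\<forall>i<n. p i \<le> p (Suc i) \<and> p (Suc i) - p i < d) \<longrightarrow>
    (\<Sum>i<n. 2 * U (p i) * (- drift (p (Suc i)) w - - drift (p i) w + (K (p (Suc i)) w - K (p i) w))
        + (- drift (p (Suc i)) w - - drift (p i) w + (K (p (Suc i)) w - K (p i) w))\<^sup>2) \<le> 2 * (JR (\<tau> w) - JR (min r (\<tau> w))) + e"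
proof (rule discrete_energy_bound)
  let ?a = "min r (\<tau> w)"
  have a: "t \<le> ?a" "?a \<le> \<tau> w" using r \<tau>w by auto
  show "?a \<le> \<tau> w" by simp
  show "continuous_on {?a..\<tau> w} U" by (rule continuous_on_subset[OF U_cont]) (use a in auto)
  show "continuous_on {?a..\<tau> w} (\<lambda>s. K s w)" by (rule continuous_on_subset[OF rK(1)]) (use a tb in auto)
  have "continuous_on {t..\<tau> w} JV" unfolding JV_def[abs_def] by (rule indefinite_integral_continuous_1[OF lam_HK(1)])
  then show "continuous_on {?a..\<tau> w} JV" by (rule continuous_on_subset) (use a in auto)
  fix s s' assume s: "?a \<le> s" "s \<le> s'" "s' \<le> \<tau> w"
  then have ts: "t \<le> s" using order_trans[OF a(1) s(1)] by simp
  show "K s w \<le> K s' w" by (rule mono_onD[OF rK(2)]) (use s ts tb in auto)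
  show "\<bar>- drift s' w - - drift s w\<bar> \<le> JV s' - JV s" by (rule drift_JV) (use s ts in auto)
  show "\<exists>r\<in>{s..s'}. U r \<le> 0" if "K s w < K s' w" by (rule K_flat) (use s ts that in auto)
  fix k assume k: "\<And>r. r \<in> {s..s'} \<Longrightarrow> k \<le> \<bar>U r\<bar>"
  have "k * (JV s' - JV s) = integral {s..s'} (\<lambda>u. k * lam (u, w))"
    unfolding JV_diff[OF ts s(2)] by simp
  also have "\<dots> \<le> integral {s..s'} (\<lambda>u. \<bar>Vt (u, w)\<bar> * lam (u, w))"
  proof (rule integral_le)
    show "(\<lambda>u. k * lam (u, w)) integrable_on {s..s'}" using lam_HK(1) by (rule integrable_on_mult_right)
    fix u assume u: "u \<in> {s..s'}"
    then have "Vt (u, w) = U u" using V_U[of u] ts s \<tau>w by (simp add: Vt_def)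
    then show "k * lam (u, w) \<le> \<bar>Vt (u, w)\<bar> * lam (u, w)"
      using k[OF u] lam_nonneg[of "(u, w)"] w_space by (auto intro: mult_right_mono)
  qed (rule lam_HK)
  also have "\<dots> = JR s' - JR s" by (rule JR_diff[OF ts s(2), symmetric])
  finally show "k * (JV s' - JV s) \<le> JR s' - JR s" .
qed (rule \<open>e > 0\<close>)

lemma JR_total:
  assumes "t \<le> r"
  shows "JR (\<tau> w) - JR (min r (\<tau> w)) = (\<integral>u. indicator {r<..} u * (\<bar>Vt (u, w)\<bar> * lam (u, w)) \<partial>lborel)"
proof -
  have "JR (\<tau> w) - JR (min r (\<tau> w)) = (\<integral>u. indicator {min r (\<tau> w)..\<tau> w} u * (\<bar>Vt (u, w)\<bar> * lam (u, w)) \<partial>lborel)"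
    using JR_diff[of "min r (\<tau> w)" "\<tau> w"] assms \<tau>w unfolding Vlam_LINT by simp
  also have "\<dots> = (\<integral>u. indicator {r<..} u * (\<bar>Vt (u, w)\<bar> * lam (u, w)) \<partial>lborel)"
  proof (rule integral_cong_AE)
    show "AE u in lborel. indicator {min r (\<tau> w)..\<tau> w} u * (\<bar>Vt (u, w)\<bar> * lam (u, w)) = indicator {r<..} u * (\<bar>Vt (u, w)\<bar> * lam (u, w))"
      using AE_lborel_singleton[of "min r (\<tau> w)"]
      by eventually_elim (auto simp: lam_def min_def split: split_indicator if_splits)
  qed (use borel_measurable_integrable[OF rVlam] in \<open>simp_all\<close>)
  finally show ?thesis .
qed

lemma var_total: "JV (\<tau> w) - JV t = P w"
proof -
  have "JV (\<tau> w) - JV t = (\<integral>u. indicator {t..\<tau> w} u * lam (u, w) \<partial>lborel)"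
    using JV_diff[of t "\<tau> w"] \<tau>w unfolding lam_LINT by simp
  also have "\<dots> = P w" unfolding P_def
    by (intro Bochner_Integration.integral_cong) (auto simp: lam_def split: split_indicator)
  finally show ?thesis .
qed

end

section \<open>The energy inequality\<close>

definition RR :: "real \<Rightarrow> 'a \<Rightarrow> real" where
  "RR r w = (\<integral>u. indicator {r<..} u * (\<bar>Vt (u, w)\<bar> * lam (u, w)) \<partial>lborel)"

lemma RRp_integrable: "integrable lM (\<lambda>p. indicator {r<..} (fst p) * (\<bar>Vt p\<bar> * lam p))"
proof (rule Bochner_Integration.integrable_bound[OF Vlam_integrable])
  have [measurable]: "(\<lambda>p. \<bar>Vt p\<bar> * lam p) \<in> borel_measurable lM"
    using borel_measurable_integrable[OF Vlam_integrable] .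
  show "(\<lambda>p. indicator {r<..} (fst p) * (\<bar>Vt p\<bar> * lam p)) \<in> borel_measurable lM" by measurable
qed (auto split: split_indicator)

lemma RR_props: "integrable M (RR r)"
  "(\<integral>w. RR r w \<partial>M) = (\<integral>p. indicator {r<..} (fst p) * (\<bar>Vt p\<bar> * lam p) \<partial>lM)"
  "w \<in> space M \<Longrightarrow> 0 \<le> RR r w"
proof -
  have i: "integrable lM (\<lambda>(u, w). indicator {r<..} u * (\<bar>Vt (u, w)\<bar> * lam (u, w)))"
    using RRp_integrable[of r] by (simp add: case_prod_beta')
  show "integrable M (RR r)" unfolding RR_def[abs_def] using lp.integrable_snd[OF i] by simp
  show "(\<integral>w. RR r w \<partial>M) = (\<integral>p. indicator {r<..} (fst p) * (\<bar>Vt p\<bar> * lam p) \<partial>lM)"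
    using lp.integral_snd[OF i] unfolding RR_def by (simp add: case_prod_beta')
  show "0 \<le> RR r w" if "w \<in> space M" unfolding RR_def using lam_nonneg[of "(_, w)"] that
    by (intro Bochner_Integration.integral_nonneg) auto
qed

text \<open>A discrete substitute for the expansion of the square of \<open>V\<close>. An increment
  of \<open>V\<close> over a cell splits into drift and reflection \<open>aa\<close> and a
  martingale part \<open>bb\<close>. The products of \<open>V\<close> with \<open>bb\<close> have
  mean zero, the squares of \<open>bb\<close> add up to the energy of \<open>H\<close>, and the
  terms with \<open>aa\<close> are bounded on each path by
  \<open>discrete_energy_bound\<close>.\<close>

lemma energy_inequality:
  assumes r: "t \<le> r" "r < b"
  shows "(\<integral>w. (V r w)\<^sup>2 \<partial>M)
     + (\<integral>p. (if r < fst p \<and> fst p \<le> \<tau> (snd p) then (norm (H (fst p) (snd p)))\<^sup>2 else 0) \<partial>lM) / 2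
    \<le> 2 * (\<integral>p. indicator {r<..} (fst p) * (\<bar>Vt p\<bar> * lam p) \<partial>lM)" (is "?u + ?w / 2 \<le> 2 * ?R")
proof -
  define gr where "gr n i = grid r b (Suc n) i" for n i
  have gr_bounds: "t \<le> gr n i \<and> gr n i \<le> b" "r \<le> gr n i" if "i \<le> Suc n" for n i
    using grid_bounds[of r b "Suc n" i] r that by (auto simp: gr_def)
  have gr_mono: "gr n i \<le> gr n (Suc i)" for n i unfolding gr_def using r by (intro grid_mono) auto
  have gr_0: "gr n 0 = r" and gr_n: "gr n (Suc n) = b" for n by (auto simp: gr_def)
  have gr_Suc: "gr n (Suc i) = gr n i + (b - r) / real (Suc n)" for n i by (simp only: gr_def grid_Suc)
  \<comment> \<open>Enumerates the points of all grids, so that one square integrable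
    \<open>m\<close> bounds \<open>V\<close> at each of them; \<open>min\<close> keeps the index
    inside its grid.\<close>
  define times where "times k = gr (fst (prod_decode k)) (min (snd (prod_decode k)) (Suc (fst (prod_decode k))))" for k
  have "t \<le> times k \<and> times k \<le> b" for k unfolding times_def by (rule gr_bounds(1)) simp
  from countable_sup_bound[of times, OF this] obtain m where m: "m \<in> borel_measurable M" "integrable M (\<lambda>w. (m w)\<^sup>2)"
    and mV: "AE w in M. \<forall>k. \<bar>V (times k) w\<bar> \<le> m w" by auto
  have mg: "AE w in M. \<forall>n. \<forall>i\<le>Suc n. \<bar>V (gr n i) w\<bar> \<le> m w"
    using mV
  proof eventually_elim
    case (elim w)
    show ?case
    proof (intro allI impI)
      fix n i assume "i \<le> Suc n"
      then have "times (prod_encode (n, i)) = gr n i" by (simp add: times_def)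
      then show "\<bar>V (gr n i) w\<bar> \<le> m w" using elim[rule_format, of "prod_encode (n, i)"] by simp
    qed
  qed
  define bb where "bb n i = incr (gr n i) (gr n (Suc i))" for n i
  define aa where "aa n i w = V (gr n i) w - V (gr n (Suc i)) w + bb n i w" for n i w
  have VF: "V (gr n i) \<in> borel_measurable (F (gr n i))" if "i \<le> Suc n" for n i
    using gr_bounds[OF that] tb by (intro V_meas) auto
  have VM: "V (gr n i) \<in> borel_measurable M" if "i \<le> Suc n" for n i by (rule measurable_F_M[OF VF[OF that]])
  have V2: "integrable M (\<lambda>w. (V (gr n i) w)\<^sup>2)" if i: "i \<le> Suc n" for n i
  proof (rule Bochner_Integration.integrable_bound[OF m(2)])
    show "AE w in M. norm ((V (gr n i) w)\<^sup>2) \<le> norm ((m w)\<^sup>2)"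
      using mg
    proof eventually_elim
      case (elim w)
      then have "\<bar>V (gr n i) w\<bar> \<le> m w" using i by auto
      then show ?case using power_mono[of "\<bar>V (gr n i) w\<bar>" "m w" 2] by simp
    qed
  qed (use VM[OF i] in measurable)
  have gi: "0 \<le> gr n i" "gr n (Suc i) \<le> T" if "i < Suc n" for n i
    using gr_bounds[of i n] gr_bounds[of "Suc i" n] that tb by auto
  note bp = incr_props[OF gi(1) gr_mono gi(2), folded bb_def]
  have bM: "bb n i \<in> borel_measurable M" "integrable M (\<lambda>w. (bb n i w)\<^sup>2)" if "i < Suc n" for n i
    using bp(1,2)[OF that that] by auto
  have Vb: "integrable M (\<lambda>w. V (gr n i) w * bb n i w)" "(\<integral>w. V (gr n i) w * bb n i w \<partial>M) = 0" if i: "i < Suc n" for n i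
  proof -
    have i': "i \<le> Suc n" using i by simp
    show "integrable M (\<lambda>w. V (gr n i) w * bb n i w)" "(\<integral>w. V (gr n i) w * bb n i w \<partial>M) = 0"
      using incr_orth[OF gi(1)[OF i] gr_mono gi(2)[OF i] VF[OF i'] V2[OF i']] by (auto simp: bb_def)
  qed
  have aM: "aa n i \<in> borel_measurable M" "integrable M (\<lambda>w. (aa n i w)\<^sup>2)" if i: "i < Suc n" for n i
  proof -
    have i': "i \<le> Suc n" "Suc i \<le> Suc n" using i by auto
    note [measurable] = VM[OF i'(1)] VM[OF i'(2)] bM(1)[OF i]
    show "aa n i \<in> borel_measurable M" unfolding aa_def[abs_def] by measurable
    have "integrable M (\<lambda>w. (V (gr n i) w - V (gr n (Suc i)) w)\<^sup>2)"
      using integrable_sq_diff[OF VM[OF i'(1)] VM[OF i'(2)]] V2[OF i'(1)] V2[OF i'(2)] by simp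
    then have "integrable M (\<lambda>w. (norm ((V (gr n i) w - V (gr n (Suc i)) w) + bb n i w))\<^sup>2)"
      using bM[OF i] by (intro integrable_sq_add) auto
    then show "integrable M (\<lambda>w. (aa n i w)\<^sup>2)" by (simp add: aa_def)
  qed
  define Q where "Q n w = (\<Sum>i<Suc n. 2 * (V (gr n i) w * aa n i w) + (aa n i w)\<^sup>2)" for n w
  have Va: "integrable M (\<lambda>w. 2 * (V (gr n i) w * aa n i w) + (aa n i w)\<^sup>2)" if i: "i < Suc n" for n i
  proof -
    have i': "i \<le> Suc n" using i by simp
    show ?thesis
      by (intro Bochner_Integration.integrable_add integrable_mult_right integrable_mult_L2 VM aM V2 i i')
  qed
  have IQ: "integrable M (Q n)" for n
    unfolding Q_def[abs_def] by (rule Bochner_Integration.integrable_sum) (use Va in auto)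
  have w_sum: "(\<Sum>i<Suc n. \<integral>w. (bb n i w)\<^sup>2 \<partial>M) = ?w" for n
  proof -
    let ?f = "\<lambda>i p. indicator {gr n i<..stop_in (gr n i) (gr n (Suc i)) (snd p)} (fst p) * (norm (H (fst p) (snd p)))\<^sup>2"
    have eq: "?f i p = (if gr n i < fst p \<and> fst p \<le> gr n (Suc i) \<and> fst p \<le> \<tau> (snd p) then (norm (H (fst p) (snd p)))\<^sup>2 else 0)" for i p
      by (auto simp: stop_in_def split: split_indicator)
    have int: "integrable lM (?f i)" if i: "i < Suc n" for i
    proof (rule Bochner_Integration.integrable_bound[OF H_L2])
      have b: "t \<le> gr n i" using gr_bounds[of i n] i by simp
      have "joint T H" by (rule iso_joint[OF N_iso])
      from joint_on_stop[OF this] have [measurable]: "(\<lambda>p. if t \<le> fst p \<and> fst p \<le> \<tau> (snd p) then H (fst p) (snd p) else 0) \<in> borel_measurable lM" .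
      have "(\<lambda>p. indicator {gr n i<..gr n (Suc i)} (fst p) * (norm (if t \<le> fst p \<and> fst p \<le> \<tau> (snd p) then H (fst p) (snd p) else 0))\<^sup>2) \<in> borel_measurable lM"
        by measurable
      moreover have "indicator {gr n i<..gr n (Suc i)} (fst p) * (norm (if t \<le> fst p \<and> fst p \<le> \<tau> (snd p) then H (fst p) (snd p) else 0))\<^sup>2 = ?f i p" for p
        unfolding eq using b by (auto split: split_indicator)
      ultimately show "?f i \<in> borel_measurable lM" by simp
      have "norm (?f i p) \<le> norm (indicator {0..T} (fst p) * (norm (H (fst p) (snd p)))\<^sup>2)" for p
        unfolding eq using gi[OF i] by (auto split: split_indicator)
      then show "AE p in lM. norm (?f i p) \<le> norm (indicator {0..T} (fst p) * (norm (H (fst p) (snd p)))\<^sup>2)" by simp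
    qed
    have "(\<Sum>i<Suc n. \<integral>w. (bb n i w)\<^sup>2 \<partial>M) = (\<Sum>i<Suc n. \<integral>p. ?f i p \<partial>lM)"
      using bp(4) by (intro sum.cong) auto
    also have "\<dots> = (\<integral>p. (\<Sum>i<Suc n. ?f i p) \<partial>lM)"
      by (rule Bochner_Integration.integral_sum[symmetric]) (use int in auto)
    also have "\<dots> = ?w"
    proof (rule Bochner_Integration.integral_cong[OF refl])
      fix p :: "real \<times> 'a" assume "p \<in> space lM"
      then have p: "snd p \<in> space M" by (auto simp: space_pair_measure)
      let ?h = "if fst p \<le> \<tau> (snd p) then (norm (H (fst p) (snd p)))\<^sup>2 else 0"
      have "(\<Sum>i<Suc n. ?f i p) = (\<Sum>i<Suc n. indicator {gr n i<..gr n (Suc i)} (fst p) *\<^sub>R ?h)"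
        unfolding eq by (intro sum.cong) (auto split: split_indicator)
      also have "\<dots> = (if r < fst p \<and> fst p \<le> \<tau> (snd p) then (norm (H (fst p) (snd p)))\<^sup>2 else 0)"
      proof (cases "r < fst p \<and> fst p \<le> b")
        case True
        then obtain j where j: "j < Suc n" "fst p \<in> {gr n j<..gr n (Suc j)}"
          using step_exists[of "gr n" "fst p" "Suc n"] by (auto simp: gr_0 gr_n)
        have "(\<Sum>i<Suc n. indicator {gr n i<..gr n (Suc i)} (fst p) *\<^sub>R ?h) = ?h"
          by (rule step_sum_eq[OF _ j]) (rule gr_mono)
        then show ?thesis using True by simp
      next
        case False
        then have "fst p \<notin> {gr n j<..gr n (Suc j)}" if "j < Suc n" for j
          using gr_bounds[of j n] gr_bounds[of "Suc j" n] that by auto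
        then have "(\<Sum>i<Suc n. indicator {gr n i<..gr n (Suc i)} (fst p) *\<^sub>R ?h) = 0" by (rule step_sum_zero)
        then show ?thesis using False \<tau>_range[OF p] by auto
      qed
      finally show "(\<Sum>i<Suc n. ?f i p) = (if r < fst p \<and> fst p \<le> \<tau> (snd p) then (norm (H (fst p) (snd p)))\<^sup>2 else 0)" .
    qed
    finally show ?thesis .
  qed
  have le_Q: "?u + ?w / 2 \<le> (\<integral>w. Q n w \<partial>M)" for n
  proof -
    have pt: "(V r w)\<^sup>2 + (\<Sum>i<Suc n. (bb n i w)\<^sup>2) / 2 \<le> Q n w - 2 * (\<Sum>i<Suc n. V (gr n i) w * bb n i w)" if w: "w \<in> space M" for w
    proof -
      \<comment> \<open>With \<open>a = v - v' + q\<close> the two sides differ by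
        \<open>(2 * a - q)\<^sup>2 / 2\<close>. Absorbing the cross term of \<open>a\<close> and
        \<open>q\<close> costs half of \<open>q\<^sup>2\<close>, which is the factor 1/2 in the
        statement.\<close>
      have elem: "v\<^sup>2 - v'\<^sup>2 + q\<^sup>2 / 2 \<le> (2 * (v * (v - v' + q)) + (v - v' + q)\<^sup>2) - 2 * (v * q)" for v v' q :: real
      proof -
        have "0 \<le> (2 * (v - v' + q) - q)\<^sup>2" by simp
        then show ?thesis by (simp add: power2_eq_square algebra_simps)
      qed
      have "V b w = 0" using \<tau>_range[OF w] by (simp add: V_def)
      then have "(V r w)\<^sup>2 = (\<Sum>i<Suc n. (V (gr n i) w)\<^sup>2 - (V (gr n (Suc i)) w)\<^sup>2)"
        using sum_lessThan_telescope'[of "\<lambda>i. (V (gr n i) w)\<^sup>2" "Suc n"] by (simp only: gr_0 gr_n zero_power2 diff_zero)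
      then have "(V r w)\<^sup>2 + (\<Sum>i<Suc n. (bb n i w)\<^sup>2) / 2
         = (\<Sum>i<Suc n. (V (gr n i) w)\<^sup>2 - (V (gr n (Suc i)) w)\<^sup>2 + (bb n i w)\<^sup>2 / 2)"
        by (simp only: sum.distrib sum_divide_distrib)
      also have "\<dots> \<le> (\<Sum>i<Suc n. (2 * (V (gr n i) w * aa n i w) + (aa n i w)\<^sup>2) - 2 * (V (gr n i) w * bb n i w))"
        unfolding aa_def by (intro sum_mono elem)
      also have "\<dots> = Q n w - 2 * (\<Sum>i<Suc n. V (gr n i) w * bb n i w)"
        by (simp only: Q_def sum_subtractf sum_distrib_left)
      finally show ?thesis .
    qed
    have Vr: "integrable M (\<lambda>w. (V r w)\<^sup>2)" using V2[of 0 n] by (simp add: gr_0)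
    have Ib: "integrable M (\<lambda>w. \<Sum>i<Suc n. (bb n i w)\<^sup>2)" by (rule Bochner_Integration.integrable_sum) (use bM in auto)
    have IVb: "integrable M (\<lambda>w. \<Sum>i<Suc n. V (gr n i) w * bb n i w)" by (rule Bochner_Integration.integrable_sum) (use Vb in auto)
    have "?u + ?w / 2 = ?u + (\<integral>w. (\<Sum>i<Suc n. (bb n i w)\<^sup>2) \<partial>M) / 2"
      unfolding w_sum[of n, symmetric] by (subst Bochner_Integration.integral_sum) (use bM in auto)
    also have "\<dots> = (\<integral>w. (V r w)\<^sup>2 + (\<Sum>i<Suc n. (bb n i w)\<^sup>2) / 2 \<partial>M)"
      using Vr Ib by simp
    also have "\<dots> \<le> (\<integral>w. Q n w - 2 * (\<Sum>i<Suc n. V (gr n i) w * bb n i w) \<partial>M)"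
      using Vr Ib IQ[of n] IVb pt
      by (intro integral_mono Bochner_Integration.integrable_add Bochner_Integration.integrable_diff integrable_divide_zero integrable_mult_right) auto
    also have "\<dots> = (\<integral>w. Q n w \<partial>M) - 2 * (\<integral>w. (\<Sum>i<Suc n. V (gr n i) w * bb n i w) \<partial>M)"
      using IQ[of n] IVb by (simp del: sum.lessThan_Suc)
    also have "(\<integral>w. (\<Sum>i<Suc n. V (gr n i) w * bb n i w) \<partial>M) = 0"
      by (subst Bochner_Integration.integral_sum) (use Vb in auto)
    finally show ?thesis by simp
  qed
  define VV where "VV w = K\<tau> w + P w" for w
  \<comment> \<open>Dominates every \<open>Q n\<close>: a cell contributes at most
    \<open>2 * m + VV\<close> times its share of the variation, and the shares sum to at most
    \<open>VV\<close>.\<close>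
  define D where "D w = 2 * (m w * VV w) + (VV w)\<^sup>2" for w
  have VVm: "VV \<in> borel_measurable M" unfolding VV_def[abs_def] using K\<tau>_L2(1) P_L2(1) by measurable
  have VV2: "integrable M (\<lambda>w. (VV w)\<^sup>2)"
    using integrable_sq_add[OF K\<tau>_L2(1) P_L2(1)] K\<tau>_L2(2) P_L2(2) by (simp add: VV_def)
  have ID: "integrable M D" unfolding D_def[abs_def]
    by (intro Bochner_Integration.integrable_add integrable_mult_right integrable_mult_L2 m VVm VV2)
  \<comment> \<open>The pathwise bound is from above, so the positive part of the excess over
    \<open>2 * RR\<close> is what tends to 0.\<close>
  have path: "AE w in M. (\<lambda>n. max (Q n w - 2 * RR r w) 0) \<longlonglongrightarrow> 0 \<and> (\<forall>n. \<bar>Q n w\<bar> \<le> D w)"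
    using AE_regular_path mg
  proof eventually_elim
    case (elim w)
    note reg = elim(1)
    note \<tau>b = \<tau>w[OF reg]
    define pp where "pp n i = min (gr n i) (\<tau> w)" for n i
    define \<alpha> where "\<alpha> n i = (- drift (pp n (Suc i)) w - - drift (pp n i) w) + (K (pp n (Suc i)) w - K (pp n i) w)" for n i
    have aa_eq: "aa n i w = \<alpha> n i" if "i < Suc n" for n i
      using step_eq[OF reg, of "gr n i" "gr n (Suc i)"] gr_bounds[of i n] gr_mono that
      by (simp add: aa_def \<alpha>_def bb_def pp_def)
    have V_eq: "V (gr n i) w = U w (pp n i)" if "i < Suc n" for n i
      using V_min[OF reg, of "gr n i"] gr_bounds[of i n] that by (simp add: pp_def)
    have Q_eq: "Q n w = (\<Sum>i<Suc n. 2 * U w (pp n i) * \<alpha> n i + (\<alpha> n i)\<^sup>2)" for n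
      unfolding Q_def using aa_eq V_eq by (intro sum.cong) auto
    have pp0: "pp n 0 = min r (\<tau> w)" and ppn: "pp n (Suc n) = \<tau> w" for n
      using \<tau>b by (auto simp: pp_def gr_0 gr_n)
    have pp_mono: "pp n i \<le> pp n (Suc i)" for n i unfolding pp_def using gr_mono[of n i] by auto
    have pp_step: "pp n (Suc i) - pp n i \<le> (b - r) / real (Suc n)" for n i
    proof -
      have "0 \<le> (b - r) / real (Suc n)" using r by (intro divide_nonneg_nonneg) auto
      then show ?thesis unfolding pp_def gr_Suc min_def by auto
    qed
    have pp_t: "t \<le> pp n i" "pp n i \<le> \<tau> w" if "i \<le> Suc n" for n i
      using gr_bounds[OF that] \<tau>b by (auto simp: pp_def)
    have R_eq: "RR r w = JR w (\<tau> w) - JR w (min r (\<tau> w))"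
      unfolding RR_def by (rule JR_total[OF reg r(1), symmetric])
    have small: "\<exists>n0. \<forall>n\<ge>n0. Q n w \<le> 2 * RR r w + e" if "e > 0" for e
    proof -
      from energy_path[OF reg r that] obtain d where d: "d > 0" and
        E: "\<And>n p. p 0 = min r (\<tau> w) \<Longrightarrow> p n = \<tau> w \<Longrightarrow> (\<And>i. i < n \<Longrightarrow> p i \<le> p (Suc i) \<and> p (Suc i) - p i < d) \<Longrightarrow>
        (\<Sum>i<n. 2 * U w (p i) * (- drift (p (Suc i)) w - - drift (p i) w + (K (p (Suc i)) w - K (p i) w))
        + (- drift (p (Suc i)) w - - drift (p i) w + (K (p (Suc i)) w - K (p i) w))\<^sup>2) \<le> 2 * (JR w (\<tau> w) - JR w (min r (\<tau> w))) + e"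
        by blast
      obtain n0 :: nat where n0: "(b - r) / d < real n0" using reals_Archimedean2 by blast
      have "Q n w \<le> 2 * RR r w + e" if n: "n \<ge> n0" for n
      proof -
        have "(b - r) / d < real (Suc n)" using n0 n by linarith
        then have "(b - r) / real (Suc n) < d" using d by (simp add: field_simps)
        then have "pp n (Suc i) - pp n i < d" for i using pp_step[of n i] by linarith
        from E[of "pp n" "Suc n", OF pp0 ppn] this pp_mono show ?thesis
          unfolding Q_eq R_eq \<alpha>_def by blast
      qed
      then show ?thesis by blast
    qed
    have lim: "(\<lambda>n. max (Q n w - 2 * RR r w) 0) \<longlonglongrightarrow> 0"
    proof (rule LIMSEQ_I)
      fix e :: real assume "e > 0"
      then obtain n0 where "\<forall>n\<ge>n0. Q n w \<le> 2 * RR r w + e / 2" using small[of "e / 2"] by auto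
      then have "\<forall>n\<ge>n0. norm (max (Q n w - 2 * RR r w) 0 - 0) < e" using \<open>e > 0\<close> by (auto simp: max_def)
      then show "\<exists>n0. \<forall>n\<ge>n0. norm (max (Q n w - 2 * RR r w) 0 - 0) < e" by blast
    qed
    have "\<bar>Q n w\<bar> \<le> D w" for n
    proof -
      define \<beta> where "\<beta> i = (JV w (pp n (Suc i)) - JV w (pp n i)) + (K (pp n (Suc i)) w - K (pp n i) w)" for i
      have \<alpha>\<beta>: "\<bar>\<alpha> n i\<bar> \<le> \<beta> i" if i: "i < Suc n" for i
      proof -
        have b: "t \<le> pp n i" "pp n (Suc i) \<le> \<tau> w" using pp_t[of i n] pp_t[of "Suc i" n] i by auto
        have "\<bar>- drift (pp n (Suc i)) w - - drift (pp n i) w\<bar> \<le> JV w (pp n (Suc i)) - JV w (pp n i)"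
          by (rule drift_JV[OF reg b(1) pp_mono b(2)])
        moreover have "K (pp n i) w \<le> K (pp n (Suc i)) w"
          by (rule mono_onD[OF rK(2)[OF reg]]) (use b pp_mono[of n i] tb in auto)
        ultimately show ?thesis unfolding \<alpha>_def \<beta>_def by linarith
      qed
      have \<beta>0: "0 \<le> \<beta> i" if "i < Suc n" for i using \<alpha>\<beta>[OF that] by linarith
      have "(\<Sum>i<Suc n. \<beta> i) = (JV w (\<tau> w) - JV w (min r (\<tau> w))) + (K (\<tau> w) w - K (min r (\<tau> w)) w)"
        unfolding \<beta>_def sum.distrib sum_lessThan_telescope[of "\<lambda>i. JV w (pp n i)"] sum_lessThan_telescope[of "\<lambda>i. K (pp n i) w"] pp0 ppn ..
      also have "\<dots> \<le> VV w"
      proof -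
        have "\<bar>- drift (min r (\<tau> w)) w - - drift t w\<bar> \<le> JV w (min r (\<tau> w)) - JV w t"
          by (rule drift_JV[OF reg]) (use r \<tau>b in auto)
        moreover have "0 \<le> K (min r (\<tau> w)) w" using rK(3)[OF reg] r tb \<tau>b by auto
        ultimately show ?thesis unfolding VV_def K\<tau>_def using var_total[OF reg] by linarith
      qed
      finally have \<beta>V: "(\<Sum>i<Suc n. \<beta> i) \<le> VV w" .
      have \<alpha>V: "\<bar>\<alpha> n i\<bar> \<le> VV w" if i: "i < Suc n" for i
      proof -
        have "\<beta> i \<le> (\<Sum>i<Suc n. \<beta> i)" by (rule member_le_sum) (use \<beta>0 i in auto)
        then show ?thesis using \<alpha>\<beta>[OF i] \<beta>V by linarith
      qed
      have m0: "0 \<le> m w" using elim(2)[rule_format, of 0 0] by auto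
      have VV0: "0 \<le> VV w" using \<alpha>V[of 0] by auto
      have "\<bar>Q n w\<bar> \<le> (\<Sum>i<Suc n. \<bar>2 * U w (pp n i) * \<alpha> n i + (\<alpha> n i)\<^sup>2\<bar>)" unfolding Q_eq by (rule sum_abs)
      also have "\<dots> \<le> (\<Sum>i<Suc n. (2 * m w + VV w) * \<beta> i)"
      proof (rule sum_mono)
        fix i assume "i \<in> {..<Suc n}"
        then have i: "i < Suc n" by simp
        have "\<bar>U w (pp n i)\<bar> \<le> m w" using elim(2)[rule_format, of i n] V_eq[OF i] i by simp
        then have "\<bar>2 * U w (pp n i) + \<alpha> n i\<bar> \<le> 2 * m w + VV w" using \<alpha>V[OF i] by linarith
        then have "\<bar>2 * U w (pp n i) + \<alpha> n i\<bar> * \<bar>\<alpha> n i\<bar> \<le> (2 * m w + VV w) * \<beta> i"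
          using \<alpha>\<beta>[OF i] by (intro mult_mono) auto
        moreover have "2 * U w (pp n i) * \<alpha> n i + (\<alpha> n i)\<^sup>2 = (2 * U w (pp n i) + \<alpha> n i) * \<alpha> n i"
          by (simp add: power2_eq_square distrib_right)
        ultimately show "\<bar>2 * U w (pp n i) * \<alpha> n i + (\<alpha> n i)\<^sup>2\<bar> \<le> (2 * m w + VV w) * \<beta> i" by (simp only: abs_mult)
      qed
      also have "\<dots> = (2 * m w + VV w) * (\<Sum>i<Suc n. \<beta> i)" by (rule sum_distrib_left[symmetric])
      also have "\<dots> \<le> (2 * m w + VV w) * VV w" using \<beta>V m0 VV0 by (intro mult_left_mono) auto
      also have "\<dots> = D w" by (simp add: D_def power2_eq_square distrib_right)
      finally show ?thesis .
    qed
    then show ?case using lim by blast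
  qed
  have R0: "AE w in M. 0 \<le> RR r w" using AE_space by eventually_elim (rule RR_props(3))
  note [measurable] = borel_measurable_integrable[OF IQ] borel_measurable_integrable[OF RR_props(1)[of r]]
  have maxD: "AE w in M. norm (max (Q n w - 2 * RR r w) 0) \<le> D w" for n
    using path R0
  proof eventually_elim
    case (elim w)
    then have "\<bar>Q n w\<bar> \<le> D w" by blast
    then show ?case using elim(2) by (auto simp: max_def)
  qed
  have Imax: "integrable M (\<lambda>w. max (Q n w - 2 * RR r w) 0)" for n
    by (rule Bochner_Integration.integrable_bound[OF ID]) (use maxD[of n] in \<open>auto elim!: eventually_mono\<close>)
  have lim0: "(\<lambda>n. \<integral>w. max (Q n w - 2 * RR r w) 0 \<partial>M) \<longlonglongrightarrow> (\<integral>w. 0 \<partial>M)"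
  proof (rule integral_dominated_convergence[where w=D])
    show "AE w in M. (\<lambda>n. max (Q n w - 2 * RR r w) 0) \<longlonglongrightarrow> 0"
      using path by eventually_elim blast
  qed (use ID maxD in auto)
  have "?u + ?w / 2 \<le> 2 * ?R + (\<integral>w. max (Q n w - 2 * RR r w) 0 \<partial>M)" for n
  proof -
    have "(\<integral>w. Q n w \<partial>M) \<le> (\<integral>w. 2 * RR r w + max (Q n w - 2 * RR r w) 0 \<partial>M)"
      using IQ[of n] RR_props(1)[of r] Imax[of n]
      by (intro integral_mono Bochner_Integration.integrable_add integrable_mult_right) (auto simp: max_def)
    also have "\<dots> = 2 * ?R + (\<integral>w. max (Q n w - 2 * RR r w) 0 \<partial>M)"
      using RR_props(1)[of r] Imax[of n] by (simp add: RR_props(2))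
    finally show ?thesis using le_Q[of n] by linarith
  qed
  moreover have "(\<lambda>n. 2 * ?R + (\<integral>w. max (Q n w - 2 * RR r w) 0 \<partial>M)) \<longlonglongrightarrow> 2 * ?R + 0"
    using lim0 by (intro tendsto_add tendsto_const) simp
  ultimately show ?thesis by (intro LIMSEQ_le_const[where X="\<lambda>n. 2 * ?R + (\<integral>w. max (Q n w - 2 * RR r w) 0 \<partial>M)"]) auto
qed

section \<open>Absorption over a short interval\<close>

text \<open>The inhomogeneous part of the growth bound: what remains of \<open>lam\<close> (up to
  the factor \<open>c\<close>) when \<open>Y\<close> and \<open>Z\<close> are replaced by the
  reference process, bounded by \<open>\<bar>x\<bar> + 1\<close>, and \<open>z\<close>.\<close>

definition \<Gamma> :: "real \<times> 'a \<Rightarrow> real" where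
  "\<Gamma> p = indicator {t..b} (fst p) * (\<gamma> (fst p) (snd p) + (\<bar>x (snd p)\<bar> + 1 + norm z))"

lemma \<Gamma>_L2: "integrable lM (\<lambda>p. (\<Gamma> p)\<^sup>2)"
proof (rule Bochner_Integration.integrable_bound)
  have "integrable M (\<lambda>w. (norm (\<bar>x w\<bar> + (1 + norm z)))\<^sup>2)"
    using x_L2 measurable_F_M[OF x_meas] by (intro integrable_sq_add) auto
  then have "integrable M (\<lambda>w. (\<bar>x w\<bar> + 1 + norm z)\<^sup>2)" by (simp add: add.assoc)
  then have "integrable lM (\<lambda>p. indicator {t..b} (fst p) * (\<bar>x (snd p)\<bar> + 1 + norm z)\<^sup>2)"
    by (intro integrable_tensor lborel.sigma_finite_measure_axioms sigma_finite_measure_axioms integrable_tb)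
  then show "integrable lM (\<lambda>p. 2 * (indicator {0..T} (fst p) * (\<gamma> (fst p) (snd p))\<^sup>2)
      + 2 * (indicator {t..b} (fst p) * (\<bar>x (snd p)\<bar> + 1 + norm z)\<^sup>2))"
    by (intro Bochner_Integration.integrable_add integrable_mult_right \<gamma>_L2)
  have "norm ((\<Gamma> p)\<^sup>2) \<le> norm (2 * (indicator {0..T} (fst p) * (\<gamma> (fst p) (snd p))\<^sup>2)
      + 2 * (indicator {t..b} (fst p) * (\<bar>x (snd p)\<bar> + 1 + norm z)\<^sup>2))" for p
  proof (cases "fst p \<in> {t..b}")
    case True
    then have "fst p \<in> {0..T}" using tb by auto
    then show ?thesis using True sq_norm_add_le[of "\<gamma> (fst p) (snd p)" "\<bar>x (snd p)\<bar> + 1 + norm z"] by (simp add: \<Gamma>_def)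
  qed (simp add: \<Gamma>_def)
  then show "AE p in lM. norm ((\<Gamma> p)\<^sup>2) \<le> norm (2 * (indicator {0..T} (fst p) * (\<gamma> (fst p) (snd p))\<^sup>2)
      + 2 * (indicator {t..b} (fst p) * (\<bar>x (snd p)\<bar> + 1 + norm z)\<^sup>2))" by simp
  have [measurable]: "(\<lambda>p. indicator {0..T} (fst p) *\<^sub>R \<gamma> (fst p) (snd p)) \<in> borel_measurable lM"
    using \<gamma>_joint unfolding joint_def .
  note [measurable] = measurable_F_M[OF x_meas]
  have "(\<lambda>p. (indicator {t..b} (fst p) * (indicator {0..T} (fst p) *\<^sub>R \<gamma> (fst p) (snd p) + (\<bar>x (snd p)\<bar> + 1 + norm z)))\<^sup>2) \<in> borel_measurable lM"
    by measurable
  moreover have "(indicator {t..b} u * (indicator {0..T} u *\<^sub>R y + v))\<^sup>2 = (indicator {t..b} u * (y + v))\<^sup>2" for u y v :: real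
    using tb by (auto split: split_indicator)
  ultimately show "(\<lambda>p. (\<Gamma> p)\<^sup>2) \<in> borel_measurable lM" by (simp add: \<Gamma>_def)
qed

definition Hq :: "real \<times> 'a \<Rightarrow> real" where
  "Hq p = (if t < fst p \<and> fst p \<le> \<tau> (snd p) then (norm (H (fst p) (snd p)))\<^sup>2 else 0)"

lemma Hq_integrable: "integrable lM Hq"
proof (rule Bochner_Integration.integrable_bound[OF H_L2])
  from joint_on_stop[OF iso_joint[OF N_iso]]
  have [measurable]: "(\<lambda>p. if t \<le> fst p \<and> fst p \<le> \<tau> (snd p) then H (fst p) (snd p) else 0) \<in> borel_measurable lM" .
  have "(\<lambda>p. indicator {t<..} (fst p) * (norm (if t \<le> fst p \<and> fst p \<le> \<tau> (snd p) then H (fst p) (snd p) else 0))\<^sup>2) \<in> borel_measurable lM"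
    by measurable
  moreover have "(\<lambda>p. indicator {t<..} (fst p) * (norm (if t \<le> fst p \<and> fst p \<le> \<tau> (snd p) then H (fst p) (snd p) else 0))\<^sup>2) = Hq"
    by (auto simp: Hq_def fun_eq_iff split: split_indicator)
  ultimately show "Hq \<in> borel_measurable lM" by simp
  show "AE p in lM. norm (Hq p) \<le> norm (indicator {0..T} (fst p) * (norm (H (fst p) (snd p)))\<^sup>2)"
  proof (rule AE_I2)
    fix p :: "real \<times> 'a" assume "p \<in> space lM"
    then have "snd p \<in> space M" by (auto simp: space_pair_measure)
    from \<tau>_range[OF this] show "norm (Hq p) \<le> norm (indicator {0..T} (fst p) * (norm (H (fst p) (snd p)))\<^sup>2)"
      using tb by (auto simp: Hq_def split: split_indicator)
  qed
qed

text \<open>Young's inequality for the products of \<open>V\<close> with \<open>\<Gamma>\<close> and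
  with \<open>H\<close>; \<open>\<kappa>\<close> remains free and is chosen twice later. The
  coefficient 1/4 of \<open>Hq\<close> is half of what the energy inequality provides. Time
  \<open>t\<close> is exempted since \<open>Hq\<close> starts strictly after it.\<close>

lemma Vlam_bound:
  assumes "\<kappa> > 0"
  shows "AE p in lM. fst p \<noteq> t \<longrightarrow> 2 * (\<bar>Vt p\<bar> * lam p) \<le> (\<kappa> + 2 * c + 4 * c\<^sup>2) * (Vt p)\<^sup>2 + c\<^sup>2 / \<kappa> * (\<Gamma> p)\<^sup>2 + Hq p / 4"
  using AE_snd_lift[OF barrier] AE_snd_lift[OF W_eq_B] AE_snd_lift[OF AE_space]
proof eventually_elim
  case (elim p)
  obtain u w where p: "p = (u, w)" by (cases p)
  show ?case
  proof (cases "t < u \<and> u < \<tau> w")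
    case True
    then have u: "u \<in> {t..b}" "u \<in> {t..\<tau> w}" using \<tau>_range[of w] elim(3) p by auto
    let ?X = "x w + z \<bullet> (B u w - B t w)"
    define v where "v = \<bar>V u w\<bar>"
    define h where "h = norm (H u w)"
    have Y: "Y u w = V u w + ?X" using True elim(2) tb p by (simp add: V_def zero_after_def)
    have "\<bar>z \<bullet> (B u w - B t w)\<bar> \<le> 1" using elim(1) u p by auto
    then have Yb: "\<bar>Y u w\<bar> \<le> v + \<bar>x w\<bar> + 1" unfolding Y v_def by linarith
    have "Z u w = H u w + z" using True by (simp add: H_def zero_after_def)
    then have Zb: "norm (Z u w) \<le> h + norm z" using norm_triangle_ineq[of "H u w" z] by (simp add: h_def)
    have G: "\<Gamma> p = \<gamma> u w + (\<bar>x w\<bar> + 1 + norm z)" using u p by (simp add: \<Gamma>_def)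
    have "\<gamma> u w + \<bar>Y u w\<bar> + norm (Z u w) \<le> \<Gamma> p + v + h" unfolding G using Yb Zb by linarith
    then have "c * (\<gamma> u w + \<bar>Y u w\<bar> + norm (Z u w)) \<le> c * (\<Gamma> p + v + h)" using c_pos by (intro mult_left_mono) auto
    then have "lam p \<le> c * (\<Gamma> p + v + h)" using True p by (simp add: lam_def)
    then have "v * lam p \<le> v * (c * (\<Gamma> p + v + h))" by (rule mult_left_mono) (simp add: v_def)
    moreover have "2 * (v * (c * \<Gamma> p)) \<le> \<kappa> * v\<^sup>2 + c\<^sup>2 / \<kappa> * (\<Gamma> p)\<^sup>2"
    proof -
      have "2 * (sqrt \<kappa> * v) * (c / sqrt \<kappa> * \<Gamma> p) \<le> (sqrt \<kappa> * v)\<^sup>2 + (c / sqrt \<kappa> * \<Gamma> p)\<^sup>2" by (rule sum_squares_bound)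
      then show ?thesis using assms by (simp add: power_mult_distrib power_divide mult_ac)
    qed
    moreover have "2 * (v * (c * h)) \<le> 4 * c\<^sup>2 * v\<^sup>2 + h\<^sup>2 / 4"
    proof -
      have "2 * (2 * c * v) * (h / 2) \<le> (2 * c * v)\<^sup>2 + (h / 2)\<^sup>2" by (rule sum_squares_bound)
      then show ?thesis by (simp add: power_mult_distrib power_divide mult_ac)
    qed
    moreover have "v * (c * (\<Gamma> p + v + h)) = v * (c * \<Gamma> p) + c * v\<^sup>2 + v * (c * h)"
      by (simp add: power2_eq_square algebra_simps)
    ultimately have "2 * (v * lam p) \<le> (\<kappa> * v\<^sup>2 + c\<^sup>2 / \<kappa> * (\<Gamma> p)\<^sup>2) + 2 * (c * v\<^sup>2) + (4 * c\<^sup>2 * v\<^sup>2 + h\<^sup>2 / 4)"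
      by argo
    also have "\<dots> = (\<kappa> + 2 * c + 4 * c\<^sup>2) * v\<^sup>2 + c\<^sup>2 / \<kappa> * (\<Gamma> p)\<^sup>2 + h\<^sup>2 / 4"
      by (simp add: algebra_simps)
    also have "\<dots> = (\<kappa> + 2 * c + 4 * c\<^sup>2) * (Vt p)\<^sup>2 + c\<^sup>2 / \<kappa> * (\<Gamma> p)\<^sup>2 + Hq p / 4"
      using True u p by (simp add: Vt_def Hq_def v_def h_def)
    finally show ?thesis using u p by (simp add: Vt_def v_def)
  next
    case False
    have "0 \<le> Hq p" by (simp add: Hq_def)
    then have rhs: "0 \<le> (\<kappa> + 2 * c + 4 * c\<^sup>2) * (Vt p)\<^sup>2 + c\<^sup>2 / \<kappa> * (\<Gamma> p)\<^sup>2 + Hq p / 4"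
      using assms c_pos by (intro add_nonneg_nonneg mult_nonneg_nonneg) auto
    have "\<bar>Vt p\<bar> * lam p = 0" if "u \<noteq> t"
      using False that p by (auto simp: Vt_def V_def lam_def)
    then show ?thesis using rhs p by auto
  qed
qed

lemma V_second_moment: "t \<le> s \<Longrightarrow> s \<le> b \<Longrightarrow> integrable M (\<lambda>w. (V s w)\<^sup>2)"
proof -
  assume s: "t \<le> s" "s \<le> b"
  then obtain m where m: "m \<in> borel_measurable M" "integrable M (\<lambda>w. (m w)\<^sup>2)" "AE w in M. \<forall>k::nat. \<bar>V s w\<bar> \<le> m w"
    using countable_sup_bound[of "\<lambda>_. s"] by auto
  have [measurable]: "V s \<in> borel_measurable M" using measurable_F_M[OF V_meas[of s]] s tb by auto
  show ?thesis
  proof (rule Bochner_Integration.integrable_bound[OF m(2)])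
    show "AE w in M. norm ((V s w)\<^sup>2) \<le> norm ((m w)\<^sup>2)"
      using m(3)
    proof eventually_elim
      case (elim w)
      then show ?case using power_mono[of "\<bar>V s w\<bar>" "m w" 2] by simp
    qed
  qed measurable
qed

text \<open>The absorption argument compares a supremum of second moments with half of itself and so
  needs it finite. The supremum in \<open>YK_sup\<close> may be non-measurable; it is compared by
  monotonicity with the positive part \<open>f\<close>.\<close>

lemma V_second_moment_bdd: "\<exists>C. \<forall>s. t \<le> s \<longrightarrow> s \<le> b \<longrightarrow> (\<integral>w. (V s w)\<^sup>2 \<partial>M) \<le> C"
proof -
  let ?Sup = "\<lambda>w. SUP s\<in>{0..\<tau> w}. ennreal (\<bar>Y s w\<bar>\<^sup>2 + \<bar>K s w\<bar>\<^sup>2)"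
  define q where "q w = 4 * (x w)\<^sup>2 + 4" for w
  have qi: "integrable M q" unfolding q_def using x_L2 by simp
  have "(\<integral>w. (V s w)\<^sup>2 \<partial>M) \<le> 2 * enn2real (\<integral>\<^sup>+w. ?Sup w \<partial>M) + (\<integral>w. q w \<partial>M)" if s: "t \<le> s" "s \<le> b" for s
  proof -
    note V2 = V_second_moment[OF s]
    define f where "f w = max (((V s w)\<^sup>2 - q w) / 2) 0" for w
    have If: "integrable M f" unfolding f_def[abs_def] using V2 qi by (intro integrable_max) auto
    have "(\<integral>\<^sup>+w. ennreal (f w) \<partial>M) \<le> (\<integral>\<^sup>+w. ?Sup w \<partial>M)"
    proof (rule nn_integral_mono_AE)
      show "AE w in M. ennreal (f w) \<le> ?Sup w"
        using barrier W_eq_B AE_space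
      proof eventually_elim
        case (elim w)
        note b = V_sq_le[OF elim(1,2) s(1), folded q_def]
        show ?case
        proof (cases "s \<le> \<tau> w")
          case True
          then have "f w \<le> \<bar>Y s w\<bar>\<^sup>2 + \<bar>K s w\<bar>\<^sup>2" using b s by (auto simp: f_def) (smt (verit) zero_le_power2)
          then have "ennreal (f w) \<le> ennreal (\<bar>Y s w\<bar>\<^sup>2 + \<bar>K s w\<bar>\<^sup>2)" by (rule ennreal_leI)
          also have "\<dots> \<le> ?Sup w" using True s tb by (intro SUP_upper) auto
          finally show ?thesis .
        next
          case False
          then have "f w = 0" using b by (simp add: f_def)
          then show ?thesis by simp
        qed
      qed
    qed
    moreover have "(\<integral>\<^sup>+w. ennreal (f w) \<partial>M) = ennreal (\<integral>w. f w \<partial>M)"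
      by (rule nn_integral_eq_integral[OF If]) (simp add: f_def)
    ultimately have "ennreal (\<integral>w. f w \<partial>M) \<le> (\<integral>\<^sup>+w. ?Sup w \<partial>M)" by simp
    from enn2real_mono[OF this] YK_sup have "enn2real (ennreal (\<integral>w. f w \<partial>M)) \<le> enn2real (\<integral>\<^sup>+w. ?Sup w \<partial>M)" by simp
    moreover have "0 \<le> (\<integral>w. f w \<partial>M)" by (simp add: f_def)
    ultimately have fb: "(\<integral>w. f w \<partial>M) \<le> enn2real (\<integral>\<^sup>+w. ?Sup w \<partial>M)" by simp
    have "(\<integral>w. (V s w)\<^sup>2 \<partial>M) \<le> (\<integral>w. 2 * f w + q w \<partial>M)"
    proof (rule integral_mono[OF V2])
      show "integrable M (\<lambda>w. 2 * f w + q w)" using If qi by simp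
      show "(V s w)\<^sup>2 \<le> 2 * f w + q w" for w by (auto simp: f_def max_def field_simps)
    qed
    also have "\<dots> = 2 * (\<integral>w. f w \<partial>M) + (\<integral>w. q w \<partial>M)" using If qi by simp
    finally show ?thesis using fb by linarith
  qed
  then show ?thesis by blast
qed

text \<open>Absorption replaces Gronwall's inequality: the time integral of the second moments of
  \<open>V\<close> is at most \<open>b - t\<close> times their supremum, and on a short interval
  half of the supremum is absorbed.\<close>

lemma short_time_estimate:
  assumes small: "(5 * c\<^sup>2 + 2 * c) * (b - t) \<le> 1 / 2"
  defines "G \<equiv> \<integral>p. (\<Gamma> p)\<^sup>2 \<partial>lM"
  shows "(\<integral>p. (Vt p)\<^sup>2 \<partial>lM) \<le> 2 * (b - t) * G"
    and "(\<integral>p. Hq p \<partial>lM) \<le> 4 * (3 * c * sqrt (b - t) + (4 * c + 8 * c\<^sup>2) * (b - t)) * G"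
proof -
  define A where "A = (\<integral>p. (Vt p)\<^sup>2 \<partial>lM)"
  define \<zeta> where "\<zeta> r = (\<integral>p. (if r < fst p \<and> fst p \<le> \<tau> (snd p) then (norm (H (fst p) (snd p)))\<^sup>2 else 0) \<partial>lM)" for r
  define u where "u s = (\<integral>w. (V s w)\<^sup>2 \<partial>M)" for s
  have G0: "0 \<le> G" and A0: "0 \<le> A" unfolding G_def A_def by simp_all
  have key: "u r + \<zeta> r / 4 \<le> (\<kappa> + 2 * c + 4 * c\<^sup>2) * A + c\<^sup>2 / \<kappa> * G" if r: "t \<le> r" "r < b" and \<kappa>: "\<kappa> > 0" for r \<kappa>
  proof -
    let ?h = "\<lambda>p. if r < fst p \<and> fst p \<le> \<tau> (snd p) then (norm (H (fst p) (snd p)))\<^sup>2 else 0"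
    have heq: "?h p = indicator {r<..} (fst p) * Hq p" for p using r by (auto simp: Hq_def split: split_indicator)
    have Ih: "integrable lM ?h"
      unfolding heq
    proof (rule Bochner_Integration.integrable_bound[OF Hq_integrable])
      note [measurable] = borel_measurable_integrable[OF Hq_integrable]
      show "(\<lambda>p. indicator {r<..} (fst p) * Hq p) \<in> borel_measurable lM" by measurable
    qed (auto simp: Hq_def split: split_indicator)
    have "2 * (\<integral>p. indicator {r<..} (fst p) * (\<bar>Vt p\<bar> * lam p) \<partial>lM)
      = (\<integral>p. 2 * (indicator {r<..} (fst p) * (\<bar>Vt p\<bar> * lam p)) \<partial>lM)" by simp
    also have "\<dots> \<le> (\<integral>p. ((\<kappa> + 2 * c + 4 * c\<^sup>2) * (Vt p)\<^sup>2 + c\<^sup>2 / \<kappa> * (\<Gamma> p)\<^sup>2) + ?h p / 4 \<partial>lM)"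
    proof (rule integral_mono_AE)
      show "integrable lM (\<lambda>p. 2 * (indicator {r<..} (fst p) * (\<bar>Vt p\<bar> * lam p)))"
        using RRp_integrable[of r] by simp
      show "integrable lM (\<lambda>p. ((\<kappa> + 2 * c + 4 * c\<^sup>2) * (Vt p)\<^sup>2 + c\<^sup>2 / \<kappa> * (\<Gamma> p)\<^sup>2) + ?h p / 4)"
        by (intro Bochner_Integration.integrable_add integrable_mult_right Vt_L2 \<Gamma>_L2 integrable_divide_zero Ih)
      show "AE p in lM. 2 * (indicator {r<..} (fst p) * (\<bar>Vt p\<bar> * lam p))
        \<le> ((\<kappa> + 2 * c + 4 * c\<^sup>2) * (Vt p)\<^sup>2 + c\<^sup>2 / \<kappa> * (\<Gamma> p)\<^sup>2) + ?h p / 4"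
        using Vlam_bound[OF \<kappa>]
      proof eventually_elim
        case (elim p)
        show ?case
        proof (cases "r < fst p")
          case True
          then show ?thesis using elim r unfolding heq by simp
        next
          case False
          have "0 \<le> (\<kappa> + 2 * c + 4 * c\<^sup>2) * (Vt p)\<^sup>2 + c\<^sup>2 / \<kappa> * (\<Gamma> p)\<^sup>2"
            using \<kappa> c_pos by (intro add_nonneg_nonneg mult_nonneg_nonneg) auto
          then show ?thesis using False by simp
        qed
      qed
    qed
    also have "\<dots> = ((\<kappa> + 2 * c + 4 * c\<^sup>2) * A + c\<^sup>2 / \<kappa> * G) + \<zeta> r / 4"
      unfolding A_def G_def \<zeta>_def using Vt_L2 \<Gamma>_L2 Ih by (simp add: Bochner_Integration.integrable_add)
    finally show ?thesis using energy_inequality[OF r] unfolding u_def \<zeta>_def by linarith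
  qed
  have w0: "0 \<le> \<zeta> r" for r unfolding \<zeta>_def by (rule Bochner_Integration.integral_nonneg) auto
  obtain C where C: "\<And>s. t \<le> s \<Longrightarrow> s \<le> b \<Longrightarrow> u s \<le> C" using V_second_moment_bdd unfolding u_def by blast
  define v where "v = Sup (u ` {t..<b})"
  have bdd: "bdd_above (u ` {t..<b})" using C by (intro bdd_aboveI2[of _ _ C]) auto
  have uv: "u s \<le> v" if "t \<le> s" "s < b" for s unfolding v_def using bdd that by (intro cSup_upper) auto
  have v0: "0 \<le> v"
  proof -
    have "0 \<le> u t" unfolding u_def by simp
    then show ?thesis using uv[of t] tb by simp
  qed
  have Av: "A \<le> (b - t) * v"
  proof -
    have "A = (\<integral>s. (\<integral>w. (Vt (s, w))\<^sup>2 \<partial>M) \<partial>lborel)"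
      unfolding A_def using lp.integral_fst'[OF Vt_L2] by simp
    also have "\<dots> \<le> (\<integral>s. indicator {t..b} s * v \<partial>lborel)"
    proof (rule integral_mono)
      show "integrable lborel (\<lambda>s. \<integral>w. (Vt (s, w))\<^sup>2 \<partial>M)" using lp.integrable_fst'[OF Vt_L2] by simp
      show "integrable lborel (\<lambda>s. indicator {t..b} s * v)" using integrable_tb by simp
      fix s :: real
      show "(\<integral>w. (Vt (s, w))\<^sup>2 \<partial>M) \<le> indicator {t..b} s * v"
      proof (cases "s \<in> {t..b}")
        case True
        then have "(\<integral>w. (Vt (s, w))\<^sup>2 \<partial>M) = u s" by (simp add: Vt_def u_def)
        also have "\<dots> \<le> v"
        proof (cases "s = b")
          case True
          have "u b = (\<integral>w. 0 \<partial>M)" unfolding u_def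
            by (rule Bochner_Integration.integral_cong) (use \<tau>_range in \<open>auto simp: V_def not_less[symmetric]\<close>)
          then show ?thesis using v0 True by simp
        qed (use uv True in auto)
        finally show ?thesis using True by simp
      qed (simp add: Vt_def)
    qed
    also have "\<dots> = (b - t) * v" using tb by simp
    finally show ?thesis .
  qed
  have v2: "v \<le> 2 * G"
  proof -
    have "u s \<le> v / 2 + G" if s: "t \<le> s" "s < b" for s
    proof -
      \<comment> \<open>Here \<open>\<kappa> = c\<^sup>2\<close>: the coefficient of
        \<open>A\<close> becomes the \<open>5 * c\<^sup>2 + 2 * c\<close> of the smallness
        condition, and that of \<open>G\<close> becomes 1.\<close>
      have "c\<^sup>2 > 0" using c_pos by simp
      from key[OF s this] have "u s \<le> (c\<^sup>2 + 2 * c + 4 * c\<^sup>2) * A + G" using w0[of s] c_pos by simp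
      also have "(c\<^sup>2 + 2 * c + 4 * c\<^sup>2) * A \<le> (c\<^sup>2 + 2 * c + 4 * c\<^sup>2) * ((b - t) * v)"
        using c_pos Av by (intro mult_left_mono) auto
      also have "\<dots> = ((5 * c\<^sup>2 + 2 * c) * (b - t)) * v" by (simp add: algebra_simps)
      also have "\<dots> \<le> 1 / 2 * v" using small v0 by (intro mult_right_mono) auto
      finally show ?thesis by simp
    qed
    then have "v \<le> v / 2 + G" unfolding v_def[of] using tb by (intro cSup_least) auto
    then show ?thesis by simp
  qed
  have A2: "A \<le> 2 * (b - t) * G"
  proof -
    have "(b - t) * v \<le> (b - t) * (2 * G)" using v2 tb by (intro mult_left_mono) auto
    also have "\<dots> = 2 * (b - t) * G" by simp
    finally show ?thesis using Av by linarith
  qed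
  then show "(\<integral>p. (Vt p)\<^sup>2 \<partial>lM) \<le> 2 * (b - t) * G" by (simp add: A_def)
  define h where "h = sqrt (b - t)"
  have h: "h > 0" "b - t = h * h" using tb by (auto simp: h_def)
  \<comment> \<open>Balances the two contributions of \<open>\<kappa>\<close>:
    \<open>\<kappa>\<close> times \<open>2 * (b - t)\<close> and \<open>c\<^sup>2 / \<kappa>\<close>
    are both of order \<open>sqrt (b - t)\<close>.\<close>
  define \<kappa> where "\<kappa> = c / h"
  have \<kappa>: "\<kappa> > 0" using h c_pos by (simp add: \<kappa>_def)
  have "0 \<le> u t" unfolding u_def by simp
  then have "\<zeta> t / 4 \<le> (\<kappa> + 2 * c + 4 * c\<^sup>2) * A + c\<^sup>2 / \<kappa> * G" using key[OF order_refl tb(2) \<kappa>] by linarith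
  also have "\<dots> \<le> (\<kappa> + 2 * c + 4 * c\<^sup>2) * (2 * (b - t) * G) + c\<^sup>2 / \<kappa> * G"
    using A2 \<kappa> c_pos by (intro add_right_mono mult_left_mono) auto
  also have "\<dots> = (3 * c * h + (4 * c + 8 * c\<^sup>2) * (b - t)) * G"
  proof -
    have 1: "\<kappa> * (2 * (b - t)) = 2 * c * h" using h by (simp add: \<kappa>_def)
    have 2: "c\<^sup>2 / \<kappa> = c * h" using h c_pos by (simp add: \<kappa>_def power2_eq_square)
    have "(\<kappa> + 2 * c + 4 * c\<^sup>2) * (2 * (b - t) * G) + c\<^sup>2 / \<kappa> * G
      = \<kappa> * (2 * (b - t)) * G + (2 * c + 4 * c\<^sup>2) * (2 * (b - t)) * G + c\<^sup>2 / \<kappa> * G" by (simp add: algebra_simps)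
    then show ?thesis unfolding 1 2 by (simp add: algebra_simps)
  qed
  finally have "\<zeta> t \<le> 4 * ((3 * c * h + (4 * c + 8 * c\<^sup>2) * (b - t)) * G)" by simp
  moreover have "\<zeta> t = (\<integral>p. Hq p \<partial>lM)" unfolding \<zeta>_def Hq_def[abs_def] ..
  ultimately show "(\<integral>p. Hq p \<partial>lM) \<le> 4 * (3 * c * sqrt (b - t) + (4 * c + 8 * c\<^sup>2) * (b - t)) * G"
    by (simp only: h_def mult.assoc)
qed

section \<open>The expected drift and its upper bound\<close>

text \<open>The equation at time \<open>t\<close>, conditioned on \<open>F t\<close> in the form of
  integrals over events: the stopped martingale increment integrates to zero over each of
  them.\<close>

lemma representation:
  shows "integrable M (drift t)" "integrable M (\<lambda>w. K\<tau> w - K t w)" "integrable M (V t)"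
    and "A \<in> sets (F t) \<Longrightarrow> (\<integral>w. indicator A w * V t w \<partial>M) =
      (\<integral>w. indicator A w * drift t w \<partial>M) + (\<integral>w. indicator A w * (K\<tau> w - K t w) \<partial>M)"
proof -
  have t0: "0 \<le> t" "t \<le> b" "t \<le> T" using tb by auto
  have "zero_after \<tau> K t \<in> borel_measurable M" using measurable_F_M[OF prog_section[OF K_prog, of t]] t0 by auto
  then have Ktm: "K t \<in> borel_measurable M"
    by (rule measurable_AE_eq) (use \<tau>_range AE_space in \<open>auto simp: zero_after_def elim!: eventually_mono\<close>)
  have Vm: "V t \<in> borel_measurable M" using measurable_F_M[OF V_meas[of t]] t0 by auto
  note V2 = V_second_moment[OF order_refl t0(2)]
  show IV: "integrable M (V t)" by (rule integrable_of_sq[OF Vm V2])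
  have Kt: "AE w in M. 0 \<le> K t w \<and> K t w \<le> K\<tau> w"
    using AE_regular_path
  proof eventually_elim
    case (elim w)
    note r = \<tau>w[OF elim]
    show ?case using mono_onD[OF rK(2)[OF elim], of t "\<tau> w"] rK(3)[OF elim] r t0 by (auto simp: K\<tau>_def)
  qed
  have IK\<tau>: "integrable M K\<tau>" by (rule integrable_of_sq[OF K\<tau>_L2])
  from Kt have "AE w in M. norm (K t w) \<le> norm (K\<tau> w)" by eventually_elim auto
  then have "integrable M (K t)"
    by (rule Bochner_Integration.integrable_bound[OF IK\<tau> Ktm])
  then show IK: "integrable M (\<lambda>w. K\<tau> w - K t w)" using IK\<tau> by simp
  note inc = incr_props[OF t0(1,2) tb(3)]
  have Ii: "integrable M (incr t b)" by (rule integrable_of_sq[OF inc(1,2)])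
  have eq: "AE w in M. V t w - (K\<tau> w - K t w) + incr t b w = drift t w"
    using AE_regular_path
  proof eventually_elim
    case (elim w)
    note r = \<tau>w[OF elim]
    show ?case
      using V_U[OF elim order_refl r(1)] U_eq[OF elim, of t] incr_path[OF elim order_refl t0(2)] r t0
      by (simp add: K\<tau>_def min_absorb1 min_absorb2)
  qed
  have I0: "integrable M (\<lambda>w. V t w - (K\<tau> w - K t w) + incr t b w)" using IV IK Ii by simp
  \<comment> \<open>Measurability of the drift is read off from the other terms of the
    equation.\<close>
  have dm: "drift t \<in> borel_measurable M"
    by (rule measurable_AE_eq[OF borel_measurable_integrable[OF I0]]) (use eq in auto)
  show Id: "integrable M (drift t)"
    by (rule integrable_cong_AE_imp[OF I0 dm]) (use eq in \<open>auto elim!: eventually_mono\<close>)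
  assume A: "A \<in> sets (F t)"
  then have AM[measurable]: "A \<in> sets M" using sets_F_sub by auto
  have mI: "integrable M (\<lambda>w. indicator A w * f w)" if "integrable M f" for f :: "'a \<Rightarrow> real"
    using integrable_mult_indicator[OF AM that] by simp
  have "(\<integral>w. indicator A w * drift t w \<partial>M) = (\<integral>w. indicator A w * V t w - indicator A w * (K\<tau> w - K t w) + indicator A w * incr t b w \<partial>M)"
  proof (rule integral_cong_AE)
    show "AE w in M. indicator A w * drift t w = indicator A w * V t w - indicator A w * (K\<tau> w - K t w) + indicator A w * incr t b w"
      using eq
    proof eventually_elim
      case (elim w)
      show ?case unfolding elim[symmetric] by (simp add: algebra_simps)
    qed
  qed (use borel_measurable_integrable[OF Id] borel_measurable_integrable[OF IV] borel_measurable_integrable[OF IK] inc(1) in measurable)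
  also have "\<dots> = (\<integral>w. indicator A w * V t w \<partial>M) - (\<integral>w. indicator A w * (K\<tau> w - K t w) \<partial>M) + (\<integral>w. indicator A w * incr t b w \<partial>M)"
    using mI[OF IV] mI[OF IK] mI[OF Ii] by simp
  also have "(\<integral>w. indicator A w * incr t b w \<partial>M) = 0" by (rule inc(3)[OF A])
  finally show "(\<integral>w. indicator A w * V t w \<partial>M) =
      (\<integral>w. indicator A w * drift t w \<partial>M) + (\<integral>w. indicator A w * (K\<tau> w - K t w) \<partial>M)" by simp
qed

lemma sqrt_Hq_integrable: "integrable lM (\<lambda>p. sqrt (Hq p))"
  and Vt_integrable: "integrable lM (\<lambda>p. \<bar>Vt p\<bar>)"
proof -
  have 1: "integrable lM (\<lambda>p. indicator {t..b} (fst p) :: real)"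
    using integrable_tensor(1)[OF lborel.sigma_finite_measure_axioms sigma_finite_measure_axioms integrable_tb, of "\<lambda>_. 1::real"] by simp
  have le: "\<bar>v\<bar> \<le> 1 + v\<^sup>2" for v :: real using abs_mult_le_sq[of v 1] by simp
  note [measurable] = borel_measurable_integrable[OF Hq_integrable] Vt_meas
  have Hq0: "0 \<le> Hq p" for p by (simp add: Hq_def)
  show "integrable lM (\<lambda>p. sqrt (Hq p))"
  proof (rule Bochner_Integration.integrable_bound[OF Bochner_Integration.integrable_add[OF 1 Hq_integrable]])
    show "AE p in lM. norm (sqrt (Hq p)) \<le> norm (indicator {t..b} (fst p) + Hq p)"
    proof (rule AE_I2)
      fix p :: "real \<times> 'a" assume "p \<in> space lM"
      then have p: "snd p \<in> space M" by (auto simp: space_pair_measure)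
      show "norm (sqrt (Hq p)) \<le> norm (indicator {t..b} (fst p) + Hq p)"
        using le[of "sqrt (Hq p)"] Hq0[of p] \<tau>_range[OF p] by (cases "fst p \<in> {t..b}") (auto simp: Hq_def)
    qed
  qed measurable
  show "integrable lM (\<lambda>p. \<bar>Vt p\<bar>)"
  proof (rule Bochner_Integration.integrable_bound[OF Bochner_Integration.integrable_add[OF 1 Vt_L2]])
    show "AE p in lM. norm \<bar>Vt p\<bar> \<le> norm (indicator {t..b} (fst p) + (Vt p)\<^sup>2)"
    proof (rule AE_I2)
      fix p :: "real \<times> 'a"
      show "norm \<bar>Vt p\<bar> \<le> norm (indicator {t..b} (fst p) + (Vt p)\<^sup>2)"
        using le[of "Vt p"] by (cases "fst p \<in> {t..b}") (auto simp: Vt_def)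
    qed
  qed measurable
qed

text \<open>With \<open>a\<close> the fourth root of the length, the energy of \<open>H\<close> is
  of order \<open>a\<^sup>2 * a ^ 4\<close>. Young's inequality with weight \<open>a\<close> then
  bounds the L1 error by the order \<open>a * a ^ 4\<close>, one factor \<open>a\<close> better than
  the length.\<close>

lemma error_bound:
  assumes small: "(5 * c\<^sup>2 + 2 * c) * (b - t) \<le> 1 / 2" and a: "0 < a" "b - t = a ^ 4"
    and G: "(\<integral>p. (\<Gamma> p)\<^sup>2 \<partial>lM) \<le> CG * a ^ 4"
  shows "(\<integral>p. \<bar>Vt p\<bar> + sqrt (Hq p) \<partial>lM) \<le> a ^ 4 * (a + (6 * c * a + (1 + 8 * c + 16 * c\<^sup>2) * a ^ 3) * CG)"
proof -
  let ?G = "\<integral>p. (\<Gamma> p)\<^sup>2 \<partial>lM"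
  have I1: "integrable lM (\<lambda>p. indicator {t..b} (fst p) :: real)" "(\<integral>p. (indicator {t..b} (fst p) :: real) \<partial>lM) = b - t"
    using integrable_tensor[OF lborel.sigma_finite_measure_axioms sigma_finite_measure_axioms integrable_tb, of "\<lambda>_. 1::real"] tb
    by (simp_all add: prob_space)
  have young: "v \<le> a / 2 + v\<^sup>2 / (2 * a)" for v
  proof -
    have "0 \<le> (v - a)\<^sup>2" by simp
    then have "2 * a * v \<le> a\<^sup>2 + v\<^sup>2" by (simp add: power2_diff mult_ac)
    then show ?thesis using a by (simp add: field_simps power2_eq_square)
  qed
  have Hq0: "0 \<le> Hq p" for p by (simp add: Hq_def)
  have "(\<integral>p. \<bar>Vt p\<bar> + sqrt (Hq p) \<partial>lM) \<le> (\<integral>p. a * indicator {t..b} (fst p) + ((Vt p)\<^sup>2 + Hq p) / (2 * a) \<partial>lM)"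
  proof (rule integral_mono_AE)
    show "AE p in lM. \<bar>Vt p\<bar> + sqrt (Hq p) \<le> a * indicator {t..b} (fst p) + ((Vt p)\<^sup>2 + Hq p) / (2 * a)"
    proof (rule AE_I2)
      fix p :: "real \<times> 'a" assume "p \<in> space lM"
      then have p: "snd p \<in> space M" by (auto simp: space_pair_measure)
      show "\<bar>Vt p\<bar> + sqrt (Hq p) \<le> a * indicator {t..b} (fst p) + ((Vt p)\<^sup>2 + Hq p) / (2 * a)"
      proof (cases "fst p \<in> {t..b}")
        case True
        have "\<bar>Vt p\<bar> + sqrt (Hq p) \<le> (a / 2 + \<bar>Vt p\<bar>\<^sup>2 / (2 * a)) + (a / 2 + (sqrt (Hq p))\<^sup>2 / (2 * a))"
          by (intro add_mono young)
        also have "\<dots> = a + ((Vt p)\<^sup>2 + Hq p) / (2 * a)" using Hq0[of p] by (simp add: add_divide_distrib)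
        finally show ?thesis using True by simp
      next
        case False
        then show ?thesis using \<tau>_range[OF p] by (auto simp: Vt_def Hq_def)
      qed
    qed
  qed (intro Bochner_Integration.integrable_add Vt_integrable sqrt_Hq_integrable integrable_mult_right integrable_divide_zero I1 Vt_L2 Hq_integrable)+
  also have "\<dots> = a * (b - t) + ((\<integral>p. (Vt p)\<^sup>2 \<partial>lM) + (\<integral>p. Hq p \<partial>lM)) / (2 * a)"
    using I1 Vt_L2 Hq_integrable by simp
  also have "\<dots> \<le> a * (b - t) + (2 * (b - t) * ?G + 4 * (3 * c * sqrt (b - t) + (4 * c + 8 * c\<^sup>2) * (b - t)) * ?G) / (2 * a)"
    using short_time_estimate[OF small] a(1) by (intro add_left_mono divide_right_mono add_mono) auto
  also have "\<dots> = a * a ^ 4 + (6 * c * a + (1 + 8 * c + 16 * c\<^sup>2) * a ^ 3) * ?G"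
  proof -
    have "a ^ 4 = (a\<^sup>2)\<^sup>2" by (simp add: power_mult[symmetric])
    then have s: "sqrt (a ^ 4) = a\<^sup>2" by (simp only: real_sqrt_abs) simp
    have "(2 * a ^ 4 * ?G + 4 * (3 * c * a\<^sup>2 + (4 * c + 8 * c\<^sup>2) * a ^ 4) * ?G) / (2 * a) = (6 * c * a + (1 + 8 * c + 16 * c\<^sup>2) * a ^ 3) * ?G"
      using a(1) by (simp add: field_simps power_numeral_reduce)
    then show ?thesis unfolding a(2) s by simp
  qed
  also have "\<dots> \<le> a * a ^ 4 + (6 * c * a + (1 + 8 * c + 16 * c\<^sup>2) * a ^ 3) * (CG * a ^ 4)"
    using G a(1) c_pos by (intro add_left_mono mult_left_mono) auto
  also have "\<dots> = a ^ 4 * (a + (6 * c * a + (1 + 8 * c + 16 * c\<^sup>2) * a ^ 3) * CG)"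
    by (simp add: algebra_simps)
  finally show ?thesis .
qed

text \<open>The sign \<open>sg\<close> is 1 for the first generator and -1 for the second, so one
  statement bounds the first drift above and the second below. \<open>d\<close> measures how far the
  reference process, started at \<open>x\<close>, is from the moving point \<open>y0\<close>. The
  error term is nonnegative, so the indicator is dropped from it.\<close>

lemma drift_upper:
  fixes sg m :: real and \<Phi> d :: "real \<times> 'a \<Rightarrow> real" and y0 :: "real \<Rightarrow> 'a \<Rightarrow> real"
  assumes m: "0 \<le> m" and A: "A \<in> sets (F t)"
    and \<Phi>: "integrable lM (\<lambda>p. indicator {t..b} (fst p) * \<Phi> p)"
    and d: "integrable lM (\<lambda>p. indicator {t..b} (fst p) * d p)"
    and bound: "AE w in M. \<forall>u\<in>{t..b}. \<forall>y zz. sg * g u w y zz \<le> \<Phi> (u, w) + m * (\<bar>y - y0 u w\<bar> + norm (zz - z))"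
    and dist: "AE w in M. \<forall>u\<in>{t..\<tau> w}. \<bar>x w + z \<bullet> (B u w - B t w) - y0 u w\<bar> \<le> d (u, w)"
  shows "integrable M (\<lambda>w. \<integral>u. (if t < u \<and> u \<le> \<tau> w then \<Phi> (u, w) + m * d (u, w) else 0) \<partial>lborel)"
    and "(\<integral>w. indicator A w * (sg * drift t w) \<partial>M) \<le>
      (\<integral>w. indicator A w * (\<integral>u. (if t < u \<and> u \<le> \<tau> w then \<Phi> (u, w) + m * d (u, w) else 0) \<partial>lborel) \<partial>M)
      + m * (\<integral>p. \<bar>Vt p\<bar> + sqrt (Hq p) \<partial>lM)"
proof -
  define f where "f p = (if t < fst p \<and> fst p \<le> \<tau> (snd p) then \<Phi> p + m * d p else 0)" for p
  define e where "e p = \<bar>Vt p\<bar> + sqrt (Hq p)" for p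
  have Ie: "integrable lM e" unfolding e_def[abs_def]
    by (intro Bochner_Integration.integrable_add Vt_integrable sqrt_Hq_integrable)
  have e0: "0 \<le> e p" for p by (simp add: e_def Hq_def)
  have If: "integrable lM f"
  proof (rule Bochner_Integration.integrable_bound)
    have i: "integrable lM (\<lambda>p. indicator {t..b} (fst p) * \<Phi> p + m * (indicator {t..b} (fst p) * d p))"
      by (intro Bochner_Integration.integrable_add integrable_mult_right \<Phi> d)
    show "integrable lM (\<lambda>p. indicator {t..b} (fst p) * \<Phi> p + m * (indicator {t..b} (fst p) * d p))" by (rule i)
    have [measurable]: "(\<lambda>p. indicator {t..b} (fst p) * \<Phi> p + m * (indicator {t..b} (fst p) * d p)) \<in> borel_measurable lM"
      using borel_measurable_integrable[OF i] .
    note [measurable] = \<tau>_meas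
    have "(\<lambda>p. if t < fst p \<and> fst p \<le> \<tau> (snd p) then indicator {t..b} (fst p) * \<Phi> p + m * (indicator {t..b} (fst p) * d p) else 0) \<in> borel_measurable lM"
      by measurable
    then show "f \<in> borel_measurable lM"
    proof (rule measurable_cong[THEN iffD1, rotated])
      fix p :: "real \<times> 'a" assume "p \<in> space lM"
      then have "snd p \<in> space M" by (auto simp: space_pair_measure)
      from \<tau>_range[OF this] show "(if t < fst p \<and> fst p \<le> \<tau> (snd p) then indicator {t..b} (fst p) * \<Phi> p + m * (indicator {t..b} (fst p) * d p) else 0) = f p"
        by (auto simp: f_def)
    qed
    show "AE p in lM. norm (f p) \<le> norm (indicator {t..b} (fst p) * \<Phi> p + m * (indicator {t..b} (fst p) * d p))"
    proof (rule AE_I2)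
      fix p :: "real \<times> 'a" assume "p \<in> space lM"
      then have "snd p \<in> space M" by (auto simp: space_pair_measure)
      from \<tau>_range[OF this] show "norm (f p) \<le> norm (indicator {t..b} (fst p) * \<Phi> p + m * (indicator {t..b} (fst p) * d p))"
        by (auto simp: f_def)
    qed
  qed
  have cs: "integrable lM (\<lambda>(u, w). f (u, w))" "integrable lM (\<lambda>(u, w). e (u, w))"
    using If Ie by (simp_all add: case_prod_beta')
  have fe: "(\<lambda>w. \<integral>u. (if t < u \<and> u \<le> \<tau> w then \<Phi> (u, w) + m * d (u, w) else 0) \<partial>lborel) = (\<lambda>w. \<integral>u. f (u, w) \<partial>lborel)"
    by (simp add: f_def)
  show J: "integrable M (\<lambda>w. \<integral>u. (if t < u \<and> u \<le> \<tau> w then \<Phi> (u, w) + m * d (u, w) else 0) \<partial>lborel)"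
    unfolding fe by (rule lp.integrable_snd[OF cs(1)])
  have Je: "integrable M (\<lambda>w. \<integral>u. e (u, w) \<partial>lborel)" by (rule lp.integrable_snd[OF cs(2)])
  have e_tot: "(\<integral>w. (\<integral>u. e (u, w) \<partial>lborel) \<partial>M) = (\<integral>p. e p \<partial>lM)"
    using lp.integral_snd[OF cs(2)] by (simp add: case_prod_beta')
  have path: "AE w in M. sg * drift t w \<le> (\<integral>u. f (u, w) \<partial>lborel) + m * (\<integral>u. e (u, w) \<partial>lborel)"
    using AE_regular_path bound dist lp.AE_integrable_snd[OF cs(1)] lp.AE_integrable_snd[OF cs(2)]
  proof eventually_elim
    case (elim w)
    note reg = elim(1) and \<tau>b = \<tau>w[OF elim(1)]
    let ?g = "\<lambda>u. g u w (Y u w) (Z u w)"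
    have sg_int: "set_integrable lborel {t..\<tau> w} ?g"
      by (rule set_integrable_subset[OF rg[OF reg]]) (use tb in auto)
    have "sg * drift t w = (\<integral>u. sg * (indicator {t..\<tau> w} u * ?g u) \<partial>lborel)"
      using drift_LINT[OF reg, of t] tb by (simp add: set_lebesgue_integral_def)
    also have "\<dots> \<le> (\<integral>u. f (u, w) + m * e (u, w) \<partial>lborel)"
    proof (rule integral_mono_AE)
      show "integrable lborel (\<lambda>u. sg * (indicator {t..\<tau> w} u * ?g u))"
        using sg_int unfolding set_integrable_def by (intro integrable_mult_right) simp
      show "integrable lborel (\<lambda>u. f (u, w) + m * e (u, w))"
        using elim(4,5) by (intro Bochner_Integration.integrable_add integrable_mult_right) auto
      show "AE u in lborel. sg * (indicator {t..\<tau> w} u * ?g u) \<le> f (u, w) + m * e (u, w)"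
        using AE_lborel_singleton[of t]
      proof eventually_elim
        case (elim u)
        show ?case
        proof (cases "t < u \<and> u \<le> \<tau> w")
          case True
          then have u: "u \<in> {t..b}" "u \<in> {t..\<tau> w}" using \<tau>b by auto
          have "sg * ?g u \<le> \<Phi> (u, w) + m * (\<bar>Y u w - y0 u w\<bar> + norm (Z u w - z))"
            using \<open>\<forall>u\<in>{t..b}. \<forall>y zz. sg * g u w y zz \<le> \<Phi> (u, w) + m * (\<bar>y - y0 u w\<bar> + norm (zz - z))\<close> u by blast
          also have "\<dots> \<le> \<Phi> (u, w) + m * ((\<bar>Vt (u, w)\<bar> + d (u, w)) + sqrt (Hq (u, w)))"
          proof (intro add_left_mono mult_left_mono add_mono m)
            have "Vt (u, w) = U w u" using V_U[OF reg, of u] u by (simp add: Vt_def)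
            then have "Y u w - y0 u w = Vt (u, w) + (x w + z \<bullet> (B u w - B t w) - y0 u w)"
              unfolding U_def[OF reg] by simp
            then show "\<bar>Y u w - y0 u w\<bar> \<le> \<bar>Vt (u, w)\<bar> + d (u, w)"
              using \<open>\<forall>u\<in>{t..\<tau> w}. \<bar>x w + z \<bullet> (B u w - B t w) - y0 u w\<bar> \<le> d (u, w)\<close> u by force
            show "norm (Z u w - z) \<le> sqrt (Hq (u, w))" using True by (simp add: Hq_def H_def zero_after_def)
          qed
          finally show ?thesis using True u by (simp add: f_def e_def algebra_simps)
        next
          case False
          then have "indicator {t..\<tau> w} u = (0::real)" "f (u, w) = 0" using elim by (auto simp: f_def)
          then show ?thesis using m e0 by simp
        qed
      qed
    qed
    also have "\<dots> = (\<integral>u. f (u, w) \<partial>lborel) + m * (\<integral>u. e (u, w) \<partial>lborel)"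
      using elim(4,5) by simp
    finally show ?case .
  qed
  have AM[measurable]: "A \<in> sets M" using A sets_F_sub by auto
  have mI: "integrable M (\<lambda>w. indicator A w * f w)" if "integrable M f" for f :: "'a \<Rightarrow> real"
    using integrable_mult_indicator[OF AM that] by simp
  have "(\<integral>w. indicator A w * (sg * drift t w) \<partial>M) \<le> (\<integral>w. indicator A w * (\<integral>u. f (u, w) \<partial>lborel) + m * (\<integral>u. e (u, w) \<partial>lborel) \<partial>M)"
  proof (rule integral_mono_AE)
    show "integrable M (\<lambda>w. indicator A w * (sg * drift t w))" by (intro mI integrable_mult_right representation(1))
    show "integrable M (\<lambda>w. indicator A w * (\<integral>u. f (u, w) \<partial>lborel) + m * (\<integral>u. e (u, w) \<partial>lborel))"
      using J Je unfolding fe by (intro Bochner_Integration.integrable_add mI integrable_mult_right)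
    show "AE w in M. indicator A w * (sg * drift t w) \<le> indicator A w * (\<integral>u. f (u, w) \<partial>lborel) + m * (\<integral>u. e (u, w) \<partial>lborel)"
      using path
    proof eventually_elim
      case (elim w)
      have "0 \<le> m * (\<integral>u. e (u, w) \<partial>lborel)" using m e0 by (intro mult_nonneg_nonneg Bochner_Integration.integral_nonneg) auto
      then show ?case using elim by (auto split: split_indicator)
    qed
  qed
  also have "\<dots> = (\<integral>w. indicator A w * (\<integral>u. f (u, w) \<partial>lborel) \<partial>M) + m * (\<integral>p. e p \<partial>lM)"
    using mI[OF J[unfolded fe]] Je by (simp add: e_tot)
  finally show "(\<integral>w. indicator A w * (sg * drift t w) \<partial>M) \<le>
      (\<integral>w. indicator A w * (\<integral>u. (if t < u \<and> u \<le> \<tau> w then \<Phi> (u, w) + m * d (u, w) else 0) \<partial>lborel) \<partial>M)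
      + m * (\<integral>p. \<bar>Vt p\<bar> + sqrt (Hq p) \<partial>lM)"
    by (simp add: f_def e_def)
qed

end

section \<open>Lipschitz envelopes of the generators\<close>

locale dominated_setting = brownian_setting M B F
  for M :: "'a measure" and B :: "real \<Rightarrow> 'a \<Rightarrow> real ^ 'd::finite" and F +
  fixes T c :: real and \<gamma> y0 :: "real \<Rightarrow> 'a \<Rightarrow> real" and S :: "'a \<Rightarrow> real" and z :: "real ^ 'd"
  assumes T_pos: "0 < T" and c_pos: "0 < c"
    and \<gamma>_joint: "joint T \<gamma>" and \<gamma>_nonneg: "\<And>u w. u \<in> {0..T} \<Longrightarrow> w \<in> space M \<Longrightarrow> 0 \<le> \<gamma> u w"
    and \<gamma>_L2: "integrable lM (\<lambda>p. indicator {0..T} (fst p) * (\<gamma> (fst p) (snd p))\<^sup>2)"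
    and y0_meas: "\<And>u. u \<in> {0..T} \<Longrightarrow> y0 u \<in> borel_measurable (F u)" and y0_joint: "joint T y0"
    and y0_cont: "AE w in M. continuous_on {0..T} (\<lambda>u. y0 u w)"
    and S_meas: "S \<in> borel_measurable M" and S_L2: "integrable M (\<lambda>w. (S w)\<^sup>2)"
    and y0_S: "AE w in M. \<forall>u\<in>{0..T}. \<bar>y0 u w\<bar> \<le> S w"
begin

text \<open>Growth is measured with the fixed \<open>c\<close> and \<open>\<gamma>\<close> of the
  locale, so that \<open>g1\<close>, \<open>g2\<close> and \<open>- g2\<close> are admissible with
  the same constants.\<close>

definition adm :: "(real \<Rightarrow> 'a \<Rightarrow> real \<Rightarrow> real ^ 'd \<Rightarrow> real) \<Rightarrow> bool" where
  "adm g \<longleftrightarrow> generator F T g \<and> continuous_generator M T g \<and>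
    (AE w in M. \<forall>u\<in>{0..T}. \<forall>y z. \<bar>g u w y z\<bar> \<le> c * (\<gamma> u w + \<bar>y\<bar> + norm z))"

lemma adm_uminus: "adm g \<Longrightarrow> adm (\<lambda>u w y z. - g u w y z)"
proof -
  assume g: "adm g"
  have "progressively_measurable F T (\<lambda>t w. - g t w y z)" for y z
    using g unfolding adm_def generator_def progressively_measurable_def
    by (auto simp: case_prod_beta' intro!: borel_measurable_uminus)
  moreover have "continuous_generator M T (\<lambda>u w y z. - g u w y z)"
    using g unfolding adm_def continuous_generator_def
    by (auto simp: case_prod_beta' intro!: continuous_on_minus elim!: eventually_mono)
  ultimately show ?thesis using g by (simp add: adm_def generator_def)
qed

definition good :: "(real \<Rightarrow> 'a \<Rightarrow> real \<Rightarrow> real ^ 'd \<Rightarrow> real) \<Rightarrow> 'a set" where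
  "good g = {w\<in>space M. \<forall>u\<in>{0..T}. (\<forall>y z. \<bar>g u w y z\<bar> \<le> c * (\<gamma> u w + \<bar>y\<bar> + norm z)) \<and>
    continuous_on UNIV (\<lambda>(y, z). g u w y z)}"

text \<open>Zero off the set of paths with growth and continuity, so that the assumptions on
  envelopes hold at every point of the product and the envelope is measurable there.\<close>

definition trunc :: "(real \<Rightarrow> 'a \<Rightarrow> real \<Rightarrow> real ^ 'd \<Rightarrow> real) \<Rightarrow> real \<times> 'a \<Rightarrow> real \<times> (real ^ 'd) \<Rightarrow> real" where
  "trunc g p q = indicator {0..T} (fst p) * (indicator (good g) (snd p) * g (fst p) (snd p) (fst q) (snd q))"

definition \<gamma>\<^sub>0 :: "real \<times> 'a \<Rightarrow> real" where
  "\<gamma>\<^sub>0 p = (if fst p \<in> {0..T} \<and> snd p \<in> space M then \<gamma> (fst p) (snd p) else 0)"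

definition env :: "(real \<Rightarrow> 'a \<Rightarrow> real \<Rightarrow> real ^ 'd \<Rightarrow> real) \<Rightarrow> real \<Rightarrow> real \<times> 'a \<Rightarrow> real" where
  "env g m p = indicator {0..T} (fst p) * sup_conv m (trunc g p) (indicator {0..T} (fst p) *\<^sub>R y0 (fst p) (snd p), z)"

lemma AE_good:
  assumes "adm g"
  shows "AE w in M. w \<in> good g"
  using assms[unfolded adm_def continuous_generator_def, THEN conjunct2, THEN conjunct1]
    assms[unfolded adm_def, THEN conjunct2, THEN conjunct2] AE_space
  by eventually_elim (auto simp: good_def)

lemma good_sets:
  assumes "adm g"
  shows "good g \<in> sets (F t)"
proof (rule sets_AE_eq[of "space M"])
  show "space M \<in> sets (F t)" using sets.top[of "F t"] by (simp add: space_F)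
  show "null_sets M \<subseteq> sets (F t)" using null_in_F by auto
  show "AE w in M. w \<in> space M \<longleftrightarrow> w \<in> good g" using AE_good[OF assms] AE_space by eventually_elim simp
qed (auto simp: good_def space_F)

lemma \<gamma>\<^sub>0_nonneg: "0 \<le> \<gamma>\<^sub>0 p" using \<gamma>_nonneg by (simp add: \<gamma>\<^sub>0_def)

text \<open>The factor 2 comes from \<open>\<bar>y\<bar> + norm \<zeta>\<close> being at most twice
  the norm of the pair.\<close>

lemma trunc_growth: "\<bar>trunc g p q\<bar> \<le> (2 * c) * (\<gamma>\<^sub>0 p + norm q)"
proof (cases "fst p \<in> {0..T} \<and> snd p \<in> good g")
  case True
  then have m: "snd p \<in> space M" by (simp add: good_def)
  obtain y \<zeta> where q: "q = (y, \<zeta>)" by (cases q)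
  have "\<bar>trunc g p q\<bar> \<le> c * (\<gamma> (fst p) (snd p) + \<bar>y\<bar> + norm \<zeta>)" using True by (simp add: trunc_def good_def q)
  also have "\<dots> \<le> c * (2 * (\<gamma> (fst p) (snd p) + norm q))"
    using norm_fst_le[of y \<zeta>] norm_snd_le[of \<zeta> y] c_pos \<gamma>_nonneg[of "fst p" "snd p"] True m
    by (intro mult_left_mono) (auto simp: q)
  also have "\<dots> = (2 * c) * (\<gamma> (fst p) (snd p) + norm q)" by simp
  finally show ?thesis using True m by (simp only: \<gamma>\<^sub>0_def) simp
next
  case False
  have "0 \<le> 2 * c * (\<gamma>\<^sub>0 p + norm q)" using c_pos \<gamma>\<^sub>0_nonneg by simp
  then show ?thesis using False by (auto simp: trunc_def)
qed

lemma trunc_cont: "continuous_on UNIV (trunc g p)"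
proof (cases "fst p \<in> {0..T} \<and> snd p \<in> good g")
  case True
  then have "trunc g p = (\<lambda>(y, \<zeta>). g (fst p) (snd p) y \<zeta>)" by (auto simp: trunc_def fun_eq_iff)
  then show ?thesis using True by (simp add: good_def)
next
  case False
  then have "trunc g p = (\<lambda>_. 0)" by (auto simp: trunc_def fun_eq_iff)
  then show ?thesis by simp
qed

lemma env_joint:
  assumes "adm g" "2 * c \<le> m"
  shows "env g m \<in> borel_measurable lM"
  unfolding env_def
proof (intro borel_measurable_times indicator_fst_measurable measurable_sup_conv)
  show "(\<lambda>p. trunc g p q) \<in> borel_measurable lM" for q
  proof -
    have "progressively_measurable F T (\<lambda>u w. g u w (fst q) (snd q))" using assms by (simp add: adm_def generator_def)
    from prog_joint[OF this] T_pos
    have "(\<lambda>p. indicator {0..T} (fst p) *\<^sub>R g (fst p) (snd p) (fst q) (snd q)) \<in> borel_measurable lM"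
      by (simp add: joint_def)
    moreover have "good g \<in> sets M" using good_sets[OF assms(1), of 0] sets_F_sub by auto
    ultimately have "(\<lambda>p. indicator (good g) (snd p) * (indicator {0..T} (fst p) *\<^sub>R g (fst p) (snd p) (fst q) (snd q))) \<in> borel_measurable lM"
      by measurable
    then show ?thesis by (simp add: trunc_def mult.left_commute)
  qed
  show "(\<lambda>p. (indicator {0..T} (fst p) *\<^sub>R y0 (fst p) (snd p), z)) \<in> borel_measurable lM"
    using y0_joint unfolding joint_def by (intro borel_measurable_Pair) auto
  show "\<exists>c \<gamma>. 0 < c \<and> c \<le> m \<and> (\<forall>q. \<bar>trunc g p q\<bar> \<le> c * (\<gamma> + norm q))" for p
    using trunc_growth assms(2) c_pos by (intro exI[of _ "2 * c"] exI[of _ "\<gamma>\<^sub>0 p"]) auto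
qed

lemma env_section:
  assumes "adm g" "2 * c \<le> m" and t: "t \<in> {0..T}"
  shows "(\<lambda>w. env g m (t, w)) \<in> borel_measurable (F t)"
  unfolding env_def fst_conv snd_conv
proof (intro borel_measurable_times borel_measurable_const measurable_sup_conv)
  show "(\<lambda>w. trunc g (t, w) q) \<in> borel_measurable (F t)" for q
  proof -
    have "progressively_measurable F T (\<lambda>u w. g u w (fst q) (snd q))" using assms by (simp add: adm_def generator_def)
    from prog_section[OF this t] have [measurable]: "(\<lambda>w. g t w (fst q) (snd q)) \<in> borel_measurable (F t)" .
    note [measurable] = good_sets[OF assms(1), of t]
    show ?thesis using t by (simp add: trunc_def)
  qed
  show "(\<lambda>w. (indicator {0..T} t *\<^sub>R y0 t w, z)) \<in> borel_measurable (F t)"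
    using y0_meas[OF t] by (intro borel_measurable_Pair) auto
  show "\<exists>c \<gamma>. 0 < c \<and> c \<le> m \<and> (\<forall>q. \<bar>trunc g (t, w) q\<bar> \<le> c * (\<gamma> + norm q))" for w
    using trunc_growth assms(2) c_pos by (intro exI[of _ "2 * c"] exI[of _ "\<gamma>\<^sub>0 (t, w)"]) auto
qed

lemma env_abs:
  assumes "2 * c \<le> m" "u \<in> {0..T}" "w \<in> space M"
  shows "\<bar>env g m (u, w)\<bar> \<le> (2 * c) * (\<gamma> u w + \<bar>y0 u w\<bar> + norm z)"
proof -
  have "\<bar>env g m (u, w)\<bar> \<le> (2 * c) * (\<gamma>\<^sub>0 (u, w) + norm (y0 u w, z))"
    using abs_sup_conv_le[OF trunc_growth _ assms(1) trunc_cont, of g "(u, w)" "(y0 u w, z)"] c_pos assms(2)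
    by (simp add: env_def)
  also have "\<dots> \<le> (2 * c) * (\<gamma> u w + (\<bar>y0 u w\<bar> + norm z))"
    using c_pos assms norm_Pair_le[of "y0 u w" z] by (intro mult_left_mono add_mono) (auto simp: \<gamma>\<^sub>0_def)
  finally show ?thesis by (simp add: add.assoc)
qed

lemma env_outside: "u \<notin> {0..T} \<Longrightarrow> env g m (u, w) = 0"
  by (simp add: env_def)

lemma env_upper:
  assumes "adm g" "2 * c \<le> m"
  shows "AE w in M. \<forall>u\<in>{0..T}. \<forall>y \<zeta>. g u w y \<zeta> \<le> env g m (u, w) + m * (\<bar>y - y0 u w\<bar> + norm (\<zeta> - z))"
  using AE_good[OF assms(1)]
proof (eventually_elim, intro ballI allI)
  fix w u y \<zeta> assume w: "w \<in> good g" and u: "u \<in> {0..T}"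
  have "trunc g (u, w) (y, \<zeta>) - m * norm ((y, \<zeta>) - (y0 u w, z)) \<le> env g m (u, w)"
    using sup_conv_lower[OF trunc_growth _ assms(2) trunc_cont, of g "(u, w)" "(y, \<zeta>)" "(y0 u w, z)"] c_pos u
    by (simp add: env_def)
  moreover have "m * norm ((y, \<zeta>) - (y0 u w, z)) \<le> m * (\<bar>y - y0 u w\<bar> + norm (\<zeta> - z))"
    using c_pos assms(2) norm_Pair_le[of "y - y0 u w" "\<zeta> - z"] by (intro mult_left_mono) auto
  moreover have "trunc g (u, w) (y, \<zeta>) = g u w y \<zeta>" using w u by (simp add: trunc_def)
  ultimately show "g u w y \<zeta> \<le> env g m (u, w) + m * (\<bar>y - y0 u w\<bar> + norm (\<zeta> - z))" by linarith
qed

lemma env_tendsto: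
  assumes "adm g"
  shows "AE w in M. \<forall>u\<in>{0..T}. (\<lambda>k. env g (real k) (u, w)) \<longlonglongrightarrow> g u w (y0 u w) z"
  using AE_good[OF assms(1)]
proof (eventually_elim, intro ballI)
  fix w u assume w: "w \<in> good g" and u: "u \<in> {0..T}"
  show "(\<lambda>k. env g (real k) (u, w)) \<longlonglongrightarrow> g u w (y0 u w) z"
    using sup_conv_tendsto[OF trunc_growth _ trunc_cont, of g "(u, w)" "(y0 u w, z)"] c_pos u w
    by (simp add: env_def trunc_def)
qed

section \<open>Integrable majorants and displacement\<close>

text \<open>One square integrable majorant for three things: the envelopes, the displacement
  \<open>disp\<close>, and \<open>\<Gamma>\<close> on the window. The 1 accounts for the bounded
  increment of \<open>z \<bullet> B\<close>.\<close>

definition dom :: "real \<times> 'a \<Rightarrow> real" where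
  "dom p = indicator {0..T} (fst p) * (\<gamma> (fst p) (snd p) + (S (snd p) + 1 + norm z))"

lemma dom_integrable: "integrable lM dom"
proof -
  let ?Q = "lM"
  have I0: "integrable ?Q (\<lambda>p. indicator {0..T} (fst p) * (1::real))"
    using T_pos by (intro integrable_tensor lborel.sigma_finite_measure_axioms sigma_finite_measure_axioms)
      (simp_all add: integrable_indicator_iff)
  have I1: "integrable ?Q (\<lambda>p. indicator {0..T} (fst p) * (S (snd p) + 1 + norm z))"
    using T_pos by (intro integrable_tensor lborel.sigma_finite_measure_axioms sigma_finite_measure_axioms
      Bochner_Integration.integrable_add integrable_of_sq[OF S_meas S_L2])
      (simp_all add: integrable_indicator_iff)
  have I2: "integrable ?Q (\<lambda>p. indicator {0..T} (fst p) * \<gamma> (fst p) (snd p))"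
  proof (rule Bochner_Integration.integrable_bound[OF Bochner_Integration.integrable_add[OF I0 \<gamma>_L2]])
    show "(\<lambda>p. indicator {0..T} (fst p) * \<gamma> (fst p) (snd p)) \<in> borel_measurable ?Q"
      using \<gamma>_joint by (simp add: joint_def)
    have le: "\<bar>v\<bar> \<le> 1 + v\<^sup>2" for v :: real using abs_mult_le_sq[of v 1] by simp
    show "AE p in ?Q. norm (indicator {0..T} (fst p) * \<gamma> (fst p) (snd p))
      \<le> norm (indicator {0..T} (fst p) * (1::real) + indicator {0..T} (fst p) * (\<gamma> (fst p) (snd p))\<^sup>2)"
      using le by (auto intro!: AE_I2 split: split_indicator)
  qed
  show ?thesis unfolding dom_def[abs_def] distrib_left[of _ "\<gamma> _ _"]
    by (intro Bochner_Integration.integrable_add I1 I2)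
qed

lemma env_le_dom:
  assumes "2 * c \<le> m"
  shows "AE w in M. \<forall>u. \<bar>env g m (u, w)\<bar> \<le> 2 * c * dom (u, w)"
  using y0_S AE_space
proof (eventually_elim, intro allI)
  fix w u assume w: "\<forall>u\<in>{0..T}. \<bar>y0 u w\<bar> \<le> S w" "w \<in> space M"
  show "\<bar>env g m (u, w)\<bar> \<le> 2 * c * dom (u, w)"
  proof (cases "u \<in> {0..T}")
    case True
    have "\<bar>env g m (u, w)\<bar> \<le> (2 * c) * (\<gamma> u w + \<bar>y0 u w\<bar> + norm z)" by (rule env_abs[OF assms True w(2)])
    also have "\<dots> \<le> (2 * c) * (\<gamma> u w + (S w + 1 + norm z))"
      using bspec[OF w(1) True] c_pos by (intro mult_left_mono) linarith+
    finally show ?thesis using True by (simp add: dom_def)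
  qed (simp add: env_outside dom_def)
qed

lemma env_integrable:
  assumes "adm g" "2 * c \<le> m"
  shows "integrable lM (env g m)"
proof (rule Bochner_Integration.integrable_bound[OF integrable_mult_right[OF dom_integrable] env_joint[OF assms]])
  show "AE p in lM. norm (env g m p) \<le> norm (2 * c * dom p)"
    using AE_snd_lift[OF env_le_dom[OF assms(2)], of g]
  proof eventually_elim
    case (elim p)
    then have "\<bar>env g m (fst p, snd p)\<bar> \<le> 2 * c * dom (fst p, snd p)" by blast
    then show ?case by simp
  qed
qed

lemma dom_sq_integrable: "integrable lM (\<lambda>p. (dom p)\<^sup>2)"
proof (rule Bochner_Integration.integrable_bound)
  have "integrable M (\<lambda>w. (norm (S w + (1 + norm z)))\<^sup>2)"
    using S_L2 S_meas by (intro integrable_sq_add) auto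
  then have "integrable M (\<lambda>w. (S w + 1 + norm z)\<^sup>2)" by (simp add: add.assoc)
  then have "integrable lM (\<lambda>p. indicator {0..T} (fst p) * (S (snd p) + 1 + norm z)\<^sup>2)"
    using T_pos by (intro integrable_tensor lborel.sigma_finite_measure_axioms sigma_finite_measure_axioms)
      (simp_all add: integrable_indicator_iff)
  then show "integrable lM (\<lambda>p. 2 * (indicator {0..T} (fst p) * (\<gamma> (fst p) (snd p))\<^sup>2)
      + 2 * (indicator {0..T} (fst p) * (S (snd p) + 1 + norm z)\<^sup>2))"
    by (intro Bochner_Integration.integrable_add integrable_mult_right \<gamma>_L2)
  show "(\<lambda>p. (dom p)\<^sup>2) \<in> borel_measurable lM"
    using borel_measurable_integrable[OF dom_integrable] by measurable
  show "AE p in lM. norm ((dom p)\<^sup>2) \<le> norm (2 * (indicator {0..T} (fst p) * (\<gamma> (fst p) (snd p))\<^sup>2)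
      + 2 * (indicator {0..T} (fst p) * (S (snd p) + 1 + norm z)\<^sup>2))"
  proof (rule AE_I2)
    fix p :: "real \<times> 'a"
    show "norm ((dom p)\<^sup>2) \<le> norm (2 * (indicator {0..T} (fst p) * (\<gamma> (fst p) (snd p))\<^sup>2)
      + 2 * (indicator {0..T} (fst p) * (S (snd p) + 1 + norm z)\<^sup>2))"
      using sq_norm_add_le[of "\<gamma> (fst p) (snd p)" "S (snd p) + 1 + norm z"] by (cases "fst p \<in> {0..T}") (simp_all add: dom_def)
  qed
qed

text \<open>The cap at 1 has no effect up to the exit time and makes \<open>disp\<close> square integrable by domination.\<close>

definition disp :: "real \<Rightarrow> real \<times> 'a \<Rightarrow> real" where
  "disp t p = indicator {0..T} (fst p) *
    (\<bar>y0 (fst p) (snd p) - y0 t (snd p)\<bar> + min 1 \<bar>z \<bullet> (W (fst p) (snd p) - W t (snd p))\<bar>)"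

lemma disp_nonneg: "0 \<le> disp t p"
  by (simp add: disp_def)

lemma disp_le_dom:
  assumes t: "t \<in> {0..T}"
  shows "AE w in M. \<forall>u. disp t (u, w) \<le> 2 * dom (u, w)"
  using y0_S AE_space
proof (eventually_elim, intro allI)
  fix w u assume w: "\<forall>u\<in>{0..T}. \<bar>y0 u w\<bar> \<le> S w" "w \<in> space M"
  show "disp t (u, w) \<le> 2 * dom (u, w)"
  proof (cases "u \<in> {0..T}")
    case True
    have "\<bar>y0 u w - y0 t w\<bar> \<le> S w + S w"
      using bspec[OF w(1) True] bspec[OF w(1) t] by linarith
    moreover have "min 1 \<bar>z \<bullet> (W u w - W t w)\<bar> \<le> 1" by simp
    ultimately have "disp t (u, w) \<le> S w + S w + 1" using True by (simp add: disp_def)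
    also have "\<dots> \<le> 2 * dom (u, w)" using True \<gamma>_nonneg[OF True w(2)] norm_ge_zero[of z] by (simp add: dom_def)
    finally show ?thesis .
  qed (simp add: disp_def dom_def)
qed

lemma disp_integrable:
  assumes t: "t \<in> {0..T}"
  shows "integrable lM (disp t)"
proof (rule Bochner_Integration.integrable_bound[OF integrable_mult_right[OF dom_integrable, of 2]])
  note [measurable] = y0_joint[unfolded joint_def] measurable_F_M[OF y0_meas[OF t]] W_joint W_meas_M[of t]
  have "(\<lambda>p. indicator {0..T} (fst p) * (\<bar>indicator {0..T} (fst p) *\<^sub>R y0 (fst p) (snd p) - y0 t (snd p)\<bar>
    + min 1 \<bar>z \<bullet> (W (fst p) (snd p) - W t (snd p))\<bar>)) \<in> borel_measurable lM"
    by measurable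
  also have "(\<lambda>p. indicator {0..T} (fst p) * (\<bar>indicator {0..T} (fst p) *\<^sub>R y0 (fst p) (snd p) - y0 t (snd p)\<bar>
    + min 1 \<bar>z \<bullet> (W (fst p) (snd p) - W t (snd p))\<bar>)) = disp t"
    by (auto simp: fun_eq_iff disp_def split: split_indicator)
  finally show "disp t \<in> borel_measurable lM" .
  show "AE p in lM. norm (disp t p) \<le> norm (2 * dom p)"
    using AE_snd_lift[OF disp_le_dom[OF t]]
  proof eventually_elim
    case (elim p)
    then have "disp t (fst p, snd p) \<le> 2 * dom (fst p, snd p)" by blast
    then show ?case using disp_nonneg[of t p] by simp
  qed
qed

lemma dom2_integrable: "integrable lborel (\<lambda>u. \<integral>w. (dom (u, w))\<^sup>2 \<partial>M)"
  by (rule lp.integrable_fst) (use dom_sq_integrable in \<open>simp add: case_prod_beta'\<close>)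

text \<open>Expresses the energy of the data over a window by the average of the second moment of
  \<open>dom\<close>; where these averages are bounded, this supplies the constant
  \<open>CG\<close>.\<close>

lemma dom_window:
  fixes t :: real and n :: nat
  defines "J \<equiv> indicator {t..t + 1 / real (Suc n)} :: real \<Rightarrow> real"
  shows "integrable lM (\<lambda>p. J (fst p) * (dom p)\<^sup>2)"
    and "(\<integral>p. J (fst p) * (dom p)\<^sup>2 \<partial>lM) = fwd_avg n (\<lambda>u. \<integral>w. (dom (u, w))\<^sup>2 \<partial>M) t / real (Suc n)"
    and "integrable M (\<lambda>w. fwd_avg n (\<lambda>u. (dom (u, w))\<^sup>2) t)"
    and "(\<integral>w. fwd_avg n (\<lambda>u. (dom (u, w))\<^sup>2) t \<partial>M) = fwd_avg n (\<lambda>u. \<integral>w. (dom (u, w))\<^sup>2 \<partial>M) t"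
proof -
  show I: "integrable lM (\<lambda>p. J (fst p) * (dom p)\<^sup>2)"
  proof (rule Bochner_Integration.integrable_bound[OF dom_sq_integrable])
    show "(\<lambda>p. J (fst p) * (dom p)\<^sup>2) \<in> borel_measurable lM"
      unfolding J_def using borel_measurable_integrable[OF dom_sq_integrable] by (intro borel_measurable_times indicator_fst_measurable)
  qed (auto simp: J_def split: split_indicator)
  have I': "integrable lM (\<lambda>(u, w). J u * (dom (u, w))\<^sup>2)" using I by (simp add: case_prod_beta')
  have e: "(\<integral>p. J (fst p) * (dom p)\<^sup>2 \<partial>lM) = (\<integral>u. (\<integral>w. J u * (dom (u, w))\<^sup>2 \<partial>M) \<partial>lborel)"
    "(\<integral>p. J (fst p) * (dom p)\<^sup>2 \<partial>lM) = (\<integral>w. (\<integral>u. J u * (dom (u, w))\<^sup>2 \<partial>lborel) \<partial>M)"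
    using lp.integral_fst[OF I'] lp.integral_snd[OF I'] by (simp_all add: case_prod_beta')
  show e1: "(\<integral>p. J (fst p) * (dom p)\<^sup>2 \<partial>lM) = fwd_avg n (\<lambda>u. \<integral>w. (dom (u, w))\<^sup>2 \<partial>M) t / real (Suc n)"
    unfolding e(1) by (simp add: fwd_avg_def J_def)
  show "integrable M (\<lambda>w. fwd_avg n (\<lambda>u. (dom (u, w))\<^sup>2) t)"
    unfolding fwd_avg_def using lp.integrable_snd[OF I'] by (simp add: J_def)
  show "(\<integral>w. fwd_avg n (\<lambda>u. (dom (u, w))\<^sup>2) t \<partial>M) = fwd_avg n (\<lambda>u. \<integral>w. (dom (u, w))\<^sup>2 \<partial>M) t"
  proof -
    have mult: "x = f / N \<Longrightarrow> N \<noteq> 0 \<Longrightarrow> N * x = f" for x f N :: real by simp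
    have "(\<integral>w. fwd_avg n (\<lambda>u. (dom (u, w))\<^sup>2) t \<partial>M) = real (Suc n) * (\<integral>w. (\<integral>u. J u * (dom (u, w))\<^sup>2 \<partial>lborel) \<partial>M)"
      unfolding fwd_avg_def J_def by (rule integral_mult_right_zero)
    also have "\<dots> = fwd_avg n (\<lambda>u. \<integral>w. (dom (u, w))\<^sup>2 \<partial>M) t"
      by (rule mult[OF e1[unfolded e(2)]]) simp
    finally show ?thesis .
  qed
qed

lemma AE_path_integrable:
  fixes f :: "real \<times> 'a \<Rightarrow> real"
  assumes "integrable lM f"
  shows "AE w in M. integrable lborel (\<lambda>u. f (u, w))"
  using lp.AE_integrable_snd[of "\<lambda>u w. f (u, w)"] assms by (simp add: case_prod_beta')

lemma disp_right_cont:
  assumes t: "t \<in> {0..T}" and cont: "continuous_on {0..T} (\<lambda>u. y0 u w)" and "0 < e"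
  shows "\<exists>\<delta>>0. \<forall>u\<in>{t..t + \<delta>}. \<bar>disp t (u, w)\<bar> \<le> e"
proof -
  obtain d1 where d1: "d1 > 0" "\<And>u. u \<in> {0..T} \<Longrightarrow> dist u t < d1 \<Longrightarrow> dist (y0 u w) (y0 t w) < e / 2"
    using cont t \<open>0 < e\<close> unfolding continuous_on_iff by (meson half_gt_zero)
  have "continuous_on UNIV (\<lambda>u. z \<bullet> W u w)" by (intro continuous_intros W_cont)
  then obtain d2 where d2: "d2 > 0" "\<And>u. dist u t < d2 \<Longrightarrow> dist (z \<bullet> W u w) (z \<bullet> W t w) < e / 2"
    using \<open>0 < e\<close> unfolding continuous_on_iff by (meson UNIV_I half_gt_zero)
  have "\<bar>disp t (u, w)\<bar> \<le> e" if u: "u \<in> {t..t + min d1 d2 / 2}" for u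
  proof (cases "u \<in> {0..T}")
    case True
    have "dist u t < d1" "dist u t < d2" using u d1(1) d2(1) by (auto simp: dist_real_def)
    from d1(2)[OF True this(1)] d2(2)[OF this(2)]
    have "\<bar>y0 u w - y0 t w\<bar> \<le> e / 2" "\<bar>z \<bullet> (W u w - W t w)\<bar> \<le> e / 2"
      by (auto simp: dist_real_def inner_diff_right)
    then have "\<bar>y0 u w - y0 t w\<bar> \<le> e / 2" "min 1 \<bar>z \<bullet> (W u w - W t w)\<bar> \<le> e / 2" by linarith+
    moreover have "0 \<le> \<bar>y0 u w - y0 t w\<bar> + min 1 \<bar>z \<bullet> (W u w - W t w)\<bar>" by simp
    ultimately show ?thesis using True by (simp add: disp_def)
  qed (use \<open>0 < e\<close> in \<open>simp add: disp_def\<close>)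
  then show ?thesis using d1(1) d2(1) by (intro exI[of _ "min d1 d2 / 2"]) auto
qed

lemma fwd_avg_disp_tendsto:
  assumes t: "t \<in> {0..T}" and cont: "continuous_on {0..T} (\<lambda>u. y0 u w)"
    and n: "(\<lambda>k. 1 / real (Suc (n k))) \<longlonglongrightarrow> 0"
  shows "(\<lambda>k. fwd_avg (n k) (\<lambda>u. disp t (u, w)) t) \<longlonglongrightarrow> 0"
proof (rule LIMSEQ_I)
  fix e :: real assume "0 < e"
  then obtain \<delta> where \<delta>: "\<delta> > 0" "\<And>u. u \<in> {t..t + \<delta>} \<Longrightarrow> \<bar>disp t (u, w)\<bar> \<le> e / 2"
    using disp_right_cont[OF t cont, of "e / 2"] by auto
  have "\<forall>\<^sub>F k in sequentially. 1 / real (Suc (n k)) < \<delta>" using order_tendstoD(2)[OF n \<delta>(1)] .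
  then obtain k0 where k0: "\<And>k. k0 \<le> k \<Longrightarrow> 1 / real (Suc (n k)) < \<delta>" by (auto simp: eventually_sequentially)
  have "\<bar>fwd_avg (n k) (\<lambda>u. disp t (u, w)) t\<bar> \<le> e / 2" if "k0 \<le> k" for k
    by (rule fwd_avg_abs_le, rule \<delta>(2)) (use k0[OF that] in auto)
  then have "\<bar>fwd_avg (n k) (\<lambda>u. disp t (u, w)) t\<bar> < e" if "k0 \<le> k" for k
    using that \<open>0 < e\<close> by fastforce
  then show "\<exists>no. \<forall>k\<ge>no. norm (fwd_avg (n k) (\<lambda>u. disp t (u, w)) t - 0) < e" by auto
qed

end

section \<open>Comparing the two solutions\<close>

locale comparison_setting = dominated_setting M B F T c \<gamma> y0 S z
  for M :: "'a measure" and B :: "real \<Rightarrow> 'a \<Rightarrow> real ^ 'd::finite" and F T c \<gamma> y0 S z +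
  fixes g1 g2 :: "real \<Rightarrow> 'a \<Rightarrow> real \<Rightarrow> real ^ 'd \<Rightarrow> real" and L :: "real \<Rightarrow> 'a \<Rightarrow> real"
  assumes g1: "adm g1" and g2: "adm g2"
    and L_prog: "progressively_measurable F T L"
    and L_cont: "AE w in M. continuous_on {0..T} (\<lambda>u. L u w)"
    and L_below: "AE w in M. \<forall>u\<in>{0..T}. L u w < y0 u w"
    and comparable_solutions: "\<And>\<tau> \<xi>.
      \<lbrakk>stopping_time F \<tau>; \<And>w. w \<in> space M \<Longrightarrow> \<tau> w \<in> {0<..T};
       L2_variable M (pre_sigma \<tau>) \<xi>;
       AE w in M. L (\<tau> w) w \<le> \<xi> w\<rbrakk> \<Longrightarrow>
      \<exists>Y1 Z1 K1 Y2 Z2 K2.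
        rbsde_solution M F B T g1 \<tau> \<xi> L Y1 Z1 K1 \<and>
        rbsde_solution M F B T g2 \<tau> \<xi> L Y2 Z2 K2 \<and>
        (\<forall>t\<in>{0..T}. AE w in M.
           Y1 (min t (\<tau> w)) w \<ge> Y2 (min t (\<tau> w)) w \<and>
           real_cond_exp M (F t) (\<lambda>w. K1 (\<tau> w) w - K1 (min t (\<tau> w)) w) w
             \<le> real_cond_exp M (F t) (\<lambda>w. K2 (\<tau> w) w - K2 (min t (\<tau> w)) w) w)"
begin

lemma y0_L2: "u \<in> {0..T} \<Longrightarrow> integrable M (\<lambda>w. (y0 u w)\<^sup>2)"
proof (rule Bochner_Integration.integrable_bound[OF S_L2])
  assume u: "u \<in> {0..T}"
  show "(\<lambda>w. (y0 u w)\<^sup>2) \<in> borel_measurable M" using measurable_F_M[OF y0_meas[OF u]] by measurable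
  show "AE w in M. norm ((y0 u w)\<^sup>2) \<le> norm ((S w)\<^sup>2)"
    using y0_S
  proof eventually_elim
    case (elim w)
    then show ?case using power_mono[of "\<bar>y0 u w\<bar>" "S w" 2] u by simp
  qed
qed

section \<open>The exit time and the comparison of drifts\<close>

text \<open>The second term keeps the reference process \<open>y0 t + z \<bullet> (B - B t)\<close> within distance 1 of its initial
  value, so that the growth of the generator along it is controlled at time \<open>t\<close>.\<close>

definition margin :: "real \<Rightarrow> 'a \<Rightarrow> real \<Rightarrow> real" where
  "margin t w s = min (y0 t w + z \<bullet> (B s w - B t w) - L s w) (1 - \<bar>z \<bullet> (B s w - B t w)\<bar>)"

definition exit_time :: "real \<Rightarrow> real \<Rightarrow> 'a \<Rightarrow> real" where
  "exit_time t b w = hit t b (margin t w)"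

context
  fixes t b :: real assumes tb: "0 < t" "t < b" "b \<le> T"
begin

lemma margin_path: "AE w in M. continuous_on {t..b} (margin t w) \<and> 0 < margin t w t"
  using B_cont L_cont L_below
proof eventually_elim
  case (elim w)
  have [continuous_intros]: "continuous_on {t..b} (\<lambda>s. B s w)" "continuous_on {t..b} (\<lambda>s. L s w)"
    by (rule continuous_on_subset[OF elim(1)], use tb in force) (rule continuous_on_subset[OF elim(2)], use tb in force)
  show ?case using elim(3) tb by (auto simp: margin_def[abs_def] intro!: continuous_intros)
qed

lemma exit_time_range: "t \<le> exit_time t b w \<and> exit_time t b w \<le> b"
  using hit_bounds[of t b] tb by (simp add: exit_time_def)

lemma exit_time_stopping: "stopping_time F (exit_time t b)"
  unfolding exit_time_def[abs_def]
proof (rule stopping_time_hit[of t b "\<lambda>s w. margin t w s"])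
  show "(\<lambda>w. margin t w s) \<in> borel_measurable (F s)" if s: "s \<in> {t..b}" for s
  proof -
    have [measurable]: "y0 t \<in> borel_measurable (F s)" "B t \<in> borel_measurable (F s)"
      "B s \<in> borel_measurable (F s)" "L s \<in> borel_measurable (F s)"
      using measurable_F_mono[OF y0_meas, of t s] B_adapted[of t s] B_adapted[of s s] prog_section[OF L_prog, of s] s tb
      by auto
    show ?thesis unfolding margin_def by measurable
  qed
  show "AE w in M. continuous_on {t..b} (\<lambda>s. margin t w s)" using margin_path by eventually_elim simp
qed (use tb in simp)

lemma exit_time_barrier: "AE w in M. \<forall>s\<in>{t..exit_time t b w}. L s w \<le> y0 t w + z \<bullet> (B s w - B t w) \<and> \<bar>z \<bullet> (B s w - B t w)\<bar> \<le> 1"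
  using margin_path
proof (eventually_elim, intro ballI)
  fix w s assume w: "continuous_on {t..b} (margin t w) \<and> 0 < margin t w t" and s: "s \<in> {t..exit_time t b w}"
  have "0 \<le> margin t w s" by (rule hit_nonneg[of t b]) (use w s tb in \<open>auto simp: exit_time_def\<close>)
  then show "L s w \<le> y0 t w + z \<bullet> (B s w - B t w) \<and> \<bar>z \<bullet> (B s w - B t w)\<bar> \<le> 1" by (auto simp: margin_def)
qed

text \<open>The exit time is at least \<open>t\<close>, so \<open>min t \<tau>\<close> is
  \<open>t\<close> and the assumed comparison becomes one at the fixed time
  \<open>t\<close>.\<close>

lemma short_time_solutions:
  obtains Y1 Z1 K1 Y2 Z2 K2 where
    "short_time_solution M B F T t b c \<gamma> g1 (y0 t) z (exit_time t b) L Y1 K1 Z1"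
    "short_time_solution M B F T t b c \<gamma> g2 (y0 t) z (exit_time t b) L Y2 K2 Z2"
    "AE w in M. Y1 t w \<ge> Y2 t w"
    "AE w in M. real_cond_exp M (F t) (\<lambda>w. K1 (exit_time t b w) w - K1 t w) w
             \<le> real_cond_exp M (F t) (\<lambda>w. K2 (exit_time t b w) w - K2 t w) w"
proof -
  let ?\<tau> = "exit_time t b" let ?\<xi> = "\<lambda>w. y0 t w + z \<bullet> (B (exit_time t b w) w - B t w)"
  have t: "t \<in> {0..T}" using tb by simp
  have r: "t \<le> ?\<tau> w \<and> ?\<tau> w \<le> T" for w using exit_time_range[of w] tb by auto
  have r0: "?\<tau> w \<in> {0<..T}" for w using r[of w] tb by auto
  have L2: "L2_variable M (pre_sigma ?\<tau>) ?\<xi>"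
    by (rule terminal_value_L2[OF _ _ y0_meas[OF t] y0_L2[OF t] exit_time_stopping r]) (use tb in auto)
  have L\<tau>: "AE w in M. L (?\<tau> w) w \<le> ?\<xi> w"
    using exit_time_barrier by eventually_elim (use exit_time_range in auto)
  obtain Y1 Z1 K1 Y2 Z2 K2 where sol: "rbsde_solution M F B T g1 ?\<tau> ?\<xi> L Y1 Z1 K1" "rbsde_solution M F B T g2 ?\<tau> ?\<xi> L Y2 Z2 K2"
    and cmp: "\<forall>t\<in>{0..T}. AE w in M. Y1 (min t (?\<tau> w)) w \<ge> Y2 (min t (?\<tau> w)) w \<and>
           real_cond_exp M (F t) (\<lambda>w. K1 (?\<tau> w) w - K1 (min t (?\<tau> w)) w) w
             \<le> real_cond_exp M (F t) (\<lambda>w. K2 (?\<tau> w) w - K2 (min t (?\<tau> w)) w) w"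
    using comparable_solutions[OF exit_time_stopping r0 L2 L\<tau>] by blast
  have mt: "min t (?\<tau> w) = t" for w using r[of w] by simp
  note cmp' = bspec[OF cmp t, unfolded mt]
  have gr: "AE w in M. \<forall>u\<in>{0..T}. \<forall>y z. \<bar>g1 u w y z\<bar> \<le> c * (\<gamma> u w + \<bar>y\<bar> + norm z)"
    "AE w in M. \<forall>u\<in>{0..T}. \<forall>y z. \<bar>g2 u w y z\<bar> \<le> c * (\<gamma> u w + \<bar>y\<bar> + norm z)"
    using g1 g2 by (simp_all add: adm_def)
  have 1: "short_time_solution M B F T t b c \<gamma> g1 (y0 t) z ?\<tau> L Y1 K1 Z1"
    by unfold_locales (use tb c_pos \<gamma>_joint \<gamma>_nonneg \<gamma>_L2 gr y0_meas[OF t] y0_L2[OF t] exit_time_stopping exit_time_range L_cont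
      exit_time_barrier sol in auto)
  have 2: "short_time_solution M B F T t b c \<gamma> g2 (y0 t) z ?\<tau> L Y2 K2 Z2"
    by unfold_locales (use tb c_pos \<gamma>_joint \<gamma>_nonneg \<gamma>_L2 gr y0_meas[OF t] y0_L2[OF t] exit_time_stopping exit_time_range L_cont
      exit_time_barrier sol in auto)
  show ?thesis
    by (rule that[OF 1 2]) (use cmp' in \<open>auto elim!: eventually_mono\<close>)
qed

text \<open>By \<open>representation\<close> the expected drift is the expectation of
  \<open>V\<close> minus that of the remaining reflection. The first solution has the larger
  \<open>V\<close>, as both subtract the same reference process, and the smaller reflection; both
  effects favour its drift.\<close>

lemma drift_comparison:
  assumes s1: "short_time_solution M B F T t b c \<gamma> g1 (y0 t) z (exit_time t b) L Y1 K1 Z1"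
    and s2: "short_time_solution M B F T t b c \<gamma> g2 (y0 t) z (exit_time t b) L Y2 K2 Z2"
    and Y: "AE w in M. Y1 t w \<ge> Y2 t w"
    and K: "AE w in M. real_cond_exp M (F t) (\<lambda>w. K1 (exit_time t b w) w - K1 t w) w
             \<le> real_cond_exp M (F t) (\<lambda>w. K2 (exit_time t b w) w - K2 t w) w"
    and A: "A \<in> sets (F t)"
  shows "(\<integral>w. indicator A w * short_time_solution.drift g2 (exit_time t b) Y2 Z2 t w \<partial>M)
    \<le> (\<integral>w. indicator A w * short_time_solution.drift g1 (exit_time t b) Y1 Z1 t w \<partial>M)"
proof -
  let ?\<tau> = "exit_time t b"
  interpret S1: short_time_solution M B F T t b c \<gamma> g1 "y0 t" z ?\<tau> L Y1 K1 Z1 by (rule s1)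
  interpret S2: short_time_solution M B F T t b c \<gamma> g2 "y0 t" z ?\<tau> L Y2 K2 Z2 by (rule s2)
  have AM: "A \<in> sets M" using A sets_F_sub by auto
  have mI: "integrable M (\<lambda>w. indicator A w * f w)" if "integrable M f" for f :: "'a \<Rightarrow> real"
    using integrable_mult_indicator[OF AM that] by simp
  interpret sf: sigma_finite_subalgebra M "F t" by (rule sigma_finite_subalgebra_F)
  have "(\<integral>w. indicator A w * S2.V t w \<partial>M) \<le> (\<integral>w. indicator A w * S1.V t w \<partial>M)"
  proof (rule integral_mono_AE[OF mI mI])
    show "AE w in M. indicator A w * S2.V t w \<le> indicator A w * S1.V t w"
      using Y by eventually_elim (auto simp: S1.V_def S2.V_def zero_after_def split: split_indicator)
  qed (rule S2.representation S1.representation)+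
  moreover have "(\<integral>w. indicator A w * (S1.K\<tau> w - K1 t w) \<partial>M) \<le> (\<integral>w. indicator A w * (S2.K\<tau> w - K2 t w) \<partial>M)"
  proof -
    note i1 = S1.representation(2)[unfolded S1.K\<tau>_def] and i2 = S2.representation(2)[unfolded S2.K\<tau>_def]
    have "(\<integral>w. indicator A w * real_cond_exp M (F t) (\<lambda>w. K1 (?\<tau> w) w - K1 t w) w \<partial>M)
      \<le> (\<integral>w. indicator A w * real_cond_exp M (F t) (\<lambda>w. K2 (?\<tau> w) w - K2 t w) w \<partial>M)"
      by (rule integral_mono_AE[OF mI mI])
        (use K sf.real_cond_exp_int(1)[OF i1] sf.real_cond_exp_int(1)[OF i2] in \<open>auto elim!: eventually_mono split: split_indicator\<close>)
    then show ?thesis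
      using sf.real_cond_exp_intA[OF i1 A] sf.real_cond_exp_intA[OF i2 A]
      by (simp add: set_lebesgue_integral_def S1.K\<tau>_def S2.K\<tau>_def)
  qed
  ultimately show ?thesis
    using S1.representation(4)[OF A] S2.representation(4)[OF A] by linarith
qed

end

section \<open>Majorants of the drifts and their limit\<close>

text \<open>The right-hand side of \<open>drift_upper\<close> on a path, with the envelope as main
  term and \<open>disp\<close> as distance.\<close>

definition majorant :: "real \<Rightarrow> real \<Rightarrow> real \<Rightarrow> (real \<Rightarrow> 'a \<Rightarrow> real \<Rightarrow> real ^ 'd \<Rightarrow> real) \<Rightarrow> 'a \<Rightarrow> real" where
  "majorant m t b g w = (\<integral>u. (if t < u \<and> u \<le> exit_time t b w then env g m (u, w) + m * disp t (u, w) else 0) \<partial>lborel)"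

definition dom2 :: "real \<Rightarrow> real" where
  "dom2 u = (\<integral>w. (dom (u, w))\<^sup>2 \<partial>M)"

text \<open>\<open>drift_upper\<close> for \<open>g1\<close> with sign 1 and for \<open>g2\<close>
  with sign -1 is added to \<open>drift_comparison\<close>; the factor 2 counts the two
  errors.\<close>

lemma majorant_bound:
  assumes tb: "0 < t" "t < b" "b \<le> T" and m: "2 * c \<le> m" and A: "A \<in> sets (F t)"
    and small: "(5 * c\<^sup>2 + 2 * c) * (b - t) \<le> 1 / 2" and a: "0 < a" "b - t = a ^ 4"
    and CG: "(\<integral>p. indicator {t..b} (fst p) * (dom p)\<^sup>2 \<partial>lM) \<le> CG * a ^ 4"
  shows "integrable M (majorant m t b g1)" "integrable M (majorant m t b (\<lambda>u w y z. - g2 u w y z))"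
    and "0 \<le> (\<integral>w. indicator A w * majorant m t b g1 w \<partial>M) + (\<integral>w. indicator A w * majorant m t b (\<lambda>u w y z. - g2 u w y z) w \<partial>M)
      + 2 * m * (a ^ 4 * (a + (6 * c * a + (1 + 8 * c + 16 * c\<^sup>2) * a ^ 3) * CG))"
proof -
  obtain Y1 Z1 K1 Y2 Z2 K2 where
    s1: "short_time_solution M B F T t b c \<gamma> g1 (y0 t) z (exit_time t b) L Y1 K1 Z1"
    and s2: "short_time_solution M B F T t b c \<gamma> g2 (y0 t) z (exit_time t b) L Y2 K2 Z2"
    and Y: "AE w in M. Y1 t w \<ge> Y2 t w"
    and K: "AE w in M. real_cond_exp M (F t) (\<lambda>w. K1 (exit_time t b w) w - K1 t w) w
             \<le> real_cond_exp M (F t) (\<lambda>w. K2 (exit_time t b w) w - K2 t w) w"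
    by (rule short_time_solutions[OF tb])
  have t: "t \<in> {0..T}" using tb by simp
  have m0: "0 \<le> m" using m c_pos by simp
  have sub: "AE w in M. \<forall>u\<in>{t..b}. P w u" if "AE w in M. \<forall>u\<in>{0..T}. P w u" for P
    using that by eventually_elim (use tb in auto)
  have win: "integrable lM (\<lambda>p. indicator {t..b} (fst p) * f p)"
    if "integrable lM f" for f :: "real \<times> 'a \<Rightarrow> real"
  proof (rule Bochner_Integration.integrable_bound[OF that])
    show "(\<lambda>p. indicator {t..b} (fst p) * f p) \<in> borel_measurable lM"
      using borel_measurable_integrable[OF that] by (intro borel_measurable_times indicator_fst_measurable)
  qed (auto split: split_indicator)
  interpret S1: short_time_solution M B F T t b c \<gamma> g1 "y0 t" z "exit_time t b" L Y1 K1 Z1 by (rule s1)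
  interpret S2: short_time_solution M B F T t b c \<gamma> g2 "y0 t" z "exit_time t b" L Y2 K2 Z2 by (rule s2)
  have dist: "AE w in M. \<forall>u\<in>{t..exit_time t b w}. \<bar>y0 t w + z \<bullet> (B u w - B t w) - y0 u w\<bar> \<le> disp t (u, w)"
    using exit_time_barrier[OF tb] W_eq_B
  proof (eventually_elim, intro ballI)
    fix w u assume b: "\<forall>s\<in>{t..exit_time t b w}. L s w \<le> y0 t w + z \<bullet> (B s w - B t w) \<and> \<bar>z \<bullet> (B s w - B t w)\<bar> \<le> 1"
      and w: "\<forall>u\<ge>0. W u w = B u w" and u: "u \<in> {t..exit_time t b w}"
    have "u \<in> {0..T}" using u exit_time_range[OF tb, of w] tb by auto
    moreover have "W u w = B u w" "W t w = B t w" using w u tb by auto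
    moreover have "\<bar>z \<bullet> (B u w - B t w)\<bar> \<le> 1" using b u by blast
    ultimately show "\<bar>y0 t w + z \<bullet> (B u w - B t w) - y0 u w\<bar> \<le> disp t (u, w)" by (simp add: disp_def)
  qed
  note b1 = sub[OF env_upper[OF g1 m]] and b2 = sub[OF env_upper[OF adm_uminus[OF g2] m]]
  have b1': "AE w in M. \<forall>u\<in>{t..b}. \<forall>y zz. 1 * g1 u w y zz \<le> env g1 m (u, w) + m * (\<bar>y - y0 u w\<bar> + norm (zz - z))" using b1 by simp
  have b2': "AE w in M. \<forall>u\<in>{t..b}. \<forall>y zz. (- 1) * g2 u w y zz \<le> env (\<lambda>u w y z. - g2 u w y z) m (u, w) + m * (\<bar>y - y0 u w\<bar> + norm (zz - z))" using b2 by simp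
  note d1 = S1.drift_upper[OF m0 A win[OF env_integrable[OF g1 m]] win[OF disp_integrable[OF t]] b1' dist, folded majorant_def]
  note d2 = S2.drift_upper[OF m0 A win[OF env_integrable[OF adm_uminus[OF g2] m]] win[OF disp_integrable[OF t]] b2' dist, folded majorant_def]
  show "integrable M (majorant m t b g1)" "integrable M (majorant m t b (\<lambda>u w y z. - g2 u w y z))"
    using d1(1) d2(1) by (simp_all add: majorant_def[abs_def])
  have \<Gamma>: "(\<integral>p. (indicator {t..b} (fst p) * (\<gamma> (fst p) (snd p) + (\<bar>y0 t (snd p)\<bar> + 1 + norm z)))\<^sup>2 \<partial>lM) \<le> CG * a ^ 4"
  proof (rule order_trans[OF integral_mono_AE CG])
    show "integrable lM (\<lambda>p. (indicator {t..b} (fst p) * (\<gamma> (fst p) (snd p) + (\<bar>y0 t (snd p)\<bar> + 1 + norm z)))\<^sup>2)"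
      using S1.\<Gamma>_L2 by (simp add: S1.\<Gamma>_def)
    show "integrable lM (\<lambda>p. indicator {t..b} (fst p) * (dom p)\<^sup>2)" by (rule win[OF dom_sq_integrable])
    show "AE p in lM. (indicator {t..b} (fst p) * (\<gamma> (fst p) (snd p) + (\<bar>y0 t (snd p)\<bar> + 1 + norm z)))\<^sup>2 \<le> indicator {t..b} (fst p) * (dom p)\<^sup>2"
      using AE_snd_lift[OF y0_S] AE_snd_lift[OF AE_space]
    proof eventually_elim
      case (elim p)
      show ?case
      proof (cases "fst p \<in> {t..b}")
        case True
        then have p: "fst p \<in> {0..T}" using tb by auto
        have "(\<gamma> (fst p) (snd p) + (\<bar>y0 t (snd p)\<bar> + 1 + norm z))\<^sup>2 \<le> (dom p)\<^sup>2"
          using elim(1) t p \<gamma>_nonneg[OF p elim(2)] by (intro power_mono) (auto simp: dom_def)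
        then show ?thesis using True by simp
      qed simp
    qed
  qed
  have e1: "(\<integral>p. \<bar>S1.Vt p\<bar> + sqrt (S1.Hq p) \<partial>lM) \<le> a ^ 4 * (a + (6 * c * a + (1 + 8 * c + 16 * c\<^sup>2) * a ^ 3) * CG)"
    by (rule S1.error_bound[OF small a]) (use \<Gamma> in \<open>simp add: S1.\<Gamma>_def\<close>)
  have e2: "(\<integral>p. \<bar>S2.Vt p\<bar> + sqrt (S2.Hq p) \<partial>lM) \<le> a ^ 4 * (a + (6 * c * a + (1 + 8 * c + 16 * c\<^sup>2) * a ^ 3) * CG)"
    by (rule S2.error_bound[OF small a]) (use \<Gamma> in \<open>simp add: S2.\<Gamma>_def\<close>)
  have x2: "(\<integral>w. indicator A w * (- 1 * S2.drift t w) \<partial>M) = - (\<integral>w. indicator A w * S2.drift t w \<partial>M)" by simp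
  have x1: "(\<integral>w. indicator A w * (1 * S1.drift t w) \<partial>M) = (\<integral>w. indicator A w * S1.drift t w \<partial>M)" by simp
  have me: "m * e \<le> m * E" if "e \<le> E" for e E using that m0 by (rule mult_left_mono)
  show "0 \<le> (\<integral>w. indicator A w * majorant m t b g1 w \<partial>M) + (\<integral>w. indicator A w * majorant m t b (\<lambda>u w y z. - g2 u w y z) w \<partial>M)
      + 2 * m * (a ^ 4 * (a + (6 * c * a + (1 + 8 * c + 16 * c\<^sup>2) * a ^ 3) * CG))"
    using drift_comparison[OF tb s1 s2 Y K A] d1(2)[unfolded x1] d2(2)[unfolded x2] me[OF e1] me[OF e2]
    by (simp add: mult.assoc)
qed

text \<open>A positive margin at \<open>t\<close> stays positive for a while by continuity, so on a
  fixed path stopping has no effect once the window is short enough.\<close>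

lemma exit_time_eventually:
  assumes t: "0 < t" "t < T" and n: "(\<lambda>k. 1 / real (Suc (n k))) \<longlonglongrightarrow> 0"
    and w: "continuous_on {t..T} (margin t w)" "0 < margin t w t"
  shows "\<forall>\<^sub>F k in sequentially. exit_time t (t + 1 / real (Suc (n k))) w = t + 1 / real (Suc (n k))"
proof -
  obtain d where d: "d > 0" "\<And>u. u \<in> {t..T} \<Longrightarrow> dist u t < d \<Longrightarrow> dist (margin t w u) (margin t w t) < margin t w t"
    using w t unfolding continuous_on_iff by (metis atLeastAtMost_iff less_eq_real_def)
  have "0 < min d (T - t)" using d t by simp
  from order_tendstoD(2)[OF n this]
  show ?thesis
  proof eventually_elim
    case (elim k)
    let ?b = "t + 1 / real (Suc (n k))"
    have sub: "{t..?b} \<subseteq> {t..T}" using elim by auto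
    show ?case unfolding exit_time_def
    proof (rule hit_eq_end)
      show "continuous_on {t..?b} (margin t w)" by (rule continuous_on_subset[OF w(1) sub])
      fix s assume s: "s \<in> {t..?b}"
      then have "dist s t < d" using elim by (auto simp: dist_real_def)
      with d(2)[of s] s sub have "dist (margin t w s) (margin t w t) < margin t w t" by blast
      then show "0 < margin t w s" by (simp add: dist_real_def)
    qed simp
  qed
qed

lemma majorant_full:
  assumes e: "exit_time t (t + 1 / real (Suc n)) w = t + 1 / real (Suc n)"
    and I: "integrable lborel (\<lambda>u. env g m (u, w))" "integrable lborel (\<lambda>u. disp t (u, w))"
  shows "real (Suc n) * majorant m t (t + 1 / real (Suc n)) g w
    = fwd_avg n (\<lambda>u. env g m (u, w)) t + m * fwd_avg n (\<lambda>u. disp t (u, w)) t"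
proof -
  let ?W = "indicator {t..t + 1 / real (Suc n)} :: real \<Rightarrow> real"
  note w = integrable_window[OF I(1), of t "t + 1 / real (Suc n)"] integrable_window[OF I(2), of t "t + 1 / real (Suc n)"]
  have "majorant m t (t + 1 / real (Suc n)) g w = (\<integral>u. ?W u * env g m (u, w) + m * (?W u * disp t (u, w)) \<partial>lborel)"
    unfolding majorant_def e
  proof (rule integral_cong_AE)
    have [measurable]: "(\<lambda>u. env g m (u, w)) \<in> borel_measurable borel" "(\<lambda>u. disp t (u, w)) \<in> borel_measurable borel"
      using borel_measurable_integrable[OF I(1)] borel_measurable_integrable[OF I(2)] by simp_all
    show "(\<lambda>u. if t < u \<and> u \<le> t + 1 / real (Suc n) then env g m (u, w) + m * disp t (u, w) else 0) \<in> borel_measurable lborel"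
      "(\<lambda>u. ?W u * env g m (u, w) + m * (?W u * disp t (u, w))) \<in> borel_measurable lborel"
      by measurable
    show "AE u in lborel. (if t < u \<and> u \<le> t + 1 / real (Suc n) then env g m (u, w) + m * disp t (u, w) else 0)
      = ?W u * env g m (u, w) + m * (?W u * disp t (u, w))"
      using AE_lborel_singleton[of t] by eventually_elim (auto split: split_indicator)
  qed
  also have "\<dots> = (\<integral>u. ?W u * env g m (u, w) \<partial>lborel) + m * (\<integral>u. ?W u * disp t (u, w) \<partial>lborel)"
    using w by simp
  finally show ?thesis unfolding fwd_avg_def by (simp only: distrib_left mult.left_commute)
qed

text \<open>The envelope contributes \<open>2 * c\<close> and the displacement \<open>2 * m\<close>
  times \<open>dom\<close>, whatever the exit time is.\<close>

lemma majorant_abs_le: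
  assumes tb: "0 < t" "t + 1 / real (Suc n) \<le> T" and m: "2 * c \<le> m"
  shows "AE w in M. \<bar>real (Suc n) * majorant m t (t + 1 / real (Suc n)) g w\<bar> \<le> (2 * c + 2 * m) * fwd_avg n (\<lambda>u. dom (u, w)) t"
proof -
  let ?b = "t + 1 / real (Suc n)"
  let ?W = "indicator {t..?b} :: real \<Rightarrow> real"
  have "t < ?b" by simp
  with tb have t: "t \<in> {0..T}" "t < ?b" by (simp_all only: atLeastAtMost_iff) linarith
  have m0: "0 \<le> m" using m c_pos by simp
  show ?thesis
    using env_le_dom[OF m, of g] disp_le_dom[OF t(1)] AE_path_integrable[OF dom_integrable]
  proof eventually_elim
    case (elim w)
    have dom0: "0 \<le> dom (u, w)" for u using spec[OF elim(2), of u] disp_nonneg[of t "(u, w)"] by linarith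
    have "\<bar>majorant m t ?b g w\<bar> \<le> (\<integral>u. (2 * c + 2 * m) * (?W u * dom (u, w)) \<partial>lborel)"
      unfolding majorant_def
    proof (rule abs_integral_le)
      show "integrable lborel (\<lambda>u. (2 * c + 2 * m) * (?W u * dom (u, w)))"
        by (intro integrable_mult_right integrable_window elim(3))
      show "AE u in lborel. \<bar>if t < u \<and> u \<le> exit_time t ?b w then env g m (u, w) + m * disp t (u, w) else 0\<bar>
          \<le> (2 * c + 2 * m) * (?W u * dom (u, w))"
      proof (rule AE_I2)
        fix u :: real
        show "\<bar>if t < u \<and> u \<le> exit_time t ?b w then env g m (u, w) + m * disp t (u, w) else 0\<bar>
          \<le> (2 * c + 2 * m) * (?W u * dom (u, w))"
        proof (cases "t < u \<and> u \<le> exit_time t ?b w")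
          case True
          then have u: "u \<in> {t..?b}" using exit_time_range[OF tb(1) t(2) tb(2), of w] by auto
          have "\<bar>env g m (u, w) + m * disp t (u, w)\<bar> \<le> \<bar>env g m (u, w)\<bar> + m * disp t (u, w)"
            using m0 disp_nonneg[of t "(u, w)"] by (simp add: abs_if)
          also have "\<dots> \<le> 2 * c * dom (u, w) + m * (2 * dom (u, w))"
            using elim(1,2) m0 by (intro add_mono mult_left_mono) auto
          finally show ?thesis using True u by (simp add: algebra_simps)
        next
          case False
          have "0 \<le> (2 * c + 2 * m) * (?W u * dom (u, w))" using m0 c_pos dom0[of u] by simp
          then show ?thesis using False by auto
        qed
      qed
    qed
    then have "real (Suc n) * \<bar>majorant m t ?b g w\<bar> \<le> real (Suc n) * (\<integral>u. (2 * c + 2 * m) * (?W u * dom (u, w)) \<partial>lborel)"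
      by (rule mult_left_mono) simp
    also have "\<dots> = (2 * c + 2 * m) * fwd_avg n (\<lambda>u. dom (u, w)) t"
      unfolding fwd_avg_def integral_mult_right_zero by (simp only: mult.left_commute)
    finally show ?case by (simp only: abs_mult abs_of_nat)
  qed
qed

abbreviation g2' :: "real \<Rightarrow> 'a \<Rightarrow> real \<Rightarrow> real ^ 'd \<Rightarrow> real" where
  "g2' \<equiv> \<lambda>u w y z. - g2 u w y z"

lemma scaled_majorants_tendsto:
  assumes t: "0 < t" "t < T" and m: "2 * c \<le> m" and n: "(\<lambda>k. 1 / real (Suc (n k))) \<longlonglongrightarrow> 0"
    and lim: "AE w in M. (\<lambda>k. fwd_avg (n k) (\<lambda>u. env g1 m (u, w) + env g2' m (u, w)) t) \<longlonglongrightarrow> h w"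
  shows "AE w in M. (\<lambda>k. real (Suc (n k)) * (majorant m t (t + 1 / real (Suc (n k))) g1 w
    + majorant m t (t + 1 / real (Suc (n k))) g2' w)) \<longlonglongrightarrow> h w"
proof -
  have t': "t \<in> {0..T}" using t by simp
  show ?thesis
    using lim margin_path[OF t order_refl] y0_cont AE_path_integrable[OF env_integrable[OF g1 m]]
      AE_path_integrable[OF env_integrable[OF adm_uminus[OF g2] m]] AE_path_integrable[OF disp_integrable[OF t']]
  proof eventually_elim
    case (elim w)
    note I = elim(4-6)
    have "(\<lambda>k. fwd_avg (n k) (\<lambda>u. env g1 m (u, w) + env g2' m (u, w)) t + 2 * m * fwd_avg (n k) (\<lambda>u. disp t (u, w)) t) \<longlonglongrightarrow> h w + 2 * m * 0"
      by (intro tendsto_add tendsto_mult tendsto_const elim(1) fwd_avg_disp_tendsto[OF t' elim(3) n])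
    then have "(\<lambda>k. fwd_avg (n k) (\<lambda>u. env g1 m (u, w) + env g2' m (u, w)) t + 2 * m * fwd_avg (n k) (\<lambda>u. disp t (u, w)) t) \<longlonglongrightarrow> h w"
      by simp
    moreover have "\<forall>\<^sub>F k in sequentially. fwd_avg (n k) (\<lambda>u. env g1 m (u, w) + env g2' m (u, w)) t + 2 * m * fwd_avg (n k) (\<lambda>u. disp t (u, w)) t
      = real (Suc (n k)) * (majorant m t (t + 1 / real (Suc (n k))) g1 w + majorant m t (t + 1 / real (Suc (n k))) g2' w)"
      using exit_time_eventually[OF t n conjunct1[OF elim(2)] conjunct2[OF elim(2)]]
    proof eventually_elim
      case (elim k)
      show ?case unfolding distrib_left majorant_full[OF elim I(1,3)] majorant_full[OF elim I(2,3)] fwd_avg_add[OF I(1,2)]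
        by simp
    qed
    ultimately show ?case by (rule Lim_transform_eventually)
  qed
qed

text \<open>The second-moment bound that makes the scaled majorants uniformly integrable as the
  window shrinks; Jensen's inequality moves the square inside the average.\<close>

lemma scaled_majorants_L2:
  assumes t: "0 < t" "t + 1 / real (Suc n) \<le> T" and m: "2 * c \<le> m" and A: "A \<in> sets M"
    and meas: "majorant m t (t + 1 / real (Suc n)) g1 \<in> borel_measurable M" "majorant m t (t + 1 / real (Suc n)) g2' \<in> borel_measurable M"
  defines "f \<equiv> \<lambda>w. indicator A w * (real (Suc n) * (majorant m t (t + 1 / real (Suc n)) g1 w + majorant m t (t + 1 / real (Suc n)) g2' w))"
  shows "f \<in> borel_measurable M" "integrable M (\<lambda>w. (f w)\<^sup>2)"
    and "(\<integral>w. (f w)\<^sup>2 \<partial>M) \<le> (4 * c + 4 * m)\<^sup>2 * fwd_avg n dom2 t"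
proof -
  let ?a = "\<lambda>w. fwd_avg n (\<lambda>u. (dom (u, w))\<^sup>2) t"
  note [measurable] = A meas
  show fm: "f \<in> borel_measurable M" unfolding f_def by measurable
  have I: "integrable M (\<lambda>w. (4 * c + 4 * m)\<^sup>2 * ?a w)" by (intro integrable_mult_right dom_window(3))
  have le: "AE w in M. (f w)\<^sup>2 \<le> (4 * c + 4 * m)\<^sup>2 * ?a w"
    using majorant_abs_le[OF t m, of g1] majorant_abs_le[OF t m, of g2'] AE_path_integrable[OF dom_integrable] AE_path_integrable[OF dom_sq_integrable]
  proof eventually_elim
    case (elim w)
    have "\<bar>f w\<bar> \<le> \<bar>real (Suc n) * majorant m t (t + 1 / real (Suc n)) g1 w + real (Suc n) * majorant m t (t + 1 / real (Suc n)) g2' w\<bar>"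
      unfolding f_def distrib_left[symmetric] by (simp split: split_indicator)
    also have "\<dots> \<le> (4 * c + 4 * m) * fwd_avg n (\<lambda>u. dom (u, w)) t"
      using elim(1,2) by (simp only: distrib_right)
    finally have "\<bar>f w\<bar>\<^sup>2 \<le> ((4 * c + 4 * m) * fwd_avg n (\<lambda>u. dom (u, w)) t)\<^sup>2" by (rule power_mono) simp
    also have "\<dots> \<le> (4 * c + 4 * m)\<^sup>2 * ?a w"
      unfolding power_mult_distrib by (intro mult_left_mono fwd_avg_sq_le elim(3,4)) simp
    finally show ?case by simp
  qed
  show I2: "integrable M (\<lambda>w. (f w)\<^sup>2)"
    by (rule Bochner_Integration.integrable_bound[OF I]) (use fm le in \<open>auto elim!: eventually_mono\<close>)
  have "(\<integral>w. (f w)\<^sup>2 \<partial>M) \<le> (\<integral>w. (4 * c + 4 * m)\<^sup>2 * ?a w \<partial>M)" by (rule integral_mono_AE[OF I2 I le])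
  then show "(\<integral>w. (f w)\<^sup>2 \<partial>M) \<le> (4 * c + 4 * m)\<^sup>2 * fwd_avg n dom2 t"
    using dom_window(4)[of n t] by (simp add: dom2_def[abs_def])
qed

text \<open>Integrated over an event of \<open>F t\<close> and multiplied by \<open>Suc n\<close>,
  the majorant inequality has an error of order \<open>a\<close>, while the majorants converge to
  the envelopes in L1. Applied to the event where the envelope sum is negative, the limit makes this
  event null.\<close>

lemma envelope_sum_nonneg_at:
  assumes t: "0 < t" "t < T" and m: "2 * c \<le> m" and r: "strict_mono r"
    and lim: "AE w in M. (\<lambda>k. fwd_avg (r k) (\<lambda>u. env g1 m (u, w) + env g2' m (u, w)) t) \<longlonglongrightarrow> env g1 m (t, w) + env g2' m (t, w)"
    and C: "\<And>k. fwd_avg (r k) dom2 t \<le> C"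
  shows "AE w in M. 0 \<le> env g1 m (t, w) + env g2' m (t, w)"
proof -
  let ?h = "\<lambda>w. env g1 m (t, w) + env g2' m (t, w)"
  have t': "t \<in> {0..T}" using t by simp
  have rlim: "(\<lambda>k. 1 / real (Suc (r k))) \<longlonglongrightarrow> 0"
    using LIMSEQ_subseq_LIMSEQ[OF lim_1_over_n r] LIMSEQ_subseq_LIMSEQ[OF LIMSEQ_inverse_real_of_nat r]
    by (simp add: o_def inverse_eq_divide)
  let ?q = "5 * c\<^sup>2 + 2 * c"
  have q: "0 < ?q" using c_pos by (simp add: add_pos_pos)
  \<comment> \<open>From \<open>k0\<close> on the window fits into \<open>{t..T}\<close> and
    satisfies the smallness condition of the energy estimate.\<close>
  have "0 < min (T - t) (1 / (2 * ?q))" using t q by simp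
  from order_tendstoD(2)[OF rlim this] obtain k0 where k0: "\<And>k. k0 \<le> k \<Longrightarrow> 1 / real (Suc (r k)) < min (T - t) (1 / (2 * ?q))"
    by (auto simp: eventually_sequentially)
  define n where "n k = r (k + k0)" for k
  define b where "b k = t + 1 / real (Suc (n k))" for k
  \<comment> \<open>The fourth root of the window length, as \<open>error_bound\<close>
    requires.\<close>
  define a where "a k = sqrt (sqrt (1 / real (Suc (n k))))" for k
  have nlim: "(\<lambda>k. 1 / real (Suc (n k))) \<longlonglongrightarrow> 0" unfolding n_def by (rule LIMSEQ_ignore_initial_segment[OF rlim])
  have pos: "0 < 1 / real (Suc (n k))" for k by simp
  have bound: "1 / real (Suc (n k)) < T - t" "1 / real (Suc (n k)) < 1 / (2 * ?q)" for k
    using k0[of "k + k0"] by (simp_all add: n_def)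
  have tb: "0 < t" "t < b k" "b k \<le> T" for k using t pos[of k] bound(1)[of k] unfolding b_def by linarith+
  have bt: "b k - t = 1 / real (Suc (n k))" for k by (simp add: b_def)
  have a4: "a k ^ 4 = 1 / real (Suc (n k))" for k
  proof -
    have "a k ^ 4 = ((a k)\<^sup>2)\<^sup>2" by (simp flip: power_mult)
    then show ?thesis by (simp add: a_def)
  qed
  have a0: "0 < a k" for k by (simp add: a_def)
  have alim: "a \<longlonglongrightarrow> 0" unfolding a_def using tendsto_real_sqrt[OF tendsto_real_sqrt[OF nlim]] by simp
  have half: "Q * x \<le> 1 / 2" if "0 < Q" "x < 1 / (2 * Q)" for Q x :: real using that by (simp add: field_simps)
  have small: "?q * (b k - t) \<le> 1 / 2" for k
    unfolding bt by (rule half[OF q bound(2)])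
  have CG: "(\<integral>p. indicator {t..b k} (fst p) * (dom p)\<^sup>2 \<partial>lM) \<le> C * a k ^ 4" for k
    unfolding b_def dom_window(2) a4 using C[of "k + k0"]
    by (simp add: n_def dom2_def[abs_def] divide_right_mono del: of_nat_Suc)
  define err where "err k = 2 * m * (a k + (6 * c * a k + (1 + 8 * c + 16 * c\<^sup>2) * a k ^ 3) * C)" for k
  have "err \<longlonglongrightarrow> 2 * m * (0 + (6 * c * 0 + (1 + 8 * c + 16 * c\<^sup>2) * 0 ^ 3) * C)"
    unfolding err_def by (intro tendsto_intros alim)
  then have err: "err \<longlonglongrightarrow> 0" by simp
  have mb: "integrable M (majorant m t (b k) g1)" "integrable M (majorant m t (b k) g2')"
    "A \<in> sets (F t) \<Longrightarrow> 0 \<le> (\<integral>w. indicator A w * majorant m t (b k) g1 w \<partial>M) + (\<integral>w. indicator A w * majorant m t (b k) g2' w \<partial>M)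
      + a k ^ 4 * err k" for k A
  proof -
    have ak: "b k - t = a k ^ 4" by (simp add: bt a4)
    have e: "{} \<in> sets (F t)" by simp
    show "integrable M (majorant m t (b k) g1)" "integrable M (majorant m t (b k) g2')"
      using majorant_bound(1,2)[OF tb m e small a0 ak CG] by simp_all
    show "0 \<le> (\<integral>w. indicator A w * majorant m t (b k) g1 w \<partial>M) + (\<integral>w. indicator A w * majorant m t (b k) g2' w \<partial>M)
      + a k ^ 4 * err k" if "A \<in> sets (F t)"
      using majorant_bound(3)[OF tb m that small a0 ak CG] unfolding err_def by (simp only: mult_ac)
  qed
  have hF: "?h \<in> borel_measurable (F t)"
    using env_section[OF g1 m t'] env_section[OF adm_uminus[OF g2] m t'] by (rule borel_measurable_add)
  \<comment> \<open>An event of \<open>F t\<close>, because the envelopes at time \<open>t\<close>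
    are measurable there.\<close>
  define A where "A = {w\<in>space M. ?h w < 0}"
  have A: "A \<in> sets (F t)"
    using borel_measurable_less[OF hF borel_measurable_const, of 0] by (simp add: A_def space_F)
  then have AM: "A \<in> sets M" using sets_F_sub by auto
  have lim': "AE w in M. (\<lambda>k. fwd_avg (n k) (\<lambda>u. env g1 m (u, w) + env g2' m (u, w)) t) \<longlonglongrightarrow> ?h w"
    using lim by eventually_elim (unfold n_def, rule LIMSEQ_ignore_initial_segment)
  define f where "f k = (\<lambda>w. indicator A w * (real (Suc (n k)) * (majorant m t (b k) g1 w + majorant m t (b k) g2' w)))" for k
  have flim: "AE w in M. (\<lambda>k. f k w) \<longlonglongrightarrow> indicator A w * ?h w"
    using scaled_majorants_tendsto[OF t m nlim lim'] unfolding f_def b_def by eventually_elim (rule tendsto_mult_left)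
  have tn: "t + 1 / real (Suc (n k)) \<le> T" for k using tb(3)[of k] by (simp add: b_def)
  have f2: "f k \<in> borel_measurable M" "integrable M (\<lambda>w. (f k w)\<^sup>2)"
    "(\<integral>w. (f k w)\<^sup>2 \<partial>M) \<le> (4 * c + 4 * m)\<^sup>2 * fwd_avg (n k) dom2 t" for k
    using scaled_majorants_L2[OF t(1) tn m AM borel_measurable_integrable[OF mb(1), unfolded b_def]
      borel_measurable_integrable[OF mb(2), unfolded b_def], of k] unfolding f_def b_def by blast+
  have f2C: "(\<integral>w. (f k w)\<^sup>2 \<partial>M) \<le> (4 * c + 4 * m)\<^sup>2 * C" for k
    by (rule order_trans[OF f2(3) mult_left_mono]) (use C in \<open>simp_all add: n_def\<close>)
  have hM: "(\<lambda>w. indicator A w * ?h w) \<in> borel_measurable M"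
    using measurable_F_M[OF hF] AM by measurable
  note lims = L2_bounded_L1_tendsto[OF hM f2(1) flim f2(2) f2C]
  have fpos: "0 \<le> (\<integral>w. f k w \<partial>M) + err k" for k
  proof -
    let ?i = "\<lambda>g. \<integral>w. indicator A w * majorant m t (b k) g w \<partial>M"
    have mI: "integrable M (\<lambda>w. indicator A w * f w)" if "integrable M f" for f :: "'a \<Rightarrow> real"
      using integrable_mult_indicator[OF AM that] by simp
    have "(\<integral>w. f k w \<partial>M) = (\<integral>w. real (Suc (n k)) * (indicator A w * majorant m t (b k) g1 w + indicator A w * majorant m t (b k) g2' w) \<partial>M)"
      unfolding f_def by (simp only: distrib_left mult.left_commute)
    also have "\<dots> = real (Suc (n k)) * (?i g1 + ?i g2')"
      using mI[OF mb(1)] mI[OF mb(2)] by simp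
    finally have "(\<integral>w. f k w \<partial>M) + err k = real (Suc (n k)) * (?i g1 + ?i g2' + a k ^ 4 * err k)"
      unfolding a4 by (simp add: field_simps)
    also have "\<dots> \<ge> 0" using mb(3)[OF A] by (intro mult_nonneg_nonneg) auto
    finally show ?thesis .
  qed
  have "(\<lambda>k. (\<integral>w. f k w \<partial>M) + err k) \<longlonglongrightarrow> (\<integral>w. indicator A w * ?h w \<partial>M) + 0" by (intro tendsto_add lims(4) err)
  from LIMSEQ_le_const[OF this] fpos have hint: "0 \<le> (\<integral>w. indicator A w * ?h w \<partial>M)" by simp
  have np: "0 \<le> - (indicator A w * ?h w)" for w by (auto simp: A_def split: split_indicator)
  have "(\<integral>w. - (indicator A w * ?h w) \<partial>M) = 0"
    using hint Bochner_Integration.integral_nonneg[of M "\<lambda>w. - (indicator A w * ?h w)"] np by simp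
  then have "AE w in M. - (indicator A w * ?h w) = 0"
    using integral_nonneg_eq_0_iff_AE[of M "\<lambda>w. - (indicator A w * ?h w)"] lims(2) np by simp
  then show ?thesis using AE_space by eventually_elim (auto simp: A_def split: split_indicator_asm)
qed

text \<open>\<open>dom2\<close> is regarded as a function on the product, so that its averages
  converge along the same subsequence as those of the envelopes and are therefore bounded.\<close>

lemma envelope_sum_nonneg:
  assumes m: "2 * c \<le> m"
  shows "AE t in (lborel :: real measure). 0 < t \<longrightarrow> t < T \<longrightarrow> (AE w in M. 0 \<le> env g1 m (t, w) + env g2' m (t, w))"
proof -
  have i1: "integrable lM (\<lambda>(u, w). env g1 m (u, w) + env g2' m (u, w))"
    using Bochner_Integration.integrable_add[OF env_integrable[OF g1 m] env_integrable[OF adm_uminus[OF g2] m]]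
    by (simp add: case_prod_beta')
  have i2: "integrable lM (\<lambda>(u, w). dom2 u)"
    using integrable_tensor(1)[OF lborel.sigma_finite_measure_axioms sigma_finite_measure_axioms dom2_integrable, of "\<lambda>_. 1::real"]
    by (simp add: case_prod_beta' dom2_def[abs_def])
  from fwd_avg_AE_subseq[OF sigma_finite_measure_axioms i1 i2] obtain r where r: "strict_mono r"
    and lim: "AE t in (lborel :: real measure). AE w in M.
      (\<lambda>k. fwd_avg (r k) (\<lambda>u. env g1 m (u, w) + env g2' m (u, w)) t) \<longlonglongrightarrow> env g1 m (t, w) + env g2' m (t, w)
      \<and> (\<lambda>k. fwd_avg (r k) (\<lambda>u. dom2 u) t) \<longlonglongrightarrow> dom2 t" by blast
  show ?thesis
    using lim
  proof (eventually_elim, intro impI)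
    fix t :: real assume l: "AE w in M.
      (\<lambda>k. fwd_avg (r k) (\<lambda>u. env g1 m (u, w) + env g2' m (u, w)) t) \<longlonglongrightarrow> env g1 m (t, w) + env g2' m (t, w)
      \<and> (\<lambda>k. fwd_avg (r k) (\<lambda>u. dom2 u) t) \<longlonglongrightarrow> dom2 t" and t: "0 < t" "t < T"
    \<comment> \<open>This part of \<open>l\<close> is deterministic, and on a probability space it
      may be taken out of the almost sure quantifier.\<close>
    then have "(\<lambda>k. fwd_avg (r k) dom2 t) \<longlonglongrightarrow> dom2 t" by simp
    then have "Bseq (\<lambda>k. fwd_avg (r k) dom2 t)" by (intro convergent_imp_Bseq convergentI)
    then obtain C where "\<And>k. norm (fwd_avg (r k) dom2 t) \<le> C" by (auto simp: Bseq_def)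
    then have C: "fwd_avg (r k) dom2 t \<le> C" for k by (metis abs_le_D1 real_norm_def)
    show "AE w in M. 0 \<le> env g1 m (t, w) + env g2' m (t, w)"
      by (rule envelope_sum_nonneg_at[OF t m r _ C]) (use l in \<open>auto elim!: eventually_mono\<close>)
  qed
qed

text \<open>Countably many slopes share one null set of times, after which the slopes tend to
  infinity; the shift by \<open>k0\<close> keeps each slope at least \<open>2 * c\<close>.\<close>

lemma generators_ordered:
  "AE t in (lborel :: real measure). 0 < t \<longrightarrow> t < T \<longrightarrow> (AE w in M. g2 t w (y0 t w) z \<le> g1 t w (y0 t w) z)"
proof -
  obtain k0 :: nat where k0: "2 * c \<le> real k0" using real_arch_simple by blast
  have k: "2 * c \<le> real (k + k0)" for k using k0 by simp
  have "AE t in (lborel :: real measure). \<forall>k. 0 < t \<longrightarrow> t < T \<longrightarrow> (AE w in M. 0 \<le> env g1 (real (k + k0)) (t, w) + env g2' (real (k + k0)) (t, w))"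
    unfolding AE_all_countable by (intro allI envelope_sum_nonneg k)
  then show ?thesis
  proof (eventually_elim, intro impI)
    fix t :: real assume e: "\<forall>k. 0 < t \<longrightarrow> t < T \<longrightarrow> (AE w in M. 0 \<le> env g1 (real (k + k0)) (t, w) + env g2' (real (k + k0)) (t, w))"
      and t: "0 < t" "t < T"
    have "AE w in M. \<forall>k. 0 \<le> env g1 (real (k + k0)) (t, w) + env g2' (real (k + k0)) (t, w)"
      unfolding AE_all_countable using e t by blast
    then show "AE w in M. g2 t w (y0 t w) z \<le> g1 t w (y0 t w) z"
      using env_tendsto[OF g1] env_tendsto[OF adm_uminus[OF g2]]
    proof eventually_elim
      case (elim w)
      have "(\<lambda>k. env g1 (real k) (t, w) + env g2' (real k) (t, w)) \<longlonglongrightarrow> g1 t w (y0 t w) z + - g2 t w (y0 t w) z"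
        by (rule tendsto_add) (use elim t in auto)
      from LIMSEQ_le_const[OF LIMSEQ_ignore_initial_segment[OF this, of k0], of 0] elim(1)
      show ?case by auto
    qed
  qed
qed

end

section \<open>The comparison theorem\<close>

theorem theorem4p1:
  fixes M :: "'a measure"
    and B :: "real \<Rightarrow> 'a \<Rightarrow> real ^ 'd::finite"
    and F :: "real \<Rightarrow> 'a measure"
    and T :: real
    and g1 g2 :: "real \<Rightarrow> 'a \<Rightarrow> real \<Rightarrow> real ^ 'd \<Rightarrow> real"
    and L :: "real \<Rightarrow> 'a \<Rightarrow> real"
  assumes "prob_space M" and "complete_measure M"
    and "brownian_motion M B"
    and "F = augmented_filtration M B"
    and "T > 0"
    and "generator F T g1" and "linear_growth M F T g1" and "continuous_generator M T g1"
    and "generator F T g2" and "linear_growth M F T g2" and "continuous_generator M T g2"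
    and "obstacle M F T L"
    and "\<And>\<tau> \<xi>.
      \<lbrakk>stopping_time F \<tau>; \<And>\<omega>. \<omega> \<in> space M \<Longrightarrow> \<tau> \<omega> \<in> {0<..T};
       L2_variable M (filtration.pre_sigma (space M) F \<tau>) \<xi>;
       AE \<omega> in M. L (\<tau> \<omega>) \<omega> \<le> \<xi> \<omega>\<rbrakk> \<Longrightarrow>
      \<exists>Y1 Z1 K1 Y2 Z2 K2.
        rbsde_solution M F B T g1 \<tau> \<xi> L Y1 Z1 K1 \<and>
        rbsde_solution M F B T g2 \<tau> \<xi> L Y2 Z2 K2 \<and>
        (\<forall>t\<in>{0..T}. AE \<omega> in M.
           Y1 (min t (\<tau> \<omega>)) \<omega> \<ge> Y2 (min t (\<tau> \<omega>)) \<omega> \<and>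
           real_cond_exp M (F t) (\<lambda>\<omega>. K1 (\<tau> \<omega>) \<omega> - K1 (min t (\<tau> \<omega>)) \<omega>) \<omega>
             \<le> real_cond_exp M (F t) (\<lambda>\<omega>. K2 (\<tau> \<omega>) \<omega> - K2 (min t (\<tau> \<omega>)) \<omega>) \<omega>)"
  shows "\<forall>\<eta> z. S2_process M F T \<eta> \<and> (AE \<omega> in M. \<forall>t\<in>{0..T}. L t \<omega> \<le> \<eta> t \<omega>) \<longrightarrow>
           (AE t in lborel. t \<in> {0..<T} \<longrightarrow>
              (AE \<omega> in M. g1 t \<omega> (\<eta> t \<omega>) z \<ge> g2 t \<omega> (\<eta> t \<omega>) z))"
proof (intro allI impI, elim conjE)
  fix \<eta> :: "real \<Rightarrow> 'a \<Rightarrow> real" and z :: "real ^ 'd"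
  assume \<eta>: "S2_process M F T \<eta>" and L\<eta>: "AE w in M. \<forall>t\<in>{0..T}. L t w \<le> \<eta> t w"
  interpret brownian_setting M B F by (rule brownian_setting.intro) (fact assms(1-4))+
  note T = \<open>T > 0\<close>
  obtain c1 \<gamma>1 where c1: "c1 > 0" and \<gamma>1: "H2_process M F T \<gamma>1" "\<forall>t\<in>{0..T}. \<forall>w\<in>space M. 0 \<le> \<gamma>1 t w"
    and gr1: "AE w in M. \<forall>t\<in>{0..T}. \<forall>y z. \<bar>g1 t w y z\<bar> \<le> c1 * (\<gamma>1 t w + \<bar>y\<bar> + norm z)"
    using \<open>linear_growth M F T g1\<close> unfolding linear_growth_def by blast
  obtain c2 \<gamma>2 where c2: "c2 > 0" and \<gamma>2: "H2_process M F T \<gamma>2" "\<forall>t\<in>{0..T}. \<forall>w\<in>space M. 0 \<le> \<gamma>2 t w"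
    and gr2: "AE w in M. \<forall>t\<in>{0..T}. \<forall>y z. \<bar>g2 t w y z\<bar> \<le> c2 * (\<gamma>2 t w + \<bar>y\<bar> + norm z)"
    using \<open>linear_growth M F T g2\<close> unfolding linear_growth_def by blast
  \<comment> \<open>Sums of the constants and of the processes give a growth bound common to both
    generators.\<close>
  define c where "c = c1 + c2"
  define \<gamma> where "\<gamma> u w = \<gamma>1 u w + \<gamma>2 u w" for u w
  have cc: "c1 \<le> c" "c2 \<le> c" "0 < c" using c1 c2 by (auto simp: c_def)
  have grow: "c' * (\<gamma>' + \<bar>y\<bar> + norm \<zeta>) \<le> c * (\<gamma>1 u w + \<gamma>2 u w + \<bar>y\<bar> + norm \<zeta>)"
    if "0 < c'" "c' \<le> c" "0 \<le> \<gamma>'" "\<gamma>' \<le> \<gamma>1 u w + \<gamma>2 u w" for c' \<gamma>' y u w and \<zeta> :: "real ^ 'd"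
    using that by (intro mult_mono) auto
  have gr1': "AE w in M. \<forall>u\<in>{0..T}. \<forall>y z. \<bar>g1 u w y z\<bar> \<le> c * (\<gamma> u w + \<bar>y\<bar> + norm z)"
    using gr1 AE_space
  proof (eventually_elim, intro ballI allI)
    fix w u y z assume "\<forall>t\<in>{0..T}. \<forall>y z. \<bar>g1 t w y z\<bar> \<le> c1 * (\<gamma>1 t w + \<bar>y\<bar> + norm z)" "w \<in> space M" "u \<in> {0..T}"
    then have "\<bar>g1 u w y z\<bar> \<le> c1 * (\<gamma>1 u w + \<bar>y\<bar> + norm z)" "0 \<le> \<gamma>1 u w" "0 \<le> \<gamma>2 u w" using \<gamma>1(2) \<gamma>2(2) by blast+
    then show "\<bar>g1 u w y z\<bar> \<le> c * (\<gamma> u w + \<bar>y\<bar> + norm z)"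
      using grow[of c1 "\<gamma>1 u w" u w y z] c1 cc unfolding \<gamma>_def by linarith
  qed
  have gr2': "AE w in M. \<forall>u\<in>{0..T}. \<forall>y z. \<bar>g2 u w y z\<bar> \<le> c * (\<gamma> u w + \<bar>y\<bar> + norm z)"
    using gr2 AE_space
  proof (eventually_elim, intro ballI allI)
    fix w u y z assume "\<forall>t\<in>{0..T}. \<forall>y z. \<bar>g2 t w y z\<bar> \<le> c2 * (\<gamma>2 t w + \<bar>y\<bar> + norm z)" "w \<in> space M" "u \<in> {0..T}"
    then have "\<bar>g2 u w y z\<bar> \<le> c2 * (\<gamma>2 u w + \<bar>y\<bar> + norm z)" "0 \<le> \<gamma>1 u w" "0 \<le> \<gamma>2 u w" using \<gamma>1(2) \<gamma>2(2) by blast+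
    then show "\<bar>g2 u w y z\<bar> \<le> c * (\<gamma> u w + \<bar>y\<bar> + norm z)"
      using grow[of c2 "\<gamma>2 u w" u w y z] c2 cc unfolding \<gamma>_def by linarith
  qed
  note J1 = H2_process_joint_L2[OF \<gamma>1(1) less_imp_le[OF T]] and J2 = H2_process_joint_L2[OF \<gamma>2(1) less_imp_le[OF T]]
  have joint_add: "joint T (\<lambda>u w. X u w + Y u w)" if "joint T X" "joint T Y" for X Y :: "real \<Rightarrow> 'a \<Rightarrow> real"
    using that borel_measurable_add unfolding joint_def scaleR_add_right by blast
  have \<gamma>J: "joint T \<gamma>" unfolding \<gamma>_def[abs_def] by (rule joint_add[OF J1(1) J2(1)])
  have \<gamma>L2: "integrable lM (\<lambda>p. indicator {0..T} (fst p) * (\<gamma> (fst p) (snd p))\<^sup>2)"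
  proof (rule Bochner_Integration.integrable_bound)
    show "integrable lM (\<lambda>p. 2 * (indicator {0..T} (fst p) * (\<gamma>1 (fst p) (snd p))\<^sup>2)
      + 2 * (indicator {0..T} (fst p) * (\<gamma>2 (fst p) (snd p))\<^sup>2))"
      by (intro Bochner_Integration.integrable_add integrable_mult_right J1(2) J2(2))
    have "(\<lambda>p. (indicator {0..T} (fst p) *\<^sub>R \<gamma> (fst p) (snd p))\<^sup>2) \<in> borel_measurable lM"
      using \<gamma>J unfolding joint_def by measurable
    moreover have "(indicator {0..T} u *\<^sub>R x)\<^sup>2 = indicator {0..T} u * x\<^sup>2" for u x :: real by (simp split: split_indicator)
    ultimately show "(\<lambda>p. indicator {0..T} (fst p) * (\<gamma> (fst p) (snd p))\<^sup>2) \<in> borel_measurable lM" by (simp only:)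
    show "AE p in lM. norm (indicator {0..T} (fst p) * (\<gamma> (fst p) (snd p))\<^sup>2)
      \<le> norm (2 * (indicator {0..T} (fst p) * (\<gamma>1 (fst p) (snd p))\<^sup>2) + 2 * (indicator {0..T} (fst p) * (\<gamma>2 (fst p) (snd p))\<^sup>2))"
    proof (rule AE_I2)
      fix p :: "real \<times> 'a"
      show "norm (indicator {0..T} (fst p) * (\<gamma> (fst p) (snd p))\<^sup>2)
      \<le> norm (2 * (indicator {0..T} (fst p) * (\<gamma>1 (fst p) (snd p))\<^sup>2) + 2 * (indicator {0..T} (fst p) * (\<gamma>2 (fst p) (snd p))\<^sup>2))"
        using sq_norm_add_le[of "\<gamma>1 (fst p) (snd p)" "\<gamma>2 (fst p) (snd p)"] by (cases "fst p \<in> {0..T}") (simp_all add: \<gamma>_def)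
    qed
  qed
  obtain S where S: "S \<in> borel_measurable M" "integrable M (\<lambda>w. (S w)\<^sup>2)" "AE w in M. \<forall>u\<in>{0..T}. \<bar>\<eta> u w\<bar> \<le> S w"
    using S2_process_majorant[OF \<eta> T] .
  have pr: "predictable_process F T \<eta>" and \<eta>c: "AE w in M. continuous_on {0..T} (\<lambda>t. \<eta> t w)"
    using \<eta> by (auto simp: S2_process_def)
  have S1: "integrable M (\<lambda>w. (S w + 1)\<^sup>2)"
  proof -
    have "integrable M (\<lambda>w. (norm (S w + 1))\<^sup>2)" using S(1,2) by (intro integrable_sq_add) auto
    then show ?thesis by simp
  qed
  have ordered: "AE t in (lborel :: real measure). 0 < t \<longrightarrow> t < T \<longrightarrow>
      (AE w in M. g2 t w (\<eta> t w + 1 / real (Suc n)) z \<le> g1 t w (\<eta> t w + 1 / real (Suc n)) z)" for n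
  proof -
    let ?e = "1 / real (Suc n)" let ?y = "\<lambda>u w. \<eta> u w + 1 / real (Suc n)"
    \<comment> \<open>The shift lifts \<open>\<eta>\<close> strictly above the obstacle; being at
      most 1, it allows the majorant \<open>S + 1\<close> for every \<open>n\<close>.\<close>
    have e: "0 < ?e" "?e \<le> 1" by simp_all
    have ds: "dominated_setting M B F T c \<gamma> ?y (\<lambda>w. S w + 1)"
    proof (unfold_locales, fact T, fact cc(3), fact \<gamma>J)
      show "0 \<le> \<gamma> u w" if "u \<in> {0..T}" "w \<in> space M" for u w using that \<gamma>1(2) \<gamma>2(2) by (simp add: \<gamma>_def)
      show "integrable lM (\<lambda>p. indicator {0..T} (fst p) * (\<gamma> (fst p) (snd p))\<^sup>2)" by (rule \<gamma>L2)
      show "?y u \<in> borel_measurable (F u)" if "u \<in> {0..T}" for u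
        using predictable_section[OF pr that] by (intro borel_measurable_add borel_measurable_const)
      show "joint T ?y" 
        by (rule joint_add[OF predictable_joint[OF pr]]) (use T in \<open>simp_all add: joint_def del: of_nat_Suc\<close>)
      show "AE w in M. continuous_on {0..T} (\<lambda>u. ?y u w)"
        using \<eta>c by eventually_elim (intro continuous_intros)
      show "(\<lambda>w. S w + 1) \<in> borel_measurable M" using S(1) by measurable
      show "integrable M (\<lambda>w. (S w + 1)\<^sup>2)" by (rule S1)
      show "AE w in M. \<forall>u\<in>{0..T}. \<bar>?y u w\<bar> \<le> S w + 1"
        using S(3)
      proof (eventually_elim, intro ballI)
        fix w u assume "\<forall>u\<in>{0..T}. \<bar>\<eta> u w\<bar> \<le> S w" "u \<in> {0..T}"
        then have "\<bar>\<eta> u w\<bar> \<le> S w" by blast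
        then show "\<bar>?y u w\<bar> \<le> S w + 1" using e by linarith
      qed
    qed
    interpret dominated_setting M B F T c \<gamma> ?y "\<lambda>w. S w + 1" z by (rule ds)
    interpret comparison_setting M B F T c \<gamma> ?y "\<lambda>w. S w + 1" z g1 g2 L
    proof
      show "adm g1" "adm g2" unfolding adm_def by (intro conjI assms(6,8,9,11) gr1' gr2')+
      show "progressively_measurable F T L" "AE w in M. continuous_on {0..T} (\<lambda>u. L u w)"
        using \<open>obstacle M F T L\<close> by (simp_all add: obstacle_def)
      show "AE w in M. \<forall>u\<in>{0..T}. L u w < ?y u w"
        using L\<eta>
      proof (eventually_elim, intro ballI)
        fix w u assume "\<forall>t\<in>{0..T}. L t w \<le> \<eta> t w" "u \<in> {0..T}"
        then have "L u w \<le> \<eta> u w" by blast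
        then show "L u w < ?y u w" using e by linarith
      qed
    qed (rule assms(13))
    show ?thesis by (rule generators_ordered)
  qed
  have "AE t in (lborel :: real measure). \<forall>n. 0 < t \<longrightarrow> t < T \<longrightarrow>
      (AE w in M. g2 t w (\<eta> t w + 1 / real (Suc n)) z \<le> g1 t w (\<eta> t w + 1 / real (Suc n)) z)"
    unfolding AE_all_countable using ordered by blast
  \<comment> \<open>Time 0 is removed as a null set: the argument starts the solutions at some
    \<open>t > 0\<close>, so that the exit times are positive.\<close>
  then show "AE t in lborel. t \<in> {0..<T} \<longrightarrow> (AE w in M. g1 t w (\<eta> t w) z \<ge> g2 t w (\<eta> t w) z)"
    using AE_lborel_singleton[of "0::real"]
  proof (eventually_elim, intro impI)
    fix t :: real
    assume all: "\<forall>n. 0 < t \<longrightarrow> t < T \<longrightarrow>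
      (AE w in M. g2 t w (\<eta> t w + 1 / real (Suc n)) z \<le> g1 t w (\<eta> t w + 1 / real (Suc n)) z)"
      and t: "t \<noteq> 0" "t \<in> {0..<T}"
    have "AE w in M. \<forall>n. g2 t w (\<eta> t w + 1 / real (Suc n)) z \<le> g1 t w (\<eta> t w + 1 / real (Suc n)) z"
      unfolding AE_all_countable using all t by auto
    then show "AE w in M. g1 t w (\<eta> t w) z \<ge> g2 t w (\<eta> t w) z"
      using \<open>continuous_generator M T g1\<close>[unfolded continuous_generator_def] \<open>continuous_generator M T g2\<close>[unfolded continuous_generator_def]
    proof eventually_elim
      case (elim w)
      have conv: "(\<lambda>n. g t w (\<eta> t w + 1 / real (Suc n)) z) \<longlonglongrightarrow> g t w (\<eta> t w) z"
        if "\<forall>t\<in>{0..T}. continuous_on UNIV (\<lambda>(y, z). g t w y z)" for g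
      proof -
        have "continuous_on UNIV (\<lambda>(y, z). g t w y z)" using that t by simp
        then have "isCont (\<lambda>(y, z). g t w y z) (\<eta> t w + 0, z)" by (simp add: continuous_on_eq_continuous_at)
        moreover have "(\<lambda>n. (\<eta> t w + 1 / real (Suc n), z)) \<longlonglongrightarrow> (\<eta> t w + 0, z)"
          by (intro tendsto_Pair tendsto_add tendsto_const LIMSEQ_Suc[OF lim_1_over_n])
        ultimately have "(\<lambda>n. (\<lambda>(y, z). g t w y z) (\<eta> t w + 1 / real (Suc n), z)) \<longlonglongrightarrow> (\<lambda>(y, z). g t w y z) (\<eta> t w + 0, z)"
          by (rule isCont_tendsto_compose)
        then show ?thesis by (simp del: of_nat_Suc)
      qed
      show ?case by (rule LIMSEQ_le[OF conv[of g2, OF elim(3)] conv[of g1, OF elim(2)]]) (use elim(1) in auto)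
    qed
  qed
qed

end
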